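(* Let $N\ge 1$ be an integer, let $\alpha>0$ and $\lambda\in\mathbb{C}$. Let $k,m,n$ be integers such that $$k>\frac N2,\qquad n>\max\Bigl\{\frac N2+1,\frac{N}{2\alpha}\Bigr\},\qquad 2m\ge k+n+1,$$ let $J=2m+2+k+n$, and let $\mathcal{X}$ be the Banach space defined in the context. If $u_0\in\mathcal{X}$ satisfies $$\inf_{x\in\mathbb{R}^N}\langle x\rangle^{n}|u_0(x)|>0,$$ then there exist $T>0$ and a unique solution $u\in C([-T,T],\mathcal{X})$ of $$u(t)=e^{it\Delta}u_0+i\lambda\int_0^t e^{i(t-s)\Delta}|u(s)|^\alpha u(s)\,ds,\qquad t\in[-T,T].$$
   Context: Functions are complex valued on $\mathbb{R}^N$, $\langle x\rangle=(1+|x|^2)^{1/2}$, $\beta$ denotes multi-indices, and $(e^{it\Delta})_{t\in\mathbb{R}}$ is the Schrödinger group on $\mathbb{R}^N$. Given the integers $k,m,n$ and $J=2m+2+k+n$, the space $\mathcal{X}$ is the set of all $u\in H^J(\mathbb{R}^N)$ such that: $\langle x\rangle^n D^\beta u\in L^\infty(\mathbb{R}^N)$ for $0\le|\beta|\le 2m$; $\langle x\rangle^n D^\beta u\in L^2(\mathbb{R}^N)$ for $2m+1\le|\beta|\le 2m+2+k$; and $\langle x\rangle^{J-|\beta|}D^\beta u\in L^2(\mathbb{R}^N)$ for $2m+2+k<|\beta|\le J$. It is equipped with the norm $$\|u\|_{\mathcal{X}}=\sum_{j=0}^{2m}\sup_{|\beta|=j}\|\langle x\rangle^nD^\beta u\|_{L^\infty}+\sum_{\nu=0}^{k+1}\sum_{\mu=0}^{n}\sum_{|\beta|=\nu+\mu+2m+1}\|\langle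 x\rangle^{n-\mu}D^\beta u\|_{L^2},$$ for which it is a Banach space. Let $\Sigma=H^1(\mathbb{R}^N)\cap L^2(\mathbb{R}^N,|x|^2dx)$. One has $\mathcal{X}\hookrightarrow H^J(\mathbb{R}^N)\cap\Sigma$, and if $u\in C([a,b],\Sigma)\cap L^\infty((a,b)\times\mathbb{R}^N)$ then $|u|^\alpha u\in C([a,b],\Sigma)$, so the integral equation makes sense in $\Sigma$. *)

theory Defs
  imports "HOL-Analysis.Analysis" "HOL-Probability.Essential_Supremum"
begin

section \<open>The space \<open>L\<^sup>2\<close> of classes of functions on Euclidean space\<close>

definition square_integrable :: "(real^'n::finite \<Rightarrow> complex) \<Rightarrow> bool" where
  "square_integrable f \<longleftrightarrow>
     f \<in> borel_measurable lebesgue \<and> integrable lebesgue (\<lambda>x. (cmod (f x))\<^sup>2)"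

definition L2_rel :: "(real^'n::finite \<Rightarrow> complex) \<Rightarrow> (real^'n \<Rightarrow> complex) \<Rightarrow> bool" where
  "L2_rel f g \<longleftrightarrow> square_integrable f \<and> square_integrable g \<and> (AE x in lebesgue. f x = g x)"

lemma square_integrable_zero: "square_integrable (\<lambda>x. 0)"
  by (simp add: square_integrable_def)

lemma square_integrable_add:
  assumes "square_integrable f" "square_integrable g"
  shows "square_integrable (\<lambda>x. f x + g x)"
proof -
  have [measurable]: "f \<in> borel_measurable lebesgue" "g \<in> borel_measurable lebesgue"
    and i: "integrable lebesgue (\<lambda>x. (cmod (f x))\<^sup>2)" "integrable lebesgue (\<lambda>x. (cmod (g x))\<^sup>2)"
    using assms by (auto simp: square_integrable_def)
  have "integrable lebesgue (\<lambda>x. 2 * (cmod (f x))\<^sup>2 + 2 * (cmod (g x))\<^sup>2)"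
    using i by simp
  moreover have "(cmod (f x + g x))\<^sup>2 \<le> 2 * (cmod (f x))\<^sup>2 + 2 * (cmod (g x))\<^sup>2" for x
  proof -
    have "(cmod (f x + g x))\<^sup>2 \<le> (cmod (f x) + cmod (g x))\<^sup>2"
      by (intro power_mono norm_triangle_ineq) auto
    also have "\<dots> \<le> 2 * (cmod (f x))\<^sup>2 + 2 * (cmod (g x))\<^sup>2"
      using sum_squares_bound[of "cmod (f x)" "cmod (g x)"] by (simp add: power2_sum)
    finally show ?thesis .
  qed
  ultimately have "integrable lebesgue (\<lambda>x. (cmod (f x + g x))\<^sup>2)"
    by (elim Bochner_Integration.integrable_bound) auto
  then show ?thesis by (simp add: square_integrable_def)
qed

lemma square_integrable_cmult:
  assumes "square_integrable f" shows "square_integrable (\<lambda>x. c * f x)"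
  using assms by (auto simp: square_integrable_def norm_mult power_mult_distrib)

lemma square_integrable_uminus:
  assumes "square_integrable f" shows "square_integrable (\<lambda>x. - f x)"
  using assms by (auto simp: square_integrable_def)

quotient_type 'n L2 = "real^'n::finite \<Rightarrow> complex" / partial: L2_rel
  morphisms rep_L2 abs_L2
proof (rule part_equivpI)
  show "\<exists>f::real^'n \<Rightarrow> complex. L2_rel f f"
    using square_integrable_zero by (auto simp: L2_rel_def)
  show "symp (L2_rel :: (real^'n \<Rightarrow> complex) \<Rightarrow> _)"
    by (intro sympI) (auto simp: L2_rel_def elim: eventually_mono)
  show "transp (L2_rel :: (real^'n \<Rightarrow> complex) \<Rightarrow> _)"
    by (intro transpI) (auto simp: L2_rel_def elim: eventually_elim2)
qed

lemma square_integrable_rep_L2: "square_integrable (rep_L2 u)"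
  using Quotient3_rep_reflp[OF Quotient3_L2, of u] by (simp add: L2_rel_def)

lemma abs_rep_L2: "abs_L2 (rep_L2 u) = u"
  using Quotient3_abs_rep[OF Quotient3_L2] .

lemma abs_L2_eq_iff:
  "square_integrable f \<Longrightarrow> square_integrable g \<Longrightarrow>
     abs_L2 f = abs_L2 g \<longleftrightarrow> (AE x in lebesgue. f x = g x)"
  using Quotient3_rel[OF Quotient3_L2, of f g] by (auto simp: L2_rel_def)

lemma rep_abs_L2: "square_integrable f \<Longrightarrow> AE x in lebesgue. rep_L2 (abs_L2 f) x = f x"
  using abs_L2_eq_iff[OF square_integrable_rep_L2, of f "abs_L2 f"] by (simp add: abs_rep_L2)

definition L2_norm :: "(real^'n::finite \<Rightarrow> complex) \<Rightarrow> real" where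
  "L2_norm f = sqrt (LINT x|lebesgue. (cmod (f x))\<^sup>2)"

lemma L2_norm_triangle:
  assumes f: "square_integrable f" and g: "square_integrable g"
  shows "L2_norm (\<lambda>x. f x + g x) \<le> L2_norm f + L2_norm g"
proof -
  have [measurable]: "f \<in> borel_measurable lebesgue" "g \<in> borel_measurable lebesgue"
    using f g by (auto simp: square_integrable_def)
  note i = f[unfolded square_integrable_def, THEN conjunct2]
    g[unfolded square_integrable_def, THEN conjunct2]
    square_integrable_add[OF f g, unfolded square_integrable_def, THEN conjunct2]
  define a b where "a = L2_norm f" and "b = L2_norm g"
  have a2: "(LINT x|lebesgue. (cmod (f x))\<^sup>2) = a\<^sup>2" and b2: "(LINT x|lebesgue. (cmod (g x))\<^sup>2) = b\<^sup>2"
    and ab: "0 \<le> a" "0 \<le> b"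
    by (auto simp: a_def b_def L2_norm_def)
  have z: "AE x in lebesgue. h x = 0" if "L2_norm h = 0" "square_integrable h" for h :: "real^'n \<Rightarrow> complex"
    using that integral_nonneg_eq_0_iff_AE[of lebesgue "\<lambda>x. (cmod (h x))\<^sup>2"]
    by (auto simp: L2_norm_def square_integrable_def)
  consider "a = 0" | "b = 0" | "a > 0" "b > 0" using ab by linarith
  then show ?thesis
  proof cases
    case 1
    then have "AE x in lebesgue. f x = 0" using z f by (simp add: a_def)
    then have "(LINT x|lebesgue. (cmod (f x + g x))\<^sup>2) = (LINT x|lebesgue. (cmod (g x))\<^sup>2)"
      by (intro integral_cong_AE) (auto elim: eventually_mono)
    then show ?thesis using 1 by (simp add: L2_norm_def a_def)
  next
    case 2
    then have "AE x in lebesgue. g x = 0" using z g by (simp add: b_def)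
    then have "(LINT x|lebesgue. (cmod (f x + g x))\<^sup>2) = (LINT x|lebesgue. (cmod (f x))\<^sup>2)"
      by (intro integral_cong_AE) (auto elim: eventually_mono)
    then show ?thesis using 2 by (simp add: L2_norm_def b_def)
  next
    case 3
    have p: "(cmod (f x + g x))\<^sup>2 \<le> (1 + b/a) * (cmod (f x))\<^sup>2 + (1 + a/b) * (cmod (g x))\<^sup>2" for x
    proof -
      let ?s = "cmod (f x)" and ?t = "cmod (g x)"
      have "(cmod (f x + g x))\<^sup>2 \<le> (?s + ?t)\<^sup>2"
        by (intro power_mono norm_triangle_ineq) auto
      moreover have "0 \<le> (b * ?s - a * ?t)\<^sup>2 / (a * b)" using 3 by simp
      moreover have "(b * ?s - a * ?t)\<^sup>2 / (a * b) = b/a * ?s\<^sup>2 + a/b * ?t\<^sup>2 - 2 * ?s * ?t"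
        using 3 by (simp add: field_simps power2_eq_square)
      ultimately show ?thesis by (simp add: power2_sum algebra_simps)
    qed
    have "(LINT x|lebesgue. (cmod (f x + g x))\<^sup>2)
        \<le> (LINT x|lebesgue. (1 + b/a) * (cmod (f x))\<^sup>2 + (1 + a/b) * (cmod (g x))\<^sup>2)"
      using i p by (intro integral_mono) auto
    also have "\<dots> = (1 + b/a) * a\<^sup>2 + (1 + a/b) * b\<^sup>2"
      using i by (simp add: a2 b2)
    also have "\<dots> = (a + b)\<^sup>2"
      using 3 by (simp add: field_simps power2_eq_square)
    finally have "sqrt (LINT x|lebesgue. (cmod (f x + g x))\<^sup>2) \<le> sqrt ((a + b)\<^sup>2)"
      by (rule real_sqrt_le_mono)
    then show ?thesis using ab by (simp add: L2_norm_def a_def b_def)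
  qed
qed

lemma L2_norm_cong:
  assumes "L2_rel f g" shows "L2_norm f = L2_norm g"
proof -
  have [measurable]: "f \<in> borel_measurable lebesgue" "g \<in> borel_measurable lebesgue"
    and "AE x in lebesgue. f x = g x"
    using assms by (auto simp: L2_rel_def square_integrable_def)
  then have "(LINT x|lebesgue. (cmod (f x))\<^sup>2) = (LINT x|lebesgue. (cmod (g x))\<^sup>2)"
    by (intro integral_cong_AE) (auto elim: eventually_mono)
  then show ?thesis by (simp add: L2_norm_def)
qed

lift_definition cmult_L2 :: "complex \<Rightarrow> 'n::finite L2 \<Rightarrow> 'n L2" is "\<lambda>c f x. c * f x"
  by (auto simp: L2_rel_def square_integrable_cmult elim: eventually_mono)

instantiation L2 :: (finite) scaleR
begin

definition scaleR_L2 :: "real \<Rightarrow> 'a L2 \<Rightarrow> 'a L2" where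
  "scaleR_L2 r u = cmult_L2 (complex_of_real r) u"

instance ..

end

instantiation L2 :: (finite) real_normed_vector
begin

lift_definition zero_L2 :: "'a L2" is "\<lambda>x. 0"
  by (auto simp: L2_rel_def square_integrable_zero)

lift_definition plus_L2 :: "'a L2 \<Rightarrow> 'a L2 \<Rightarrow> 'a L2" is "\<lambda>f g x. f x + g x"
  by (auto simp: L2_rel_def square_integrable_add elim: eventually_elim2)

lift_definition uminus_L2 :: "'a L2 \<Rightarrow> 'a L2" is "\<lambda>f x. - f x"
  by (auto simp: L2_rel_def square_integrable_uminus elim: eventually_mono)

definition minus_L2 :: "'a L2 \<Rightarrow> 'a L2 \<Rightarrow> 'a L2" where
  "minus_L2 u v = u + (- v)"

lift_definition norm_L2 :: "'a L2 \<Rightarrow> real" is L2_norm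
  by (rule L2_norm_cong)

definition dist_L2 :: "'a L2 \<Rightarrow> 'a L2 \<Rightarrow> real" where
  "dist_L2 u v = norm (u - v)"

definition sgn_L2 :: "'a L2 \<Rightarrow> 'a L2" where
  "sgn_L2 u = u /\<^sub>R norm u"

definition uniformity_L2 :: "('a L2 \<times> 'a L2) filter" where
  "uniformity_L2 = (INF e\<in>{0<..}. principal {(u, v). dist u v < e})"

definition open_L2 :: "'a L2 set \<Rightarrow> bool" where
  "open_L2 U \<longleftrightarrow> (\<forall>u\<in>U. eventually (\<lambda>(u', v). u' = u \<longrightarrow> v \<in> U) uniformity)"

instance
proof
  fix u v w :: "'a L2" and r s :: real
  show "u + v + w = u + (v + w)"
    by transfer (auto simp: L2_rel_def square_integrable_add add.assoc)
  show "u + v = v + u"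
    by transfer (auto simp: L2_rel_def square_integrable_add add.commute)
  show "0 + u = u"
    by transfer (auto simp: L2_rel_def)
  show "- u + u = 0"
    by transfer (auto simp: L2_rel_def square_integrable_zero)
  show "u - v = u + - v"
    by (simp add: minus_L2_def)
  show "r *\<^sub>R (u + v) = r *\<^sub>R u + r *\<^sub>R v"
    unfolding scaleR_L2_def
    by transfer (auto simp: L2_rel_def square_integrable_add square_integrable_cmult distrib_left)
  show "(r + s) *\<^sub>R u = r *\<^sub>R u + s *\<^sub>R u"
    unfolding scaleR_L2_def
    by transfer
      (auto simp: L2_rel_def square_integrable_add square_integrable_cmult distrib_right)
  show "r *\<^sub>R s *\<^sub>R u = (r * s) *\<^sub>R u"
    unfolding scaleR_L2_def
    by transfer (auto simp: L2_rel_def square_integrable_cmult mult.assoc)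
  show "1 *\<^sub>R u = u"
    unfolding scaleR_L2_def by transfer (auto simp: L2_rel_def)
  show "dist u v = norm (u - v)"
    by (simp add: dist_L2_def)
  show "sgn u = u /\<^sub>R norm u"
    by (simp add: sgn_L2_def)
  show "uniformity = (INF e\<in>{0<..}. principal {(u, v :: 'a L2). dist u v < e})"
    by (simp add: uniformity_L2_def)
  show "open U \<longleftrightarrow> (\<forall>u\<in>U. eventually (\<lambda>(u', v). u' = u \<longrightarrow> v \<in> U) uniformity)" for U :: "'a L2 set"
    by (simp add: open_L2_def)
  show "norm u = 0 \<longleftrightarrow> u = 0"
  proof transfer
    fix f :: "real^'a \<Rightarrow> complex" assume "L2_rel f f"
    then have f: "square_integrable f" by (simp add: L2_rel_def)
    then show "L2_norm f = 0 \<longleftrightarrow> L2_rel f (\<lambda>x. 0)"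
      using integral_nonneg_eq_0_iff_AE[of lebesgue "\<lambda>x. (cmod (f x))\<^sup>2"]
      by (auto simp: L2_norm_def L2_rel_def square_integrable_zero square_integrable_def)
  qed
  show "norm (u + v) \<le> norm u + norm v"
    by transfer (auto simp: L2_rel_def intro: L2_norm_triangle)
  show "norm (r *\<^sub>R u) = \<bar>r\<bar> * norm u"
    unfolding scaleR_L2_def
    by transfer (auto simp: L2_norm_def norm_mult power_mult_distrib real_sqrt_mult)
qed

end


section \<open>Weak derivatives and Sobolev spaces\<close>

definition partial_deriv :: "'n \<Rightarrow> (real^'n::finite \<Rightarrow> complex) \<Rightarrow> real^'n \<Rightarrow> complex" where
  "partial_deriv i f x = vector_derivative (\<lambda>h. f (x + h *\<^sub>R axis i 1)) (at 0)"

text \<open>If all iterated partial derivatives are Frechet differentiable, then they are all continuous,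
  and conversely; so this is the usual \<open>C\<^sup>\<infinity>\<close>.\<close>

definition smooth :: "(real^'n::finite \<Rightarrow> complex) \<Rightarrow> bool" where
  "smooth f \<longleftrightarrow> (\<forall>is. foldr partial_deriv is f differentiable_on UNIV)"

definition test_function :: "(real^'n::finite \<Rightarrow> complex) \<Rightarrow> bool" where
  "test_function f \<longleftrightarrow> smooth f \<and> compact (closure {x. f x \<noteq> 0})"

type_synonym 'n multiindex = "'n \<Rightarrow> nat"

definition morder :: "'n::finite multiindex \<Rightarrow> nat" where
  "morder \<beta> = (\<Sum>i\<in>UNIV. \<beta> i)"

lemma finite_morder: "finite {\<beta> :: 'n::finite multiindex. morder \<beta> = j}"
proof (rule finite_subset)
  show "{\<beta> :: 'n multiindex. morder \<beta> = j} \<subseteq> {\<beta>. \<forall>i. (i \<in> UNIV \<longrightarrow> \<beta> i \<in> {..j}) \<and> (i \<notin> UNIV \<longrightarrow> \<beta> i = 0)}"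
    by (auto simp: morder_def intro: member_le_sum)
  show "finite \<dots>" by (rule finite_set_of_finite_funs) auto
qed

lemma morder_nonempty: "{\<beta> :: 'n::finite multiindex. morder \<beta> = j} \<noteq> {}"
proof -
  obtain i :: 'n where True by simp
  have "morder ((\<lambda>_. 0)(i := j)) = j"
    by (simp add: morder_def sum.delta if_distrib fun_upd_def)
  then show ?thesis by blast
qed

text \<open>The classical derivative \<open>D\<^sup>\<beta>\<close>: differentiate along a list of coordinates containing each
  \<open>i\<close> exactly \<open>\<beta> i\<close> times.  It is only applied to smooth functions, for which the order of
  differentiation (hence the choice of the list) is irrelevant.\<close>

definition multi_deriv ::
    "'n multiindex \<Rightarrow> (real^'n::finite \<Rightarrow> complex) \<Rightarrow> real^'n \<Rightarrow> complex" where
  "multi_deriv \<beta> f = foldr partial_deriv (SOME is. \<forall>i. count_list is i = \<beta> i) f"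

lemma ex_multiindex_list: "\<exists>is. \<forall>i. count_list is i = (\<beta> :: 'n::finite multiindex) i"
proof -
  obtain js :: "'n list" where js: "set js = UNIV" "distinct js"
    using finite_distinct_list[OF finite] by blast
  have c: "count_list (replicate a x) y = (if x = y then a else 0)" for a and x y :: 'n
    by (induction a) auto
  have "count_list (concat (map (\<lambda>j. replicate (\<beta> j) j) ks)) i = (if i \<in> set ks then \<beta> i else 0)"
    if "distinct ks" for ks i
    using that by (induction ks) (auto simp: c)
  with js show ?thesis by (metis UNIV_I)
qed

definition has_weak_deriv :: "'n multiindex \<Rightarrow> 'n::finite L2 \<Rightarrow> 'n L2 \<Rightarrow> bool" where
  "has_weak_deriv \<beta> u v \<longleftrightarrow>
     (\<forall>\<phi>. test_function \<phi> \<longrightarrow>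
        (LINT x|lebesgue. rep_L2 u x * multi_deriv \<beta> \<phi> x) =
        (-1) ^ morder \<beta> * (LINT x|lebesgue. rep_L2 v x * \<phi> x))"

definition weak_deriv :: "'n multiindex \<Rightarrow> 'n::finite L2 \<Rightarrow> 'n L2" where
  "weak_deriv \<beta> u = (THE v. has_weak_deriv \<beta> u v)"

definition sobolev :: "nat \<Rightarrow> 'n::finite L2 set" where
  "sobolev s = {u. \<forall>\<beta>. morder \<beta> \<le> s \<longrightarrow> (\<exists>v. has_weak_deriv \<beta> u v)}"


section \<open>The space \<open>\<X>\<close>\<close>

definition japanese :: "real^'n::finite \<Rightarrow> real" where
  "japanese x = sqrt (1 + (norm x)\<^sup>2)"

definition bounded_AE :: "(real^'n::finite \<Rightarrow> complex) \<Rightarrow> bool" where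
  "bounded_AE f \<longleftrightarrow>
     f \<in> borel_measurable lebesgue \<and> esssup lebesgue (\<lambda>x. ereal (cmod (f x))) < \<infinity>"

definition Linf_norm :: "(real^'n::finite \<Rightarrow> complex) \<Rightarrow> real" where
  "Linf_norm f = real_of_ereal (esssup lebesgue (\<lambda>x. ereal (cmod (f x))))"

definition weighted_deriv ::
    "nat \<Rightarrow> 'n multiindex \<Rightarrow> 'n::finite L2 \<Rightarrow> real^'n \<Rightarrow> complex" where
  "weighted_deriv p \<beta> u x = japanese x ^ p *\<^sub>R rep_L2 (weak_deriv \<beta> u) x"

definition Xspace :: "nat \<Rightarrow> nat \<Rightarrow> nat \<Rightarrow> 'n::finite L2 set" where
  "Xspace k m n =
    (let J = 2*m + 2 + k + n in
     {u \<in> sobolev J.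
        (\<forall>\<beta>. morder \<beta> \<le> 2*m \<longrightarrow> bounded_AE (weighted_deriv n \<beta> u)) \<and>
        (\<forall>\<beta>. 2*m + 1 \<le> morder \<beta> \<and> morder \<beta> \<le> 2*m + 2 + k \<longrightarrow>
              square_integrable (weighted_deriv n \<beta> u)) \<and>
        (\<forall>\<beta>. 2*m + 2 + k < morder \<beta> \<and> morder \<beta> \<le> J \<longrightarrow>
              square_integrable (weighted_deriv (J - morder \<beta>) \<beta> u))})"

definition Xnorm :: "nat \<Rightarrow> nat \<Rightarrow> nat \<Rightarrow> 'n::finite L2 \<Rightarrow> real" where
  "Xnorm k m n u =
     (\<Sum>j=0..2*m. SUP \<beta>\<in>{\<beta>. morder \<beta> = j}. Linf_norm (weighted_deriv n \<beta> u)) +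
     (\<Sum>\<nu>=0..k+1. \<Sum>\<mu>=0..n. \<Sum>\<beta> | morder \<beta> = \<nu> + \<mu> + 2*m + 1.
         L2_norm (weighted_deriv (n - \<mu>) \<beta> u))"

definition continuous_on_X ::
    "nat \<Rightarrow> nat \<Rightarrow> nat \<Rightarrow> real set \<Rightarrow> (real \<Rightarrow> 'n::finite L2) \<Rightarrow> bool" where
  "continuous_on_X k m n I u \<longleftrightarrow>
     (\<forall>t\<in>I. u t \<in> Xspace k m n) \<and>
     (\<forall>t\<in>I. ((\<lambda>s. Xnorm k m n (u s - u t)) \<longlongrightarrow> 0) (at t within I))"


section \<open>The Schroedinger group\<close>

definition fourier :: "(real^'n::finite \<Rightarrow> complex) \<Rightarrow> real^'n \<Rightarrow> complex" where
  "fourier f \<xi> =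
     ((2 * pi) powr (- real CARD('n) / 2)) *\<^sub>R (LINT x|lebesgue. exp (- \<i> * of_real (x \<bullet> \<xi>)) * f x)"

text \<open>The Fourier-Plancherel transform: the extension by continuity to \<open>L\<^sup>2\<close> of the Fourier
  integral on \<open>L\<^sup>1 \<inter> L\<^sup>2\<close>.\<close>

definition has_fourier_L2 :: "'n::finite L2 \<Rightarrow> 'n L2 \<Rightarrow> bool" where
  "has_fourier_L2 u v \<longleftrightarrow>
     (\<exists>f. (\<forall>j::nat. square_integrable (f j) \<and> integrable lebesgue (f j) \<and>
                     square_integrable (fourier (f j))) \<and>
          (\<lambda>j. abs_L2 (f j)) \<longlonglongrightarrow> u \<and> (\<lambda>j. abs_L2 (fourier (f j))) \<longlonglongrightarrow> v)"

definition fourier_L2 :: "'n::finite L2 \<Rightarrow> 'n L2" where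
  "fourier_L2 u = (THE v. has_fourier_L2 u v)"

text \<open>\<open>e\<^sup>i\<^sup>t\<^sup>\<Delta>\<close> is the Fourier multiplier with symbol \<open>exp (- i t |\<xi>|\<^sup>2)\<close>.\<close>

definition schroedinger :: "real \<Rightarrow> 'n::finite L2 \<Rightarrow> 'n L2" where
  "schroedinger t u =
     (THE v. fourier_L2 v =
        abs_L2 (\<lambda>\<xi>. exp (- \<i> * of_real (t * (norm \<xi>)\<^sup>2)) * rep_L2 (fourier_L2 u) \<xi>))"


section \<open>The integral equation\<close>

text \<open>If the function \<open>|u|\<^sup>\<alpha> u\<close> is not square integrable, the value of \<open>nonlin\<close> is unspecified;
  this does not happen for \<open>u \<in> L\<^sup>2 \<inter> L\<^sup>\<infinity>\<close>, in particular not for \<open>u \<in> \<X>\<close>.\<close>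

definition nonlin :: "real \<Rightarrow> 'n::finite L2 \<Rightarrow> 'n L2" where
  "nonlin \<alpha> u = abs_L2 (\<lambda>x. (cmod (rep_L2 u x) powr \<alpha>) *\<^sub>R rep_L2 u x)"

text \<open>The oriented integral from \<open>a\<close> to \<open>b\<close>, for \<open>a\<close> and \<open>b\<close> in any order.\<close>

definition has_oriented_integral ::
    "(real \<Rightarrow> 'a::real_normed_vector) \<Rightarrow> 'a \<Rightarrow> real \<Rightarrow> real \<Rightarrow> bool" where
  "has_oriented_integral F v a b \<longleftrightarrow>
     (if a \<le> b then (F has_integral v) {a..b} else (F has_integral (- v)) {b..a})"

text \<open>The integral is that of an \<open>L\<^sup>2\<close>-valued function.  As \<open>\<Sigma>\<close> is continuously embedded
  in \<open>L\<^sup>2\<close>, it agrees with the integral in \<open>\<Sigma>\<close> of the (continuous, \<open>\<Sigma>\<close>-valued) integrand.\<close>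

definition NLS_solution ::
    "real \<Rightarrow> complex \<Rightarrow> 'n::finite L2 \<Rightarrow> real set \<Rightarrow> (real \<Rightarrow> 'n L2) \<Rightarrow> bool" where
  "NLS_solution \<alpha> lam u0 I u \<longleftrightarrow>
     (\<forall>t\<in>I. \<exists>v. has_oriented_integral (\<lambda>s. schroedinger (t - s) (nonlin \<alpha> (u s))) v 0 t \<and>
                u t = schroedinger t u0 + cmult_L2 (\<i> * lam) v)"

text \<open>An element of \<open>\<X>\<close> is a class of functions modulo null sets; its pointwise values are
  those of its continuous representative, which is unique.\<close>

definition continuous_representative :: "'n::finite L2 \<Rightarrow> (real^'n \<Rightarrow> complex) \<Rightarrow> bool" where
  "continuous_representative u f \<longleftrightarrow>
     continuous_on UNIV f \<and> (AE x in lebesgue. rep_L2 u x = f x)"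

end

theory Submission
  imports Defs "HOL-Probability.Probability"
begin

text \<open>The equation is solved by Picard iteration for \<open>w(t) = e\<^sup>-\<^sup>i\<^sup>t\<^sup>\<Delta> u(t)\<close>, which takes two ingredients.

  The group \<open>e\<^sup>i\<^sup>t\<^sup>\<Delta>\<close> is bounded and strongly continuous on \<open>\<X>\<close>.  The weighted \<open>L\<^sup>2\<close> bounds propagate because
  \<open>x\<^sub>j\<close> and \<open>e\<^sup>i\<^sup>t\<^sup>\<Delta>\<close> commute up to \<open>t \<partial>\<^sub>j\<close>, so that a power of the weight costs a derivative.  The
  weighted uniform bounds follow from \<open>e\<^sup>i\<^sup>t\<^sup>\<Delta> v = v + i \<integral> e\<^sup>i\<^sup>s\<^sup>\<Delta> \<Delta>v ds\<close>, used until enough derivatives are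
  available for the Sobolev embedding.

  The nonlinearity is Lipschitz on \<open>\<X>\<close> near \<open>u\<^sub>0\<close>.  Put \<open>w = \<langle>x\<rangle>\<^sup>n u\<close> and \<open>z = 1 - |w|\<^sup>2/M\<^sup>2\<close>, where
  \<open>M\<close> bounds \<open>|w|\<close>; the lower bound on \<open>|w|\<close> gives \<open>sup |z| < 1\<close>, and
  \<open>|u|\<^sup>\<alpha> u = \<langle>x\<rangle>\<^sup>-\<^sup>n\<^sup>(\<^sup>1\<^sup>+\<^sup>\<alpha>\<^sup>) M\<^sup>\<alpha> \<Sum>\<^sub>q (\<alpha>/2 gchoose q) (-z)\<^sup>q w\<close>.  The series converges in the algebra of the functions whose
  derivatives are bounded up to order \<open>2m\<close> and in weighted \<open>L\<^sup>2\<close> spaces up to order \<open>J\<close>: by \<open>2m \<ge> k + n + 1\<close> the Leibniz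
  rule never produces two factors of order above \<open>2m\<close>, and by \<open>n\<alpha> > N/2\<close> the products of bounded factors lie in
  the weighted \<open>L\<^sup>2\<close> space.  The norm \<open>\<Sum>\<^sub>l \<epsilon>\<^sup>l c\<^sub>l / l!\<close>, with \<open>c\<^sub>l\<close> bounding the derivatives of order \<open>l\<close>, is
  submultiplicative and tends to the sup norm as \<open>\<epsilon> \<rightarrow> 0\<close>, hence is below one at \<open>z\<close> for small \<open>\<epsilon>\<close>.

  Uniqueness is Gronwall's inequality in \<open>L\<^sup>2\<close>.\<close>

section \<open>The Banach space \<open>L\<^sup>2\<close>\<close>

text \<open>The function |u|^\<alpha> u has limited smoothness at u = 0, and differentiating it J
  times would produce negative powers of |u|; the lower bound keeps these under control, and the
  power series does so without a chain rule of order J. The group and the nonlinearity want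
  different descriptions of a derivative: \<open>D\<close> is a Fourier multiplier, hence commutes
  with \<open>S\<close>, while \<open>ACL\<close> is local, hence obeys the product rule without
  global integrability of the factors. \<open>D_imp_ACL\<close> and \<open>ACL_imp_D\<close> join
  them. Spaces are handled through bound predicates such as \<open>XL\<close>, which state
  membership together with an estimate; \<open>Xspace_XL\<close> and \<open>XL_Xspace\<close>
  compare them with \<open>Xnorm\<close>. Integrals in time are taken in \<open>L2\<close>; bounds
  in the smaller space pass to them by closedness of unbounded multipliers and, for uniform norms,
  by duality. The exponent \<sigma> is n \<alpha>, the decay gained from |u|^\<alpha>: the factor
  <x>^(-\<sigma>) is square integrable and puts products of merely bounded functions into the right
  L2 space.\<close>

abbreviation BM :: "('a::topological_space => 'b::topological_space) set" where
  "BM == borel_measurable borel"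

abbreviation sh :: "'n => real => real^'n::finite => real^'n" where
  "sh j h x == x + h *\<^sub>R axis j 1"

abbreviation cut :: "real => real => 'a::real_vector => 'a" where
  "cut s r z == indicator {0..s} r *\<^sub>R z"

text \<open>Compositions and product measures are handled with Borel functions and
  \<open>lborel\<close>. Each class gets a Borel representative \<open>rp\<close>, whereas
  \<open>rep_L2\<close> is only Lebesgue measurable.\<close>

definition sqi :: "(real^'n::finite => complex) => bool" where
  "sqi f \<longleftrightarrow> f \<in> BM & integrable lborel (%x. (cmod (f x))^2)"

lemma sqi_measurable [measurable_dest]: "sqi f ==> f \<in> BM"
  by (simp add: sqi_def)

lemma sqi_integrable: "sqi f ==> integrable lborel (%x. (cmod (f x))^2)"
  by (simp add: sqi_def)

lemma sqi_square_integrable: assumes "sqi f" shows "square_integrable f"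
proof -
  have [measurable]: "f \<in> BM" using assms by (rule sqi_measurable)
  have "f \<in> borel_measurable lebesgue" by (intro measurable_completion) simp
  moreover have "integrable lebesgue (%x. (cmod (f x))^2)"
    using assms by (subst integrable_completion) (auto simp: sqi_def)
  ultimately show ?thesis by (simp add: square_integrable_def)
qed

lemma lebesgue_borel_representative:
  fixes f :: "'a::euclidean_space => complex"
  assumes "f \<in> borel_measurable lebesgue"
  shows "\<exists>g. g \<in> BM & (AE x in lborel. f x = g x)"
proof -
  have "(%x. Re (f x)) \<in> borel_measurable lebesgue" "(%x. Im (f x)) \<in> borel_measurable lebesgue"
    using assms by auto
  from this[THEN completion_ex_borel_measurable_real] obtain a b
    where a: "a \<in> borel_measurable lborel" "AE x in lborel. Re (f x) = a x"
      and b: "b \<in> borel_measurable lborel" "AE x in lborel. Im (f x) = b x" by blast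
  have [measurable]: "a \<in> BM" "b \<in> BM" using a b by auto
  show ?thesis
  proof (intro exI conjI)
    show "(%x. Complex (a x) (b x)) \<in> BM"
      by (subst Complex_eq) measurable
    show "AE x in lborel. f x = Complex (a x) (b x)"
      using a(2) b(2) by eventually_elim (simp add: complex_eq_iff)
  qed
qed

lemma sqi_AE_lebesgue:
  assumes "square_integrable f" "g \<in> BM" "AE x in lborel. f x = g x"
  shows "sqi g"
proof -
  have [measurable]: "g \<in> BM" by fact
  have g: "g \<in> borel_measurable lebesgue" by (intro measurable_completion) simp
  have "integrable lebesgue (%x. (cmod (f x))^2)" "f \<in> borel_measurable lebesgue"
    using assms by (auto simp: square_integrable_def)
  moreover have "AE x in lebesgue. f x = g x" using assms(3) by (rule AE_completion)
  ultimately have "integrable lebesgue (%x. (cmod (g x))^2)"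
    using g by (subst integrable_cong_AE[where g="%x. (cmod (f x))^2"]) auto
  then show ?thesis
    by (subst (asm) integrable_completion) (auto simp: sqi_def)
qed

definition rp :: "'n::finite L2 => real^'n => complex" where
  "rp u = (SOME g. g \<in> BM & (AE x in lborel. rep_L2 u x = g x))"

lemma
  shows rp_measurable [measurable]: "rp u \<in> BM"
    and rep_rp: "AE x in lborel. rep_L2 u x = rp u x"
proof -
  have "rep_L2 u \<in> borel_measurable lebesgue"
    using square_integrable_rep_L2[of u] by (simp add: square_integrable_def)
  from someI_ex[OF lebesgue_borel_representative[OF this]]
  show "rp u \<in> BM" "AE x in lborel. rep_L2 u x = rp u x"
    by (auto simp: rp_def)
qed

lemma sqi_rp: "sqi (rp u)"
  using sqi_AE_lebesgue[OF square_integrable_rep_L2 rp_measurable rep_rp] .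

lemma abs_rp: "abs_L2 (rp u) = u"
proof -
  have "abs_L2 (rp u) = abs_L2 (rep_L2 u)"
    using AE_completion[OF rep_rp[of u]]
    by (subst abs_L2_eq_iff) (auto simp: sqi_square_integrable sqi_rp square_integrable_rep_L2
      elim: eventually_mono)
  then show ?thesis by (simp add: abs_rep_L2)
qed

lemma rp_abs: assumes "sqi f" shows "AE x in lborel. rp (abs_L2 f) x = f x"
proof -
  have "AE x in lebesgue. rep_L2 (abs_L2 f) x = f x"
    by (rule rep_abs_L2[OF sqi_square_integrable[OF assms]])
  then have "AE x in lborel. rep_L2 (abs_L2 f) x = f x" by (simp add: AE_completion_iff)
  with rep_rp[of "abs_L2 f"] show ?thesis by eventually_elim simp
qed

lemma abs_eqI: "sqi f ==> sqi g ==> (AE x in lborel. f x = g x) ==> abs_L2 f = abs_L2 g"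
  by (subst abs_L2_eq_iff) (auto simp: sqi_square_integrable AE_completion)

lemma L2_eqI: "(AE x in lborel. rp u x = rp v x) ==> u = v"
  using abs_eqI[OF sqi_rp sqi_rp, of u v] by (simp add: abs_rp)

lemma abs_eqD: assumes "sqi f" "sqi g" "abs_L2 f = abs_L2 g" shows "AE x in lborel. f x = g x"
  using rp_abs[OF assms(1)] rp_abs[OF assms(2)] unfolding assms(3) by eventually_elim simp

lemma sqi_bound:
  assumes "sqi g" "f \<in> BM" "AE x in lborel. cmod (f x) <= cmod (g x)"
  shows "sqi f"
proof -
  have [measurable]: "f \<in> BM" by fact
  have "integrable lborel (%x. (cmod (f x))^2)"
    using sqi_integrable[OF assms(1)]
    by (rule Bochner_Integration.integrable_bound)
       (use assms(3) in "auto elim!: eventually_mono intro: power_mono")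
  then show ?thesis by (simp add: sqi_def)
qed

lemma sqi_cmult: "sqi f ==> sqi (%x. c * f x)"
  by (auto simp: sqi_def norm_mult power_mult_distrib)

lemma sqi_zero: "sqi (%x. 0)" by (simp add: sqi_def)

lemma sqi_norm: "sqi f ==> sqi (%x. complex_of_real (cmod (f x)))"
  by (auto simp: sqi_def)

lemma sqi_cnj: "sqi f ==> sqi (%x. cnj (f x))"
  by (auto simp: sqi_def intro: continuous_intros borel_measurable_continuous_on[where f=cnj])

lemma sqi_uminus: "sqi f ==> sqi (%x. - f x)"
  by (auto simp: sqi_def)

lemma sqi_add: assumes "sqi f" "sqi g" shows "sqi (%x. f x + g x)"
proof -
  have m [measurable]: "(%x. f x + g x) \<in> BM"
    using assms by (auto simp: sqi_def)
  have "square_integrable (%x. f x + g x)"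
    by (intro square_integrable_add sqi_square_integrable assms)
  from sqi_AE_lebesgue[OF this m] show ?thesis by simp
qed

lemma sqi_diff: assumes "sqi f" "sqi g" shows "sqi (%x. f x - g x)"
  using sqi_add[OF assms(1) sqi_uminus[OF assms(2)]] by simp

lemma abs_add: "sqi f ==> sqi g ==> abs_L2 f + abs_L2 g = abs_L2 (%x. f x + g x)"
  using plus_L2.abs_eq[of f g] by (simp add: L2_rel_def sqi_square_integrable)

lemma abs_uminus: "sqi f ==> - abs_L2 f = abs_L2 (%x. - f x)"
  using uminus_L2.abs_eq[of f] by (simp add: L2_rel_def sqi_square_integrable)

lemma abs_cmult: "sqi f ==> cmult_L2 c (abs_L2 f) = abs_L2 (%x. c * f x)"
  using cmult_L2.abs_eq[of f c] by (simp add: L2_rel_def sqi_square_integrable)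

lemma abs_zero: "abs_L2 (%x. 0) = 0"
  by (simp add: zero_L2.abs_eq)

lemma rp_add: "AE x in lborel. rp (u + v) x = rp u x + rp v x"
  using rp_abs[OF sqi_add[OF sqi_rp[of u] sqi_rp[of v]]]
  by (simp add: abs_add[OF sqi_rp sqi_rp, symmetric] abs_rp)

lemma rp_uminus: "AE x in lborel. rp (- u) x = - rp u x"
  using rp_abs[OF sqi_uminus[OF sqi_rp[of u]]]
  by (simp add: abs_uminus[OF sqi_rp, symmetric] abs_rp)

lemma rp_cmult: "AE x in lborel. rp (cmult_L2 c u) x = c * rp u x"
  using rp_abs[OF sqi_cmult[OF sqi_rp[of u], of c]]
  by (simp add: abs_cmult[OF sqi_rp, symmetric] abs_rp)

lemma rp_scaleR: "AE x in lborel. rp (c *\<^sub>R u) x = complex_of_real c * rp u x"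
  by (simp add: scaleR_L2_def rp_cmult)

lemma rp_diff: "AE x in lborel. rp (u - v) x = rp u x - rp v x"
  using rp_add[of u "- v"] rp_uminus[of v] by eventually_elim simp

lemma rp_zero: "AE x in lborel. rp 0 x = 0"
  using rp_abs[OF sqi_zero] by (simp add: abs_zero)

lemma norm_abs_sqr: assumes "sqi f" shows "(norm (abs_L2 f))^2 = (LINT x|lborel. (cmod (f x))^2)"
proof -
  have "norm (abs_L2 f) = L2_norm f"
    using norm_L2.abs_eq[of f] by (simp add: L2_rel_def sqi_square_integrable assms)
  also have "\<dots> = sqrt (LINT x|lborel. (cmod (f x))^2)"
    using assms unfolding L2_norm_def by (subst integral_completion) (auto simp: sqi_def)
  finally show ?thesis by simp
qed

lemma norm_rp_sqr: "(norm u)^2 = (LINT x|lborel. (cmod (rp u x))^2)"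
  using norm_abs_sqr[OF sqi_rp[of u]] by (simp add: abs_rp)

lemma norm_le_of_AE:
  assumes "AE x in lborel. cmod (rp u x) <= C * cmod (rp v x)" "0 <= C"
  shows "norm u <= C * norm v"
proof -
  have "(norm u)^2 <= (LINT x|lborel. C^2 * (cmod (rp v x))^2)"
    unfolding norm_rp_sqr
  proof (rule integral_mono_AE)
    show "AE x in lborel. (cmod (rp u x))^2 <= C^2 * (cmod (rp v x))^2"
      using assms(1) by eventually_elim (simp flip: power_mult_distrib add: power_mono)
  qed (intro integrable_mult_right sqi_integrable sqi_rp)+
  also have "\<dots> = (C * norm v)^2" by (simp add: norm_rp_sqr power_mult_distrib)
  finally show ?thesis by (rule power2_le_imp_le) (use assms(2) in simp)
qed

lemma norm_eq_of_AE:
  assumes "AE x in lborel. cmod (rp u x) = cmod (rp v x)"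
  shows "norm u = norm v"
proof (rule antisym)
  show "norm u <= norm v" using norm_le_of_AE[of u 1 v] assms eventually_mono[OF assms] by auto
  show "norm v <= norm u" using norm_le_of_AE[of v 1 u] eventually_mono[OF assms, of "%x. cmod (rp v x) <= cmod (rp u x)"] by auto
qed

lemma norm_cmult [simp]: "norm (cmult_L2 c u) = cmod c * norm u"
proof -
  have "(norm (cmult_L2 c u))^2 = (LINT x|lborel. (cmod c)^2 * (cmod (rp u x))^2)"
    unfolding norm_rp_sqr using rp_cmult[of c u]
    by (intro integral_cong_AE) (auto elim!: eventually_mono simp: norm_mult power_mult_distrib)
  also have "\<dots> = (cmod c * norm u)^2" by (simp add: norm_rp_sqr power_mult_distrib)
  finally show ?thesis by simp
qed

lemma cmult_add: "cmult_L2 c (u + v) = cmult_L2 c u + cmult_L2 c v"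
  by (rule L2_eqI) (use rp_cmult[of c "u + v"] rp_cmult[of c u] rp_cmult[of c v] rp_add[of u v]
    rp_add[of "cmult_L2 c u" "cmult_L2 c v"] in "eventually_elim, simp add: algebra_simps")

lemma cmult_cmult: "cmult_L2 c (cmult_L2 d u) = cmult_L2 (c * d) u"
  by (rule L2_eqI) (use rp_cmult[of c "cmult_L2 d u"] rp_cmult[of d u] rp_cmult[of "c * d" u]
    in "eventually_elim, simp add: algebra_simps")

lemma cmult_1: "cmult_L2 1 u = u"
  by (rule L2_eqI) (use rp_cmult[of 1 u] in "eventually_elim, simp")

lemma bounded_linear_cmult: "bounded_linear (cmult_L2 c)"
proof (rule bounded_linear_intro[where K="cmod c"])
  show "cmult_L2 c (r *\<^sub>R u) = r *\<^sub>R cmult_L2 c u" for r u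
    by (simp add: scaleR_L2_def cmult_cmult mult.commute)
qed (simp_all add: cmult_add mult.commute)

lemmas cmult_diff = linear_diff[OF bounded_linear.linear[OF bounded_linear_cmult]]

section \<open>The bilinear pairing of two classes and its nondegeneracy\<close>

lemma sqi_mult_integrable:
  assumes "sqi f" "sqi g" shows "integrable lborel (%x. f x * g x)"
proof -
  have [measurable]: "f \<in> BM" "g \<in> BM"
    using assms by (auto simp: sqi_def)
  have "integrable lborel (%x. (cmod (f x))^2 + (cmod (g x))^2)"
    using assms by (auto simp: sqi_def)
  then show ?thesis
  proof (rule Bochner_Integration.integrable_bound)
    show "AE x in lborel. norm (f x * g x) <= norm ((cmod (f x))^2 + (cmod (g x))^2)"
    proof (rule AE_I2)
      fix x
      have "2 * cmod (f x) * cmod (g x) <= (cmod (f x))^2 + (cmod (g x))^2" by (rule sum_squares_bound)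
      moreover have "0 <= cmod (f x) * cmod (g x)" by simp
      ultimately have "cmod (f x) * cmod (g x) <= (cmod (f x))^2 + (cmod (g x))^2" by linarith
      then show "norm (f x * g x) <= norm ((cmod (f x))^2 + (cmod (g x))^2)"
        by (simp add: norm_mult)
    qed
  qed simp
qed

lemma L2_holder:
  assumes "sqi f" "sqi g"
  shows "(LINT x|lborel. cmod (f x) * cmod (g x)) <= norm (abs_L2 f) * norm (abs_L2 g)"
proof -
  have [measurable]: "f \<in> BM" "g \<in> BM"
    using assms by (auto simp: sqi_def)
  have i: "integrable lborel (%x. cmod (f x) * cmod (g x))"
    using sqi_mult_integrable[OF assms, THEN integrable_norm] by (simp add: norm_mult)
  have n: "(\<integral>\<^sup>+x. ennreal (cmod (h x)) ^ 2 \<partial>lborel) = ennreal ((norm (abs_L2 h))^2)" if "sqi h" for h :: "real^'a => complex"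
    using that norm_abs_sqr[OF that] sqi_integrable[OF that]
    by (simp add: ennreal_power nn_integral_eq_integral)
  have "(\<integral>\<^sup>+x. ennreal (cmod (f x)) * ennreal (cmod (g x)) \<partial>lborel)^2
      <= (\<integral>\<^sup>+x. ennreal (cmod (f x)) ^ 2 \<partial>lborel) * (\<integral>\<^sup>+x. ennreal (cmod (g x)) ^ 2 \<partial>lborel)"
    by (rule Cauchy_Schwarz_nn_integral) auto
  also have "(\<integral>\<^sup>+x. ennreal (cmod (f x)) * ennreal (cmod (g x)) \<partial>lborel)
     = ennreal (LINT x|lborel. cmod (f x) * cmod (g x))"
    using i by (subst nn_integral_eq_integral[symmetric]) (auto simp: ennreal_mult)
  finally have "(LINT x|lborel. cmod (f x) * cmod (g x))^2 <= (norm (abs_L2 f) * norm (abs_L2 g))^2"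
    unfolding n[OF assms(1)] n[OF assms(2)]
    by (simp add: ennreal_power ennreal_mult[symmetric] power_mult_distrib)
  then show ?thesis by (rule power2_le_imp_le) simp
qed

text \<open>Bilinear rather than Hermitian, because weak derivatives and the multiplication formula
  of the Fourier transform carry no conjugates. With the conjugation \<open>cj\<close>, the
  Hermitian product is \<open>pr u (cj v)\<close>.\<close>

definition pr :: "'n::finite L2 => 'n L2 => complex" where
  "pr u v = (LINT x|lborel. rp u x * rp v x)"

lemma pr_cong_AE:
  assumes "AE x in lborel. rp u x = f x" "AE x in lborel. rp v x = g x"
    "f \<in> BM" "g \<in> BM"
  shows "pr u v = (LINT x|lborel. f x * g x)"
  unfolding pr_def using assms by (intro integral_cong_AE) auto

lemma pr_abs: "sqi f ==> sqi g ==> pr (abs_L2 f) (abs_L2 g) = (LINT x|lborel. f x * g x)"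
  by (intro pr_cong_AE rp_abs) (auto simp: sqi_def)

lemma pr_commute: "pr u v = pr v u"
  by (simp add: pr_def mult.commute)

lemma pr_add_right: "pr u (v + w) = pr u v + pr u w"
proof -
  have "pr u (v + w) = (LINT x|lborel. rp u x * (rp v x + rp w x))"
    by (rule pr_cong_AE) (auto simp: rp_add)
  also have "\<dots> = pr u v + pr u w"
    unfolding pr_def distrib_left
    by (rule Bochner_Integration.integral_add) (auto intro!: sqi_mult_integrable sqi_rp)
  finally show ?thesis .
qed

lemma pr_cmult_right: "pr u (cmult_L2 c v) = c * pr u v"
proof -
  have "pr u (cmult_L2 c v) = (LINT x|lborel. rp u x * (c * rp v x))"
    by (rule pr_cong_AE) (auto simp: rp_cmult)
  also have "\<dots> = c * pr u v"
    unfolding pr_def by (subst integral_mult_right_zero[symmetric]) (simp add: ac_simps)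
  finally show ?thesis .
qed

lemma norm_pr_le: "norm (pr u v) <= norm u * norm v"
proof -
  have "norm (pr u v) <= (LINT x|lborel. cmod (rp u x) * cmod (rp v x))"
    unfolding pr_def norm_mult[symmetric] by (rule integral_norm_bound)
  also have "\<dots> <= norm u * norm v" using L2_holder[OF sqi_rp[of u] sqi_rp[of v]] by (simp add: abs_rp)
  finally show ?thesis .
qed

lemma bounded_bilinear_pr: "bounded_bilinear pr"
proof
  show "pr (u + v) w = pr u w + pr v w" for u v w :: "'a L2" by (metis pr_commute pr_add_right)
  show "pr u (v + w) = pr u v + pr u w" for u v w :: "'a L2" by (rule pr_add_right)
  show "pr (r *\<^sub>R u) v = r *\<^sub>R pr u v" for r and u v :: "'a L2"
    by (metis pr_commute pr_cmult_right scaleR_L2_def scaleR_conv_of_real)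
  show "pr u (r *\<^sub>R v) = r *\<^sub>R pr u v" for r and u v :: "'a L2"
    by (metis pr_cmult_right scaleR_L2_def scaleR_conv_of_real)
  show "\<exists>K. \<forall>u v :: 'a L2. norm (pr u v) <= norm u * norm v * K"
    by (rule exI[of _ 1]) (simp add: norm_pr_le)
qed

lemmas bounded_linear_pr_right = bounded_bilinear.bounded_linear_right[OF bounded_bilinear_pr]
lemmas bounded_linear_pr_left = bounded_bilinear.bounded_linear_left[OF bounded_bilinear_pr]
lemmas pr_diff_right = bounded_bilinear.diff_right[OF bounded_bilinear_pr]
lemmas pr_diff_left = bounded_bilinear.diff_left[OF bounded_bilinear_pr]
lemmas pr_add_left = bounded_bilinear.add_left[OF bounded_bilinear_pr]

lemma pr_cmult_left: "pr (cmult_L2 c u) v = c * pr u v"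
  by (metis pr_commute pr_cmult_right)

definition cj :: "'n::finite L2 => 'n L2" where "cj u = abs_L2 (%x. cnj (rp u x))"

lemma rp_cj: "AE x in lborel. rp (cj u) x = cnj (rp u x)"
  unfolding cj_def by (intro rp_abs sqi_cnj sqi_rp)

lemma cj_cj [simp]: "cj (cj u) = u"
  by (rule L2_eqI) (use rp_cj[of u] rp_cj[of "cj u"] in "eventually_elim, simp")

lemma cj_add: "cj (u + v) = cj u + cj v"
  by (rule L2_eqI) (use rp_cj[of "u + v"] rp_cj[of u] rp_cj[of v] rp_add[of u v]
    rp_add[of "cj u" "cj v"] in "eventually_elim, simp")

lemma cj_cmult: "cj (cmult_L2 c u) = cmult_L2 (cnj c) (cj u)"
  by (rule L2_eqI) (use rp_cj[of "cmult_L2 c u"] rp_cj[of u] rp_cmult[of c u]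
    rp_cmult[of "cnj c" "cj u"] in "eventually_elim, simp")

lemma cj_abs: "sqi f ==> cj (abs_L2 f) = abs_L2 (%x. cnj (f x))"
  unfolding cj_def using rp_abs[of f]
  by (intro abs_eqI sqi_cnj sqi_rp) (auto elim: eventually_mono)

lemma pr_cj_self: "pr u (cj u) = of_real ((norm u)^2)"
proof -
  have "pr u (cj u) = (LINT x|lborel. rp u x * cnj (rp u x))"
    by (rule pr_cong_AE) (auto simp: rp_cj intro: borel_measurable_continuous_on[where f=cnj] continuous_intros)
  also have "\<dots> = (LINT x|lborel. complex_of_real ((cmod (rp u x))^2))"
    by (simp only: complex_norm_square)
  also have "\<dots> = of_real ((norm u)^2)" unfolding norm_rp_sqr by (rule integral_complex_of_real)
  finally show ?thesis .
qed

lemma pr_nondegenerate: assumes "!!v. pr u v = 0" shows "u = 0"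
  using pr_cj_self[of u] assms[of "cj u"] by simp

lemma pr_eqI: assumes "!!w. pr u w = pr v w" shows "u = v"
  using pr_nondegenerate[of "u - v"] assms by (simp add: pr_diff_left)

section \<open>Dominated convergence and completeness\<close>

lemma L2_dominated_convergence:
  fixes f :: "nat => real^'n::finite => complex"
  assumes meas: "!!j. f j \<in> BM" "g \<in> BM"
    and lim: "AE x in lborel. (%j. f j x) \<longlonglongrightarrow> g x"
    and bd: "!!j. AE x in lborel. cmod (f j x) <= cmod (w x)" and w: "sqi w"
  shows "sqi g" "!!j. sqi (f j)" "(%j. abs_L2 (f j)) \<longlonglongrightarrow> abs_L2 g"
proof -
  note [measurable] = meas sqi_measurable[OF w]
  show f: "sqi (f j)" for j by (rule sqi_bound[OF w]) (use bd in auto)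
  have bd': "AE x in lborel. \<forall>j. cmod (f j x) <= cmod (w x)" using bd by (simp add: AE_all_countable)
  have gb: "AE x in lborel. cmod (g x) <= cmod (w x)"
    using lim bd' by eventually_elim (metis LIMSEQ_le_const2 tendsto_norm)
  show g: "sqi g" by (rule sqi_bound[OF w]) (use gb in auto)
  have "(%j. LINT x|lborel. (cmod (f j x - g x))^2) \<longlonglongrightarrow> (LINT x|(lborel::(real^'n) measure). 0)"
  proof (rule integral_dominated_convergence[where w="%x. 4 * (cmod (w x))^2"])
    show "AE x in lborel. (%j. (cmod (f j x - g x))^2) \<longlonglongrightarrow> 0"
      using lim by eventually_elim (auto intro!: tendsto_eq_intros simp: LIM_zero_iff)
    show "AE x in lborel. norm ((cmod (f j x - g x))^2) <= 4 * (cmod (w x))^2" for j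
      using bd[of j] gb
    proof eventually_elim
      case (elim x)
      have "cmod (f j x - g x) <= 2 * cmod (w x)"
        using norm_triangle_ineq4[of "f j x" "g x"] elim by linarith
      then have "(cmod (f j x - g x))^2 <= (2 * cmod (w x))^2" by (intro power_mono) auto
      then show ?case by (simp add: power_mult_distrib)
    qed
  qed (use sqi_integrable[OF w] in auto)
  then have "(%j. (norm (abs_L2 (f j) - abs_L2 g))^2) \<longlonglongrightarrow> 0"
    using f g norm_abs_sqr[OF sqi_diff, of "f _" g]
    by (simp add: abs_uminus abs_add sqi_uminus minus_L2_def)
  then have "(%j. sqrt ((norm (abs_L2 (f j) - abs_L2 g))^2)) \<longlonglongrightarrow> sqrt 0"
    by (rule tendsto_real_sqrt)
  then have "(%j. norm (abs_L2 (f j) - abs_L2 g)) \<longlonglongrightarrow> 0"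
    by (simp only: real_sqrt_abs abs_norm_cancel real_sqrt_zero)
  then show "(%j. abs_L2 (f j)) \<longlonglongrightarrow> abs_L2 g"
    by (simp add: tendsto_norm_zero_iff LIM_zero_iff)
qed

lemma abs_diff: "sqi f ==> sqi g ==> abs_L2 f - abs_L2 g = abs_L2 (%x. f x - g x)"
  by (simp add: abs_uminus abs_add sqi_uminus minus_L2_def)

text \<open>On a space of infinite measure a square integrable function need not be integrable. Its
  product with such a weight is, and dividing by the weight afterwards recovers statements that hold
  almost everywhere.\<close>

lemma sqi_positive: "\<exists>w :: real^'n::finite => complex. sqi w & (\<forall>x. 0 < cmod (w x))"
proof -
  obtain h :: "real^'n => real" where h: "h \<in> borel_measurable lborel" "!!x. h x > 0" "integrable lborel h"
    using sigma_finite_measure.obtain_positive_integrable_function[OF sigma_finite_lborel] by metis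
  have [measurable]: "h \<in> BM" using h by simp
  have "sqi (%x. complex_of_real (sqrt (h x)))"
    using h by (auto simp: sqi_def abs_of_pos less_imp_le)
  moreover have "\<forall>x. 0 < cmod (complex_of_real (sqrt (h x)))" using h(2) less_imp_neq by fastforce
  ultimately show ?thesis by (intro exI conjI)
qed

text \<open>The Riesz-Fischer argument: the increments, multiplied by a positive square integrable
  weight, have summable integrals, so the representatives converge almost everywhere. Fatou's lemma
  then yields convergence in norm.\<close>

lemma L2_Cauchy_subseq_convergent:
  fixes X :: "nat => 'n::finite L2"
  assumes X: "Cauchy X" and r: "!!j. norm (X (Suc j) - X j) <= (1/2)^j"
  shows "convergent X"
proof -
  obtain w :: "real^'n => complex" where w: "sqi w" "!!x. 0 < cmod (w x)" using sqi_positive by blast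
  note [measurable] = sqi_measurable[OF w(1)]
  define f where "f j = rp (X j)" for j
  have [measurable]: "f j \<in> BM" and f: "sqi (f j)" for j
    by (auto simp: f_def sqi_rp)
  have af: "abs_L2 (%x. f i x - f j x) = X i - X j" for i j
    by (subst abs_diff[symmetric]) (simp_all add: f, simp add: f_def abs_rp)
  have "(\<integral>\<^sup>+x. (\<Sum>j. ennreal (cmod (w x) * cmod (f (Suc j) x - f j x))) \<partial>lborel)
     = (\<Sum>j. \<integral>\<^sup>+x. ennreal (cmod (w x) * cmod (f (Suc j) x - f j x)) \<partial>lborel)"
    by (intro nn_integral_suminf) auto
  also have "\<dots> <= (\<Sum>j. ennreal (norm (abs_L2 w) * (1/2)^j))"
  proof (intro suminf_le)
    fix j
    have "integrable lborel (%x. cmod (w x) * cmod (f (Suc j) x - f j x))"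
      using sqi_mult_integrable[OF w(1) sqi_diff[OF f f], THEN integrable_norm, of "Suc j" j] by (simp add: norm_mult)
    then have "(\<integral>\<^sup>+x. ennreal (cmod (w x) * cmod (f (Suc j) x - f j x)) \<partial>lborel)
        = ennreal (LINT x|lborel. cmod (w x) * cmod (f (Suc j) x - f j x))"
      by (intro nn_integral_eq_integral) auto
    also have "\<dots> <= ennreal (norm (abs_L2 w) * (1/2)^j)"
      using L2_holder[OF w(1) sqi_diff[OF f f], of "Suc j" j] r[of j]
      unfolding af by (intro ennreal_leI) (use mult_left_mono[OF r[of j], of "norm (abs_L2 w)"] in simp)
    finally show "(\<integral>\<^sup>+x. ennreal (cmod (w x) * cmod (f (Suc j) x - f j x)) \<partial>lborel)
      <= ennreal (norm (abs_L2 w) * (1/2)^j)" .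
  qed auto
  also have "\<dots> < \<infinity>"
    by (subst suminf_ennreal2) (auto intro!: summable_mult summable_geometric simp del: power_one_over)
  finally have "AE x in lborel. (\<Sum>j. ennreal (cmod (w x) * cmod (f (Suc j) x - f j x))) ~= \<infinity>"
    by (intro nn_integral_PInf_AE) auto
  then have conv: "AE x in lborel. convergent (%j. f j x)"
  proof eventually_elim
    case (elim x)
    then have "summable (%j. cmod (w x) * cmod (f (Suc j) x - f j x))"
      by (intro summable_suminf_not_top) (auto simp: infinity_ennreal_def)
    then have "summable (%j. cmod (f (Suc j) x - f j x))"
      using w(2)[of x] by (simp add: summable_cmult_iff)
    then have "summable (%j. f (Suc j) x - f j x)" by (rule summable_norm_cancel)
    then have "convergent (%n. f 0 x + (\<Sum>j<n. f (Suc j) x - f j x))"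
      by (intro convergent_add convergent_const) (simp add: summable_iff_convergent)
    moreover have "f 0 x + (\<Sum>j<n. f (Suc j) x - f j x) = f n x" for n
      using sum_lessThan_telescope[of "%j. f j x" n] by simp
    ultimately show ?case by simp
  qed
  define g where "g x = (if convergent (%j. f j x) then lim (%j. f j x) else 0)" for x
  have cm [measurable]: "Measurable.pred borel (%x. convergent (%j. f j x))"
    unfolding Cauchy_convergent_iff[symmetric] by measurable
  have [measurable]: "g \<in> BM" unfolding g_def by measurable
  have lim: "AE x in lborel. (%j. f j x) \<longlonglongrightarrow> g x"
    using conv by eventually_elim (simp add: g_def convergent_LIMSEQ_iff)
  \<comment> \<open>Fatou's lemma for \<open>f j - f i\<close> with growing j: a bound on the tail
    of the sequence passes to the pointwise limit.\<close>
  have key: "sqi (%x. g x - f i x) & norm (abs_L2 (%x. g x - f i x)) <= e"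
    if e: "0 < e" "!!j. j >= i ==> norm (X j - X i) <= e" for e i
  proof -
    have "(\<integral>\<^sup>+x. ennreal ((cmod (g x - f i x))^2) \<partial>lborel) = (\<integral>\<^sup>+x. liminf (%j. ennreal ((cmod (f j x - f i x))^2)) \<partial>lborel)"
    proof (intro nn_integral_cong_AE, use lim in eventually_elim)
      case (elim x)
      have "(%j. ennreal ((cmod (f j x - f i x))^2)) \<longlonglongrightarrow> ennreal ((cmod (g x - f i x))^2)"
        by (intro tendsto_intros tendsto_ennrealI elim)
      then show ?case by (intro lim_imp_Liminf[symmetric]) auto
    qed
    also have "\<dots> <= liminf (%j. \<integral>\<^sup>+x. ennreal ((cmod (f j x - f i x))^2) \<partial>lborel)"
      by (intro nn_integral_liminf) auto
    also have "\<dots> <= liminf (%j. ennreal (e^2))"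
    proof (intro Liminf_mono eventually_sequentiallyI[of i])
      fix j assume "i <= j"
      have "(\<integral>\<^sup>+x. ennreal ((cmod (f j x - f i x))^2) \<partial>lborel) = ennreal ((norm (X j - X i))^2)"
        using norm_abs_sqr[OF sqi_diff[OF f f], of j i] sqi_integrable[OF sqi_diff[OF f f], of j i]
        by (subst nn_integral_eq_integral) (auto simp: af)
      also have "\<dots> <= ennreal (e^2)" using e(2)[OF \<open>i <= j\<close>] by (intro ennreal_leI power_mono) auto
      finally show "(\<integral>\<^sup>+x. ennreal ((cmod (f j x - f i x))^2) \<partial>lborel) <= ennreal (e^2)" .
    qed
    finally have le: "(\<integral>\<^sup>+x. ennreal ((cmod (g x - f i x))^2) \<partial>lborel) <= ennreal (e^2)"
      by (simp add: Liminf_const)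
    have s: "sqi (%x. g x - f i x)"
      unfolding sqi_def using le by (auto intro!: integrableI_bounded simp: less_top top_unique)
        (metis ennreal_less_top le_less_trans)
    have "ennreal ((norm (abs_L2 (%x. g x - f i x)))^2) <= ennreal (e^2)"
      using le norm_abs_sqr[OF s] sqi_integrable[OF s] by (simp add: nn_integral_eq_integral)
    then have "(norm (abs_L2 (%x. g x - f i x)))^2 <= e^2" by simp
    with s e(1) show ?thesis by (auto intro: power2_le_imp_le)
  qed
  have C: "\<exists>M. \<forall>j\<ge>M. \<forall>i\<ge>M. norm (X j - X i) <= e" if "0 < e" for e
    using X that by (metis CauchyD less_imp_le)
  obtain M where "!!j i. j >= M ==> i >= M ==> norm (X j - X i) <= 1" using C[of 1] by auto
  then have "sqi (%x. g x - f M x)" using key[of 1 M] by auto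
  from sqi_add[OF this f[of M]] have g: "sqi g" by simp
  have "X \<longlonglongrightarrow> abs_L2 g"
  proof (rule LIMSEQ_I)
    fix e :: real assume "0 < e"
    then obtain M where M: "!!j i. j >= M ==> i >= M ==> norm (X j - X i) <= e/2"
      using C[of "e/2"] by auto
    have "norm (X i - abs_L2 g) < e" if "i >= M" for i
    proof -
      have "norm (abs_L2 (%x. g x - f i x)) <= e/2" using key[of "e/2" i] M that \<open>0 < e\<close> by auto
      then have "norm (abs_L2 g - X i) <= e/2"
        using abs_diff[OF g f[of i]] by (simp add: f_def abs_rp)
      then show ?thesis using \<open>0 < e\<close> by (simp add: norm_minus_commute)
    qed
    then show "\<exists>no. \<forall>n\<ge>no. norm (X n - abs_L2 g) < e" by blast
  qed
  then show ?thesis by (rule convergentI)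
qed

instance L2 :: (finite) banach
proof
  fix X :: "nat => 'a L2" assume X: "Cauchy X"
  have "\<forall>j. \<exists>M. \<forall>m\<ge>M. \<forall>n\<ge>M. norm (X m - X n) < (1/2)^j"
    by (intro allI CauchyD X) simp
  then obtain M where M: "!!j m n. m >= M j ==> n >= M j ==> norm (X m - X n) < (1/2)^j" by metis
  \<comment> \<open>\<open>Suc s\<close> keeps the indices strictly increasing, and
    \<open>M (Suc j)\<close> puts them beyond the Cauchy thresholds.\<close>
  define r where "r = rec_nat (M 0) (%j s. max (Suc s) (M (Suc j)))"
  have r: "strict_mono r" by (rule strict_mono_Suc_iff[THEN iffD2]) (auto simp: r_def)
  have rM: "M j <= r j" for j by (cases j) (auto simp: r_def)
  have "convergent (X \<circ> r)"
  proof (rule L2_Cauchy_subseq_convergent)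
    show "Cauchy (X \<circ> r)" using X r by (rule Cauchy_subseq_Cauchy)
    fix j
    have "norm (X (r (Suc j)) - X (r j)) < (1/2)^j"
      by (rule M) (use rM[of j] r in "auto simp: strict_mono_Suc_iff intro: order_trans less_imp_le")
    then show "norm ((X \<circ> r) (Suc j) - (X \<circ> r) j) <= (1/2)^j" by simp
  qed
  then obtain l where "(X \<circ> r) \<longlonglongrightarrow> l" by (auto simp: convergent_def)
  have "X \<longlonglongrightarrow> l" by (rule Cauchy_converges_subseq) fact+
  then show "convergent X" by (rule convergentI)
qed

section \<open>Density of the continuous functions with bounded support\<close>

definition Cc :: "(real^'n::finite => complex) => bool" where
  "Cc f \<longleftrightarrow> continuous_on UNIV f & (\<exists>R. \<forall>x. R < norm x --> f x = 0)"

lemma Cc_measurable: "Cc f ==> f \<in> BM"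
  by (auto simp: Cc_def intro: borel_measurable_continuous_onI)

lemma Cc_bounded: assumes "Cc f" shows "\<exists>B>0. \<exists>R. \<forall>x. cmod (f x) <= B * indicator (cball 0 R) x"
proof -
  obtain R where R: "!!x. R < norm x ==> f x = 0" using assms by (auto simp: Cc_def)
  have "compact (f ` cball 0 R)"
    using assms by (intro compact_continuous_image compact_cball) (auto simp: Cc_def intro: continuous_on_subset)
  then have "bounded (f ` cball 0 R)" by (rule compact_imp_bounded)
  then obtain B where B: "0 < B" "\<forall>y\<in>f ` cball 0 R. norm y <= B" unfolding bounded_pos by blast
  have "cmod (f x) <= B * indicator (cball 0 R) x" for x
    using B(2) R[of x] by (cases "x \<in> cball 0 R") (simp_all add: not_le image_iff)
  with B show ?thesis by blast
qed

lemma indicator_cball_integrable: "integrable lborel (indicator (cball (0::real^'n::finite) R) :: _ => real)"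
  using emeasure_lborel_cball_finite[of 0 R] by (simp add: integrable_indicator_iff less_top)

lemma Cc_integrable: assumes "Cc f" shows "integrable lborel f"
proof -
  have [measurable]: "f \<in> BM" using assms by (rule Cc_measurable)
  obtain B R where "!!x. cmod (f x) <= B * indicator (cball 0 R) x" using Cc_bounded[OF assms] by blast
  then show ?thesis
    by (intro Bochner_Integration.integrable_bound[OF integrable_mult_right[OF indicator_cball_integrable]])
       (auto intro!: AE_I2 order_trans[OF _ abs_ge_self])
qed

lemma Cc_sqi: assumes "Cc f" shows "sqi f"
proof -
  have [measurable]: "f \<in> BM" using assms by (rule Cc_measurable)
  obtain B R where B: "!!x. cmod (f x) <= B * indicator (cball 0 R) x" using Cc_bounded[OF assms] by blast
  have "(cmod (f x))^2 <= B^2 * indicator (cball 0 R) x" for x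
    using power_mono[OF B[of x], of 2] by (auto simp: indicator_def split: if_splits)
  then have "integrable lborel (%x. (cmod (f x))^2)"
    by (intro Bochner_Integration.integrable_bound[OF integrable_mult_right[OF indicator_cball_integrable]])
       (auto intro!: AE_I2 order_trans[OF _ abs_ge_self])
  then show ?thesis by (simp add: sqi_def)
qed

text \<open>Truncate first in space and in size. A bounded measurable function vanishing off a ball
  is an almost everywhere limit of continuous ones; these are corrected to share its bound and, up
  to a margin of one, its support, so that dominated convergence applies.\<close>

lemma Cc_dense: fixes u :: "'n::finite L2" shows "\<exists>f. (\<forall>j::nat. Cc (f j)) & (%j. abs_L2 (f j)) \<longlonglongrightarrow> u"
proof -
  have trunc: "\<exists>f. (\<forall>j::nat. Cc (f j)) & (%j. abs_L2 (f j)) \<longlonglongrightarrow> abs_L2 g"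
    if g: "g \<in> BM" and B: "!!x. cmod (g x) <= B * indicator (cball 0 R) x" "B > 0"
    for g :: "real^'n => complex" and B R
  proof -
    have "g measurable_on UNIV"
      using g by (intro lebesgue_measurable_imp_measurable_on) (auto intro: measurable_completion)
    then obtain N h where N: "negligible N" and hc: "!!j. continuous_on UNIV (h j)"
      and hl: "!!x. x \<notin> N ==> (%j. h j x) \<longlonglongrightarrow> g x"
      unfolding measurable_on_def by (auto simp: UNIV_I)
    define c where "c x = complex_of_real (max 0 (min 1 (R + 1 - norm x)))" for x :: "real^'n"
    \<comment> \<open>The nearest point projection onto the disc of radius B is continuous and fixes
      the values of g: it bounds the approximants without changing their limit.\<close>
    define p where "p = closest_point (cball (0::complex) B)"
    have ne: "closed (cball (0::complex) B)" "cball (0::complex) B ~= {}" "convex (cball (0::complex) B)" using B(2) by auto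
    have pc: "continuous_on UNIV p" unfolding p_def using ne by (intro continuous_on_closest_point) auto
    have pb: "cmod (p z) <= B" for z unfolding p_def using closest_point_in_set[OF ne(1,2), of z] by simp
    have pid: "cmod z <= B ==> p z = z" for z unfolding p_def by (rule closest_point_self) simp
    define f where "f j x = c x * p (h j x)" for j x
    have cc: "continuous_on UNIV c" unfolding c_def by (intro continuous_intros)
    have fc: "Cc (f j)" for j
      unfolding Cc_def f_def
    proof (intro conjI exI[of _ "R + 1"] allI impI continuous_on_mult cc)
      show "continuous_on UNIV (%x. p (h j x))"
        by (rule continuous_on_compose2[OF pc hc]) auto
    qed (auto simp: c_def)
    have fl: "(%j. f j x) \<longlonglongrightarrow> g x" if "x \<notin> N" for x
    proof -
      have "cmod (g x) <= B" using B(1)[of x] B(2) by (cases "x \<in> cball 0 R") auto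
      then have "(%j. p (h j x)) \<longlonglongrightarrow> p (g x)" "p (g x) = g x"
        using hl[OF that] pid continuous_on_tendsto_compose[OF pc, of "%j. h j x" "g x"] by auto
      then have "(%j. f j x) \<longlonglongrightarrow> c x * g x" unfolding f_def by (auto intro!: tendsto_intros)
      moreover have "c x * g x = g x"
        using B(1)[of x] by (cases "x \<in> cball 0 R") (auto simp: c_def)
      ultimately show ?thesis by simp
    qed
    have "(%j. abs_L2 (f j)) \<longlonglongrightarrow> abs_L2 g"
    proof (rule L2_dominated_convergence(3))
      show "f j \<in> BM" for j by (intro Cc_measurable fc)
      show "AE x in lborel. (%j. f j x) \<longlonglongrightarrow> g x"
      proof -
        have "AE x in lebesgue. x \<notin> N" using N by (intro AE_not_in) (simp add: negligible_iff_null_sets)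
        then show ?thesis unfolding AE_completion_iff by eventually_elim (rule fl)
      qed
      let ?w = "%x::real^'n. complex_of_real (B * indicator (cball 0 (R + 1)) x)"
      show "sqi ?w"
      proof -
        have "(cmod (?w x))^2 = B^2 * indicator (cball 0 (R + 1)) x" for x
          using B(2) by (auto simp: indicator_def)
        moreover have [measurable]: "cball (0::real^'n) (R + 1) \<in> sets borel" by simp
        have "?w \<in> BM" by measurable
        ultimately show ?thesis
          unfolding sqi_def using integrable_mult_right[OF indicator_cball_integrable[of "R+1"], of "B^2"]
          by (simp only:)
      qed
      show "AE x in lborel. cmod (f j x) <= cmod (?w x)" for j
      proof (rule AE_I2)
        fix x
        have "cmod (c x) <= indicator (cball 0 (R + 1)) x" by (auto simp: c_def indicator_def)
        then have "cmod (c x) * cmod (p (h j x)) <= indicator (cball 0 (R + 1)) x * B"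
          by (intro mult_mono pb) auto
        then show "cmod (f j x) <= cmod (?w x)" using B(2) by (simp add: f_def norm_mult mult.commute)
      qed
    qed (use g in auto)
    with fc show ?thesis by blast
  qed
  define g where "g j x = (if norm x <= real j & cmod (rp u x) <= real j then rp u x else 0)" for j x
  have [measurable]: "g j \<in> BM" for j unfolding g_def by measurable
  have gl: "(%j. abs_L2 (g j)) \<longlonglongrightarrow> abs_L2 (rp u)"
  proof (rule L2_dominated_convergence(3))
    show "AE x in lborel. (%j. g j x) \<longlonglongrightarrow> rp u x"
    proof (rule AE_I2, rule tendsto_eventually)
      fix x
      obtain M where "norm x <= real M" "cmod (rp u x) <= real M"
        by (metis real_arch_simple max.bounded_iff)
      then show "\<forall>\<^sub>F j in sequentially. g j x = rp u x"
        by (intro eventually_sequentiallyI[of M]) (auto simp: g_def)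
    qed
    show "AE x in lborel. cmod (g j x) <= cmod (rp u x)" for j by (auto simp: g_def)
  qed (auto simp: sqi_rp)
  have "\<exists>f. Cc f & norm (abs_L2 f - u) < 1 / real (Suc j)" for j
  proof -
    obtain i where i: "norm (abs_L2 (g i) - u) < 1 / real (Suc j) / 2"
      using LIMSEQ_D[OF gl, of "1 / real (Suc j) / 2"] by (auto simp: abs_rp)
    have "cmod (g i x) <= real (Suc i) * indicator (cball 0 (real i)) x" for x
      by (auto simp: g_def indicator_def)
    from trunc[OF _ this] obtain f where f: "!!j::nat. Cc (f j)" "(%j. abs_L2 (f j)) \<longlonglongrightarrow> abs_L2 (g i)"
      by auto
    obtain l where l: "norm (abs_L2 (f l) - abs_L2 (g i)) < 1 / real (Suc j) / 2"
      using LIMSEQ_D[OF f(2), of "1 / real (Suc j) / 2"] by auto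
    have "norm (abs_L2 (f l) - u) < 1 / real (Suc j)"
      using norm_triangle_ineq[of "abs_L2 (f l) - abs_L2 (g i)" "abs_L2 (g i) - u"] i l
      by (simp only: diff_add_cancel add_diff_eq)
    with f(1) show ?thesis by blast
  qed
  then obtain f where f: "!!j. Cc (f j)" "!!j. norm (abs_L2 (f j) - u) < 1 / real (Suc j)" by metis
  have "(%j. abs_L2 (f j) - u) \<longlonglongrightarrow> 0"
    using LIMSEQ_inverse_real_of_nat
    by (rule Lim_null_comparison[rotated]) (auto intro!: always_eventually less_imp_le f(2) simp: inverse_eq_divide simp del: of_nat_Suc)
  then show ?thesis using f(1) by (auto simp: LIM_zero_iff)
qed

lemma pr_eq_0_Cc:
  fixes u :: "'n::finite L2" assumes "!!f. Cc f ==> pr u (abs_L2 f) = 0" shows "u = 0"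
proof (rule pr_nondegenerate)
  fix v :: "'n L2"
  obtain f where f: "!!j::nat. Cc (f j)" "(%j. abs_L2 (f j)) \<longlonglongrightarrow> v" using Cc_dense by blast
  have "(%j. pr u (abs_L2 (f j))) \<longlonglongrightarrow> pr u v"
    by (intro bounded_linear.tendsto[OF bounded_linear_pr_right] f)
  then show "pr u v = 0" using f(1) assms by (simp add: LIMSEQ_const_iff)
qed

section \<open>The Fourier transform\<close>

lemma lborel_integrable_affine_iff:
  fixes f :: "'a::euclidean_space => 'b::{banach, second_countable_topology}"
  assumes [measurable]: "f \<in> BM" and c: "c ~= 0"
  shows "integrable lborel (%x. f (t + c *\<^sub>R x)) \<longleftrightarrow> integrable lborel f"
proof -
  have "integrable lborel f \<longleftrightarrow> integrable (distr lborel borel (%x. t + c *\<^sub>R x)) (%x. \<bar>c\<bar>^DIM('a) *\<^sub>R f x)"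
    by (subst lborel_affine[OF c, of t]) (simp add: integrable_density)
  also have "\<dots> \<longleftrightarrow> integrable lborel (%x. \<bar>c\<bar>^DIM('a) *\<^sub>R f (t + c *\<^sub>R x))"
    by (subst integrable_distr_eq) auto
  also have "\<dots> \<longleftrightarrow> integrable lborel (%x. f (t + c *\<^sub>R x))"
  proof
    assume "integrable lborel (%x. \<bar>c\<bar>^DIM('a) *\<^sub>R f (t + c *\<^sub>R x))"
    then have "integrable lborel (%x. (1 / \<bar>c\<bar>^DIM('a)) *\<^sub>R (\<bar>c\<bar>^DIM('a) *\<^sub>R f (t + c *\<^sub>R x)))"
      by (rule integrable_scaleR_right)
    then show "integrable lborel (%x. f (t + c *\<^sub>R x))" using c by simp
  qed auto
  finally show ?thesis by simp
qed

lemma lborel_integral_affine: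
  fixes f :: "'a::euclidean_space => 'b::{banach, second_countable_topology}"
  assumes [measurable]: "f \<in> BM" and c: "c ~= 0"
  shows "(LINT x|lborel. f x) = \<bar>c\<bar>^DIM('a) *\<^sub>R (LINT x|lborel. f (t + c *\<^sub>R x))"
proof -
  have "(LINT x|lborel. f x) = (LINT x|distr lborel borel (%x. t + c *\<^sub>R x). \<bar>c\<bar>^DIM('a) *\<^sub>R f x)"
    by (subst lborel_affine[OF c, of t]) (simp add: integral_density)
  also have "\<dots> = (LINT x|lborel. \<bar>c\<bar>^DIM('a) *\<^sub>R f (t + c *\<^sub>R x))"
    by (subst integral_distr) auto
  finally show ?thesis by simp
qed

lemma
  fixes h :: "'a::euclidean_space => real => complex"
  assumes "!!b. b \<in> Basis ==> integrable lborel (h b)"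
  shows integrable_prod_Basis: "integrable lborel (%x::'a. \<Prod>b\<in>Basis. h b (x \<bullet> b))"
    and integral_prod_Basis: "(LINT x|(lborel::'a measure). (\<Prod>b\<in>Basis. h b (x \<bullet> b))) = (\<Prod>b\<in>Basis. (LINT x|lborel. h b x))"
proof -
  interpret product_sigma_finite "%_::'a. lborel :: real measure" ..
  define k where "k b = (if b \<in> Basis then h b else (%_. 0))" for b :: 'a
  have k: "integrable lborel (k b)" for b using assms by (auto simp: k_def)
  have [measurable]: "k b \<in> BM" for b using k[of b] by auto
  have hk: "(%x::'a. \<Prod>b\<in>Basis. h b (x \<bullet> b)) = (%x. \<Prod>b\<in>Basis. k b (x \<bullet> b))"
    by (intro ext prod.cong) (auto simp: k_def)
  have eq: "(\<Prod>b\<in>Basis. k b ((\<Sum>c\<in>Basis. f c *\<^sub>R c) \<bullet> b)) = (\<Prod>b\<in>Basis. k b (f b))" for f :: "'a => real"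
    by (intro prod.cong) auto
  have [measurable]: "(%f. \<Sum>c\<in>Basis. f c *\<^sub>R c) \<in> measurable (PiM (Basis::'a set) (%_. lborel)) borel"
    by measurable
  have "integrable (PiM Basis (%_. lborel)) (%f. \<Prod>b\<in>Basis. k b (f b))"
    by (rule product_integrable_prod) (auto simp: k)
  then show "integrable lborel (%x::'a. \<Prod>b\<in>Basis. h b (x \<bullet> b))"
    unfolding hk by (subst lborel_eq) (subst integrable_distr_eq, simp_all add: eq)
  have "(LINT x|(lborel::'a measure). (\<Prod>b\<in>Basis. k b (x \<bullet> b))) = (\<Prod>b\<in>Basis. (LINT x|lborel. k b x))"
    by (subst lborel_eq) (subst integral_distr, simp_all add: eq product_integral_prod[OF finite_Basis k])
  then show "(LINT x|(lborel::'a measure). (\<Prod>b\<in>Basis. h b (x \<bullet> b))) = (\<Prod>b\<in>Basis. (LINT x|lborel. h b x))"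
    unfolding hk by (simp add: k_def cong: prod.cong)
qed

text \<open>The integral is the characteristic function of the standard normal law, rescaled by
  \<open>sqrt (2 * pi)\<close>.\<close>

lemma
  shows gauss1_integrable: "integrable lborel (%x. exp (- \<i> * of_real (x * t)) * complex_of_real (exp (- x\<^sup>2 / 2)))"
    and gauss1_integral: "(LINT x|lborel. exp (- \<i> * of_real (x * t)) * complex_of_real (exp (- x\<^sup>2 / 2)))
       = of_real (sqrt (2 * pi) * exp (- t\<^sup>2 / 2))"
proof -
  have e: "exp (- \<i> * of_real (x * t)) * complex_of_real (exp (- x\<^sup>2 / 2))
      = of_real (sqrt (2 * pi)) * (std_normal_density x *\<^sub>R iexp ((- t) * x))" for x
    by (simp add: std_normal_density_def scaleR_conv_of_real mult.commute mult.left_commute)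
  have d: "integrable lborel (%x. std_normal_density x *\<^sub>R iexp ((- t) * x))"
    by (rule Bochner_Integration.integrable_bound[OF integrable_normal_density[of 1 0]]) auto
  then show "integrable lborel (%x. exp (- \<i> * of_real (x * t)) * complex_of_real (exp (- x\<^sup>2 / 2)))"
    unfolding e by (rule integrable_mult_right)
  have "(LINT x|lborel. std_normal_density x *\<^sub>R iexp ((- t) * x)) = char std_normal_distribution (- t)"
    unfolding char_def by (subst integral_density) auto
  also have "\<dots> = of_real (exp (- t\<^sup>2 / 2))" by (simp add: char_std_normal_distribution)
  finally show "(LINT x|lborel. exp (- \<i> * of_real (x * t)) * complex_of_real (exp (- x\<^sup>2 / 2)))
       = of_real (sqrt (2 * pi) * exp (- t\<^sup>2 / 2))"
    unfolding e integral_mult_right_zero by (simp only: of_real_mult)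
qed

section \<open>The Gaussian as a fixed point of the Fourier integral\<close>

definition gaussian :: "real^'n::finite => complex" where
  "gaussian x = of_real (exp (- (norm x)\<^sup>2 / 2))"

lemma gaussian_measurable [measurable]: "gaussian \<in> BM"
  unfolding gaussian_def by measurable

lemma gaussian_eq_prod: "exp (- \<i> * of_real (x \<bullet> \<xi>)) * gaussian x =
  (\<Prod>b\<in>Basis. exp (- \<i> * of_real ((x \<bullet> b) * (\<xi> \<bullet> b))) * complex_of_real (exp (- (x \<bullet> b)\<^sup>2 / 2)))"
proof -
  have "x \<bullet> \<xi> = (\<Sum>b\<in>Basis. (x \<bullet> b) * (\<xi> \<bullet> b))" by (rule euclidean_inner)
  moreover have "(norm x)^2 = (\<Sum>b\<in>Basis. (x \<bullet> b)^2)"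
    unfolding power2_norm_eq_inner by (subst euclidean_inner) (simp add: power2_eq_square)
  ultimately show ?thesis
    by (simp add: gaussian_def prod.distrib exp_sum[symmetric] sum_distrib_left sum_negf
        sum_divide_distrib of_real_prod[symmetric] del: of_real_prod)
qed

lemma gaussian_integrable: "integrable lborel (%x::real^'n::finite. exp (- \<i> * of_real (x \<bullet> \<xi>)) * gaussian x)"
  unfolding gaussian_eq_prod by (rule integrable_prod_Basis) (rule gauss1_integrable)

lemma gaussian_integrable0: "integrable lborel (gaussian :: real^'n::finite => complex)"
  using gaussian_integrable[of 0] by simp

definition cN :: "'n::finite itself => real" where
  "cN _ = (2 * pi) powr (- real CARD('n) / 2)"

lemma cN_pos: "0 < cN TYPE('n::finite)" by (simp add: cN_def)

lemma cN_gauss: "cN TYPE('n::finite) * sqrt (2 * pi) ^ CARD('n) = 1"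
proof -
  have "sqrt (2 * pi) ^ CARD('n) = (2 * pi) powr (real CARD('n) / 2)"
    by (simp add: powr_half_sqrt[symmetric] powr_powr powr_realpow[symmetric])
  then show ?thesis by (simp add: cN_def powr_add[symmetric])
qed

lemma fourier_eq:
  fixes f :: "real^'n::finite => complex"
  assumes [measurable]: "f \<in> BM"
  shows "fourier f \<xi> = cN TYPE('n) * (LINT x|lborel. exp (- \<i> * of_real (x \<bullet> \<xi>)) * f x)"
  unfolding fourier_def cN_def by (subst integral_completion) (auto simp: scaleR_conv_of_real)

lemma fourier_gaussian: "fourier gaussian = gaussian"
proof
  fix \<xi> :: "real^'n"
  have "(LINT x|lborel. exp (- \<i> * of_real (x \<bullet> \<xi>)) * gaussian x)
      = (\<Prod>b\<in>Basis. of_real (sqrt (2 * pi) * exp (- (\<xi> \<bullet> b)\<^sup>2 / 2)))"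
    unfolding gaussian_eq_prod by (subst integral_prod_Basis) (simp_all only: gauss1_integrable gauss1_integral)
  also have "\<dots> = of_real (sqrt (2 * pi) ^ CARD('n) * exp (\<Sum>b\<in>Basis. - (\<xi> \<bullet> b)\<^sup>2 / 2))"
    by (simp add: prod.distrib exp_sum)
  also have "(\<Sum>b\<in>Basis. - (\<xi> \<bullet> b)\<^sup>2 / 2) = - (norm \<xi>)\<^sup>2 / 2"
    unfolding power2_norm_eq_inner by (subst (2) euclidean_inner) (simp add: power2_eq_square sum_negf sum_divide_distrib)
  finally show "fourier gaussian \<xi> = gaussian \<xi>"
    using cN_gauss[where 'n='n]
    by (simp add: fourier_eq gaussian_def of_real_mult[symmetric] mult.assoc[symmetric] del: of_real_mult)
qed

lemma gaussian_total: "(LINT x|lborel. gaussian (x::real^'n::finite)) = of_real (1 / cN TYPE('n))"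
  using fun_cong[OF fourier_gaussian, of "0::real^'n"] cN_pos[where 'n='n]
  by (simp add: fourier_eq gaussian_def field_simps)

definition L1f :: "(real^'n::finite => complex) => bool" where
  "L1f f \<longleftrightarrow> f \<in> BM & integrable lborel f"

lemma L1f_I: "integrable lborel f ==> L1f f" by (auto simp: L1f_def)

lemma L1f_measurable: "L1f f ==> f \<in> BM"
  and L1f_integrable: "L1f f ==> integrable lborel f"
  by (auto simp: L1f_def)

lemma cmod_exp_i [simp]: "cmod (exp (- \<i> * of_real r)) = 1" "cmod (exp (- (\<i> * of_real r))) = 1"
  "cmod (exp (\<i> * of_real r)) = 1"
  by simp_all

lemma exp_mult_integrable:
  assumes "L1f f" shows "integrable lborel (%x. exp (- \<i> * of_real (x \<bullet> \<xi>)) * f x)"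
proof -
  have [measurable]: "f \<in> BM" using assms by (rule L1f_measurable)
  show ?thesis
    by (rule Bochner_Integration.integrable_bound[OF L1f_integrable[OF assms]]) (auto simp: norm_mult)
qed

lemma fourier_bound:
  fixes f :: "real^'n::finite => complex"
  assumes "L1f f" shows "cmod (fourier f \<xi>) <= cN TYPE('n) * (LINT x|lborel. cmod (f x))"
proof -
  have "cmod (LINT x|lborel. exp (- \<i> * of_real (x \<bullet> \<xi>)) * f x) <= (LINT x|lborel. cmod (exp (- \<i> * of_real (x \<bullet> \<xi>)) * f x))"
    by (rule integral_norm_bound)
  also have "\<dots> = (LINT x|lborel. cmod (f x))" by (simp add: norm_mult)
  finally show ?thesis
    using cN_pos[where 'n='n] by (simp add: fourier_eq[OF L1f_measurable[OF assms]] norm_mult)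
qed

lemma fourier_continuous: assumes "L1f f" shows "continuous_on UNIV (fourier f)"
proof -
  have [measurable]: "f \<in> BM" using assms by (rule L1f_measurable)
  show ?thesis
    unfolding continuous_on_sequentially comp_def
  proof (intro allI ballI impI)
    fix X :: "nat => real^'a" and \<xi> assume X: "(\<forall>j. X j \<in> UNIV) & X \<longlonglongrightarrow> \<xi>"
    have "(%j. LINT x|lborel. exp (- \<i> * of_real (x \<bullet> X j)) * f x) \<longlonglongrightarrow> (LINT x|lborel. exp (- \<i> * of_real (x \<bullet> \<xi>)) * f x)"
      by (rule integral_dominated_convergence[where w="%x. cmod (f x)"])
         (use assms X in "auto simp: norm_mult L1f_def intro!: tendsto_intros")
    then show "(%j. fourier f (X j)) \<longlonglongrightarrow> fourier f \<xi>"
      by (simp add: fourier_eq) (intro tendsto_intros)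
  qed
qed

lemma fourier_measurable: "L1f f ==> fourier f \<in> BM"
  by (intro borel_measurable_continuous_onI fourier_continuous)

lemma L1f_mult_bounded:
  assumes "L1f f" "g \<in> BM" "!!x. cmod (g x) <= B"
  shows "L1f (%x. g x * f x)"
proof -
  have [measurable]: "f \<in> BM" "g \<in> BM"
    using assms by (auto simp: L1f_def)
  have "integrable lborel (%x. B * cmod (f x))" using assms by (auto simp: L1f_def)
  then have "integrable lborel (%x. g x * f x)"
    by (rule Bochner_Integration.integrable_bound)
       (use assms(3) in "auto simp: norm_mult intro!: mult_right_mono order_trans[OF _ abs_ge_self]")
  then show ?thesis by (rule L1f_I)
qed

text \<open>Fubini for a kernel of modulus \<open>cmod (f x) * cmod (g y)\<close>. Moving the
  transform from one factor of the pairing to the other is the source of both Plancherel's identity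
  and the uniqueness of the extension to L2.\<close>

lemma fourier_multiplication:
  fixes f g :: "real^'n::finite => complex"
  assumes f: "L1f f" and g: "L1f g"
  shows "(LINT x|lborel. fourier f x * g x) = (LINT x|lborel. f x * fourier g x)"
proof -
  have m [measurable]: "f \<in> BM" "g \<in> BM"
    using f g by (auto simp: L1f_def)
  let ?h = "%(x, y). exp (- \<i> * of_real (x \<bullet> y)) * f x * g y"
  have hm [measurable]: "?h \<in> borel_measurable (lborel \<Otimes>\<^sub>M lborel)"
    by measurable
  have "integrable (lborel \<Otimes>\<^sub>M lborel) (%(x, y). cmod (f x) * cmod (g y))"
    using f g by (intro lborel_pair.Fubini_integrable) (auto simp: L1f_def)
  then have hi: "integrable (lborel \<Otimes>\<^sub>M lborel) ?h"
    by (rule Bochner_Integration.integrable_bound) (auto simp: norm_mult)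
  have "(LINT y|lborel. fourier f y * g y) = (LINT y|lborel. cN TYPE('n) * (LINT x|lborel. ?h (x, y)))"
    by (simp add: fourier_eq[OF m(1)] mult.assoc flip: integral_mult_left_zero)
  also have "\<dots> = cN TYPE('n) * (LINT y|lborel. LINT x|lborel. ?h (x, y))" by simp
  also have "(LINT y|lborel. LINT x|lborel. ?h (x, y)) = (LINT x|lborel. LINT y|lborel. ?h (x, y))"
    using lborel_pair.Fubini_integral[of "%x y. ?h (x, y)"] hi by simp
  also have "cN TYPE('n) * \<dots> = (LINT x|lborel. cN TYPE('n) * (LINT y|lborel. ?h (x, y)))" by simp
  also have "\<dots> = (LINT x|lborel. f x * fourier g x)"
  proof (intro Bochner_Integration.integral_cong refl)
    fix x
    have "(LINT y|lborel. ?h (x, y)) = f x * (LINT y|lborel. exp (- \<i> * of_real (y \<bullet> x)) * g y)"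
      by (simp add: inner_commute mult_ac flip: integral_mult_right_zero)
    then show "cN TYPE('n) * (LINT y|lborel. ?h (x, y)) = f x * fourier g x"
      by (simp add: fourier_eq[OF m(2)])
  qed
  finally show ?thesis .
qed

lemma cnj_measurable [measurable (raw)]:
  "f \<in> borel_measurable M ==> (%x. cnj (f x)) \<in> borel_measurable M"
  by (rule borel_measurable_continuous_on[where f=cnj]) (auto intro: continuous_intros)

section \<open>Plancherel's identity for continuous functions with bounded support\<close>

lemma gaussian_scaled_L1: "s > 0 ==> L1f (%x::real^'n::finite. gaussian (s *\<^sub>R x))"
  using lborel_integrable_affine_iff[of "gaussian :: real^'n => complex" s 0] gaussian_integrable0
  by (intro L1f_I) simp

text \<open>A modulated wide Gaussian has a transform that concentrates at x as s tends to 0, that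
  is, an approximate identity centred at x.\<close>

lemma fourier_gaussian_shift:
  fixes x y :: "real^'n::finite"
  assumes s: "s > 0"
  shows "fourier (%\<xi>. exp (\<i> * of_real (x \<bullet> \<xi>)) * gaussian (s *\<^sub>R \<xi>)) y
     = of_real ((1/s) ^ CARD('n)) * gaussian ((1/s) *\<^sub>R (y - x))"
proof -
  have e: "exp (- \<i> * of_real (\<xi> \<bullet> y)) * (exp (\<i> * of_real (x \<bullet> \<xi>)) * g) = exp (- \<i> * of_real (\<xi> \<bullet> (y - x))) * g" for \<xi> g
    unfolding mult.assoc[symmetric] exp_add[symmetric]
    by (simp add: inner_diff_right inner_commute[of x] right_diff_distrib)
  have "fourier (%\<xi>. exp (\<i> * of_real (x \<bullet> \<xi>)) * gaussian (s *\<^sub>R \<xi>)) y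
      = cN TYPE('n) * (LINT \<xi>|lborel. exp (- \<i> * of_real (\<xi> \<bullet> (y - x))) * gaussian (s *\<^sub>R \<xi>))"
    by (subst fourier_eq) (simp_all only: e, measurable)
  also have "(LINT \<xi>|lborel. exp (- \<i> * of_real (\<xi> \<bullet> (y - x))) * gaussian (s *\<^sub>R \<xi>))
     = \<bar>1/s\<bar>^DIM(real^'n) *\<^sub>R (LINT \<xi>|lborel. exp (- \<i> * of_real (\<xi> \<bullet> ((1/s) *\<^sub>R (y - x)))) * gaussian \<xi>)"
    using s by (subst lborel_integral_affine[where c="1/s" and t=0]) auto
  also have "cN TYPE('n) * \<dots> = of_real ((1/s) ^ CARD('n)) * fourier gaussian ((1/s) *\<^sub>R (y - x))"
    using s by (simp add: fourier_eq scaleR_conv_of_real)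
  finally show ?thesis by (simp add: fourier_gaussian)
qed

lemma fourier_cnj:
  fixes f :: "real^'n::finite => complex"
  assumes [measurable]: "f \<in> BM"
  shows "fourier (%x. cnj (f x)) \<xi> = cnj (fourier f (- \<xi>))"
  by (simp add: fourier_eq exp_cnj flip: Bochner_Integration.integral_cnj)

text \<open>The Gaussian factor makes the left integrand integrable before the transform is known to
  be square integrable. The multiplication formula turns the integral into the pairing of f with its
  own Gaussian mollification at scale s, which for s tending to 0 becomes the squared norm of
  f.\<close>

lemma fourier_gaussian_mollified:
  fixes f :: "real^'n::finite => complex"
  assumes f: "L1f f" and s: "s > 0"
  shows "(LINT \<xi>|lborel. fourier f \<xi> * (cnj (fourier f \<xi>) * gaussian (s *\<^sub>R \<xi>)))
     = (LINT x|lborel. f x * cnj (cN TYPE('n) * (LINT w|lborel. f (x + s *\<^sub>R w) * gaussian w)))"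
proof -
  have m [measurable]: "f \<in> BM" using f by (rule L1f_measurable)
  have fm [measurable]: "fourier f \<in> BM" using f by (rule fourier_measurable)
  have gr: "cnj (gaussian z) = gaussian z" for z :: "real^'n" by (simp add: gaussian_def)
  have g1: "L1f (%\<xi>. cnj (fourier f \<xi>) * gaussian (s *\<^sub>R \<xi>))"
    by (rule L1f_mult_bounded[OF gaussian_scaled_L1[OF s]]) (auto intro: fourier_bound f)
  have "fourier (%\<xi>. cnj (fourier f \<xi>) * gaussian (s *\<^sub>R \<xi>)) x
      = cnj (cN TYPE('n) * (LINT w|lborel. f (x + s *\<^sub>R w) * gaussian w))" for x
  proof -
    have g2: "L1f (%\<xi>. exp (\<i> * of_real (x \<bullet> \<xi>)) * gaussian (s *\<^sub>R \<xi>))"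
      by (rule L1f_mult_bounded[OF gaussian_scaled_L1[OF s], where B=1]) auto
    have "fourier (%\<xi>. cnj (fourier f \<xi>) * gaussian (s *\<^sub>R \<xi>)) x
       = cN TYPE('n) * (LINT \<xi>|lborel. cnj (fourier f \<xi> * (exp (\<i> * of_real (x \<bullet> \<xi>)) * gaussian (s *\<^sub>R \<xi>))))"
      by (subst fourier_eq) (auto simp: exp_cnj gr inner_commute mult_ac)
    also have "\<dots> = cnj (cN TYPE('n) * (LINT \<xi>|lborel. fourier f \<xi> * (exp (\<i> * of_real (x \<bullet> \<xi>)) * gaussian (s *\<^sub>R \<xi>))))"
      unfolding Bochner_Integration.integral_cnj by simp
    also have "(LINT \<xi>|lborel. fourier f \<xi> * (exp (\<i> * of_real (x \<bullet> \<xi>)) * gaussian (s *\<^sub>R \<xi>)))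
       = (LINT y|lborel. f y * (of_real ((1/s) ^ CARD('n)) * gaussian ((1/s) *\<^sub>R (y - x))))"
      by (subst fourier_multiplication[OF f g2]) (simp only: fourier_gaussian_shift[OF s])
    also have "\<dots> = \<bar>s\<bar>^DIM(real^'n) *\<^sub>R (LINT w|lborel. f (x + s *\<^sub>R w) * (of_real ((1/s) ^ CARD('n)) * gaussian w))"
      using s by (subst lborel_integral_affine[where c=s and t=x]) auto
    also have "\<dots> = (LINT w|lborel. f (x + s *\<^sub>R w) * gaussian w)"
    proof -
      have "(LINT w|lborel. f (x + s *\<^sub>R w) * (of_real ((1/s) ^ CARD('n)) * gaussian w))
         = of_real ((1/s) ^ CARD('n)) * (LINT w|lborel. f (x + s *\<^sub>R w) * gaussian w)"
        by (subst integral_mult_right_zero[symmetric]) (simp add: mult_ac)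
      then show ?thesis using s by (simp add: scaleR_conv_of_real power_mult_distrib[symmetric] power_divide field_simps)
    qed
    finally show ?thesis .
  qed
  then show ?thesis using fourier_multiplication[OF f g1] by simp
qed

lemma plancherel_Cc:
  fixes f :: "real^'n::finite => complex"
  assumes f: "Cc f"
  shows "sqi (fourier f)" "norm (abs_L2 (fourier f)) = norm (abs_L2 f)"
proof -
  have L1: "L1f f" by (intro L1f_I Cc_integrable f)
  note m [measurable] = L1f_measurable[OF L1] fourier_measurable[OF L1]
  obtain B where B: "B > 0" "!!x. cmod (f x) <= B"
  proof -
    obtain B R where "B > 0" "!!x. cmod (f x) <= B * indicator (cball 0 R) x" using Cc_bounded[OF f] by blast
    then have "cmod (f x) <= B" for x
      using order_trans[of "cmod (f x)" "B * indicator (cball 0 R) x" B] by (auto simp: indicator_def)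
    with \<open>B > 0\<close> show ?thesis by (rule that)
  qed
  define s where "s j = 1 / real (Suc j)" for j
  have s0: "s \<longlonglongrightarrow> 0" unfolding s_def using LIMSEQ_inverse_real_of_nat by (simp add: inverse_eq_divide)
  have sp: "s j > 0" for j by (simp add: s_def)
  define \<Phi> where "\<Phi> j x = cN TYPE('n) * (LINT w|lborel. f (x + s j *\<^sub>R w) * gaussian w)" for j x
  have gn: "cmod (gaussian w) = Re (gaussian w)" for w :: "real^'n" by (simp add: gaussian_def)
  have gp: "0 <= Re (gaussian w)" for w :: "real^'n" by (simp add: gaussian_def)
  have gi: "integrable lborel (%w::real^'n. Re (gaussian w))"
    using gaussian_integrable0 by (rule integrable_Re)
  have gI: "(LINT w|lborel. Re (gaussian (w::real^'n))) = 1 / cN TYPE('n)"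
    unfolding integral_Re[OF gaussian_integrable0] gaussian_total by simp
  have \<Phi>b: "cmod (\<Phi> j x) <= B" for j x
  proof -
    have "cmod (LINT w|lborel. f (x + s j *\<^sub>R w) * gaussian w) <= (LINT w|lborel. B * Re (gaussian (w::real^'n)))"
      by (rule Bochner_Integration.integral_norm_bound_integral)
         (use B(2) L1f_mult_bounded[of gaussian "%w. f (x + s j *\<^sub>R w)" B] gi gaussian_integrable0 in
          \<open>auto simp: norm_mult gn gp L1f_def intro!: mult_right_mono\<close>)
    then show ?thesis using gI cN_pos[where 'n='n] by (simp add: \<Phi>_def norm_mult field_simps)
  qed
  have \<Phi>l: "(%j. \<Phi> j x) \<longlonglongrightarrow> f x" for x
  proof -
    have "(%j. LINT w|lborel. f (x + s j *\<^sub>R w) * gaussian w) \<longlonglongrightarrow> (LINT w|lborel. f x * gaussian (w::real^'n))"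
    proof (rule integral_dominated_convergence[where w="%w. B * Re (gaussian (w::real^'n))"])
      have fc: "isCont f x" for x using f by (auto simp: Cc_def continuous_on_eq_continuous_at)
      have "(%j. f (x + s j *\<^sub>R w)) \<longlonglongrightarrow> f x" for w
        by (rule isCont_tendsto_compose[OF fc]) (use s0 in "auto intro!: tendsto_eq_intros")
      then show "AE w in lborel. (%j. f (x + s j *\<^sub>R w) * gaussian w) \<longlonglongrightarrow> f x * gaussian w"
        by (auto intro!: tendsto_intros)
      show "AE w in lborel. norm (f (x + s j *\<^sub>R w) * gaussian w) <= B * Re (gaussian w)" for j
        using B(2) by (auto simp: norm_mult gn intro!: mult_right_mono) (simp add: gaussian_def)
    qed (use gi in auto)
    then have "(%j. \<Phi> j x) \<longlonglongrightarrow> cN TYPE('n) * (LINT w|lborel. f x * gaussian (w::real^'n))"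
      unfolding \<Phi>_def by (intro tendsto_intros)
    then show ?thesis using gaussian_total[where 'n='n] cN_pos[where 'n='n] by simp
  qed
  have [measurable]: "\<Phi> j \<in> BM" for j unfolding \<Phi>_def by measurable
  have lim: "(%j. LINT x|lborel. f x * cnj (\<Phi> j x)) \<longlonglongrightarrow> (LINT x|lborel. f x * cnj (f x))"
  proof (rule integral_dominated_convergence[where w="%x. B * cmod (f x)"])
    show "integrable lborel (%x. B * cmod (f x))" using L1 by (auto simp: L1f_def)
    show "AE x in lborel. (%j. f x * cnj (\<Phi> j x)) \<longlonglongrightarrow> f x * cnj (f x)"
      using \<Phi>l by (auto intro!: tendsto_intros)
    show "AE x in lborel. norm (f x * cnj (\<Phi> j x)) <= B * cmod (f x)" for j
      by (rule AE_I2) (simp add: norm_mult mult.commute[of B] mult_left_mono \<Phi>b)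
  qed measurable
  have ff: "(LINT x|lborel. f x * cnj (f x)) = of_real ((norm (abs_L2 f))^2)"
    unfolding norm_abs_sqr[OF Cc_sqi[OF f]] complex_norm_square[symmetric] by (rule integral_complex_of_real)
  define g where "g j \<xi> = (cmod (fourier f \<xi>))^2 * Re (gaussian (s j *\<^sub>R \<xi>))" for j \<xi>
  have [measurable]: "g j \<in> BM" for j unfolding g_def by measurable
  have gc: "of_real (g j \<xi>) = fourier f \<xi> * (cnj (fourier f \<xi>) * gaussian (s j *\<^sub>R \<xi>))" for j \<xi>
    unfolding g_def by (simp add: gaussian_def complex_norm_square[symmetric] mult.assoc[symmetric] del: of_real_power)
  have gint: "integrable lborel (g j)" for j
  proof -
    have "L1f (%\<xi>. fourier f \<xi> * (cnj (fourier f \<xi>) * gaussian (s j *\<^sub>R \<xi>)))"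
      by (intro L1f_mult_bounded gaussian_scaled_L1 sp) (auto intro: fourier_bound L1)
    then have "integrable lborel (%\<xi>. complex_of_real (g j \<xi>))" by (simp add: gc L1f_def)
    then show ?thesis using integrable_Re by fastforce
  qed
  have gI: "of_real (LINT \<xi>|lborel. g j \<xi>) = (LINT x|lborel. f x * cnj (\<Phi> j x))" for j
    using fourier_gaussian_mollified[OF L1 sp[of j]]
    unfolding integral_complex_of_real[symmetric] gc \<Phi>_def .
  have glim: "(%j. LINT \<xi>|lborel. g j \<xi>) \<longlonglongrightarrow> (norm (abs_L2 f))^2"
    using lim unfolding gI[symmetric] ff by (simp only: tendsto_of_real_iff)
  have gpt: "(%j. g j \<xi>) \<longlonglongrightarrow> (cmod (fourier f \<xi>))^2" for \<xi>
    unfolding g_def gaussian_def using s0 by (auto intro!: tendsto_eq_intros)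
  have gle: "0 <= g j \<xi>" "g j \<xi> <= (cmod (fourier f \<xi>))^2" for j \<xi>
    unfolding g_def gaussian_def by (auto intro!: mult_left_le)
  \<comment> \<open>The order matters: Fatou's lemma first makes the square of the transform
    integrable, and only then can that square dominate the \<open>g j\<close> and give
    equality.\<close>
  have "(\<integral>\<^sup>+\<xi>. ennreal ((cmod (fourier f \<xi>))^2) \<partial>lborel) = (\<integral>\<^sup>+\<xi>. liminf (%j. ennreal (g j \<xi>)) \<partial>lborel)"
    by (intro nn_integral_cong lim_imp_Liminf[symmetric] tendsto_ennrealI gpt) auto
  also have "\<dots> <= liminf (%j. \<integral>\<^sup>+\<xi>. ennreal (g j \<xi>) \<partial>lborel)"
    by (intro nn_integral_liminf) auto
  also have "\<dots> = liminf (%j. ennreal (LINT \<xi>|lborel. g j \<xi>))"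
    by (subst nn_integral_eq_integral[OF gint]) (auto simp: gle)
  also have "\<dots> = ennreal ((norm (abs_L2 f))^2)"
    by (intro lim_imp_Liminf tendsto_ennrealI glim) auto
  finally have "(\<integral>\<^sup>+\<xi>. ennreal ((cmod (fourier f \<xi>))^2) \<partial>lborel) < \<infinity>"
    by (rule le_less_trans) simp
  then have i: "integrable lborel (%\<xi>. (cmod (fourier f \<xi>))^2)" by (intro integrableI_bounded) auto
  then show s: "sqi (fourier f)" by (simp add: sqi_def)
  have "(%j. LINT \<xi>|lborel. g j \<xi>) \<longlonglongrightarrow> (LINT \<xi>|lborel. (cmod (fourier f \<xi>))^2)"
    by (rule integral_dominated_convergence[OF _ _ i]) (use gpt gle in auto)
  then have "(norm (abs_L2 (fourier f)))^2 = (norm (abs_L2 f))^2"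
    unfolding norm_abs_sqr[OF s] using glim by (rule LIMSEQ_unique)
  then show "norm (abs_L2 (fourier f)) = norm (abs_L2 f)" by simp
qed

section \<open>The Fourier transform of square integrable classes\<close>

lemma fourier_AE_cong:
  fixes f g :: "real^'n::finite => complex"
  assumes [measurable]: "f \<in> borel_measurable lebesgue" "g \<in> borel_measurable lebesgue"
    and "AE x in lebesgue. f x = g x"
  shows "fourier f = fourier g"
proof
  fix \<xi> :: "real^'n"
  have [measurable]: "(%x. exp (- \<i> * of_real (x \<bullet> \<xi>))) \<in> borel_measurable lebesgue"
    by (intro measurable_completion) measurable
  have m: "(%x. exp (- \<i> * of_real (x \<bullet> \<xi>)) * f x) \<in> borel_measurable lebesgue"
    "(%x. exp (- \<i> * of_real (x \<bullet> \<xi>)) * g x) \<in> borel_measurable lebesgue"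
    by (rule borel_measurable_times; measurable)+
  have "(LINT x|lebesgue. exp (- \<i> * of_real (x \<bullet> \<xi>)) * f x) = (LINT x|lebesgue. exp (- \<i> * of_real (x \<bullet> \<xi>)) * g x)"
    by (rule integral_cong_AE[OF m]) (use assms(3) in eventually_elim, simp)
  then show "fourier f \<xi> = fourier g \<xi>" by (simp add: fourier_def)
qed

lemma fourier_diff:
  fixes f g :: "real^'n::finite => complex"
  assumes "L1f f" "L1f g"
  shows "fourier (%x. f x - g x) \<xi> = fourier f \<xi> - fourier g \<xi>"
proof -
  have [measurable]: "f \<in> BM" "g \<in> BM" using assms by (auto simp: L1f_def)
  show ?thesis
    using Bochner_Integration.integral_diff[OF exp_mult_integrable[OF assms(1), of \<xi>] exp_mult_integrable[OF assms(2), of \<xi>]]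
    by (simp add: fourier_eq right_diff_distrib)
qed

lemma Cc_diff: assumes "Cc f" "Cc g" shows "Cc (%x. f x - g x)"
proof -
  obtain R S where "!!x. R < norm x ==> f x = 0" "!!x. S < norm x ==> g x = 0"
    using assms by (auto simp: Cc_def)
  then have "\<forall>x. max R S < norm x --> f x - g x = 0" by auto
  then show ?thesis using assms unfolding Cc_def by (blast intro: continuous_on_diff)
qed

lemma Cc_mult: assumes "Cc f" "continuous_on UNIV g" shows "Cc (%x. g x * f x)"
  using assms by (auto simp: Cc_def intro: continuous_on_mult)

lemma Cc_L1f: "Cc f ==> L1f f" by (intro L1f_I Cc_integrable)

text \<open>Pairings against functions in \<open>Cc\<close> determine a class. This identity
  therefore makes the limit in \<open>has_fourier_L2\<close> independent of the approximating
  sequence, so that \<open>fourier_L2\<close> is well defined.\<close>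

lemma has_fourier_L2_pr:
  fixes u :: "'n::finite L2"
  assumes "has_fourier_L2 u v" and g: "Cc g"
  shows "pr v (abs_L2 g) = pr u (abs_L2 (fourier g))"
proof -
  obtain f where f: "!!j::nat. square_integrable (f j)" "!!j. integrable lebesgue (f j)" "!!j. square_integrable (fourier (f j))"
    and lim: "(%j. abs_L2 (f j)) \<longlonglongrightarrow> u" "(%j. abs_L2 (fourier (f j))) \<longlonglongrightarrow> v"
    using assms(1) unfolding has_fourier_L2_def by blast
  have "\<exists>h. h \<in> BM & (AE x in lborel. f j x = h x)" for j
    using f(1)[of j] by (intro lebesgue_borel_representative) (simp add: square_integrable_def)
  then obtain h where h: "!!j. h j \<in> BM" "!!j. AE x in lborel. f j x = h j x" by metis
  note [measurable] = h(1)
  have hl: "h j \<in> borel_measurable lebesgue" for j by (intro measurable_completion) simp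
  have hs: "sqi (h j)" for j using sqi_AE_lebesgue[OF f(1) h] .
  have ae: "AE x in lebesgue. f j x = h j x" for j using h(2) by (rule AE_completion)
  have fl: "f j \<in> borel_measurable lebesgue" for j using f(1)[of j] by (simp add: square_integrable_def)
  have "integrable lebesgue (h j)" for j
    using integrable_cong_AE[OF fl hl ae[of j]] f(2) by simp
  then have hi: "L1f (h j)" for j by (intro L1f_I) (simp add: integrable_completion)
  have ff: "fourier (f j) = fourier (h j)" for j by (rule fourier_AE_cong[OF fl hl ae])
  have fs: "sqi (fourier (h j))" for j
    using sqi_AE_lebesgue[OF f(3)[of j] fourier_measurable[OF hi[of j]]] by (simp add: ff)
  have ah: "abs_L2 (f j) = abs_L2 (h j)" for j
    by (subst abs_L2_eq_iff[OF f(1) sqi_square_integrable[OF hs]]) (rule ae)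
  have "pr (abs_L2 (fourier (f j))) (abs_L2 g) = pr (abs_L2 (f j)) (abs_L2 (fourier g))" for j
    unfolding ff ah by (simp add: pr_abs fs hs plancherel_Cc(1)[OF g] Cc_sqi[OF g] fourier_multiplication hi Cc_L1f[OF g])
  moreover have "(%j. pr (abs_L2 (fourier (f j))) (abs_L2 g)) \<longlonglongrightarrow> pr v (abs_L2 g)"
    by (intro bounded_linear.tendsto[OF bounded_linear_pr_left] lim)
  moreover have "(%j. pr (abs_L2 (f j)) (abs_L2 (fourier g))) \<longlonglongrightarrow> pr u (abs_L2 (fourier g))"
    by (intro bounded_linear.tendsto[OF bounded_linear_pr_left] lim)
  ultimately show ?thesis using LIMSEQ_unique by simp
qed

lemma Cc_eqI: assumes "!!f. Cc f ==> pr u (abs_L2 f) = pr v (abs_L2 f)" shows "u = v"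
  using pr_eq_0_Cc[of "u - v"] assms by (simp add: pr_diff_left)

lemma has_fourier_L2_unique: "has_fourier_L2 u v ==> has_fourier_L2 u w ==> v = w"
  by (rule Cc_eqI) (simp add: has_fourier_L2_pr)

text \<open>By Plancherel the transforms have the same mutual distances as the functions, so they
  form a Cauchy sequence.\<close>

lemma has_fourier_L2_Cc:
  assumes f: "!!j::nat. Cc (f j)" and u: "(%j. abs_L2 (f j)) \<longlonglongrightarrow> u"
  shows "\<exists>v. has_fourier_L2 u v & (%j. abs_L2 (fourier (f j))) \<longlonglongrightarrow> v"
proof -
  have d: "norm (abs_L2 (fourier (f i)) - abs_L2 (fourier (f j))) = norm (abs_L2 (f i) - abs_L2 (f j))" for i j
  proof -
    have "fourier (%x. f i x - f j x) = (%\<xi>. fourier (f i) \<xi> - fourier (f j) \<xi>)"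
      using fourier_diff[OF Cc_L1f[OF f] Cc_L1f[OF f], of i j] by auto
    then show ?thesis
      using plancherel_Cc(2)[OF Cc_diff[OF f f], of i j] by (simp add: abs_diff plancherel_Cc f Cc_sqi)
  qed
  have "Cauchy (%j. abs_L2 (fourier (f j)))"
    using LIMSEQ_imp_Cauchy[OF u] unfolding Cauchy_def dist_norm d .
  then obtain v where v: "(%j. abs_L2 (fourier (f j))) \<longlonglongrightarrow> v"
    using Cauchy_convergent convergent_def by blast
  have "integrable lebesgue (f j)" for j
    using Cc_integrable[OF f] by (simp add: integrable_completion Cc_measurable f)
  then have "has_fourier_L2 u v"
    unfolding has_fourier_L2_def
    by (intro exI[of _ f] conjI allI u v sqi_square_integrable Cc_sqi plancherel_Cc f)
  with v show ?thesis by blast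
qed

lemma has_fourier_fourier_L2: "has_fourier_L2 u (fourier_L2 u)"
proof -
  obtain f where f: "!!j::nat. Cc (f j)" "(%j. abs_L2 (f j)) \<longlonglongrightarrow> u" using Cc_dense by blast
  obtain v where "has_fourier_L2 u v" using has_fourier_L2_Cc[OF f] by blast
  then show ?thesis unfolding fourier_L2_def by (rule theI) (metis has_fourier_L2_unique \<open>has_fourier_L2 u v\<close>)
qed

lemma fourier_L2_tendsto:
  assumes f: "!!j::nat. Cc (f j)" and u: "(%j. abs_L2 (f j)) \<longlonglongrightarrow> u"
  shows "(%j. abs_L2 (fourier (f j))) \<longlonglongrightarrow> fourier_L2 u"
  using has_fourier_L2_Cc[OF f u] has_fourier_L2_unique[OF _ has_fourier_fourier_L2] by blast

lemma fourier_L2_pr_Cc: "Cc g ==> pr (fourier_L2 u) (abs_L2 g) = pr u (abs_L2 (fourier g))"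
  by (rule has_fourier_L2_pr[OF has_fourier_fourier_L2])

text \<open>The integral transform of an integrable f is bounded and continuous, but its square
  integrability is part of the claim. It is therefore compared with the abstract transform locally,
  after multiplication by cut-offs.\<close>

lemma fourier_L2_abs:
  fixes f :: "real^'n::finite => complex"
  assumes s: "sqi f" and i: "L1f f"
  shows "fourier_L2 (abs_L2 f) = abs_L2 (fourier f)" "sqi (fourier f)"
proof -
  define v where "v = rp (fourier_L2 (abs_L2 f))"
  note [measurable] = fourier_measurable[OF i]
  have [measurable]: "v \<in> BM" and vs: "sqi v" by (auto simp: v_def sqi_rp)
  have "AE x in lborel. norm x < real R --> v x = fourier f x" for R :: nat
  proof -
    \<comment> \<open>Positive exactly on the open ball of radius R, and of bounded support, so that
      \<open>fourier f x * c x\<close> is square integrable.\<close>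
    define c where "c x = complex_of_real (max 0 (real R - norm x))" for x :: "real^'n"
    have cc: "continuous_on UNIV c" unfolding c_def by (intro continuous_intros)
    have c: "Cc c" using cc by (auto simp: Cc_def c_def intro!: exI[of _ "real R"])
    define w where "w x = (v x - fourier f x) * c x" for x
    have ws: "sqi w"
    proof -
      have cs: "sqi (%x. (cN TYPE('n) * (LINT x|lborel. cmod (f x))) * c x)" "sqi (%x. real R * v x)"
        by (intro sqi_cmult Cc_sqi c vs)+
      have "sqi (%x. fourier f x * c x)"
        by (rule sqi_bound[OF cs(1)])
           (use fourier_bound[OF i] Cc_measurable[OF c] in "auto simp: norm_mult intro!: mult_right_mono order_trans[OF fourier_bound[OF i]] mult_mono")
      moreover have "sqi (%x. v x * c x)"
        by (rule sqi_bound[OF cs(2)])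
           (use Cc_measurable[OF c] in \<open>auto simp: norm_mult mult.commute[of "real R"] c_def intro!: mult_left_mono\<close>)
      ultimately show ?thesis unfolding w_def left_diff_distrib by (rule sqi_diff[rotated])
    qed
    have "abs_L2 w = 0"
    proof (rule pr_eq_0_Cc)
      fix g :: "real^'n => complex" assume g: "Cc g"
      have cg: "Cc (%x. c x * g x)" by (rule Cc_mult[OF g cc])
      have cb: "L1f (%x. fourier f x * (c x * g x))"
        by (rule L1f_mult_bounded[OF Cc_L1f[OF cg]]) (auto intro: fourier_bound[OF i])
      have "pr (abs_L2 w) (abs_L2 g) = (LINT x|lborel. v x * (c x * g x) - fourier f x * (c x * g x))"
        unfolding pr_abs[OF ws Cc_sqi[OF g]] w_def by (simp add: algebra_simps)
      also have "\<dots> = (LINT x|lborel. v x * (c x * g x)) - (LINT x|lborel. fourier f x * (c x * g x))"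
        by (intro Bochner_Integration.integral_diff sqi_mult_integrable vs Cc_sqi cg L1f_integrable cb)
      also have "(LINT x|lborel. v x * (c x * g x)) = pr (fourier_L2 (abs_L2 f)) (abs_L2 (%x. c x * g x))"
        by (subst pr_abs[OF vs Cc_sqi[OF cg], symmetric]) (simp add: v_def abs_rp)
      also have "\<dots> = (LINT x|lborel. fourier f x * (c x * g x))"
        by (simp add: fourier_L2_pr_Cc[OF cg] pr_abs s plancherel_Cc(1)[OF cg] fourier_multiplication i Cc_L1f[OF cg])
      finally show "pr (abs_L2 w) (abs_L2 g) = 0" by simp
    qed
    then have "AE x in lborel. w x = 0" using rp_abs[OF ws] rp_zero[where 'a='n] by (auto elim: eventually_elim2)
    then show ?thesis by eventually_elim (auto simp: w_def c_def)
  qed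
  then have "AE x in lborel. \<forall>R::nat. norm x < real R --> v x = fourier f x" unfolding AE_all_countable by blast
  then have ae: "AE x in lborel. v x = fourier f x" by eventually_elim (metis reals_Archimedean2)
  show fs: "sqi (fourier f)"
    using vs by (rule sqi_bound) (use ae in "auto elim: eventually_mono")
  show "fourier_L2 (abs_L2 f) = abs_L2 (fourier f)"
    using abs_eqI[OF vs fs ae] by (simp add: v_def abs_rp)
qed

abbreviation FT :: "'n::finite L2 => 'n L2" where "FT \<equiv> fourier_L2"

lemma norm_FT [simp]: "norm (FT u) = norm u"
proof -
  obtain f where f: "!!j::nat. Cc (f j)" "(%j. abs_L2 (f j)) \<longlonglongrightarrow> u" using Cc_dense by blast
  from tendsto_norm[OF fourier_L2_tendsto[OF f]] tendsto_norm[OF f(2)] show ?thesis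
    unfolding plancherel_Cc(2)[OF f(1)] by (rule LIMSEQ_unique)
qed

lemma FT_add: "FT (u + v) = FT u + FT v"
  by (rule Cc_eqI) (simp add: fourier_L2_pr_Cc pr_add_left)

lemma FT_cmult: "FT (cmult_L2 c u) = cmult_L2 c (FT u)"
  by (rule Cc_eqI) (simp add: fourier_L2_pr_Cc pr_cmult_left)

lemma bounded_linear_FT: "bounded_linear FT"
  by (rule bounded_linear_intro[where K=1]) (simp_all add: FT_add FT_cmult scaleR_L2_def)

lemmas FT_diff = linear_diff[OF bounded_linear.linear[OF bounded_linear_FT]]

lemma pr_FT: "pr (FT u) v = pr u (FT v)"
proof -
  obtain f where f: "!!j::nat. Cc (f j)" "(%j. abs_L2 (f j)) \<longlonglongrightarrow> v" using Cc_dense by blast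
  have "(%j. pr (FT u) (abs_L2 (f j))) \<longlonglongrightarrow> pr (FT u) v"
    by (intro bounded_linear.tendsto[OF bounded_linear_pr_right] f)
  moreover have "(%j. pr u (abs_L2 (fourier (f j)))) \<longlonglongrightarrow> pr u (FT v)"
    by (intro bounded_linear.tendsto[OF bounded_linear_pr_right] fourier_L2_tendsto f)
  ultimately show ?thesis unfolding fourier_L2_pr_Cc[OF f(1)] by (rule LIMSEQ_unique)
qed

text \<open>Polarisation: a sesquilinear form vanishing on the diagonal vanishes.\<close>

lemma pr_FT_cj: "pr (FT u) (cj (FT v)) = pr u (cj v)"
proof -
  define H where "H u v = pr (FT u) (cj (FT v)) - pr u (cj v)" for u v :: "'a L2"
  have d: "H u u = 0" for u unfolding H_def pr_cj_self by simp
  have add: "H (u + v) w = H u w + H v w" "H w (u + v) = H w u + H w v" for u v w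
    by (simp_all add: H_def FT_add cj_add pr_add_left pr_add_right)
  have mu: "H (cmult_L2 c u) w = c * H u w" "H w (cmult_L2 c u) = cnj c * H w u" for c u w
    by (simp_all add: H_def FT_cmult cj_cmult pr_cmult_left pr_cmult_right algebra_simps)
  have "H u v + H v u = 0" using d[of "u + v"] unfolding add d[of u] d[of v] by (simp add: add.commute)
  moreover have "- \<i> * H u v + \<i> * H v u = 0"
    using d[of "u + cmult_L2 \<i> v"] unfolding add mu d[of u] d[of v] by simp
  then have "H v u = H u v" by (simp add: algebra_simps)
  ultimately have "H u v = 0" by (simp add: add_self_div_2)
  then show ?thesis by (simp add: H_def)
qed

text \<open>The adjoint of the isometry \<open>FT\<close> for the Hermitian product. It is also a
  right inverse, because the transpose of \<open>FT\<close> for the bilinear pairing is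
  \<open>FT\<close> itself (\<open>pr_FT\<close>).\<close>

definition iFT :: "'n::finite L2 => 'n L2" where "iFT v = cj (FT (cj v))"

lemma FT_iFT [simp]: "FT (iFT v) = v"
proof (rule pr_eqI)
  fix w
  have "pr (FT (iFT v)) w = pr (FT w) (cj (FT (cj v)))" by (simp add: pr_FT iFT_def pr_commute)
  then show "pr (FT (iFT v)) w = pr v w" by (simp add: pr_FT_cj pr_commute)
qed

lemma iFT_FT [simp]: "iFT (FT u) = u"
  using FT_iFT[of "cj u"] by (metis cj_cj iFT_def)

lemma FT_eq_iff: "FT u = FT v \<longleftrightarrow> u = v" by (metis iFT_FT)

lemma iFT_abs:
  fixes f :: "real^'n::finite => complex"
  assumes s: "sqi f" and i: "L1f f"
  shows "iFT (abs_L2 f) = abs_L2 (%x. fourier f (- x))" "sqi (%x. fourier f (- x))"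
proof -
  have [measurable]: "f \<in> BM" using s by (rule sqi_measurable)
  have ci: "L1f (%x. cnj (f x))" using i by (auto simp: L1f_def)
  have eq: "cnj (fourier (%x. cnj (f x)) x) = fourier f (- x)" for x by (simp add: fourier_cnj)
  show "iFT (abs_L2 f) = abs_L2 (%x. fourier f (- x))"
    unfolding iFT_def using fourier_L2_abs[OF sqi_cnj[OF s] ci] by (simp add: cj_abs s eq)
  show "sqi (%x. fourier f (- x))"
    using sqi_cnj[OF fourier_L2_abs(2)[OF sqi_cnj[OF s] ci]] by (simp add: eq)
qed

section \<open>Multiplication operators and the Schroedinger group\<close>

text \<open>Multiplication by an unbounded symbol is only partially defined on L2. As a relation it
  carries its own domain: existence of \<open>v\<close> says that the product is square
  integrable.\<close>

definition isM :: "(real^'n::finite => complex) => 'n L2 => 'n L2 => bool" where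
  "isM a u v \<longleftrightarrow> (AE x in lborel. rp v x = a x * rp u x)"

lemma isM_unique: "isM a u v ==> isM a u w ==> v = w"
  unfolding isM_def by (rule L2_eqI) (auto elim: eventually_elim2)

lemma isM_add:
  assumes "isM a u v" "isM a u' v'"
  shows "isM a (u + u') (v + v')"
  using assms rp_add[of u u'] rp_add[of v v'] unfolding isM_def by eventually_elim (simp add: distrib_left)

lemma isM_cmult:
  assumes "isM a u v"
  shows "isM a (cmult_L2 c u) (cmult_L2 c v)"
  using assms rp_cmult[of c u] rp_cmult[of c v] unfolding isM_def by eventually_elim simp

lemma isM_diff:
  assumes "isM a u v" "isM a u' v'"
  shows "isM a (u - u') (v - v')"
  using assms rp_diff[of u u'] rp_diff[of v v'] unfolding isM_def by eventually_elim (simp add: right_diff_distrib)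

lemma isM_scaleR: "isM a u v ==> isM a (r *\<^sub>R u) (r *\<^sub>R v)"
  unfolding scaleR_L2_def by (rule isM_cmult)

lemma isM_zero: "isM a 0 0"
  unfolding isM_def using rp_zero by eventually_elim simp

lemma isM_isM:
  assumes "isM a u v" "isM b v w"
  shows "isM (%x. b x * a x) u w"
  using assms unfolding isM_def by eventually_elim simp

lemma isM_cong: "isM a u v ==> (!!x. a x = b x) ==> isM b u v"
  unfolding isM_def by simp

lemma isM_one: "isM (%x. 1) u u" by (simp add: isM_def)

lemma isM_add_left:
  assumes "isM a u v" "isM b u w"
  shows "isM (%x. a x + b x) u (v + w)"
  using assms rp_add[of v w] unfolding isM_def by eventually_elim (simp add: distrib_right)

lemma isM_cmult_left:
  assumes "isM a u v"
  shows "isM (%x. c * a x) u (cmult_L2 c v)"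
  using assms rp_cmult[of c v] unfolding isM_def by eventually_elim simp

lemma isM_abs: "sqi (%x. a x * rp u x) ==> isM a u (abs_L2 (%x. a x * rp u x))"
  unfolding isM_def by (rule rp_abs)

lemma isM_ex_bound:
  assumes "isM b u v" "a \<in> BM" "!!x. cmod (a x) <= C * cmod (b x)" "0 <= C"
  shows "\<exists>w. isM a u w & norm w <= C * norm v"
proof -
  have [measurable]: "a \<in> BM" by fact
  have ae: "AE x in lborel. cmod (a x * rp u x) <= cmod (of_real C * rp v x)"
    using assms(1) unfolding isM_def
    by eventually_elim (use assms(3,4) in "auto simp: norm_mult mult.assoc[symmetric] intro!: mult_right_mono")
  have s: "sqi (%x. a x * rp u x)"
    by (rule sqi_bound[OF sqi_cmult[OF sqi_rp[of v], of "of_real C"] _ ae]) simp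
  have w: "isM a u (abs_L2 (%x. a x * rp u x))" by (rule isM_abs[OF s])
  moreover have "norm (abs_L2 (%x. a x * rp u x)) <= C * norm v"
    by (rule norm_le_of_AE[OF _ assms(4)])
       (use rp_abs[OF s] ae in "eventually_elim, simp add: norm_mult assms(4)")
  ultimately show ?thesis by blast
qed

lemma isM_bounded_ex:
  assumes "a \<in> BM" "!!x. cmod (a x) <= C"
  shows "\<exists>w. isM a u w & norm w <= C * norm u"
proof -
  have "0 <= C" using assms(2)[of 0] norm_ge_zero order_trans by blast
  then show ?thesis using isM_ex_bound[OF isM_one, of a C u] assms by simp
qed

lemma isM_norm_le: assumes "isM a u v" "!!x. cmod (a x) <= C" shows "norm v <= C * norm u"
proof (rule norm_le_of_AE)
  show "0 <= C" using assms(2)[of 0] norm_ge_zero order_trans by blast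
  show "AE x in lborel. cmod (rp v x) <= C * cmod (rp u x)"
    using assms(1) unfolding isM_def
    by eventually_elim (auto simp: norm_mult assms(2) intro!: mult_right_mono)
qed

lemma isM_pr: assumes "isM a u v" "isM a w z" "a \<in> BM" shows "pr u z = pr v w"
proof -
  have "AE x in lborel. rp u x * rp z x = rp v x * rp w x"
    using assms(1,2) unfolding isM_def by eventually_elim simp
  then show ?thesis unfolding pr_def by (intro integral_cong_AE) auto
qed

definition mu :: "(real^'n::finite => complex) => 'n L2 => 'n L2" where
  "mu a u = abs_L2 (%x. a x * rp u x)"

lemma isM_mu: "a \<in> BM ==> (!!x. cmod (a x) <= C) ==> isM a u (mu a u)"
  unfolding mu_def using isM_bounded_ex[of a C u]
  by (intro isM_abs sqi_bound[OF sqi_cmult[OF sqi_rp[of u], of "of_real C"]])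
     (auto simp: norm_mult intro!: mult_right_mono order_trans[OF _ abs_ge_self])

definition phase :: "real => real^'n::finite => complex" where
  "phase t \<xi> = exp (- \<i> * of_real (t * (norm \<xi>)^2))"

lemma phase_measurable [measurable]: "phase t \<in> BM"
  unfolding phase_def by measurable

lemma cmod_phase [simp]: "cmod (phase t \<xi>) = 1"
  unfolding phase_def by (rule cmod_exp_i)

lemma isM_phase: "isM (phase t) u (mu (phase t) u)"
  by (rule isM_mu[where C=1]) auto

abbreviation S :: "real => 'n::finite L2 => 'n L2" where "S \<equiv> schroedinger"

lemma schroedinger_eq: "S t u = iFT (mu (phase t) (FT u))"
proof -
  let ?f = "%\<xi>. exp (- \<i> * of_real (t * (norm \<xi>)^2)) * rep_L2 (FT u) \<xi>"
  have s: "sqi (%\<xi>. phase t \<xi> * rp (FT u) \<xi>)"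
    by (rule sqi_bound[OF sqi_rp[of "FT u"]]) (auto simp: norm_mult)
  have ae: "AE x in lebesgue. phase t x * rp (FT u) x = ?f x"
    using AE_completion[OF rep_rp[of "FT u"]] by eventually_elim (simp add: phase_def)
  have "square_integrable ?f"
  proof -
    have p: "(%\<xi>. exp (- \<i> * of_real (t * (norm \<xi>)^2))) \<in> borel_measurable lebesgue"
      by (intro measurable_completion) measurable
    show ?thesis
      using square_integrable_rep_L2[of "FT u"] borel_measurable_times[OF p] unfolding square_integrable_def
      by (simp only: norm_mult cmod_exp_i mult_1) blast
  qed
  then have "mu (phase t) (FT u) = abs_L2 ?f"
    unfolding mu_def using ae by (subst abs_L2_eq_iff) (auto intro: sqi_square_integrable s)
  then show ?thesis
    unfolding schroedinger_def
    by (intro the_equality) (simp, metis iFT_FT)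
qed

lemma isM_S: "isM (phase t) (FT u) (FT (S t u))"
  by (simp add: schroedinger_eq isM_phase)

lemma S_eqI: "isM (phase t) (FT u) (FT v) ==> S t u = v"
  using isM_unique[OF isM_S] FT_eq_iff by blast

lemma S_0 [simp]: "S 0 u = u"
  by (rule S_eqI) (rule isM_cong[OF isM_one], simp add: phase_def)

lemma S_S: "S s (S t u) = S (s + t) u"
  by (rule sym, rule S_eqI, rule isM_cong[OF isM_isM[OF isM_S[of t u] isM_S[of s]]])
     (simp add: phase_def exp_add[symmetric] algebra_simps)

lemma S_add: "S t (u + v) = S t u + S t v"
  by (rule S_eqI) (simp add: FT_add isM_add isM_S)

lemma S_cmult: "S t (cmult_L2 c u) = cmult_L2 c (S t u)"
  by (rule S_eqI) (simp add: FT_cmult isM_cmult isM_S)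

lemma norm_S [simp]: "norm (S t u) = norm u"
proof -
  have "norm (FT (S t u)) = norm (FT u)"
    using isM_S[of t u] unfolding isM_def by (intro norm_eq_of_AE) (auto simp: norm_mult elim: eventually_mono)
  then show ?thesis by simp
qed

lemma bounded_linear_S: "bounded_linear (S t)"
  by (rule bounded_linear_intro[where K=1]) (simp_all add: S_add S_cmult scaleR_L2_def)

lemmas S_diff = linear_diff[OF bounded_linear.linear[OF bounded_linear_S]]

section \<open>Test functions and weak derivatives\<close>

text \<open>Derivatives of exp (-1/t) stay in the linear span of this family, so that iterated
  derivatives of a bump function are found without leaving one explicit class.\<close>

definition flat_exp :: "nat => real => real" where
  "flat_exp k t = (if t > 0 then (1/t)^k * exp (- (1/t)) else 0)"

lemma flat_exp_Suc: "t * flat_exp (Suc k) t = flat_exp k t"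
  by (simp add: flat_exp_def)

lemma flat_exp_deriv: "(flat_exp k has_real_derivative flat_exp (k + 2) t - real k * flat_exp (k + 1) t) (at t)"
proof -
  consider "t > 0" | "t < 0" | "t = 0" by linarith
  then show ?thesis
  proof cases
    case 1
    have "((%t. (1/t)^k * exp (- (1/t))) has_real_derivative flat_exp (k + 2) t - real k * flat_exp (k + 1) t) (at t)"
    proof -
      have d1: "((%t. 1/t) has_real_derivative - ((1/t)^2)) (at t)"
        using 1 by (auto intro!: derivative_eq_intros simp: power2_eq_square)
      have "real k * (- ((1/t)^2) * (1/t) ^ (k - Suc 0)) = - real k * (1/t) ^ (k + 1)"
      proof -
        have "real k * (- (u^2) * u ^ (k - Suc 0)) = - real k * u ^ (k + 1)" for u :: real
          by (cases k) (auto simp: power2_eq_square algebra_simps)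
        then show ?thesis .
      qed
      then show ?thesis
        using 1 by (auto intro!: derivative_eq_intros DERIV_power[OF d1] d1 DERIV_minus[OF d1]
            simp: flat_exp_def power2_eq_square algebra_simps)
    qed
    then show ?thesis
      by (rule has_field_derivative_transform_within_open[where S="{0<..}"]) (use 1 in "auto simp: flat_exp_def")
  next
    case 2
    have "((%t. 0) has_real_derivative 0) (at t)" by simp
    then have "(flat_exp k has_real_derivative 0) (at t)"
      by (rule has_field_derivative_transform_within_open[where S="{..<0}"]) (use 2 in "auto simp: flat_exp_def")
    then show ?thesis using 2 by (simp add: flat_exp_def)
  next
    case 3
    \<comment> \<open>With u = 1/h the difference quotient from the right is
      \<open>u ^ Suc k / exp u\<close>; from the left it vanishes.\<close>
    have "((%h. (flat_exp k (0 + h) - flat_exp k 0) / h) \<longlongrightarrow> 0) (at 0)"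
    proof (rule filterlim_split_at_real)
      have "((%x::real. x ^ Suc k / exp x) \<longlongrightarrow> 0) at_top" by (rule tendsto_power_div_exp_0)
      then have "((%h::real. inverse h ^ Suc k / exp (inverse h)) \<longlongrightarrow> 0) (at_right 0)"
        by (rule filterlim_compose) (rule filterlim_inverse_at_top_right)
      moreover have "\<forall>\<^sub>F h in at_right 0. inverse h ^ Suc k / exp (inverse h) = (flat_exp k (0 + h) - flat_exp k 0) / h"
        by (rule eventually_at_rightI[of 0 1]) (auto simp: flat_exp_def exp_minus field_simps)
      ultimately show "((%h. (flat_exp k (0 + h) - flat_exp k 0) / h) \<longlongrightarrow> 0) (at_right 0)"
        by (rule Lim_transform_eventually)
      show "((%h. (flat_exp k (0 + h) - flat_exp k 0) / h) \<longlongrightarrow> 0) (at_left 0)"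
        by (rule tendsto_eventually, rule eventually_at_leftI[of "-1"]) (auto simp: flat_exp_def)
    qed
    then show ?thesis using 3 by (simp add: DERIV_def flat_exp_def)
  qed
qed

inductive coord_poly :: "(real^'n::finite => real) => bool" where
  const: "coord_poly (%x. c)"
| coord: "coord_poly (%x. x $ i)"
| add: "coord_poly P ==> coord_poly Q ==> coord_poly (%x. P x + Q x)"
| mult: "coord_poly P ==> coord_poly Q ==> coord_poly (%x. P x * Q x)"

lemma coord_poly_sum: "finite A ==> (!!i. i \<in> A ==> coord_poly (P i)) ==> coord_poly (%x. \<Sum>i\<in>A. P i x)"
  by (induction A rule: finite_induct) (auto intro: coord_poly.intros)

lemma coord_poly_diff: "coord_poly P ==> coord_poly Q ==> coord_poly (%x. P x - Q x)"
  using coord_poly.add[OF _ coord_poly.mult[OF coord_poly.const[of "-1"]], of P Q] by simp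

lemma coord_poly_differentiable: "coord_poly P ==> P differentiable (at x)"
proof (induction rule: coord_poly.induct)
  case (coord i)
  show ?case by (rule bounded_linear_imp_differentiable) (rule bounded_linear_vec_nth)
qed auto

lemma coord_poly_deriv:
  "coord_poly P ==> \<exists>P'. coord_poly P' & (\<forall>x h. ((%h. P (sh i h x)) has_real_derivative P' (sh i h x)) (at h))"
proof (induction rule: coord_poly.induct)
  case (const c)
  show ?case by (rule exI[of _ "%x. 0"]) (auto intro: coord_poly.const)
next
  case (coord j)
  show ?case
    by (rule exI[of _ "%x. if i = j then 1 else 0"])
       (auto intro!: coord_poly.const derivative_eq_intros simp: axis_def)
next
  case (add P Q)
  then obtain P' Q' where "coord_poly P'" "!!x h. ((%h. P (sh i h x)) has_real_derivative P' (sh i h x)) (at h)"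
    "coord_poly Q'" "!!x h. ((%h. Q (sh i h x)) has_real_derivative Q' (sh i h x)) (at h)" by blast
  then show ?case
    by (intro exI[of _ "%x. P' x + Q' x"]) (auto intro!: coord_poly.add derivative_intros)
next
  case (mult P Q)
  then obtain P' Q' where "coord_poly P'" "!!x h. ((%h. P (sh i h x)) has_real_derivative P' (sh i h x)) (at h)"
    "coord_poly Q'" "!!x h. ((%h. Q (sh i h x)) has_real_derivative Q' (sh i h x)) (at h)" by blast
  with mult.hyps show ?case
    by (intro exI[of _ "%x. P' x * Q x + Q' x * P x"]) (auto intro!: coord_poly.intros DERIV_mult)
qed

definition sqdist :: "real => real^'n::finite => real^'n => real" where
  "sqdist r y x = r^2 - (norm (x - y))^2"

lemma coord_poly_sqdist: "coord_poly (sqdist r y)"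
proof -
  have "sqdist r y = (%x. r^2 - (\<Sum>i\<in>UNIV. (x $ i - y $ i) * (x $ i - y $ i)))"
    by (auto simp: sqdist_def power2_norm_eq_inner inner_vec_def)
  then show ?thesis by (auto intro!: coord_poly.intros coord_poly_diff coord_poly_sum)
qed

text \<open>The classical bump on the ball of radius r around y is the case \<open>P = 1\<close>,
  \<open>k = 0\<close>. A polynomial factor P and the index k are carried along so that partial
  derivatives have the same form.\<close>

definition bump :: "real => real^'n::finite => (real^'n => real) => nat => real^'n => complex" where
  "bump r y P k x = of_real (P x * flat_exp k (sqdist r y x))"

lemma bump_differentiable: "coord_poly P ==> bump r y P k differentiable (at x)"
proof -
  assume P: "coord_poly P"
  have "flat_exp k differentiable (at (sqdist r y x))"
    using flat_exp_deriv unfolding has_field_derivative_def by (rule differentiableI)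
  then have "(flat_exp k \<circ> sqdist r y) differentiable (at x)"
    by (intro differentiable_chain_at coord_poly_differentiable coord_poly_sqdist) simp
  then have "(%x. P x * (flat_exp k \<circ> sqdist r y) x) differentiable (at x)"
    by (rule differentiable_mult[OF coord_poly_differentiable[OF P]])
  then have "(complex_of_real \<circ> (%x. P x * (flat_exp k \<circ> sqdist r y) x)) differentiable (at x)"
    by (rule differentiable_chain_at[OF _ bounded_linear_imp_differentiable[OF bounded_linear_of_real]])
  then show ?thesis by (simp add: bump_def[abs_def] comp_def)
qed

lemma bump_partial_deriv:
  assumes P: "coord_poly P"
  shows "\<exists>Q. coord_poly Q & partial_deriv i (bump r y P k) = bump r y Q (k + 2)"
proof -
  obtain P' where P': "coord_poly P'" "!!x h. ((%h. P (sh i h x)) has_real_derivative P' (sh i h x)) (at h)"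
    using coord_poly_deriv[OF P] by blast
  obtain D' where D': "coord_poly D'" "!!x h. ((%h. sqdist r y (sh i h x)) has_real_derivative D' (sh i h x)) (at h)"
    using coord_poly_deriv[OF coord_poly_sqdist] by blast
  \<comment> \<open>Differentiating \<open>flat_exp k\<close> creates the indices k + 1 and k + 2.
    By \<open>flat_exp_Suc\<close> all terms are brought to index k + 2 at the price of factors
    \<open>sqdist\<close>, which are again polynomial.\<close>
  define Q where "Q x = P' x * (sqdist r y x * sqdist r y x) + P x * (D' x * (1 - real k * sqdist r y x))" for x
  have "coord_poly Q" unfolding Q_def
    by (intro coord_poly.add coord_poly.mult coord_poly_diff coord_poly.const P P' D' coord_poly_sqdist)
  moreover have "partial_deriv i (bump r y P k) x = bump r y Q (k + 2) x" for x
  proof -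
    have "((%h. P (sh i h x) * flat_exp k (sqdist r y (sh i h x))) has_real_derivative
      P' x * flat_exp k (sqdist r y x) + (flat_exp (k + 2) (sqdist r y x) - real k * flat_exp (k + 1) (sqdist r y x)) * D' x * P x) (at 0)"
      using DERIV_mult[OF P'(2)[of x 0] DERIV_chain2[OF flat_exp_deriv D'(2)[of x 0]]] by simp
    also have "P' x * flat_exp k (sqdist r y x) + (flat_exp (k + 2) (sqdist r y x) - real k * flat_exp (k + 1) (sqdist r y x)) * D' x * P x
        = Q x * flat_exp (k + 2) (sqdist r y x)"
      unfolding Q_def flat_exp_Suc[of "sqdist r y x" k, symmetric] flat_exp_Suc[of "sqdist r y x" "Suc k", symmetric]
      by (simp add: flat_exp_Suc[of "sqdist r y x" "Suc k", symmetric] algebra_simps)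
    finally have "((%h. bump r y P k (sh i h x)) has_vector_derivative bump r y Q (k + 2) x) (at 0)"
      unfolding bump_def has_real_derivative_iff_has_vector_derivative by (rule bounded_linear.has_vector_derivative[OF bounded_linear_of_real])
    then show ?thesis unfolding partial_deriv_def by (rule vector_derivative_at)
  qed
  ultimately show ?thesis by blast
qed

lemma test_function_bump: assumes "coord_poly P" shows "test_function (bump r y P k)"
proof -
  have "\<exists>Q k'. coord_poly Q & foldr partial_deriv js (bump r y P k) = bump r y Q k'" for js
  proof (induction js)
    case (Cons i js)
    then show ?case by (metis bump_partial_deriv foldr.simps(2) comp_apply)
  qed (use assms in auto)
  then have "smooth (bump r y P k)"
    unfolding smooth_def differentiable_on_def
    by (metis bump_differentiable differentiable_at_withinI)
  moreover have "{x. bump r y P k x ~= 0} \<subseteq> cball y \<bar>r\<bar>"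
  proof
    fix x assume "x \<in> {x. bump r y P k x ~= 0}"
    then have "(norm (x - y))^2 < \<bar>r\<bar>^2" by (auto simp: bump_def flat_exp_def sqdist_def split: if_splits)
    then have "norm (x - y) < \<bar>r\<bar>" by (rule power_less_imp_less_base) simp
    then show "x \<in> cball y \<bar>r\<bar>" by (simp add: dist_norm norm_minus_commute)
  qed
  then have "closure {x. bump r y P k x ~= 0} \<subseteq> cball y \<bar>r\<bar>" by (rule closure_minimal) simp
  then have "compact (closure {x. bump r y P k x ~= 0})"
    using compact_Int_closed[OF compact_cball closed_closure] by (metis inf.absorb_iff2)
  ultimately show ?thesis by (simp add: test_function_def)
qed

section \<open>Derivatives of test functions under the Fourier transform\<close>

lemma test_function_Cc: assumes "test_function \<phi>" shows "Cc \<phi>"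
proof -
  have "foldr partial_deriv [] \<phi> differentiable_on UNIV"
    using assms unfolding test_function_def smooth_def by blast
  then have "continuous_on UNIV \<phi>" by (simp add: differentiable_imp_continuous_on)
  moreover have "bounded (closure {x. \<phi> x ~= 0})"
    using assms by (auto simp: test_function_def compact_imp_bounded)
  then obtain R where "\<forall>x\<in>closure {x. \<phi> x ~= 0}. norm x <= R" unfolding bounded_iff by blast
  then have "\<forall>x. R < norm x --> \<phi> x = 0" using closure_subset[of "{x. \<phi> x ~= 0}"] by force
  ultimately show ?thesis by (auto simp: Cc_def)
qed

lemma test_function_differentiable: "test_function \<phi> ==> \<phi> differentiable (at x)"
  unfolding test_function_def smooth_def
  by (metis foldr.simps(1) id_apply differentiable_on_def UNIV_I)

lemma partial_deriv_line:
  assumes "f differentiable (at (sh i h x))"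
  shows "((%h. f (sh i h x)) has_vector_derivative partial_deriv i f (sh i h x)) (at h)"
proof -
  obtain f' where f': "(f has_derivative f') (at (sh i h x))" using assms by (auto simp: differentiable_def)
  have *: "((%s. f (sh i s z)) has_vector_derivative f' (axis i 1)) (at s)"
    if "z + s *\<^sub>R axis i 1 = x + h *\<^sub>R axis i 1" for z s
  proof -
    have "((%s. z + s *\<^sub>R axis i 1) has_derivative (%s. s *\<^sub>R axis i 1)) (at s)"
      by (auto intro!: derivative_eq_intros)
    from has_derivative_compose[OF this, of f f'] f'
    have "((%s. f (sh i s z)) has_derivative (%s. f' (s *\<^sub>R axis i 1))) (at s)"
      by (simp add: that)
    then show ?thesis
      by (simp add: has_vector_derivative_def linear_scale[OF has_derivative_linear[OF f']])
  qed
  from *[of "x + h *\<^sub>R axis i 1" 0] have "partial_deriv i f (sh i h x) = f' (axis i 1)"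
    unfolding partial_deriv_def by (intro vector_derivative_at) simp
  with *[of x h] show ?thesis by simp
qed

lemma test_function_partial_deriv:
  assumes "test_function \<phi>" shows "test_function (partial_deriv i \<phi>)"
proof -
  have "smooth (partial_deriv i \<phi>)"
    unfolding smooth_def
  proof
    fix js
    have "foldr partial_deriv (js @ [i]) \<phi> differentiable_on UNIV"
      using assms unfolding test_function_def smooth_def by blast
    then show "foldr partial_deriv js (partial_deriv i \<phi>) differentiable_on UNIV" by simp
  qed
  moreover have "{x. partial_deriv i \<phi> x ~= 0} \<subseteq> closure {x. \<phi> x ~= 0}"
  proof (rule subsetI, rule ccontr)
    fix x assume x: "x \<in> {x. partial_deriv i \<phi> x ~= 0}" "x \<notin> closure {x. \<phi> x ~= 0}"
    let ?U = "{h::real. x + h *\<^sub>R axis i 1 \<in> - closure {x. \<phi> x ~= 0}}"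
    have "open ?U"
      by (rule continuous_open_vimage[unfolded vimage_def]) (auto intro!: continuous_intros)
    have "((%h. 0::complex) has_vector_derivative 0) (at 0)" by simp
    then have "((%h. \<phi> (sh i h x)) has_vector_derivative 0) (at 0)"
      by (rule has_vector_derivative_transform_within_open[OF _ \<open>open ?U\<close>])
         (use x(2) closure_subset[of "{x. \<phi> x ~= 0}"] in auto)
    then have "partial_deriv i \<phi> x = 0" unfolding partial_deriv_def by (rule vector_derivative_at)
    then show False using x by simp
  qed
  then have "closure {x. partial_deriv i \<phi> x ~= 0} \<subseteq> closure {x. \<phi> x ~= 0}" by (rule closure_minimal) simp
  then have "compact (closure {x. partial_deriv i \<phi> x ~= 0})"
    using assms compact_Int_closed[OF _ closed_closure] unfolding test_function_def by (metis inf.absorb_iff2)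
  ultimately show ?thesis by (simp add: test_function_def)
qed

lemma norm_diff_le_of_vector_derivative:
  fixes f :: "real => complex"
  assumes "!!s. (f has_vector_derivative f' s) (at s)" "!!s. cmod (f' s) <= B"
  shows "cmod (f h - f 0) <= B * \<bar>h\<bar>"
proof -
  have "norm (f h - f 0) <= B * norm (h - 0)"
  proof (rule differentiable_bound[where S=UNIV and f'="%s t. t *\<^sub>R f' s"])
    show "(f has_derivative (%t. t *\<^sub>R f' s)) (at s within UNIV)" for s
      using assms(1)[of s] by (simp add: has_vector_derivative_def)
    show "onorm (%t. t *\<^sub>R f' s) <= B" for s
    proof (rule onorm_le)
      show "norm (t *\<^sub>R f' s) <= B * norm t" for t
        using mult_right_mono[OF assms(2)[of s], of "norm t"] by (simp add: mult.commute)
    qed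
  qed auto
  then show ?thesis by simp
qed

lemma fourier_translate:
  fixes f :: "real^'n::finite => complex"
  assumes "L1f f"
  shows "fourier (%x. f (x + y)) \<xi> = exp (\<i> * of_real (y \<bullet> \<xi>)) * fourier f \<xi>"
proof -
  have [measurable]: "f \<in> BM" using assms by (rule L1f_measurable)
  have "(LINT x|lborel. exp (- \<i> * of_real (x \<bullet> \<xi>)) * f x) = (LINT x|lborel. exp (- \<i> * of_real ((y + x) \<bullet> \<xi>)) * f (y + x))"
    by (subst lborel_integral_affine[where c=1 and t=y]) simp_all
  also have "\<dots> = (LINT x|lborel. exp (- \<i> * of_real (y \<bullet> \<xi>)) * (exp (- \<i> * of_real (x \<bullet> \<xi>)) * f (x + y)))"
    by (simp add: mult.assoc[symmetric] exp_add[symmetric] inner_add_left distrib_left add.commute)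
  finally have "exp (\<i> * of_real (y \<bullet> \<xi>)) * (LINT x|lborel. exp (- \<i> * of_real (x \<bullet> \<xi>)) * f x)
     = exp (\<i> * of_real (y \<bullet> \<xi>)) * (exp (- \<i> * of_real (y \<bullet> \<xi>)) * (LINT x|lborel. exp (- \<i> * of_real (x \<bullet> \<xi>)) * f (x + y)))"
    by simp
  also have "\<dots> = (LINT x|lborel. exp (- \<i> * of_real (x \<bullet> \<xi>)) * f (x + y))"
    by (simp add: mult.assoc[symmetric] exp_add[symmetric])
  finally show ?thesis by (simp add: fourier_eq)
qed

lemma vector_derivative_quotient:
  assumes "(f has_vector_derivative f') (at x)"
  shows "((%y. (f y - f x) /\<^sub>R (y - x)) \<longlongrightarrow> f') (at x)"
proof -
  have "((%y. norm (f y - f x - (y - x) *\<^sub>R f') / norm (y - x)) \<longlongrightarrow> 0) (at x)"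
    using assms unfolding has_vector_derivative_def has_derivative_iff_norm by blast
  moreover have "\<forall>\<^sub>F y in at x. norm (f y - f x - (y - x) *\<^sub>R f') / norm (y - x) = norm ((f y - f x) /\<^sub>R (y - x) - f')"
  proof (rule eventually_at_filter[THEN iffD2], intro always_eventually allI impI)
    fix y assume "y ~= x"
    then have "(f y - f x) /\<^sub>R (y - x) - f' = (f y - f x - (y - x) *\<^sub>R f') /\<^sub>R (y - x)"
      by (simp add: scaleR_diff_right)
    then show "norm (f y - f x - (y - x) *\<^sub>R f') / norm (y - x) = norm ((f y - f x) /\<^sub>R (y - x) - f')"
      by (simp add: divide_inverse_commute)
  qed
  ultimately have "((%y. norm ((f y - f x) /\<^sub>R (y - x) - f')) \<longlongrightarrow> 0) (at x)"
    by (rule Lim_transform_eventually)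
  then show ?thesis by (simp add: tendsto_norm_zero_iff LIM_zero_iff)
qed

lemma exp_i_vector_derivative:
  "((%h. exp (\<i> * of_real (h * a))) has_vector_derivative \<i> * of_real a * exp (\<i> * of_real (h * a))) (at h)"
proof -
  have "((%z. exp (\<i> * of_real a * z)) has_field_derivative \<i> * of_real a * exp (\<i> * of_real a * of_real h)) (at (of_real h))"
    by (auto intro!: derivative_eq_intros)
  from has_vector_derivative_real_field[OF this] show ?thesis by (simp add: mult_ac)
qed

lemma exp_difference_quotient: "((%h. (exp (\<i> * of_real (h * a)) - 1) / of_real h) \<longlongrightarrow> \<i> * of_real a) (at (0::real))"
  using vector_derivative_quotient[OF exp_i_vector_derivative[of a 0]]
  by (simp add: scaleR_conv_of_real divide_inverse mult.commute)

text \<open>The derivative is a dominated limit of difference quotients, and a translation becomes a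
  character under the transform; so the quotients transform into
  \<open>(exp (\<i> * of_real (h * \<xi> $ i)) - 1) / of_real h\<close> times the transform of
  \<phi>. This takes the place of an integration by parts.\<close>

lemma fourier_partial_deriv:
  fixes \<phi> :: "real^'n::finite => complex"
  assumes t: "test_function \<phi>"
  shows "fourier (partial_deriv i \<phi>) \<xi> = \<i> * of_real (\<xi> $ i) * fourier \<phi> \<xi>"
proof -
  note c = test_function_Cc[OF t] and c' = test_function_Cc[OF test_function_partial_deriv[OF t, of i]]
  note [measurable] = Cc_measurable[OF c] Cc_measurable[OF c']
  obtain B R where B: "B > 0" "!!x. cmod (partial_deriv i \<phi> x) <= B * indicator (cball 0 R) x"
    using Cc_bounded[OF c'] by blast
  then have B': "cmod (partial_deriv i \<phi> x) <= B" for x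
    using order_trans[OF B(2)[of x], of B] by (auto simp: indicator_def)
  obtain R0 where R0: "!!x. R0 < norm x ==> \<phi> x = 0" using c by (auto simp: Cc_def)
  define h where "h j = 1 / real (Suc j)" for j
  have h0: "h \<longlonglongrightarrow> 0" unfolding h_def using LIMSEQ_inverse_real_of_nat by (simp add: inverse_eq_divide)
  have hp: "0 < h j" "h j <= 1" for j by (auto simp: h_def)
  have h0': "filterlim h (at 0) sequentially"
    using h0 hp by (auto simp: filterlim_at intro!: always_eventually less_imp_neq[symmetric] simp: less_imp_neq[THEN not_sym])
  define q where "q j x = (\<phi> (x + h j *\<^sub>R axis i 1) - \<phi> x) / of_real (h j)" for j x
  have [measurable]: "q j \<in> BM" for j unfolding q_def by measurable
  have vd: "((%h. \<phi> (sh i h x)) has_vector_derivative partial_deriv i \<phi> (sh i h x)) (at h)" for x h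
    by (rule partial_deriv_line) (rule test_function_differentiable[OF t])
  have qb: "cmod (q j x) <= B * indicator (cball 0 (R0 + 1)) x" for j x
  proof (cases "norm x <= R0 + 1")
    case True
    have "cmod (\<phi> (x + h j *\<^sub>R axis i 1) - \<phi> (sh i 0 x)) <= B * \<bar>h j\<bar>"
      by (rule norm_diff_le_of_vector_derivative[OF vd]) (rule B')
    then show ?thesis using True hp[of j] by (simp add: q_def norm_divide divide_simps)
  next
    case False
    have "norm x <= norm (x + h j *\<^sub>R axis i 1) + norm (h j *\<^sub>R axis i (1::real))"
      by (metis add_diff_cancel norm_triangle_ineq4)
    then have "R0 < norm (x + h j *\<^sub>R axis i 1)" "R0 < norm x"
      using False hp[of j] by (auto simp: norm_axis_1)
    then show ?thesis using R0 False by (simp add: q_def)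
  qed
  have ql: "(%j. q j x) \<longlonglongrightarrow> partial_deriv i \<phi> x" for x
  proof -
    have "((%y. (\<phi> (sh i y x) - \<phi> (sh i 0 x)) /\<^sub>R (y - 0)) \<longlongrightarrow> partial_deriv i \<phi> x) (at 0)"
      using vector_derivative_quotient[OF vd[of x 0]] by simp
    from filterlim_compose[OF this h0'] show ?thesis
      by (simp add: q_def scaleR_conv_of_real divide_inverse mult.commute)
  qed
  have "(%j. LINT x|lborel. exp (- \<i> * of_real (x \<bullet> \<xi>)) * q j x) \<longlonglongrightarrow> (LINT x|lborel. exp (- \<i> * of_real (x \<bullet> \<xi>)) * partial_deriv i \<phi> x)"
    by (rule integral_dominated_convergence[where w="%x. B * indicator (cball 0 (R0 + 1)) x"])
       (use indicator_cball_integrable[of "R0 + 1"] in "auto simp: norm_mult qb intro!: tendsto_intros ql")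
  then have l1: "(%j. fourier (q j) \<xi>) \<longlonglongrightarrow> fourier (partial_deriv i \<phi>) \<xi>"
    by (simp add: fourier_eq) (intro tendsto_intros)
  have "fourier (q j) \<xi> = (exp (\<i> * of_real (h j * \<xi> $ i)) - 1) / of_real (h j) * fourier \<phi> \<xi>" for j
  proof -
    have L: "L1f \<phi>" "L1f (%x. \<phi> (x + h j *\<^sub>R axis i 1))"
      using Cc_L1f[OF c] lborel_integrable_affine_iff[of \<phi> 1 "h j *\<^sub>R axis i 1"] by (auto simp: L1f_def add.commute)
    have "fourier (q j) \<xi> = (1 / of_real (h j)) * fourier (%x. \<phi> (x + h j *\<^sub>R axis i 1) - \<phi> x) \<xi>"
      by (simp add: fourier_eq q_def mult.left_commute flip: integral_mult_right_zero integral_divide_zero times_divide_eq_right)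
    also have "\<dots> = (1 / of_real (h j)) * (exp (\<i> * of_real (h j * \<xi> $ i)) * fourier \<phi> \<xi> - fourier \<phi> \<xi>)"
      by (subst fourier_diff[OF L(2,1)], subst fourier_translate[OF L(1)]) (simp add: inner_axis' )
    finally show ?thesis by (simp add: field_simps)
  qed
  moreover have "(%j. (exp (\<i> * of_real (h j * \<xi> $ i)) - 1) / of_real (h j) * fourier \<phi> \<xi>) \<longlonglongrightarrow> \<i> * of_real (\<xi> $ i) * fourier \<phi> \<xi>"
    by (intro tendsto_mult tendsto_const filterlim_compose[OF exp_difference_quotient h0'])
  ultimately show ?thesis using l1 LIMSEQ_unique by simp
qed

section \<open>Weak derivatives as Fourier multipliers\<close>

definition msym :: "'n::finite multiindex => real^'n => complex" where
  "msym \<beta> \<xi> = (\<Prod>i\<in>UNIV. (\<i> * of_real (\<xi> $ i)) ^ \<beta> i)"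

lemma msym_measurable [measurable]: "msym \<beta> \<in> BM"
  unfolding msym_def by measurable

lemma msym_uminus: "msym \<beta> (- \<xi>) = (-1) ^ morder \<beta> * msym \<beta> \<xi>"
proof -
  have "(\<i> * of_real ((- \<xi>) $ i)) ^ \<beta> i = (-1) ^ \<beta> i * (\<i> * of_real (\<xi> $ i)) ^ \<beta> i" for i
    by (simp add: power_minus[of "\<i> * of_real (\<xi> $ i)"])
  then show ?thesis by (simp add: msym_def morder_def power_sum prod.distrib)
qed

lemma prod_list_count: "(\<Prod>i\<leftarrow>js. f i) = (\<Prod>i\<in>UNIV. f i ^ count_list js i)"
  for f :: "'n::finite => 'a::comm_monoid_mult"
proof (induction js)
  case (Cons j js)
  have "(\<Prod>i\<in>UNIV. f i ^ count_list (j # js) i) = (\<Prod>i\<in>UNIV. (if i = j then f i else 1) * f i ^ count_list js i)"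
    by (intro prod.cong) auto
  then show ?case using Cons by (simp add: prod.distrib prod.delta)
qed simp

lemma test_function_multi_deriv:
  assumes t: "test_function \<phi>"
  shows "test_function (multi_deriv \<beta> \<phi>)" "fourier (multi_deriv \<beta> \<phi>) \<xi> = msym \<beta> \<xi> * fourier \<phi> \<xi>"
proof -
  have *: "test_function (foldr partial_deriv js \<phi>) & fourier (foldr partial_deriv js \<phi>) \<xi> = (\<Prod>i\<leftarrow>js. \<i> * of_real (\<xi> $ i)) * fourier \<phi> \<xi>" for js
    by (induction js) (auto simp: t test_function_partial_deriv fourier_partial_deriv)
  define js where "js = (SOME js. \<forall>i. count_list js i = \<beta> i)"
  have "\<forall>i. count_list js i = \<beta> i" unfolding js_def by (rule someI_ex[OF ex_multiindex_list])
  then show "test_function (multi_deriv \<beta> \<phi>)" "fourier (multi_deriv \<beta> \<phi>) \<xi> = msym \<beta> \<xi> * fourier \<phi> \<xi>"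
    using *[of js] by (auto simp: multi_deriv_def js_def[symmetric] msym_def prod_list_count)
qed

lemma LINT_rep:
  assumes "Cc \<phi>" shows "(LINT x|lebesgue. rep_L2 u x * \<phi> x) = pr u (abs_L2 \<phi>)"
proof -
  note [measurable] = Cc_measurable[OF assms]
  have m: "\<phi> \<in> borel_measurable lebesgue" "rep_L2 u \<in> borel_measurable lebesgue" "rp u \<in> borel_measurable lebesgue"
    using square_integrable_rep_L2[of u] by (auto simp: square_integrable_def intro: measurable_completion)
  have "(LINT x|lebesgue. rep_L2 u x * \<phi> x) = (LINT x|lebesgue. rp u x * \<phi> x)"
    using AE_completion[OF rep_rp[of u]] m by (intro integral_cong_AE) auto
  also have "\<dots> = (LINT x|lborel. rp u x * \<phi> x)" by (rule integral_completion) simp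
  also have "\<dots> = pr u (abs_L2 \<phi>)"
    by (rule pr_cong_AE[symmetric]) (auto intro: rp_abs Cc_sqi assms)
  finally show ?thesis .
qed

lemma has_weak_deriv_pr: "has_weak_deriv \<beta> u v \<longleftrightarrow>
   (\<forall>\<phi>. test_function \<phi> --> pr u (abs_L2 (multi_deriv \<beta> \<phi>)) = (-1) ^ morder \<beta> * pr v (abs_L2 \<phi>))"
  unfolding has_weak_deriv_def
  by (intro all_cong1 imp_cong refl) (simp add: LINT_rep test_function_Cc test_function_multi_deriv)

lemma isM_iFT_multi_deriv:
  assumes t: "test_function \<phi>"
  shows "isM (%\<xi>. (-1) ^ morder \<beta> * msym \<beta> \<xi>) (iFT (abs_L2 \<phi>)) (iFT (abs_L2 (multi_deriv \<beta> \<phi>)))"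
proof -
  note c = test_function_Cc[OF t] and c' = test_function_Cc[OF test_function_multi_deriv(1)[OF t, of \<beta>]]
  note f = iFT_abs[OF Cc_sqi[OF c] Cc_L1f[OF c]] and f' = iFT_abs[OF Cc_sqi[OF c'] Cc_L1f[OF c']]
  show ?thesis
    unfolding isM_def f(1) f'(1) using rp_abs[OF f(2)] rp_abs[OF f'(2)]
    by eventually_elim (simp add: test_function_multi_deriv(2)[OF t] msym_uminus)
qed

lemma pr_iFT: "pr u v = pr (FT u) (iFT v)"
  by (simp add: pr_FT)

lemma has_weak_derivI: assumes "isM (msym \<beta>) (FT u) (FT v)" shows "has_weak_deriv \<beta> u v"
  unfolding has_weak_deriv_pr
proof (intro allI impI)
  fix \<phi> :: "real^'a => complex" assume t: "test_function \<phi>"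
  have "isM (%\<xi>. (-1) ^ morder \<beta> * msym \<beta> \<xi>) (FT u) (cmult_L2 ((-1) ^ morder \<beta>) (FT v))"
    by (rule isM_cmult_left[OF assms])
  from isM_pr[OF this isM_iFT_multi_deriv[OF t]]
  show "pr u (abs_L2 (multi_deriv \<beta> \<phi>)) = (-1) ^ morder \<beta> * pr v (abs_L2 \<phi>)"
    by (simp add: pr_iFT[of _ "abs_L2 _"] pr_cmult_left)
qed

text \<open>On the support of the bump the character differs from 1 by at most r |\<xi>| < 1, so it
  cannot cancel the integral of a nonnegative function. This permits division by the transform of a
  test function.\<close>

lemma bump_fourier_nonzero:
  fixes \<xi> :: "real^'n::finite"
  assumes r: "r > 0" "r * norm \<xi> < 1"
  shows "fourier (bump r 0 (%x. 1) 0) (- \<xi>) ~= 0"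
proof
  let ?\<phi> = "bump r (0::real^'n) (%x. 1) 0"
  have c: "Cc ?\<phi>" by (intro test_function_Cc test_function_bump coord_poly.const)
  note [measurable] = Cc_measurable[OF c]
  have i: "integrable lborel ?\<phi>" by (rule Cc_integrable[OF c])
  have nn: "cmod (?\<phi> x) = Re (?\<phi> x)" "?\<phi> x = of_real (Re (?\<phi> x))" for x by (auto simp: bump_def flat_exp_def)
  have sup: "?\<phi> x ~= 0 \<longleftrightarrow> norm x < r" for x
  proof -
    have "(norm x)^2 < r^2 \<longleftrightarrow> norm x < r"
      using r by (auto intro: power2_less_imp_less power_strict_mono)
    then show ?thesis by (auto simp: bump_def flat_exp_def sqdist_def)
  qed
  let ?I = "LINT x|lborel. Re (?\<phi> x)"
  have iR: "integrable lborel (%x. Re (?\<phi> x))" using i by (rule integrable_Re)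
  have "?I ~= 0"
  proof
    assume "?I = 0"
    then have "AE x in lborel. Re (?\<phi> x) = 0"
      using integral_nonneg_eq_0_iff_AE[OF iR] nn(1) by (metis AE_I2 norm_ge_zero)
    then have "AE x in lborel. x \<notin> ball (0::real^'n) r" 
    proof eventually_elim
      case (elim x)
      then have "?\<phi> x = 0" by (subst nn(2)) simp
      then show ?case using sup[of x] by simp
    qed
    then have "ball (0::real^'n) r \<in> null_sets lborel" by (simp add: AE_iff_null_sets)
    then have "negligible (ball (0::real^'n) r)" by (simp add: negligible_iff_null_sets null_sets_completionI)
    then show False using open_not_negligible[of "ball (0::real^'n) r"] r by auto
  qed
  moreover have "?I >= 0" by (rule integral_nonneg_AE) (metis AE_I2 nn(1) norm_ge_zero)
  ultimately have I: "?I > 0" by simp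
  assume "fourier ?\<phi> (- \<xi>) = 0"
  then have z: "(LINT x|lborel. exp (\<i> * of_real (x \<bullet> \<xi>)) * ?\<phi> x) = 0"
    using cN_pos[where 'n='n] by (simp add: fourier_eq)
  have ei: "integrable lborel (%x. exp (\<i> * of_real (x \<bullet> \<xi>)) * ?\<phi> x)"
    using exp_mult_integrable[OF Cc_L1f[OF c], of "- \<xi>"] by simp
  have "of_real ?I = (LINT x|lborel. ?\<phi> x) - (LINT x|lborel. exp (\<i> * of_real (x \<bullet> \<xi>)) * ?\<phi> x)"
    unfolding z using nn(2) by (simp flip: integral_complex_of_real)
  also have "\<dots> = (LINT x|lborel. ?\<phi> x - exp (\<i> * of_real (x \<bullet> \<xi>)) * ?\<phi> x)"
    by (rule Bochner_Integration.integral_diff[symmetric]) fact+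
  finally have "?I = cmod (LINT x|lborel. ?\<phi> x - exp (\<i> * of_real (x \<bullet> \<xi>)) * ?\<phi> x)"
    using I by (metis abs_of_pos norm_of_real)
  also have "\<dots> <= (LINT x|lborel. (r * norm \<xi>) * Re (?\<phi> x))"
  proof (rule Bochner_Integration.integral_norm_bound_integral)
    fix x
    have "cmod (exp (\<i> * of_real (1 * (x \<bullet> \<xi>))) - exp (\<i> * of_real (0 * (x \<bullet> \<xi>)))) <= \<bar>x \<bullet> \<xi>\<bar> * \<bar>1\<bar>"
      by (rule norm_diff_le_of_vector_derivative[OF exp_i_vector_derivative]) (simp add: norm_mult)
    then have "cmod (1 - exp (\<i> * of_real (x \<bullet> \<xi>))) <= \<bar>x \<bullet> \<xi>\<bar>"
      by (simp add: norm_minus_commute)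
    also have "\<dots> <= norm x * norm \<xi>" by (rule Cauchy_Schwarz_ineq2)
    finally have "cmod (1 - exp (\<i> * of_real (x \<bullet> \<xi>))) * cmod (?\<phi> x) <= (norm x * norm \<xi>) * cmod (?\<phi> x)"
      by (rule mult_right_mono) simp
    also have "\<dots> <= (r * norm \<xi>) * cmod (?\<phi> x)"
      using sup[of x] by (cases "norm x < r") (auto intro!: mult_right_mono)
    finally show "norm (?\<phi> x - exp (\<i> * of_real (x \<bullet> \<xi>)) * ?\<phi> x) <= (r * norm \<xi>) * Re (?\<phi> x)"
      unfolding nn(1)[symmetric] by (simp add: norm_mult[symmetric] left_diff_distrib)
  qed (use i ei iR in auto)
  also have "\<dots> = (r * norm \<xi>) * ?I" by simp
  finally show False using I r by (simp add: mult_le_cancel_right1)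
qed

text \<open>Testing with all translates of one bump gives the vanishing of a Fourier integral at
  every point, so the defect \<open>h\<close> times the transform of the bump is zero almost
  everywhere. Small bumps have nonvanishing transforms on large balls, whence
  \<open>h = 0\<close>.\<close>

lemma has_weak_derivD:
  fixes u v :: "'n::finite L2"
  assumes w: "has_weak_deriv \<beta> u v" shows "isM (msym \<beta>) (FT u) (FT v)"
proof -
  define h where "h \<xi> = msym \<beta> \<xi> * rp (FT u) \<xi> - rp (FT v) \<xi>" for \<xi>
  have [measurable]: "h \<in> BM" unfolding h_def by measurable
  have key: "AE \<xi> in lborel. h \<xi> * fourier (bump r 0 (%x. 1) 0) (- \<xi>) = 0" for r
  proof -
    define \<phi> where "\<phi> y = bump r y (%x. 1) 0" for y :: "real^'n"
    have t: "test_function (\<phi> y)" for y unfolding \<phi>_def by (intro test_function_bump coord_poly.const)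
    define \<psi> where "\<psi> y = multi_deriv \<beta> (\<phi> y)" for y
    have t': "test_function (\<psi> y)" for y unfolding \<psi>_def by (rule test_function_multi_deriv(1)[OF t])
    note c = test_function_Cc[OF t] and c' = test_function_Cc[OF t']
    have [measurable]: "fourier (\<phi> y) \<in> BM" "fourier (\<psi> y) \<in> BM" for y
      by (intro fourier_measurable Cc_L1f c c')+
    define k where "k y \<xi> = h \<xi> * fourier (\<phi> y) (- \<xi>)" for y \<xi>
    define e :: complex where "e = (-1) ^ morder \<beta>"
    have ee: "e * e = 1" "e ~= 0" by (auto simp: e_def simp flip: power_mult_distrib)
    have \<psi>f: "fourier (\<psi> y) (- \<xi>) = e * msym \<beta> \<xi> * fourier (\<phi> y) (- \<xi>)" for y \<xi>
      unfolding \<psi>_def e_def by (simp add: test_function_multi_deriv(2)[OF t] msym_uminus)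
    \<comment> \<open>The function \<open>h\<close> is not known to be square integrable. With the
      symbol moved onto the test function, \<open>k y\<close> visibly is, and it is integrable
      too.\<close>
    have k_eq: "k y \<xi> = e * (rp (FT u) \<xi> * fourier (\<psi> y) (- \<xi>)) - rp (FT v) \<xi> * fourier (\<phi> y) (- \<xi>)" for y \<xi>
    proof -
      have "e * (rp (FT u) \<xi> * (e * msym \<beta> \<xi> * fourier (\<phi> y) (- \<xi>)))
        = (e * e) * (msym \<beta> \<xi> * rp (FT u) \<xi> * fourier (\<phi> y) (- \<xi>))" by (simp only: mult_ac)
      then show ?thesis unfolding \<psi>f ee(1) k_def h_def by (simp only: mult_1 left_diff_distrib)
    qed
    have ts: "sqi (%\<xi>. rp w \<xi> * fourier f (- \<xi>))" if "Cc f" for w and f :: "real^'n => complex"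
    proof -
      note [measurable] = fourier_measurable[OF Cc_L1f[OF that]]
      define K where "K = cN TYPE('n) * (LINT x|lborel. cmod (f x))"
      have K: "cmod (fourier f \<xi>) <= K" for \<xi> unfolding K_def by (rule fourier_bound[OF Cc_L1f[OF that]])
      then have "0 <= K" using norm_ge_zero order_trans by blast
      then show ?thesis
        by (intro sqi_bound[OF sqi_cmult[OF sqi_rp[of w], of "of_real K"]])
           (auto simp: norm_mult mult.commute[of K] mult_left_mono K)
    qed
    have ks: "sqi (k y)" for y
      unfolding k_eq by (intro sqi_diff sqi_cmult ts c c')
    have ti: "integrable lborel (%\<xi>. rp w \<xi> * fourier f (- \<xi>))"
      and tI: "(LINT \<xi>|lborel. rp w \<xi> * fourier f (- \<xi>)) = pr w (iFT (abs_L2 f))" if "Cc f" for w and f :: "real^'n => complex"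
    proof -
      note f = iFT_abs[OF Cc_sqi[OF that] Cc_L1f[OF that]]
      show "integrable lborel (%\<xi>. rp w \<xi> * fourier f (- \<xi>))" by (rule sqi_mult_integrable[OF sqi_rp f(2)])
      show "(LINT \<xi>|lborel. rp w \<xi> * fourier f (- \<xi>)) = pr w (iFT (abs_L2 f))"
        unfolding f(1) using f(2) by (intro pr_cong_AE[symmetric] rp_abs) (auto simp: sqi_def)
    qed
    have ki: "L1f (k y)" for y
      by (intro L1f_I) (unfold k_eq, intro Bochner_Integration.integrable_diff integrable_mult_right ti c c')
    have kI: "(LINT \<xi>|lborel. k y \<xi>) = 0" for y
    proof -
      have "(LINT \<xi>|lborel. k y \<xi>) = e * pr (FT u) (iFT (abs_L2 (\<psi> y))) - pr (FT v) (iFT (abs_L2 (\<phi> y)))"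
        unfolding k_eq tI[OF c, symmetric] tI[OF c', symmetric]
        by (simp add: Bochner_Integration.integral_diff ti c c')
      also have "\<dots> = e * pr u (abs_L2 (\<psi> y)) - pr v (abs_L2 (\<phi> y))" by (simp add: pr_FT)
      also have "pr u (abs_L2 (\<psi> y)) = e * pr v (abs_L2 (\<phi> y))"
        using w t unfolding has_weak_deriv_pr \<psi>_def e_def by blast
      also have "e * (e * pr v (abs_L2 (\<phi> y))) = pr v (abs_L2 (\<phi> y))"
        unfolding mult.assoc[symmetric] ee(1) by simp
      finally show ?thesis by simp
    qed
    \<comment> \<open>Translating the bump multiplies \<open>k 0\<close> by a character, so the
      integrals in \<open>kI\<close> are the values of the Fourier transform of
      \<open>k 0\<close>.\<close>
    have ktr: "k y \<xi> = exp (\<i> * of_real (y \<bullet> \<xi>)) * k 0 \<xi>" for y \<xi>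
    proof -
      have "\<phi> y = (%x. \<phi> 0 (x + (- y)))" by (auto simp: \<phi>_def bump_def sqdist_def)
      then show ?thesis using fourier_translate[OF Cc_L1f[OF c[of 0]], of "- y" "- \<xi>"] by (simp add: k_def)
    qed
    have "fourier (k 0) = (%\<xi>. 0)"
    proof
      fix y :: "real^'n"
      have "(LINT \<xi>|lborel. exp (- \<i> * of_real (\<xi> \<bullet> y)) * k 0 \<xi>) = (LINT \<xi>|lborel. k (- y) \<xi>)"
        unfolding ktr[of "- y"] by (simp add: inner_commute)
      then show "fourier (k 0) y = 0" by (simp add: fourier_eq[OF L1f_measurable[OF ki]] kI)
    qed
    then have "FT (abs_L2 (k 0)) = 0" using fourier_L2_abs(1)[OF ks ki, of 0] by (simp add: abs_zero)
    then have "abs_L2 (k 0) = 0" by (metis norm_FT norm_eq_zero)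
    then have "AE \<xi> in lborel. k 0 \<xi> = 0"
      using rp_abs[OF ks[of 0]] rp_zero[where 'a='n] by (auto elim: eventually_elim2)
    then show ?thesis by (simp add: k_def \<phi>_def)
  qed
  \<comment> \<open>The bump of radius 1/(j+1) has a nonzero transform for |\<xi>| < j + 1;
    countably many radii cover the whole space.\<close>
  have "AE \<xi> in lborel. \<forall>j. h \<xi> * fourier (bump (1 / real (Suc j)) 0 (%x. 1) 0) (- \<xi>) = 0"
    unfolding AE_all_countable using key by blast
  then have "AE \<xi> in lborel. h \<xi> = 0"
  proof eventually_elim
    case (elim \<xi>)
    obtain j where "norm \<xi> < real j" using reals_Archimedean2 by blast
    then have "norm \<xi> < real (Suc j)" by simp
    then have "1 / real (Suc j) > 0" "1 / real (Suc j) * norm \<xi> < 1" by (auto simp: divide_simps)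
    from bump_fourier_nonzero[OF this] elim show ?case by (metis mult_eq_0_iff)
  qed
  then show ?thesis unfolding isM_def by eventually_elim (simp add: h_def)
qed

lemma has_weak_deriv_iff: "has_weak_deriv \<beta> u v \<longleftrightarrow> isM (msym \<beta>) (FT u) (FT v)"
  using has_weak_derivD has_weak_derivI by blast

lemma has_weak_deriv_unique: "has_weak_deriv \<beta> u v ==> has_weak_deriv \<beta> u w ==> v = w"
  unfolding has_weak_deriv_iff using isM_unique FT_eq_iff by blast

lemma weak_deriv_eqI: "has_weak_deriv \<beta> u v ==> weak_deriv \<beta> u = v"
  unfolding weak_deriv_def using has_weak_deriv_unique by blast

section \<open>Absolute continuity on lines\<close>

text \<open>\<open>ACL j f g\<close>: on almost every line in direction \<open>j\<close>, \<open>f\<close> is absolutely continuous with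
  derivative \<open>g\<close>.  No integrability over the whole space is required, so that this notion of derivative is
  stable under products.\<close>

definition ACL :: "'n => (real^'n::finite => complex) => (real^'n => complex) => bool" where
  "ACL j f g \<longleftrightarrow> f \<in> BM & g \<in> BM &
     (AE x in lborel. AE s in lborel. 0 <= s -->
        integrable lborel (%r. cut s r (g (sh j r x))) &
        f (sh j s x) = f x + (LINT r|lborel. cut s r (g (sh j r x))))"

lemma measurable_vec_nth [measurable (raw)]:
  fixes f :: "'a => real^'n::finite"
  shows "f \<in> borel_measurable M ==> (%x. f x $ j) \<in> borel_measurable M"
  by (rule borel_measurable_continuous_on[where f="%x. x $ j"]) (auto intro: continuous_intros)

lemma AE_lborel_ex_in_interval:
  assumes "AE s in lborel. Q s" "(a::real) < b" shows "\<exists>s. a < s & s < b & Q s"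
proof (rule ccontr)
  assume *: "\<not> (\<exists>s. a < s & s < b & Q s)"
  have "AE s in lborel. s \<notin> {a<..<b}"
    using assms(1) by eventually_elim (use * in auto)
  then have "{a<..<b} \<in> null_sets lborel" using AE_iff_null_sets[of "{a<..<b}" lborel] by simp
  then have "emeasure lborel {a<..<b} = 0" by (rule null_setsD1)
  then show False using assms(2) by simp
qed

lemma indicator_integrable_subset:
  fixes g :: "real => 'b::{banach, second_countable_topology}"
  assumes i: "integrable lborel (%r. cut s r (g r))" and le: "s' <= s"
  shows "integrable lborel (%r. cut s' r (g r))"
proof -
  have "integrable lborel (%r. indicator {0..s'} r *\<^sub>R (cut s r (g r)))"
    by (rule integrable_mult_indicator[OF _ i]) simp
  also have "(%r. indicator {0..s'} r *\<^sub>R (cut s r (g r))) = (%r. cut s' r (g r))"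
    using le by (auto simp: indicator_def)
  finally show ?thesis .
qed

text \<open>Integration by parts for two absolutely continuous functions vanishing at \<open>0\<close>: split the square
  \<open>[0,s]\<^sup>2\<close> along its diagonal.\<close>

lemma product_of_primitives:
  fixes \<phi> \<gamma> :: "real => complex"
  assumes m [measurable]: "\<phi> \<in> BM" "\<gamma> \<in> BM"
    and i: "integrable lborel (%r. cut s r (\<phi> r))" "integrable lborel (%r. cut s r (\<gamma> r))"
  defines "\<Phi> \<equiv> %r. LINT q|lborel. cut r q (\<phi> q)" and "\<Gamma> \<equiv> %r. LINT q|lborel. cut r q (\<gamma> q)"
  shows "integrable lborel (%r. cut s r (\<phi> r * \<Gamma> r + \<Phi> r * \<gamma> r))"
    and "(LINT r|lborel. cut s r (\<phi> r * \<Gamma> r + \<Phi> r * \<gamma> r)) = \<Phi> s * \<Gamma> s"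
proof -
  define a b where "a r = cut s r (\<phi> r)" and "b r = cut s r (\<gamma> r)" for r
  have [measurable]: "a \<in> BM" "b \<in> BM" unfolding a_def b_def by measurable
  have ai: "integrable lborel a" "integrable lborel b" using i by (auto simp: a_def[abs_def] b_def[abs_def])
  define K where "K = (%(r, q). a r * b q)"
  have Km [measurable]: "K \<in> borel_measurable (lborel \<Otimes>\<^sub>M lborel)" unfolding K_def by measurable
  have K: "integrable (lborel \<Otimes>\<^sub>M lborel) K"
    by (rule lborel_pair.Fubini_integrable) (use ai in "auto simp: K_def norm_mult")
  have K1: "integrable (lborel \<Otimes>\<^sub>M lborel) (%(r, q). indicator {q. q <= r} q *\<^sub>R K (r, q))"
    by (rule Bochner_Integration.integrable_bound[OF K]) (auto simp: indicator_def)
  have K2: "integrable (lborel \<Otimes>\<^sub>M lborel) (%(r, q). indicator {q. r < q} q *\<^sub>R K (r, q))"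
    by (rule Bochner_Integration.integrable_bound[OF K]) (auto simp: indicator_def)
  have e1: "(LINT q|lborel. indicator {q. q <= r} q *\<^sub>R K (r, q)) = cut s r (\<phi> r * \<Gamma> r)" for r
  proof (cases "r \<in> {0..s}")
    case True
    have "(LINT q|lborel. indicator {q. q <= r} q *\<^sub>R K (r, q)) = (LINT q|lborel. \<phi> r * (cut r q (\<gamma> q)))"
      using True by (intro Bochner_Integration.integral_cong refl) (auto simp: K_def a_def b_def indicator_def)
    also have "\<dots> = \<phi> r * \<Gamma> r" unfolding \<Gamma>_def by (rule integral_mult_right_zero)
    finally show ?thesis using True by simp
  qed (simp add: K_def a_def)
  have e2: "(LINT r|lborel. indicator {q. r < q} q *\<^sub>R K (r, q)) = cut s q (\<Phi> q * \<gamma> q)" for q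
  proof (cases "q \<in> {0..s}")
    case True
    have "(LINT r|lborel. indicator {q. r < q} q *\<^sub>R K (r, q)) = (LINT r|lborel. (cut q r (\<phi> r)) * \<gamma> q)"
    proof (rule integral_cong_AE)
      show "AE r in lborel. indicator {q. r < q} q *\<^sub>R K (r, q) = (cut q r (\<phi> r)) * \<gamma> q"
        using AE_lborel_singleton[of q] by eventually_elim (use True in "auto simp: K_def a_def b_def indicator_def")
    qed (unfold K_def split_conv, measurable)
    also have "\<dots> = \<Phi> q * \<gamma> q" unfolding \<Phi>_def by (rule integral_mult_left_zero)
    finally show ?thesis using True by simp
  qed (simp add: K_def b_def)
  have i1: "integrable lborel (%r. cut s r (\<phi> r * \<Gamma> r))"
    using lborel_pair.integrable_fst'[OF K1] by (simp add: e1)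
  have K2': "integrable (lborel \<Otimes>\<^sub>M lborel) (case_prod (%r q. indicator {q. r < q} q *\<^sub>R K (r, q)))" using K2 by simp
  have i2: "integrable lborel (%r. cut s r (\<Phi> r * \<gamma> r))"
    using lborel_pair.integrable_snd[OF K2'] by (simp add: e2)
  show "integrable lborel (%r. cut s r (\<phi> r * \<Gamma> r + \<Phi> r * \<gamma> r))"
    unfolding scaleR_add_right by (rule Bochner_Integration.integrable_add[OF i1 i2])
  have "(LINT r|lborel. cut s r (\<phi> r * \<Gamma> r + \<Phi> r * \<gamma> r))
     = (LINT r|lborel. cut s r (\<phi> r * \<Gamma> r)) + (LINT r|lborel. cut s r (\<Phi> r * \<gamma> r))"
    unfolding scaleR_add_right by (rule Bochner_Integration.integral_add[OF i1 i2])
  also have "(LINT r|lborel. cut s r (\<phi> r * \<Gamma> r)) = integral\<^sup>L (lborel \<Otimes>\<^sub>M lborel) (%(r, q). indicator {q. q <= r} q *\<^sub>R K (r, q))"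
    using lborel_pair.integral_fst'[OF K1] by (simp add: e1)
  also have "(LINT r|lborel. cut s r (\<Phi> r * \<gamma> r)) = integral\<^sup>L (lborel \<Otimes>\<^sub>M lborel) (%(r, q). indicator {q. r < q} q *\<^sub>R K (r, q))"
    using lborel_pair.integral_snd[OF K2'] by (simp add: e2)
  also have "integral\<^sup>L (lborel \<Otimes>\<^sub>M lborel) (%(r, q). indicator {q. q <= r} q *\<^sub>R K (r, q)) + \<dots> = integral\<^sup>L (lborel \<Otimes>\<^sub>M lborel) K"
    by (subst Bochner_Integration.integral_add[OF K1 K2, symmetric])
       (intro Bochner_Integration.integral_cong refl, auto simp: indicator_def)
  also have "\<dots> = (LINT r|lborel. LINT q|lborel. K (r, q))"
    by (rule lborel_pair.integral_fst'[OF K, symmetric])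
  also have "\<dots> = \<Phi> s * \<Gamma> s"
    unfolding K_def split_conv integral_mult_right_zero integral_mult_left_zero
    by (simp only: \<Phi>_def \<Gamma>_def a_def[abs_def] b_def[abs_def])
  finally show "(LINT r|lborel. cut s r (\<phi> r * \<Gamma> r + \<Phi> r * \<gamma> r)) = \<Phi> s * \<Gamma> s" .
qed

text \<open>Splitting off the constants \<open>F0\<close> and \<open>G0\<close> leaves two
  primitives that vanish at 0. As F and G are known on the line only almost everywhere, the end
  value is expressed through the primitives.\<close>

lemma product_of_absolutely_continuous:
  fixes \<phi> \<gamma> F G :: "real => complex"
  assumes m [measurable]: "\<phi> \<in> BM" "\<gamma> \<in> BM"
      "F \<in> BM" "G \<in> BM"
    and i: "integrable lborel (%r. cut s r (\<phi> r))" "integrable lborel (%r. cut s r (\<gamma> r))"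
    and F: "AE r in lborel. r \<in> {0..s} --> F r = F0 + (LINT q|lborel. cut r q (\<phi> q))"
    and G: "AE r in lborel. r \<in> {0..s} --> G r = G0 + (LINT q|lborel. cut r q (\<gamma> q))"
  shows "integrable lborel (%r. cut s r (\<phi> r * G r + F r * \<gamma> r))"
    and "(LINT r|lborel. cut s r (\<phi> r * G r + F r * \<gamma> r))
       = (F0 + (LINT q|lborel. cut s q (\<phi> q))) * (G0 + (LINT q|lborel. cut s q (\<gamma> q))) - F0 * G0"
proof -
  define \<Phi> \<Gamma> where "\<Phi> r = (LINT q|lborel. cut r q (\<phi> q))" and "\<Gamma> r = (LINT q|lborel. cut r q (\<gamma> q))" for r
  have [measurable]: "\<Phi> \<in> BM" "\<Gamma> \<in> BM"
    unfolding \<Phi>_def \<Gamma>_def by (measurable; simp)+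
  note P = product_of_primitives[OF m(1,2) i, folded \<Phi>_def \<Gamma>_def]
  let ?f = "%r. cut s r (\<phi> r * G r + F r * \<gamma> r)"
  let ?g = "%r. G0 * (cut s r (\<phi> r)) + F0 * (cut s r (\<gamma> r)) + cut s r (\<phi> r * \<Gamma> r + \<Phi> r * \<gamma> r)"
  have ae: "AE r in lborel. ?f r = ?g r"
    using F G by eventually_elim (auto simp: \<Phi>_def \<Gamma>_def indicator_def algebra_simps)
  have g1: "integrable lborel (%r. G0 * (cut s r (\<phi> r)))" and g2: "integrable lborel (%r. F0 * (cut s r (\<gamma> r)))"
    by (intro integrable_mult_right i)+
  have gi: "integrable lborel ?g"
    by (intro Bochner_Integration.integrable_add g1 g2 P(1))
  have fm: "?f \<in> borel_measurable lborel" by measurable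
  have gm: "?g \<in> borel_measurable lborel" by measurable
  show "integrable lborel ?f" unfolding integrable_cong_AE[OF fm gm ae] by (rule gi)
  have "(LINT r|lborel. ?f r) = (LINT r|lborel. ?g r)" by (rule integral_cong_AE[OF fm gm ae])
  also have "\<dots> = G0 * \<Phi> s + F0 * \<Gamma> s + \<Phi> s * \<Gamma> s"
    unfolding Bochner_Integration.integral_add[OF Bochner_Integration.integrable_add[OF g1 g2] P(1)]
      Bochner_Integration.integral_add[OF g1 g2] P(2) integral_mult_right_zero
    by (simp add: \<Phi>_def \<Gamma>_def)
  finally show "(LINT r|lborel. ?f r) = (F0 + (LINT q|lborel. cut s q (\<phi> q))) * (G0 + (LINT q|lborel. cut s q (\<gamma> q))) - F0 * G0"
    by (simp add: \<Phi>_def \<Gamma>_def algebra_simps)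
qed

lemma ACL_measurable: assumes "ACL j f g"
  shows "f \<in> BM" "g \<in> BM"
  using assms by (auto simp: ACL_def)

lemma AE_reals_all_of_AE:
  assumes "AE s in lborel. 0 <= s --> P s" "!!s s'. P s ==> s' <= s ==> P s'"
  shows "P (s::real)"
proof -
  obtain t where "max 0 s < t" "0 <= t --> P t"
    using AE_lborel_ex_in_interval[OF assms(1), of "max 0 s" "max 0 s + 1"] by auto
  then show ?thesis using assms(2)[of t s] by auto
qed

text \<open>On a good line the two factors agree with their primitives for almost every s, which is
  all that \<open>product_of_absolutely_continuous\<close> asks; the identity for the product is
  then read off at those s.\<close>

lemma ACL_mult:
  assumes f: "ACL j f f'" and g: "ACL j g g'"
  shows "ACL j (%x. f x * g x) (%x. f' x * g x + f x * g' x)"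
proof -
  note [measurable] = ACL_measurable[OF f] ACL_measurable[OF g]
  have "AE x in lborel. AE s in lborel. 0 <= s -->
        integrable lborel (%r. cut s r (f' (sh j r x) * g (sh j r x) + f (sh j r x) * g' (sh j r x))) &
        f (sh j s x) * g (sh j s x) = f x * g x +
         (LINT r|lborel. cut s r (f' (sh j r x) * g (sh j r x) + f (sh j r x) * g' (sh j r x)))"
    using f[unfolded ACL_def, THEN conjunct2, THEN conjunct2] g[unfolded ACL_def, THEN conjunct2, THEN conjunct2]
  proof eventually_elim
    case (elim x)
    have fi: "integrable lborel (%r. cut s r (f' (sh j r x)))" for s
      by (rule AE_reals_all_of_AE[of "%s. integrable lborel (%r. cut s r (f' (sh j r x)))"])
         (use elim(1) in "auto elim: eventually_mono intro: indicator_integrable_subset")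
    have gi: "integrable lborel (%r. cut s r (g' (sh j r x)))" for s
      by (rule AE_reals_all_of_AE[of "%s. integrable lborel (%r. cut s r (g' (sh j r x)))"])
         (use elim(2) in "auto elim: eventually_mono intro: indicator_integrable_subset")
    have F: "AE r in lborel. r \<in> {0..s} --> f (sh j r x) = f x + (LINT q|lborel. cut r q (f' (sh j q x)))" for s
      using elim(1) by eventually_elim auto
    have G: "AE r in lborel. r \<in> {0..s} --> g (sh j r x) = g x + (LINT q|lborel. cut r q (g' (sh j q x)))" for s
      using elim(2) by eventually_elim auto
    note P = product_of_absolutely_continuous[OF _ _ _ _ fi gi F G]
    show ?case
      using elim(1,2)
    proof eventually_elim
      case (elim s)
      show ?case
      proof (intro impI conjI)
        assume "0 <= s"
        show "integrable lborel (%r. cut s r (f' (sh j r x) * g (sh j r x) + f (sh j r x) * g' (sh j r x)))"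
          by (rule P(1)) measurable
        have "(LINT r|lborel. cut s r (f' (sh j r x) * g (sh j r x) + f (sh j r x) * g' (sh j r x)))
          = (f x + (LINT q|lborel. cut s q (f' (sh j q x)))) * (g x + (LINT q|lborel. cut s q (g' (sh j q x)))) - f x * g x"
          by (rule P(2)) measurable
        then show "f (sh j s x) * g (sh j s x) = f x * g x +
         (LINT r|lborel. cut s r (f' (sh j r x) * g (sh j r x) + f (sh j r x) * g' (sh j r x)))"
          using elim \<open>0 <= s\<close> by simp
      qed
    qed
  qed
  then show ?thesis unfolding ACL_def by simp
qed

lemma ACL_add:
  assumes f: "ACL j f f'" and g: "ACL j g g'"
  shows "ACL j (%x. f x + g x) (%x. f' x + g' x)"
proof -
  note [measurable] = ACL_measurable[OF f] ACL_measurable[OF g]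
  have "AE x in lborel. AE s in lborel. 0 <= s -->
        integrable lborel (%r. cut s r (f' (sh j r x) + g' (sh j r x))) &
        f (sh j s x) + g (sh j s x) = f x + g x +
         (LINT r|lborel. cut s r (f' (sh j r x) + g' (sh j r x)))"
    using f[unfolded ACL_def, THEN conjunct2, THEN conjunct2] g[unfolded ACL_def, THEN conjunct2, THEN conjunct2]
  proof eventually_elim
    case (elim x)
    then show ?case
      by eventually_elim (auto simp: scaleR_add_right)
  qed
  then show ?thesis unfolding ACL_def by simp
qed

lemma ACL_cnj: assumes f: "ACL j f f'" shows "ACL j (%x. cnj (f x)) (%x. cnj (f' x))"
proof -
  note [measurable] = ACL_measurable[OF f]
  have e: "(%r. cut s r (cnj (f' (sh j r x)))) = (%r. cnj (cut s r (f' (sh j r x))))" for s x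
    by (simp add: complex_cnj_scaleR)
  have "AE x in lborel. AE s in lborel. 0 <= s -->
        integrable lborel (%r. cut s r (cnj (f' (sh j r x)))) &
        cnj (f (sh j s x)) = cnj (f x) +
         (LINT r|lborel. cut s r (cnj (f' (sh j r x))))"
    using f[unfolded ACL_def, THEN conjunct2, THEN conjunct2]
  proof eventually_elim
    case (elim x)
    then show ?case
      unfolding e by eventually_elim (simp add: Bochner_Integration.integral_cnj del: complex_cnj_scaleR)
  qed
  then show ?thesis unfolding ACL_def by simp
qed

lemma ACL_classical:
  assumes d: "!!x h. ((%h. f (sh j h x)) has_vector_derivative g (sh j h x)) (at h)"
    and f: "f \<in> BM" and g: "continuous_on UNIV g"
  shows "ACL j f g"
proof -
  have c: "continuous_on {0..s} (%r. g (sh j r x))" for s x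
    by (rule continuous_on_compose2[OF g]) (auto intro!: continuous_intros)
  have hb: "has_bochner_integral lborel (%r. cut s r (g (sh j r x))) (f (sh j s x) - f (sh j 0 x))"
    if "0 <= s" for x s
    by (rule has_bochner_integral_FTC_Icc[OF that _ c]) (rule has_vector_derivative_at_within[OF d])
  show ?thesis
    unfolding ACL_def using f borel_measurable_continuous_onI[OF g] hb
    by (auto intro!: AE_I2 simp: has_bochner_integral_iff)
qed

lemma ACL_const: "ACL j (%x. c) (%x. 0)"
  by (rule ACL_classical) auto

lemma ACL_cmult: "ACL j f f' ==> ACL j (%x. c * f x) (%x. c * f' x)"
  using ACL_mult[OF ACL_const, of j f f' c] by simp

lemma ACL_coord: "ACL j (%x. of_real (x $ i)) (%x. if i = j then 1 else 0)"
proof (rule ACL_classical)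
  fix x :: "real^'a" and h
  have "((%h. (sh j h x) $ i) has_real_derivative (if i = j then 1 else 0)) (at h)"
    by (auto intro!: derivative_eq_intros simp: axis_def)
  from bounded_linear.has_vector_derivative[OF bounded_linear_of_real this[unfolded has_real_derivative_iff_has_vector_derivative]]
  show "((%h. complex_of_real ((sh j h x) $ i)) has_vector_derivative (if i = j then 1 else 0)) (at h)"
    by (simp split: if_splits)
qed auto

section \<open>Translations and the Fourier characterisation of derivatives\<close>

definition tr :: "'n => real => 'n::finite L2 => 'n L2" where
  "tr j s u = abs_L2 (%x. rp u (sh j s x))"

lemma sqi_translate: assumes "sqi f" shows "sqi (%x. f (x + y))"
proof -
  have [measurable]: "f \<in> BM" using assms by (rule sqi_measurable)
  show ?thesis
    using assms lborel_integrable_affine_iff[of "%x. (cmod (f x))^2" 1 y]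
    by (simp add: sqi_def add.commute)
qed

lemma norm_translate: assumes "sqi f" shows "norm (abs_L2 (%x. f (x + y))) = norm (abs_L2 f)"
proof -
  have [measurable]: "f \<in> BM" using assms by (rule sqi_measurable)
  have "(norm (abs_L2 (%x. f (x + y))))^2 = (norm (abs_L2 f))^2"
    unfolding norm_abs_sqr[OF assms] norm_abs_sqr[OF sqi_translate[OF assms]]
    by (subst lborel_integral_affine[where c=1 and t=y]) (simp_all add: add.commute)
  then show ?thesis by simp
qed

lemma rp_tr: "AE x in lborel. rp (tr j s u) x = rp u (sh j s x)"
  unfolding tr_def by (intro rp_abs sqi_translate sqi_rp)

lemma isM_FT_tr: "isM (%\<xi>. exp (\<i> * of_real (s * \<xi> $ j))) (FT u) (FT (tr j s u))"
proof -
  let ?e = "%\<xi>::real^'a. exp (\<i> * of_real (s * \<xi> $ j))"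
  have em: "?e \<in> BM" by measurable
  have e: "isM ?e w (mu ?e w)" for w by (rule isM_mu[OF em, of 1]) simp
  have "FT (tr j s u) = mu ?e (FT u)"
  proof (rule Cc_eqI)
    fix g :: "real^'a => complex" assume g: "Cc g"
    have eg: "Cc (%\<xi>. ?e \<xi> * g \<xi>)" by (rule Cc_mult[OF g]) (intro continuous_intros)
    note [measurable] = Cc_measurable[OF g] fourier_measurable[OF Cc_L1f[OF g]]
    have fg: "fourier (%\<xi>. ?e \<xi> * g \<xi>) x = fourier g (x - s *\<^sub>R axis j 1)" for x
    proof -
      have "exp (- \<i> * of_real (\<xi> \<bullet> x)) * (?e \<xi> * z) = exp (- \<i> * of_real (\<xi> \<bullet> (x - s *\<^sub>R axis j 1))) * z" for \<xi> z
        unfolding mult.assoc[symmetric] exp_add[symmetric] by (simp add: inner_diff_right inner_axis right_diff_distrib)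
      then show ?thesis by (simp only: fourier_eq[OF Cc_measurable[OF eg]] fourier_eq[OF Cc_measurable[OF g]])
    qed
    have "pr (FT (tr j s u)) (abs_L2 g) = (LINT x|lborel. rp u (sh j s x) * fourier g x)"
      unfolding fourier_L2_pr_Cc[OF g] by (rule pr_cong_AE) (auto intro: rp_tr rp_abs plancherel_Cc g)
    also have "\<dots> = (LINT x|lborel. rp u x * fourier g (x - s *\<^sub>R axis j 1))"
      by (subst (2) lborel_integral_affine[where c=1 and t="s *\<^sub>R axis j 1"]) (simp_all add: add.commute)
    also have "\<dots> = pr (FT u) (abs_L2 (%\<xi>. ?e \<xi> * g \<xi>))"
      unfolding fourier_L2_pr_Cc[OF eg] fg[symmetric]
      by (rule pr_cong_AE[symmetric, OF _ rp_abs[OF plancherel_Cc(1)[OF eg]] rp_measurable fourier_measurable[OF Cc_L1f[OF eg]]]) simp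
    also have "\<dots> = pr (mu ?e (FT u)) (abs_L2 g)"
    proof (rule isM_pr[OF e _ em])
      show "isM ?e (abs_L2 g) (abs_L2 (%\<xi>. ?e \<xi> * g \<xi>))"
        unfolding isM_def using rp_abs[OF Cc_sqi[OF g]] rp_abs[OF Cc_sqi[OF eg]] by eventually_elim simp
    qed
    finally show "pr (FT (tr j s u)) (abs_L2 g) = pr (mu ?e (FT u)) (abs_L2 g)" .
  qed
  then show ?thesis using e by simp
qed

section \<open>Integrals along segments and their Fourier symbols\<close>

definition line_int :: "'n => real => (real^'n::finite => complex) => real^'n => complex" where
  "line_int j s f x = (LINT r|lborel. cut s r (f (sh j r x)))"

lemma line_int_measurable [measurable]:
  assumes [measurable]: "f \<in> BM" shows "line_int j s f \<in> BM"
  unfolding line_int_def by measurable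

lemma indicator_Icc_integrable: "integrable lborel (indicator {a..b::real} :: real => real)"
  by (simp add: integrable_indicator_iff emeasure_lborel_Icc_eq)

text \<open>Hoelder's inequality and translation invariance bound the integral over x uniformly in
  r, and r runs over a bounded interval.\<close>

lemma line_product_integrable:
  fixes f g :: "real^'n::finite => complex"
  assumes f: "sqi f" and g: "sqi g"
  shows "integrable (lborel \<Otimes>\<^sub>M lborel) (%(r::real, x). cut s r (f (sh j r x) * g x))"
proof (rule lborel_pair.Fubini_integrable)
  note [measurable] = sqi_measurable[OF f] sqi_measurable[OF g]
  show "(%(r::real, x). cut s r (f (sh j r x) * g x)) \<in> borel_measurable (lborel \<Otimes>\<^sub>M lborel)"
    by measurable
  have i: "integrable lborel (%x. f (sh j r x) * g x)" for r
    by (intro sqi_mult_integrable sqi_translate f g)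
  then show "AE r in lborel. integrable lborel (%x. (%(r::real, x). cut s r (f (sh j r x) * g x)) (r, x))"
    by (auto intro!: AE_I2 integrable_scaleR_right)
  have b: "(LINT x|lborel. cmod (f (sh j r x) * g x)) <= norm (abs_L2 f) * norm (abs_L2 g)" for r
    using L2_holder[OF sqi_translate[OF f] g, of "r *\<^sub>R axis j 1"] by (simp add: norm_mult norm_translate[OF f])
  have "integrable lborel (%r::real. norm (abs_L2 f) * norm (abs_L2 g) * indicator {0..s} r)"
    by (intro integrable_mult_right indicator_Icc_integrable)
  then show "integrable lborel (%r. LINT x|lborel. norm ((%(r::real, x). cut s r (f (sh j r x) * g x)) (r, x)))"
  proof (rule Bochner_Integration.integrable_bound)
    show "AE r in lborel. norm (LINT x|lborel. norm ((%(r::real, x). cut s r (f (sh j r x) * g x)) (r, x)))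
       <= norm (norm (abs_L2 f) * norm (abs_L2 g) * indicator {0..s} r)"
      using b by (auto intro!: AE_I2 simp: indicator_def integral_nonneg_AE)
  qed measurable
qed

text \<open>Fubini needs a function integrable on the product space; the factor \<open>w\<close>,
  positive and constant along the integration in r, provides it and is divided out
  afterwards.\<close>

lemma line_integrable:
  fixes f :: "real^'n::finite => complex"
  assumes f: "sqi f"
  shows "AE x in lborel. integrable lborel (%r. cut s r (f (sh j r x)))"
proof -
  obtain w :: "real^'n => complex" where w: "sqi w" "!!x. 0 < cmod (w x)" using sqi_positive by blast
  have i: "integrable (lborel \<Otimes>\<^sub>M lborel) (case_prod (%r x. cut s r (f (sh j r x) * w x)))"
    using line_product_integrable[OF f w(1)] by simp
  from lborel_pair.AE_integrable_snd[OF this] show ?thesis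
  proof eventually_elim
    case (elim x)
    have "integrable lborel (%r. (cut s r (f (sh j r x) * w x)) * inverse (w x))"
      using elim by (rule integrable_mult_left)
    moreover have "w x ~= 0" using w(2)[of x] by auto
    ultimately show ?case by (simp add: mult.assoc)
  qed
qed

lemma line_int_pairing:
  fixes f g :: "real^'n::finite => complex"
  assumes f: "sqi f" and g: "sqi g"
  shows "(LINT x|lborel. line_int j s f x * g x) = (LINT r|lborel. cut s r (LINT x|lborel. f (sh j r x) * g x))"
proof -
  have i: "integrable (lborel \<Otimes>\<^sub>M lborel) (case_prod (%r x. cut s r (f (sh j r x) * g x)))"
    using line_product_integrable[OF f g] by simp
  have "(LINT x|lborel. line_int j s f x * g x) = (LINT x|lborel. LINT r|lborel. cut s r (f (sh j r x) * g x))"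
    unfolding line_int_def by (subst integral_mult_left_zero[symmetric]) simp
  also have "\<dots> = (LINT r|lborel. LINT x|lborel. cut s r (f (sh j r x) * g x))"
    by (rule lborel_pair.Fubini_integral[OF i])
  finally show ?thesis by simp
qed

text \<open>Cauchy-Schwarz on the segment, then Tonelli and translation invariance. Where the
  segment integral diverges, its value is 0 by convention and the pointwise bound is
  trivial.\<close>

lemma sqi_line_int:
  fixes f :: "real^'n::finite => complex"
  assumes f: "sqi f" shows "sqi (line_int j s f)"
proof -
  note [measurable] = sqi_measurable[OF f]
  have le: "ennreal ((cmod (line_int j s f x))^2) <= ennreal s * (\<integral>\<^sup>+r. indicator {0..s} r * ennreal ((cmod (f (sh j r x)))^2) \<partial>lborel)" for x
  proof (cases "integrable lborel (%r. cut s r (f (sh j r x)))")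
    case True
    have "ennreal (cmod (line_int j s f x)) <= (\<integral>\<^sup>+r. ennreal (norm (cut s r (f (sh j r x)))) \<partial>lborel)"
      unfolding line_int_def by (rule integral_norm_bound_ennreal[OF True])
    also have "\<dots> = (\<integral>\<^sup>+r. indicator {0..s} r * (indicator {0..s} r * ennreal (cmod (f (sh j r x)))) \<partial>lborel)"
      by (intro nn_integral_cong) (auto simp: indicator_def)
    finally have "ennreal ((cmod (line_int j s f x))^2) <= (\<integral>\<^sup>+r. indicator {0..s} r * (indicator {0..s} r * ennreal (cmod (f (sh j r x)))) \<partial>lborel)^2"
      by (subst ennreal_power[symmetric]) (auto intro: power_mono)
    also have "\<dots> <= (\<integral>\<^sup>+r. (indicator {0..s} r)^2 \<partial>lborel) * (\<integral>\<^sup>+r. (indicator {0..s} r * ennreal (cmod (f (sh j r x))))^2 \<partial>lborel)"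
      by (rule Cauchy_Schwarz_nn_integral) measurable
    also have "(\<integral>\<^sup>+r. (indicator {0..s} r :: ennreal)^2 \<partial>lborel) = ennreal s"
    proof -
      have "(\<integral>\<^sup>+r. (indicator {0..s} r :: ennreal)^2 \<partial>lborel) = (\<integral>\<^sup>+r. indicator {0..s} r \<partial>lborel)"
        by (intro nn_integral_cong) (auto simp: indicator_def)
      also have "\<dots> = emeasure lborel {0..s}" by simp
      also have "\<dots> = ennreal s" by (cases "0 <= s") (auto simp: ennreal_neg)
      finally show ?thesis .
    qed
    also have "(\<integral>\<^sup>+r. (indicator {0..s} r * ennreal (cmod (f (sh j r x))))^2 \<partial>lborel)
        = (\<integral>\<^sup>+r. indicator {0..s} r * ennreal ((cmod (f (sh j r x)))^2) \<partial>lborel)"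
      by (intro nn_integral_cong) (auto simp: indicator_def ennreal_power)
    finally show ?thesis .
  qed (simp add: line_int_def not_integrable_integral_eq)
  have "(\<integral>\<^sup>+x. ennreal ((cmod (line_int j s f x))^2) \<partial>lborel)
     <= (\<integral>\<^sup>+x. ennreal s * (\<integral>\<^sup>+r. indicator {0..s} r * ennreal ((cmod (f (sh j r x)))^2) \<partial>lborel) \<partial>lborel)"
    by (intro nn_integral_mono le)
  also have "\<dots> = ennreal s * (\<integral>\<^sup>+x. \<integral>\<^sup>+r. indicator {0..s} r * ennreal ((cmod (f (sh j r x)))^2) \<partial>lborel \<partial>lborel)"
    by (rule nn_integral_cmult) measurable
  also have "(\<integral>\<^sup>+x. \<integral>\<^sup>+r. indicator {0..s} r * ennreal ((cmod (f (sh j r x)))^2) \<partial>lborel \<partial>lborel)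
     = (\<integral>\<^sup>+r. \<integral>\<^sup>+x. indicator {0..s} r * ennreal ((cmod (f (sh j r x)))^2) \<partial>lborel \<partial>lborel)"
    by (rule lborel_pair.Fubini') measurable
  also have "\<dots> = (\<integral>\<^sup>+r. indicator {0..s} r * ennreal ((norm (abs_L2 f))^2) \<partial>lborel)"
  proof (intro nn_integral_cong)
    fix r :: real
    have "(\<integral>\<^sup>+x. indicator {0..s} r * ennreal ((cmod (f (sh j r x)))^2) \<partial>lborel) = indicator {0..s} r * (\<integral>\<^sup>+x. ennreal ((cmod (f (sh j r x)))^2) \<partial>lborel)"
      by (rule nn_integral_cmult) measurable
    also have "(\<integral>\<^sup>+x. ennreal ((cmod (f (sh j r x)))^2) \<partial>lborel) = ennreal ((norm (abs_L2 f))^2)"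
      unfolding norm_translate[OF f, of "r *\<^sub>R axis j 1", symmetric] norm_abs_sqr[OF sqi_translate[OF f]]
      by (rule nn_integral_eq_integral) (auto intro!: sqi_integrable sqi_translate f)
    finally show "(\<integral>\<^sup>+x. indicator {0..s} r * ennreal ((cmod (f (sh j r x)))^2) \<partial>lborel) = indicator {0..s} r * ennreal ((norm (abs_L2 f))^2)" .
  qed
  also have "\<dots> = emeasure lborel {0..s} * ennreal ((norm (abs_L2 f))^2)"
    by (subst nn_integral_multc) auto
  finally have "(\<integral>\<^sup>+x. ennreal ((cmod (line_int j s f x))^2) \<partial>lborel) < \<infinity>"
    by (rule le_less_trans) (cases "0 <= s", auto simp: ennreal_mult_less_top)
  then show ?thesis unfolding sqi_def by (auto intro!: integrableI_bounded)
qed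

text \<open>Away from \<xi>_j = 0 this is (exp (i s \<xi>_j) - 1) / (i \<xi>_j). The integral form
  is defined everywhere and shows the bound s.\<close>

definition lsym :: "'n => real => real^'n::finite => complex" where
  "lsym j s \<xi> = (LINT r|lborel. cut s r (exp (\<i> * of_real (r * \<xi> $ j))))"

lemma lsym_measurable [measurable]: "lsym j s \<in> BM"
  unfolding lsym_def by measurable

lemma exp_line_integrable: "integrable lborel (%r. indicator {0..s::real} r *\<^sub>R exp (\<i> * of_real (r * a)))"
  by (rule Bochner_Integration.integrable_bound[OF indicator_Icc_integrable[of 0 s]]) (auto simp: indicator_def)

lemma lsym_bound: assumes "0 <= s" shows "cmod (lsym j s \<xi>) <= s"
proof -
  have "cmod (lsym j s \<xi>) <= (LINT r|lborel. indicator {0..s} r)"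
    unfolding lsym_def
    by (rule Bochner_Integration.integral_norm_bound_integral[OF exp_line_integrable indicator_Icc_integrable])
       (auto simp: indicator_def)
  then show ?thesis using assms by simp
qed

lemma lsym_eq: assumes "0 <= s" shows "\<i> * of_real (\<xi> $ j) * lsym j s \<xi> = exp (\<i> * of_real (s * \<xi> $ j)) - 1"
proof -
  have "(LINT r|lborel. cut s r (\<i> * of_real (\<xi> $ j) * exp (\<i> * of_real (r * \<xi> $ j)))) = exp (\<i> * of_real (s * \<xi> $ j)) - exp (\<i> * of_real (0 * \<xi> $ j))"
    by (rule integral_FTC_Icc[OF assms has_vector_derivative_at_within[OF exp_i_vector_derivative]])
       (intro continuous_intros)
  moreover have "\<i> * of_real (\<xi> $ j) * lsym j s \<xi> = (LINT r|lborel. cut s r (\<i> * of_real (\<xi> $ j) * exp (\<i> * of_real (r * \<xi> $ j))))"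
    unfolding lsym_def mult_scaleR_right[symmetric] by (rule integral_mult_right_zero[symmetric])
  ultimately show ?thesis by simp
qed

text \<open>A zero with \<xi>_j nonzero would need s \<xi>_j to be a nonzero multiple of 2
  pi.\<close>

lemma lsym_nonzero: assumes "0 < s" "s * \<bar>\<xi> $ j\<bar> < 1" shows "lsym j s \<xi> ~= 0"
proof (cases "\<xi> $ j = 0")
  case True
  then have "lsym j s \<xi> = of_real s" using assms by (simp add: lsym_def scaleR_conv_of_real)
  then show ?thesis using assms by simp
next
  case False
  have "exp (\<i> * of_real (s * \<xi> $ j)) ~= 1"
  proof
    assume "exp (\<i> * of_real (s * \<xi> $ j)) = 1"
    then obtain k :: int where k: "s * \<xi> $ j = of_int (2 * k) * pi"
      by (auto simp: exp_eq_1)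
    have "\<bar>s * \<xi> $ j\<bar> < 1" using assms by (simp add: abs_mult)
    then have "\<bar>real_of_int (2 * k)\<bar> * pi < 1" unfolding k by (simp add: abs_mult)
    moreover have "pi > 1" using pi_gt3 by simp
    ultimately have "\<bar>real_of_int (2 * k)\<bar> < 1"
      using mult_left_mono[of 1 pi "\<bar>real_of_int (2 * k)\<bar>"] by simp
    then have "k = 0" by linarith
    then show False using k False assms by simp
  qed
  then show ?thesis using lsym_eq[of s \<xi> j] assms by auto
qed

text \<open>A segment integral is an integral of translates, and translation by r is the multiplier
  exp (i r \<xi>_j); Fubini integrates the multipliers. The identity is checked by pairing with all
  w.\<close>

lemma isM_FT_line_int:
  assumes "0 <= s"
  shows "isM (lsym j s) (FT v) (FT (abs_L2 (line_int j s (rp v))))"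
proof -
  have lm: "isM (lsym j s) w (mu (lsym j s) w)" for w
    by (rule isM_mu[where C=s]) (auto simp: lsym_bound assms)
  have "FT (abs_L2 (line_int j s (rp v))) = mu (lsym j s) (FT v)"
  proof (rule pr_eqI)
    fix w :: "'a L2"
    have t: "(LINT x|lborel. rp v (sh j r x) * rp (FT w) x) = (LINT \<xi>|lborel. exp (\<i> * of_real (r * \<xi> $ j)) * (rp (FT v) \<xi> * rp w \<xi>))" for r
    proof -
      have "(LINT x|lborel. rp v (sh j r x) * rp (FT w) x) = pr (tr j r v) (FT w)"
        by (rule pr_cong_AE[symmetric]) (auto intro: rp_tr)
      also have "\<dots> = pr (FT (tr j r v)) w" by (simp add: pr_FT)
      also have "\<dots> = (LINT \<xi>|lborel. (exp (\<i> * of_real (r * \<xi> $ j)) * rp (FT v) \<xi>) * rp w \<xi>)"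
        by (rule pr_cong_AE) (use isM_FT_tr[of r j v] in "auto simp: isM_def")
      finally show ?thesis by (simp add: mult.assoc)
    qed
    have i0: "integrable lborel (%\<xi>. rp (FT v) \<xi> * rp w \<xi>)" by (intro sqi_mult_integrable sqi_rp)
    have "integrable (lborel \<Otimes>\<^sub>M lborel) (%(r::real, \<xi>). cut s r (rp (FT v) \<xi> * rp w \<xi>))"
      using i0 by (intro lborel_pair.Fubini_integrable) (auto simp: indicator_Icc_integrable)
    then have i: "integrable (lborel \<Otimes>\<^sub>M lborel) (case_prod (%r \<xi>. cut s r (exp (\<i> * of_real (r * \<xi> $ j)) * (rp (FT v) \<xi> * rp w \<xi>))))"
      by (rule Bochner_Integration.integrable_bound) (auto simp: norm_mult)
    have "pr (FT (abs_L2 (line_int j s (rp v)))) w = (LINT x|lborel. line_int j s (rp v) x * rp (FT w) x)"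
      unfolding pr_FT by (rule pr_cong_AE) (auto intro!: rp_abs sqi_line_int sqi_rp)
    also have "\<dots> = (LINT r|lborel. LINT \<xi>|lborel. cut s r (exp (\<i> * of_real (r * \<xi> $ j)) * (rp (FT v) \<xi> * rp w \<xi>)))"
      unfolding line_int_pairing[OF sqi_rp sqi_rp] t by simp
    also have "\<dots> = (LINT \<xi>|lborel. LINT r|lborel. cut s r (exp (\<i> * of_real (r * \<xi> $ j)) * (rp (FT v) \<xi> * rp w \<xi>)))"
      by (rule lborel_pair.Fubini_integral[OF i, symmetric])
    also have "\<dots> = (LINT \<xi>|lborel. (lsym j s \<xi> * rp (FT v) \<xi>) * rp w \<xi>)"
      unfolding lsym_def by (intro Bochner_Integration.integral_cong refl) (simp add: mult.assoc flip: integral_mult_left_zero)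
    also have "\<dots> = pr (mu (lsym j s) (FT v)) w"
      by (rule pr_cong_AE[symmetric]) (use lm[of "FT v"] in "auto simp: isM_def")
    finally show "pr (FT (abs_L2 (line_int j s (rp v)))) w = pr (mu (lsym j s) (FT v)) w" .
  qed
  then show ?thesis using lm by simp
qed

text \<open>As a Fourier multiplier the derivative commutes with the group for free, is closed, and
  iterates to the symbols of weak derivatives.\<close>

definition D :: "'n => 'n::finite L2 => 'n L2 => bool" where
  "D j u v \<longleftrightarrow> isM (%\<xi>. \<i> * of_real (\<xi> $ j)) (FT u) (FT v)"

lemma line_identity_measurable:
  fixes f g :: "real^'n::finite => complex"
  assumes [measurable]: "f \<in> BM" "g \<in> BM"
  shows "{p \<in> space (lborel \<Otimes>\<^sub>M lborel). 0 <= snd p -->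
        integrable lborel (%r. indicator {0..snd p} r *\<^sub>R g (fst p + r *\<^sub>R axis j 1)) &
        f (fst p + snd p *\<^sub>R axis j 1) = f (fst p) + (LINT r|lborel. indicator {0..snd p} r *\<^sub>R g (fst p + r *\<^sub>R axis j 1))} \<in> sets (lborel \<Otimes>\<^sub>M lborel)"
proof -
  have [measurable]: "(%(p :: (real^'n) \<times> real, r). indicator {0..snd p} r *\<^sub>R g (fst p + r *\<^sub>R axis j 1)) \<in> borel_measurable ((lborel \<Otimes>\<^sub>M lborel) \<Otimes>\<^sub>M lborel)"
    unfolding indicator_def atLeastAtMost_iff by measurable
  have [measurable]: "Measurable.pred (lborel \<Otimes>\<^sub>M lborel) (%p :: (real^'n) \<times> real. integrable lborel (%r. indicator {0..snd p} r *\<^sub>R g (fst p + r *\<^sub>R axis j 1)))"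
    by measurable
  have [measurable]: "(%p :: (real^'n) \<times> real. LINT r|lborel. indicator {0..snd p} r *\<^sub>R g (fst p + r *\<^sub>R axis j 1)) \<in> borel_measurable (lborel \<Otimes>\<^sub>M lborel)"
    by measurable
  show ?thesis by measurable
qed

text \<open>Fourier methods compare a function with one fixed translate, for almost every x;
  \<open>ACL\<close> speaks of almost every line. Fubini exchanges the two, provided the exceptional
  set is measurable in the product.\<close>

lemma line_identity_AE_commute:
  fixes f g :: "real^'n::finite => complex"
  assumes "f \<in> BM" "g \<in> BM"
  shows "(AE x in lborel. AE s in lborel. 0 <= s -->
        integrable lborel (%r. cut s r (g (sh j r x))) &
        f (sh j s x) = f x + (LINT r|lborel. cut s r (g (sh j r x)))) \<longleftrightarrow>
     (AE s in lborel. AE x in lborel. 0 <= s -->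
        integrable lborel (%r. cut s r (g (sh j r x))) &
        f (sh j s x) = f x + (LINT r|lborel. cut s r (g (sh j r x))))"
  by (rule lborel_pair.AE_commute[OF line_identity_measurable[OF assms]])

text \<open>By \<open>lsym_eq\<close> the multiplier of translation minus identity is
  \<open>lsym\<close> times i \<xi>_j, so the increment of u over a segment is the segment integral
  of its derivative.\<close>

lemma D_imp_ACL: assumes "D j u v" shows "ACL j (rp u) (rp v)"
proof -
  have "AE x in lborel. 0 <= s -->
        integrable lborel (%r. cut s r (rp v (sh j r x))) &
        rp u (sh j s x) = rp u x + (LINT r|lborel. cut s r (rp v (sh j r x)))" for s
  proof (cases "0 <= s")
    case True
    have "isM (%\<xi>. lsym j s \<xi> * (\<i> * of_real (\<xi> $ j))) (FT u) (FT (abs_L2 (line_int j s (rp v))))"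
      using isM_isM[OF assms[unfolded D_def] isM_FT_line_int[OF True]] .
    then have 1: "isM (%\<xi>. exp (\<i> * of_real (s * \<xi> $ j)) - 1) (FT u) (FT (abs_L2 (line_int j s (rp v))))"
      by (rule isM_cong) (metis lsym_eq[OF True] mult.commute)
    have 2: "isM (%\<xi>. exp (\<i> * of_real (s * \<xi> $ j)) - 1) (FT u) (FT (tr j s u - u))"
      using isM_add_left[OF isM_FT_tr[of s j u] isM_cmult_left[OF isM_one, of "-1" "FT u"]]
        FT_cmult[of "-1" u] FT_add[of "tr j s u" "cmult_L2 (-1) u"]
      by (simp add: FT_diff scaleR_L2_def[of "-1", symmetric, simplified])
    have E: "abs_L2 (line_int j s (rp v)) = tr j s u - u"
      using isM_unique[OF 1 2] FT_eq_iff by blast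
    show ?thesis
      using rp_abs[OF sqi_line_int[OF sqi_rp[of v]], of j s] rp_diff[of "tr j s u" u] rp_tr[of j s u] line_integrable[OF sqi_rp[of v], of s j]
      unfolding E by eventually_elim (auto simp: line_int_def diff_eq_eq add.commute)
  qed simp
  then have "AE s in lborel. AE x in lborel. 0 <= s -->
        integrable lborel (%r. cut s r (rp v (sh j r x))) &
        rp u (sh j s x) = rp u x + (LINT r|lborel. cut s r (rp v (sh j r x)))"
    by (rule AE_I2)
  then show ?thesis
    unfolding ACL_def line_identity_AE_commute[OF rp_measurable rp_measurable] by simp
qed

text \<open>The increment identity at a good s says that \<open>lsym j s\<close> annihilates the
  defect between the two transforms. A sequence of good s tending to 0 makes \<open>lsym\<close>
  nonzero at every frequency eventually.\<close>

lemma ACL_imp_D: assumes "ACL j f g" "sqi f" "sqi g" shows "D j (abs_L2 f) (abs_L2 g)"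
proof -
  let ?u = "abs_L2 f" and ?v = "abs_L2 g"
  note [measurable] = sqi_measurable[OF assms(2)] sqi_measurable[OF assms(3)]
  have ae: "AE s in lborel. AE x in lborel. 0 <= s -->
        integrable lborel (%r. cut s r (g (sh j r x))) &
        f (sh j s x) = f x + (LINT r|lborel. cut s r (g (sh j r x)))"
    using assms(1) unfolding ACL_def
      line_identity_AE_commute[OF sqi_measurable[OF assms(2)] sqi_measurable[OF assms(3)]] by simp
  define Q where "Q s \<longleftrightarrow> (AE x in lborel. 0 <= s -->
        integrable lborel (%r. cut s r (g (sh j r x))) &
        f (sh j s x) = f x + (LINT r|lborel. cut s r (g (sh j r x))))" for s
  have "\<forall>p. \<exists>s. 0 < s & s < 1 / real (Suc p) & Q s"
    by (intro allI AE_lborel_ex_in_interval ae[folded Q_def]) simp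
  then obtain s where s: "!!p. 0 < s p" "!!p. s p < 1 / real (Suc p)" "!!p. Q (s p)"
    by metis
  \<comment> \<open>Changing the representative on a null set could alter the integrals on
    particular lines; the resulting classes agree nevertheless, as pairing with an arbitrary w
    shows.\<close>
  have li: "abs_L2 (line_int j t (rp ?v)) = abs_L2 (line_int j t g)" if "0 <= t" for t
  proof (rule pr_eqI)
    fix w
    have "(LINT x|lborel. rp ?v (sh j r x) * rp w x) = (LINT x|lborel. g (sh j r x) * rp w x)" for r
    proof -
      have "tr j r ?v = abs_L2 (%x. g (sh j r x))"
      proof -
        have "norm (tr j r ?v - abs_L2 (%x. g (sh j r x))) = norm (abs_L2 (%x. rp ?v x - g x))"
          unfolding tr_def
          using norm_translate[OF sqi_diff[OF sqi_rp[of ?v] assms(3)], of "r *\<^sub>R axis j 1"]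
          by (simp add: abs_diff sqi_translate sqi_rp assms)
        also have "\<dots> = 0" by (simp add: abs_diff[symmetric] sqi_rp assms abs_rp)
        finally show ?thesis by simp
      qed
      then have "AE x in lborel. rp ?v (sh j r x) = g (sh j r x)"
        unfolding tr_def by (intro abs_eqD sqi_translate sqi_rp assms)
      then show ?thesis by (intro integral_cong_AE) auto
    qed
    then have "(LINT x|lborel. line_int j t (rp ?v) x * rp w x) = (LINT x|lborel. line_int j t g x * rp w x)"
      by (simp add: line_int_pairing sqi_rp assms)
    moreover have "pr (abs_L2 (line_int j t h)) w = (LINT x|lborel. line_int j t h x * rp w x)" if "sqi h" for h
      using sqi_measurable[OF that] by (intro pr_cong_AE rp_abs sqi_line_int that) auto
    ultimately show "pr (abs_L2 (line_int j t (rp ?v))) w = pr (abs_L2 (line_int j t g)) w"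
      by (simp add: sqi_rp assms)
  qed
  have key: "AE \<xi> in lborel. lsym j (s p) \<xi> * (rp (FT ?v) \<xi> - \<i> * of_real (\<xi> $ j) * rp (FT ?u) \<xi>) = 0" for p
  proof -
    have sp: "0 <= s p" using s(1)[of p] by simp
    have trf: "AE x in lborel. rp (tr j (s p) ?u) x = f (x + s p *\<^sub>R axis j 1)"
    proof -
      have "norm (tr j (s p) ?u - abs_L2 (%x. f (x + s p *\<^sub>R axis j 1))) = norm (abs_L2 (%x. rp ?u x - f x))"
        unfolding tr_def
        using norm_translate[OF sqi_diff[OF sqi_rp[of ?u] assms(2)], of "s p *\<^sub>R axis j 1"]
        by (simp add: abs_diff sqi_translate sqi_rp assms)
      also have "\<dots> = 0" by (simp add: abs_diff[symmetric] sqi_rp assms abs_rp)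
      finally have "tr j (s p) ?u = abs_L2 (%x. f (x + s p *\<^sub>R axis j 1))" by simp
      then show ?thesis by (simp add: rp_abs sqi_translate assms)
    qed
    have "tr j (s p) ?u - ?u = abs_L2 (line_int j (s p) (rp ?v))"
      unfolding li[OF sp]
    proof (rule L2_eqI)
      show "AE x in lborel. rp (tr j (s p) ?u - ?u) x = rp (abs_L2 (line_int j (s p) g)) x"
        using rp_diff[of "tr j (s p) ?u" ?u] trf rp_abs[OF assms(2)] rp_abs[OF sqi_line_int[OF assms(3)], of j "s p"] s(3)[of p, unfolded Q_def]
        by eventually_elim (use sp in "auto simp: line_int_def")
    qed
    then have "FT (abs_L2 (line_int j (s p) (rp ?v))) = FT (tr j (s p) ?u) - FT ?u" by (metis FT_diff)
    then have "AE \<xi> in lborel. rp (FT (abs_L2 (line_int j (s p) (rp ?v)))) \<xi> = rp (FT (tr j (s p) ?u)) \<xi> - rp (FT ?u) \<xi>"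
      by (simp add: rp_diff)
    then show ?thesis
      using isM_FT_line_int[OF sp, of j ?v, unfolded isM_def] isM_FT_tr[of "s p" j ?u, unfolded isM_def]
    proof eventually_elim
      case (elim \<xi>)
      have "lsym j (s p) \<xi> * rp (FT ?v) \<xi> = (exp (\<i> * of_real (s p * \<xi> $ j)) - 1) * rp (FT ?u) \<xi>"
        using elim by (simp add: left_diff_distrib)
      also have "\<dots> = lsym j (s p) \<xi> * (\<i> * of_real (\<xi> $ j) * rp (FT ?u) \<xi>)"
        unfolding lsym_eq[OF sp, symmetric] by (simp add: mult_ac)
      finally show ?case by (simp add: right_diff_distrib)
    qed
  qed
  then have "AE \<xi> in lborel. \<forall>p. lsym j (s p) \<xi> * (rp (FT ?v) \<xi> - \<i> * of_real (\<xi> $ j) * rp (FT ?u) \<xi>) = 0"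
    unfolding AE_all_countable by blast
  then have "AE \<xi> in lborel. rp (FT ?v) \<xi> = \<i> * of_real (\<xi> $ j) * rp (FT ?u) \<xi>"
  proof eventually_elim
    case (elim \<xi>)
    obtain p where "\<bar>\<xi> $ j\<bar> < real p" using reals_Archimedean2 by blast
    then have p: "\<bar>\<xi> $ j\<bar> < real (Suc p)" by simp
    have "s p * \<bar>\<xi> $ j\<bar> <= (1 / real (Suc p)) * \<bar>\<xi> $ j\<bar>" using s(2)[of p] by (intro mult_right_mono) auto
    also have "\<dots> < 1" using p by (simp add: field_simps)
    finally have "lsym j (s p) \<xi> ~= 0" using s(1) by (intro lsym_nonzero)
    with elim show ?case by auto
  qed
  then show ?thesis unfolding D_def isM_def .
qed

section \<open>Weights, derivatives and the Schroedinger group\<close>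

lemma D_unique: "D j u v ==> D j u w ==> v = w"
  unfolding D_def using isM_unique FT_eq_iff by blast

lemma D_add: "D j u v ==> D j u' v' ==> D j (u + u') (v + v')"
  unfolding D_def FT_add by (rule isM_add)

lemma D_diff: "D j u v ==> D j u' v' ==> D j (u - u') (v - v')"
  unfolding D_def FT_diff by (rule isM_diff)

lemma D_cmult: "D j u v ==> D j (cmult_L2 c u) (cmult_L2 c v)"
  unfolding D_def FT_cmult by (rule isM_cmult)

lemma D_zero: "D j 0 0"
  unfolding D_def using isM_zero by (metis norm_FT norm_eq_zero)

lemma isM_commute:
  assumes "isM a u v" "isM b u w" "isM b v z" shows "isM a w z"
  using assms unfolding isM_def by eventually_elim simp

lemma D_S: "D j u v ==> D j (S t u) (S t v)"
  unfolding D_def by (rule isM_commute[OF _ isM_S isM_S])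

lemma cmult_minus: "cmult_L2 (- c) u = - cmult_L2 c u"
  by (rule L2_eqI) (use rp_cmult[of "- c" u] rp_cmult[of c u] rp_uminus[of "cmult_L2 c u"]
    in "eventually_elim, simp")

section \<open>Reflection, and derivatives of a transform\<close>

definition refl :: "'n::finite L2 => 'n L2" where
  "refl u = abs_L2 (%x. rp u (- x))"

lemma sqi_reflect: assumes "sqi f" shows "sqi (%x. f (- x))"
proof -
  have [measurable]: "f \<in> BM" using assms by (rule sqi_measurable)
  show ?thesis
    using assms lborel_integrable_affine_iff[of "%x. (cmod (f x))^2" "-1" 0] by (simp add: sqi_def)
qed

lemma rp_refl: "AE x in lborel. rp (refl u) x = rp u (- x)"
  unfolding refl_def by (intro rp_abs sqi_reflect sqi_rp)

lemma pr_refl: "pr (refl u) v = pr u (refl v)"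
proof -
  have "pr (refl u) v = (LINT x|lborel. rp u (- x) * rp v x)"
    by (rule pr_cong_AE) (auto simp: rp_refl)
  also have "\<dots> = (LINT x|lborel. rp u x * rp v (- x))"
    by (subst lborel_integral_affine[where c="-1" and t=0]) simp_all
  also have "\<dots> = pr u (refl v)"
    by (rule pr_cong_AE[symmetric]) (auto simp: rp_refl)
  finally show ?thesis .
qed

lemma AE_reflect:
  assumes "AE x in (lborel :: 'a::euclidean_space measure). P x" shows "AE x in lborel. P (- x)"
proof -
  obtain N where N: "{x. \<not> P x} \<subseteq> N" "N \<in> sets borel" "emeasure lborel N = 0"
    using assms by (auto elim!: AE_E)
  have e: "lborel = distr lborel borel (%x::'a. - x)"
    using lborel_affine[of "-1" "0::'a"] by (simp add: density_1)
  have "emeasure lborel (uminus -` N) = emeasure (distr lborel borel (%x::'a. - x)) N"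
    using N(2) by (subst emeasure_distr) auto
  then have "emeasure lborel (uminus -` N) = 0" using N(3) e by simp
  moreover have "uminus -` N \<in> sets borel" using measurable_sets[of "uminus" borel borel N] N(2) by simp
  ultimately show ?thesis using N(1) by (intro AE_I[of _ _ "uminus -` N"]) auto
qed

lemma FT_eq_refl_iFT: "FT w = refl (iFT w)"
proof (rule Cc_eqI)
  fix g :: "real^'a => complex" assume g: "Cc g"
  have g': "Cc (%x. g (- x))"
  proof -
    obtain R where R: "\<forall>x. R < norm x --> g x = 0" using g by (auto simp: Cc_def)
    have "continuous_on UNIV (%x. g (- x))"
      by (rule continuous_on_compose2[of UNIV g]) (use g in "auto simp: Cc_def intro!: continuous_intros")
    moreover have "\<forall>x. R < norm x --> g (- x) = 0" using R by simp
    ultimately show ?thesis unfolding Cc_def by blast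
  qed
  have i: "pr (iFT u) v = pr u (iFT v)" for u v :: "'a L2"
    by (metis iFT_FT FT_iFT pr_FT)
  have "refl (abs_L2 g) = abs_L2 (%x. g (- x))"
    unfolding refl_def by (intro abs_eqI sqi_reflect sqi_rp Cc_sqi g AE_reflect[OF rp_abs])
  moreover have "fourier (%x. g (- x)) (- \<xi>) = fourier g \<xi>" for \<xi>
  proof -
    note [measurable] = Cc_measurable[OF g]
    show ?thesis
      by (simp add: fourier_eq, subst (2) lborel_integral_affine[where c="-1" and t=0]) simp_all
  qed
  ultimately show "pr (FT w) (abs_L2 g) = pr (refl (iFT w)) (abs_L2 g)"
    unfolding pr_refl i fourier_L2_pr_Cc[OF g] by (simp add: iFT_abs Cc_sqi Cc_L1f g')
qed

lemma FT_FT: "FT (FT u) = refl u"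
  by (simp add: FT_eq_refl_iFT[of "FT u"])

lemma isM_refl: "isM a (refl u) (refl v) \<longleftrightarrow> isM (%x. a (- x)) u v"
proof
  assume "isM a (refl u) (refl v)"
  then have "AE x in lborel. rp (refl v) (- x) = a (- x) * rp (refl u) (- x)"
    unfolding isM_def by (rule AE_reflect)
  then show "isM (%x. a (- x)) u v"
    unfolding isM_def using AE_reflect[OF rp_refl[of u]] AE_reflect[OF rp_refl[of v]]
    by eventually_elim simp
next
  assume "isM (%x. a (- x)) u v"
  then have "AE x in lborel. rp v (- x) = a x * rp u (- x)"
    unfolding isM_def using AE_reflect[of "%x. rp v x = a (- x) * rp u x"] by simp
  then show "isM a (refl u) (refl v)"
    unfolding isM_def using rp_refl[of u] rp_refl[of v] by eventually_elim simp
qed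

text \<open>Since \<open>FT\<close> applied twice is reflection, multiplication by a coordinate
  becomes a derivative of the transform. The criterion \<open>ACL_imp_D\<close> can thus be used in
  frequency space, where the group is an explicit smooth factor.\<close>

lemma D_FT_iff: "D j (FT u) (FT v) \<longleftrightarrow> isM (%x. - \<i> * of_real (x $ j)) u v"
  unfolding D_def FT_FT isM_refl by simp

abbreviation xM :: "'n => 'n::finite L2 => 'n L2 => bool" where
  "xM j \<equiv> isM (%x. of_real (x $ j))"

lemma sqi_cong_AE:
  assumes "sqi g" "f \<in> BM" "AE x in lborel. f x = g x" shows "sqi f"
  by (rule sqi_bound[OF assms(1,2)]) (use assms(3) in "eventually_elim, simp")

lemma abs_eq_AE:
  assumes "f \<in> BM" "AE x in lborel. f x = rp u x" shows "sqi f & abs_L2 f = u"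
proof
  show "sqi f" by (rule sqi_cong_AE[OF sqi_rp assms])
  from abs_eqI[OF this sqi_rp assms(2)] show "abs_L2 f = u" by (simp only: abs_rp)
qed

lemma phase_partial:
  "((%h. phase t (sh j h x)) has_vector_derivative
     - 2 * \<i> * of_real (t * (sh j h x) $ j) * phase t (sh j h x)) (at h)"
proof -
  have n: "(norm (sh j h x))^2 = (norm x)^2 + 2 * h * x $ j + h^2" for h
    unfolding power2_norm_eq_inner
    by (simp add: inner_add_left inner_add_right inner_axis inner_axis' power2_eq_square algebra_simps)
  have "((%h. - t * (norm (sh j h x))^2) has_real_derivative - 2 * t * (sh j h x) $ j) (at h)"
    unfolding n by (auto intro!: derivative_eq_intros simp: algebra_simps)
  then have "((%h. - t * (norm (sh j h x))^2) has_vector_derivative - 2 * t * (sh j h x) $ j) (at h)"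
    by (simp add: has_real_derivative_iff_has_vector_derivative)
  from vector_diff_chain_at[OF this exp_i_vector_derivative[of 1]]
  show ?thesis by (simp add: phase_def comp_def scaleR_conv_of_real mult_ac)
qed

text \<open>The Galilean identity \<open>x\<^sub>j e\<^sup>i\<^sup>t\<^sup>\<Delta> = e\<^sup>i\<^sup>t\<^sup>\<Delta> (x\<^sub>j - 2 i t \<partial>\<^sub>j)\<close>, obtained by differentiating
  the multiplier on the Fourier side.\<close>

lemma xM_S:
  assumes a: "xM j v a" and b: "D j v b"
  shows "xM j (S t v) (S t (a - cmult_L2 (2 * \<i> * of_real t) b))"
proof -
  have "D j (FT v) (FT (cmult_L2 (- \<i>) a))"
    unfolding D_FT_iff by (rule isM_cong[OF isM_cmult_left[OF a]]) simp
  then have 1: "ACL j (rp (FT v)) (rp (FT (cmult_L2 (- \<i>) a)))" by (rule D_imp_ACL)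
  have 2: "ACL j (phase t) (%\<xi>. - 2 * \<i> * of_real (t * \<xi> $ j) * phase t \<xi>)"
    by (rule ACL_classical[OF phase_partial]) (auto simp: phase_def[abs_def] intro!: continuous_intros)
  \<comment> \<open>This is -i times the class sought in the conclusion, because
    \<open>D_FT_iff\<close> identifies the derivative with multiplication by -i x_j.\<close>
  define c where "c = cmult_L2 (- 2 * of_real t) b + cmult_L2 (- \<i>) a"
  let ?f = "%\<xi>. phase t \<xi> * rp (FT v) \<xi>"
  let ?g = "%\<xi>. - 2 * \<i> * of_real (t * \<xi> $ j) * phase t \<xi> * rp (FT v) \<xi> + phase t \<xi> * rp (FT (cmult_L2 (- \<i>) a)) \<xi>"
  have f: "sqi ?f & abs_L2 ?f = FT (S t v)"
    using isM_S[of t v] by (intro abs_eq_AE) (auto simp: isM_def elim: eventually_mono)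
  have g: "sqi ?g & abs_L2 ?g = FT (S t c)"
  proof (rule abs_eq_AE)
    show "AE \<xi> in lborel. ?g \<xi> = rp (FT (S t c)) \<xi>"
      using isM_S[of t c, unfolded isM_def] b[unfolded D_def isM_def]
        rp_add[of "cmult_L2 (- 2 * of_real t) (FT b)" "FT (cmult_L2 (- \<i>) a)"] rp_cmult[of "- 2 * of_real t" "FT b"]
      unfolding c_def FT_add FT_cmult[of _ b]
      by eventually_elim (simp add: algebra_simps)
  qed measurable
  have "D j (FT (S t v)) (FT (S t c))"
    using ACL_imp_D[OF ACL_mult[OF 2 1]] f g by simp
  then have "isM (%x. - \<i> * of_real (x $ j)) (S t v) (S t c)" unfolding D_FT_iff .
  then have "isM (%x. of_real (x $ j)) (S t v) (cmult_L2 \<i> (S t c))"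
    by (rule isM_cong[OF isM_cmult_left]) simp
  moreover have "cmult_L2 \<i> (S t c) = S t (a - cmult_L2 (2 * \<i> * of_real t) b)"
    unfolding S_cmult[symmetric] c_def cmult_add cmult_cmult
    by (simp add: cmult_minus cmult_1 mult_ac)
  ultimately show ?thesis by simp
qed

text \<open>The commutator of the derivative i with the coordinate j is 1 for i = j and 0 otherwise;
  it comes from the product rule on lines.\<close>

lemma D_xM:
  assumes d: "D i v d" and a: "xM j v a" and e: "xM j d e"
  shows "D i a (e + (if i = j then v else 0))"
proof -
  have A: "ACL i (%x. of_real (x $ j) * rp v x) (%x. (if j = i then 1 else 0) * rp v x + of_real (x $ j) * rp d x)"
    by (rule ACL_mult[OF ACL_coord D_imp_ACL[OF d]])
  have f: "sqi (%x. of_real (x $ j) * rp v x) & abs_L2 (%x. of_real (x $ j) * rp v x) = a"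
    using a by (intro abs_eq_AE) (auto simp: isM_def elim: eventually_mono)
  have "sqi (%x. (if j = i then 1 else 0) * rp v x + of_real (x $ j) * rp d x) &
     abs_L2 (%x. (if j = i then 1 else 0) * rp v x + of_real (x $ j) * rp d x) = e + (if i = j then v else 0)"
  proof (rule abs_eq_AE)
    show "AE x in lborel. (if j = i then 1 else 0) * rp v x + of_real (x $ j) * rp d x = rp (e + (if i = j then v else 0)) x"
      using e[unfolded isM_def] rp_add[of e "if i = j then v else 0"] rp_zero[where 'a='a]
      by eventually_elim auto
  qed measurable
  with f show ?thesis using ACL_imp_D[OF A] by simp
qed

section \<open>Weighted Sobolev norms\<close>

lemma japanese_measurable [measurable]: "japanese \<in> BM"
  unfolding japanese_def by measurable

lemma japanese_ge_1: "1 <= japanese x"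
  by (simp add: japanese_def)

lemma japanese_pos: "0 < japanese x" using japanese_ge_1[of x] by linarith

lemma abs_japanese [simp]: "\<bar>japanese x\<bar> = japanese x"
  using japanese_pos[of x] by simp

lemma cmod_japanese [simp]: "cmod (complex_of_real (japanese x)) = japanese x"
  using japanese_pos[of x] by simp

lemma abs_coord_le_japanese: "\<bar>x $ j\<bar> <= japanese x"
proof -
  have "\<bar>x $ j\<bar> <= norm x" by (rule component_le_norm_cart)
  also have "\<dots> = sqrt ((norm x)^2)" by simp
  also have "\<dots> <= japanese x" unfolding japanese_def by (rule real_sqrt_le_mono) simp
  finally show ?thesis .
qed

lemma japanese_le_sum: "japanese x <= 1 + (\<Sum>j\<in>UNIV. \<bar>x $ j\<bar>)"
proof -
  have "japanese x <= 1 + norm x"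
    unfolding japanese_def by (rule real_le_lsqrt) (auto simp: power2_eq_square algebra_simps)
  also have "norm x <= (\<Sum>j\<in>UNIV. \<bar>x $ j\<bar>)" by (rule norm_le_l1_cart)
  finally show ?thesis by simp
qed

abbreviation wM :: "nat => 'n::finite L2 => 'n L2 => bool" where
  "wM p \<equiv> isM (%x. of_real (japanese x ^ p))"

text \<open>A bound predicate: it says at once that v lies in the weighted space and that its norm
  there is at most K.\<close>

definition wn :: "nat => real => 'n::finite L2 => bool" where
  "wn p K v \<longleftrightarrow> (\<exists>a. wM p v a & norm a <= K)"

lemma wnI: "wM p v a ==> norm a <= K ==> wn p K v"
  unfolding wn_def by blast

lemma wnE: assumes "wn p K v" obtains a where "wM p v a" "norm a <= K"
  using assms unfolding wn_def by blast

lemma wn_nonneg: assumes "wn p K v" shows "0 <= K"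
proof -
  obtain a where "wM p v a" "norm a <= K" using assms by (rule wnE)
  then show ?thesis using norm_ge_zero[of a] by linarith
qed

lemma wn_mono: assumes "wn p K v" "K <= K'" shows "wn p K' v"
proof -
  obtain a where "wM p v a" "norm a <= K" using assms(1) by (rule wnE)
  then show ?thesis using assms(2) by (intro wnI) auto
qed

lemma wn_0: "wn 0 K v \<longleftrightarrow> norm v <= K"
  unfolding wn_def using isM_one[of v] isM_unique[of "%x. 1" v] by auto

lemma wn_add: assumes "wn p K u" "wn p L v" shows "wn p (K + L) (u + v)"
proof -
  obtain a b where "wM p u a" "norm a <= K" "wM p v b" "norm b <= L" using assms by (auto elim!: wnE)
  then show ?thesis using norm_triangle_ineq[of a b] by (intro wnI[OF isM_add]) auto
qed

lemma wn_cmult: assumes "wn p K u" shows "wn p (cmod c * K) (cmult_L2 c u)"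
proof -
  obtain a where "wM p u a" "norm a <= K" using assms by (rule wnE)
  then show ?thesis by (intro wnI[OF isM_cmult]) (auto intro: mult_left_mono)
qed

lemma wn_le:
  assumes "wn p K v" "q <= p" shows "wn q K v"
proof -
  obtain a where a: "wM p v a" "norm a <= K" using assms by (auto simp: wn_def)
  have "\<exists>w. wM q v w & norm w <= 1 * norm a"
    by (rule isM_ex_bound[OF a(1)])
       (auto intro!: power_increasing simp: norm_power assms(2) japanese_ge_1)
  then show ?thesis using a(2) by (auto intro: wnI)
qed

lemma wn_xM:
  assumes "wn (Suc p) K v" shows "\<exists>a. xM j v a & wn p K a"
proof -
  obtain b where b: "wM (Suc p) v b" "norm b <= K" using assms by (auto simp: wn_def)
  have "\<bar>x $ j\<bar> <= japanese x * japanese x ^ p" for x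
  proof -
    have "\<bar>x $ j\<bar> <= japanese x ^ 1" using abs_coord_le_japanese[of x j] by simp
    also have "\<dots> <= japanese x ^ Suc p" by (intro power_increasing) (auto simp: japanese_ge_1)
    finally show ?thesis by (simp add: abs_mult)
  qed
  then have "\<exists>a. xM j v a & norm a <= 1 * norm b"
    by (intro isM_ex_bound[OF b(1)]) (auto simp: norm_power norm_mult abs_mult)
  then obtain a where a: "xM j v a" by blast
  have "japanese x ^ p * \<bar>x $ j\<bar> <= japanese x ^ Suc p" for x
    using abs_coord_le_japanese[of x j] japanese_pos[of x] by (simp add: mult.commute mult_left_mono)
  then have "\<exists>w. isM (%x. of_real (japanese x ^ p * x $ j)) v w & norm w <= 1 * norm b"
    using japanese_pos by (intro isM_ex_bound[OF b(1)]) (auto simp: norm_mult norm_power)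
  then obtain w where w: "isM (%x. of_real (japanese x ^ p * x $ j)) v w" "norm w <= norm b" by auto
  have "wM p a w" using w(1) a unfolding isM_def by eventually_elim simp
  then have "wn p K a" using order_trans[OF w(2) b(2)] by (rule wnI)
  then show ?thesis using a by blast
qed

lemma L2_dominated_sum:
  assumes "finite I" and f: "f \<in> BM"
    and b: "AE x in lborel. cmod (f x) <= (\<Sum>i\<in>I. cmod (rp (g i) x))"
  shows "sqi f & norm (abs_L2 f) <= (\<Sum>i\<in>I. norm (g i))"
proof -
  have s: "sqi (%x. \<Sum>i\<in>I. complex_of_real (cmod (rp (g i) x))) &
       norm (abs_L2 (%x. \<Sum>i\<in>I. complex_of_real (cmod (rp (g i) x)))) <= (\<Sum>i\<in>I. norm (g i))"
    using assms(1)
  proof (induction I)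
    case empty
    then show ?case by (simp add: sqi_zero abs_zero)
  next
    case (insert i I)
    have n: "norm (abs_L2 (%x. complex_of_real (cmod (rp (g i) x)))) = norm (g i)"
      by (rule norm_eq_of_AE) (use rp_abs[OF sqi_norm[OF sqi_rp[of "g i"]]] in "eventually_elim, simp")
    show ?case
      using insert norm_triangle_ineq[of "abs_L2 (%x. complex_of_real (cmod (rp (g i) x)))" "abs_L2 (%x. \<Sum>i\<in>I. complex_of_real (cmod (rp (g i) x)))"]
      by (auto simp: sqi_add sqi_norm sqi_rp abs_add n)
  qed
  have b': "AE x in lborel. cmod (f x) <= cmod (\<Sum>i\<in>I. complex_of_real (cmod (rp (g i) x)))"
    using b by eventually_elim (simp add: sum_nonneg del: of_real_sum flip: of_real_sum)
  have "sqi f" by (rule sqi_bound[OF conjunct1[OF s] f b'])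
  moreover have "norm (abs_L2 f) <= 1 * norm (abs_L2 (%x. \<Sum>i\<in>I. complex_of_real (cmod (rp (g i) x))))"
    by (rule norm_le_of_AE)
       (use rp_abs[OF \<open>sqi f\<close>] rp_abs[OF conjunct1[OF s]] b' in \<open>eventually_elim, simp\<close>, simp)
  ultimately show ?thesis using s by auto
qed

text \<open>By \<open>japanese_le_sum\<close> one more power of the weight is controlled by v and
  the products x_j v at the old power, which is what makes induction on the weight possible.\<close>

lemma wn_Suc_from_coords:
  fixes v :: "'n::finite L2"
  assumes v: "wn p K v" and a: "!!j. xM j v (a j)" "!!j. wn p L (a j)"
  shows "wn (Suc p) (K + real CARD('n) * L) v"
proof -
  obtain b where b: "wM p v b" "norm b <= K" using v by (auto simp: wn_def)
  have "\<exists>c. \<forall>j. wM p (a j) (c j) & norm (c j) <= L" using a(2) by (intro choice) (auto simp: wn_def)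
  then obtain c where c: "!!j. wM p (a j) (c j)" "!!j. norm (c j) <= L" by blast
  \<comment> \<open>The index \<open>None\<close> stands for v itself and \<open>Some j\<close> for
    x_j v, so that one finite sum dominates the weighted function.\<close>
  define g where "g i = (case i of None => b | Some j => c j)" for i
  let ?f = "%x. of_real (japanese x ^ Suc p) * rp v x"
  have "AE x in lborel. \<forall>j. rp (c j) x = of_real (japanese x ^ p) * (of_real (x $ j) * rp v x)"
  proof (rule eventually_all_finite)
    show "AE x in lborel. rp (c j) x = of_real (japanese x ^ p) * (of_real (x $ j) * rp v x)" for j
      using c(1)[of j, unfolded isM_def] a(1)[of j, unfolded isM_def] by eventually_elim simp
  qed
  then have "AE x in lborel. cmod (?f x) <= (\<Sum>i\<in>UNIV. cmod (rp (g i) x))"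
    using b(1)[unfolded isM_def]
  proof eventually_elim
    case (elim x)
    have "(\<Sum>i\<in>UNIV. cmod (rp (g i) x)) = cmod (rp b x) + (\<Sum>j\<in>UNIV. cmod (rp (c j) x))"
      by (simp add: UNIV_option_conv sum.reindex g_def)
    also have "(\<Sum>j\<in>UNIV. cmod (rp (c j) x)) = (\<Sum>j\<in>UNIV. \<bar>x $ j\<bar>) * (japanese x ^ p * cmod (rp v x))"
      unfolding sum_distrib_right using elim(1) by (simp add: norm_mult norm_power mult_ac)
    also have "cmod (rp b x) + \<dots> = (1 + (\<Sum>j\<in>UNIV. \<bar>x $ j\<bar>)) * (japanese x ^ p * cmod (rp v x))"
      using elim(2) by (simp add: norm_mult norm_power distrib_right)
    also have "\<dots> >= japanese x * (japanese x ^ p * cmod (rp v x))"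
      using japanese_pos[of x] by (intro mult_right_mono japanese_le_sum) auto
    finally show ?case using japanese_pos[of x] by (simp add: norm_mult norm_power abs_of_pos mult.assoc)
  qed
  then have s: "sqi ?f & norm (abs_L2 ?f) <= (\<Sum>i\<in>UNIV. norm (g i))"
    by (intro L2_dominated_sum) auto
  have "(\<Sum>i\<in>UNIV. norm (g i)) = norm b + (\<Sum>j\<in>UNIV. norm (c j))"
    by (simp add: UNIV_option_conv sum.reindex g_def)
  also have "\<dots> <= K + (\<Sum>j\<in>(UNIV::'n set). L)" using b(2) c(2) by (intro add_mono sum_mono) auto
  finally have "norm (abs_L2 ?f) <= K + real CARD('n) * L" using s by simp
  then show ?thesis unfolding wn_def using isM_abs[OF conjunct1[OF s]] by blast
qed

text \<open>\<open>WJ r p K v\<close>: for all \<open>i \<le> r\<close>, every derivative of \<open>v\<close> of order \<open>i\<close> has norm at most \<open>K\<close>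
  in the space \<open>L\<^sup>2\<close> with the weight \<open>\<langle>x\<rangle>\<^sup>p\<^sup>(\<^sup>i\<^sup>)\<close>.\<close>

primrec WJ :: "nat => (nat => nat) => real => 'n::finite L2 => bool" where
  "WJ 0 p K v \<longleftrightarrow> wn (p 0) K v"
| "WJ (Suc r) p K v \<longleftrightarrow> wn (p 0) K v & (\<forall>j. \<exists>d. D j v d & WJ r (%i. p (Suc i)) K d)"

lemma WJ_wn: "WJ r p K v ==> wn (p 0) K v" by (cases r) auto

lemma WJ_nonneg: "WJ r p K v ==> 0 <= K" using WJ_wn wn_nonneg by blast

lemma WJ_mono: "WJ r p K v ==> K <= K' ==> WJ r p K' v"
proof (induction r arbitrary: p v)
  case (Suc r)
  then show ?case by (auto intro: wn_mono) blast
qed (auto intro: wn_mono)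

lemma WJ_add: "WJ r p K u ==> WJ r p L v ==> WJ r p (K + L) (u + v)"
proof (induction r arbitrary: p u v)
  case (Suc r)
  then show ?case by (auto intro: wn_add) (blast intro: D_add)
qed (auto intro: wn_add)

lemma WJ_cmult: "WJ r p K u ==> WJ r p (cmod c * K) (cmult_L2 c u)"
proof (induction r arbitrary: p u)
  case (Suc r)
  then show ?case by (auto intro: wn_cmult) (blast intro: D_cmult)
qed (auto intro: wn_cmult)

lemma WJ_zero: "0 <= K ==> WJ r p K 0"
proof (induction r arbitrary: p)
  case (Suc r)
  then show ?case using isM_zero D_zero by (auto simp: wn_def intro!: exI[of _ 0])
qed (use isM_zero in "auto simp: wn_def intro!: exI[of _ 0]")

lemma WJ_le: "WJ r p K v ==> r' <= r ==> (!!i. i <= r' ==> q i <= p i) ==> WJ r' q K v"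
proof (induction r' arbitrary: r p q v)
  case 0
  then show ?case using wn_le[OF WJ_wn[OF 0(1)], of "q 0"] by simp
next
  case (Suc r')
  then obtain r0 where r: "r = Suc r0" by (cases r) auto
  have "wn (q 0) K v" using wn_le[OF WJ_wn[OF Suc(2)], of "q 0"] Suc(4)[of 0] by simp
  moreover have "\<exists>d. D j v d & WJ r' (%i. q (Suc i)) K d" for j
  proof -
    obtain d where "D j v d" "WJ r0 (%i. p (Suc i)) K d" using Suc(2) unfolding r by auto
    moreover from Suc(1)[OF this(2)] Suc(3,4) have "WJ r' (%i. q (Suc i)) K d" unfolding r by auto
    ultimately show ?thesis by blast
  qed
  ultimately show ?case by simp
qed

text \<open>Differentiating x_j v gives x_j times the derivative and possibly v itself; each order
  thus adds one K, which accounts for the factor \<open>Suc r'\<close>. The conditions on q say that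
  the weight given up for the coordinate is available in p.\<close>

lemma WJ_xM:
  assumes "WJ r p K v" "r' <= r" "!!i. i <= r' ==> Suc (q i) <= p i" "!!i. i < r' ==> q (Suc i) <= p i"
    "!!i. i < r' ==> q (Suc i) <= q i"
  shows "\<exists>a. xM j v a & WJ r' q (real (Suc r') * K) a"
  using assms
proof (induction r' arbitrary: r p q v)
  case 0
  have "wn (Suc (q 0)) K v" by (rule wn_le[OF WJ_wn[OF 0(1)]]) (use 0 in auto)
  from wn_xM[OF this] show ?case by simp
next
  case (Suc r')
  then obtain r0 where r: "r = Suc r0" by (cases r) auto
  have "wn (Suc (q 0)) K v" by (rule wn_le[OF WJ_wn[OF Suc(2)]]) (use Suc in auto)
  from wn_xM[OF this, of j] obtain a where a: "xM j v a" "wn (q 0) K a" by blast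
  have K: "0 <= K" using Suc(2) by (rule WJ_nonneg)
  have "\<exists>d. D i a d & WJ r' (%i. q (Suc i)) (real (Suc (Suc r')) * K) d" for i
  proof -
    obtain d where d: "D i v d" "WJ r0 (%i. p (Suc i)) K d" using Suc(2) unfolding r by auto
    have "\<exists>e. xM j d e & WJ r' (%i. q (Suc i)) (real (Suc r') * K) e"
      by (rule Suc(1)[OF d(2)]) (use Suc(3-) in "auto simp: r")
    then obtain e where e: "xM j d e" "WJ r' (%i. q (Suc i)) (real (Suc r') * K) e" by blast
    have "WJ r' (%i. q (Suc i)) K v"
      by (rule WJ_le[OF Suc(2)]) (use Suc(3) Suc(5) in "auto simp: less_Suc_eq_le")
    then have "WJ r' (%i. q (Suc i)) K (if i = j then v else 0)" using K by (simp add: WJ_zero)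
    from WJ_add[OF e(2) this] D_xM[OF d(1) a(1) e(1)] show ?thesis by (auto simp: algebra_simps)
  qed
  moreover have "wn (q 0) (real (Suc (Suc r')) * K) a"
    by (rule wn_mono[OF a(2)]) (use K in "simp add: mult_le_cancel_right1")
  ultimately show ?case using a(1) by auto
qed

text \<open>A weight that falls by at most one per derivative dominates the profile
  \<open>p 0 - i\<close>, the one for which a coordinate and a derivative cost the same.\<close>

lemma weight_slow:
  assumes "!!i. i < r ==> p i <= Suc (p (Suc i))" "i <= r" shows "p 0 - i <= p i"
  using assms(2)
proof (induction i)
  case (Suc i)
  then show ?case using assms(1)[of i] by auto
qed simp

text \<open>Induction on w with the Galilean identity: x_j S v is S applied to x_j v - 2 i t times
  the derivative, and both classes lie in the space for w because a unit of weight and a derivative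
  are interchangeable in the profile \<open>w - i\<close>.\<close>

lemma WJ_S_weight:
  "\<exists>C\<ge>0. \<forall>t K (v :: 'n::finite L2). \<bar>t\<bar> <= 1 --> WJ w (%i. w - i) K v --> wn w (C * K) (S t v)"
proof (induction w)
  case 0
  then show ?case by (intro exI[of _ 1]) (simp add: wn_0)
next
  case (Suc w)
  then obtain C where C: "C >= 0" "!!t K (v :: 'n L2). \<bar>t\<bar> <= 1 ==> WJ w (%i. w - i) K v ==> wn w (C * K) (S t v)" by blast
  \<comment> \<open>\<open>Suc w\<close> comes from \<open>WJ_xM\<close> for the coordinate, and 2
    bounds the modulus of 2 i t.\<close>
  define C' where "C' = C + real CARD('n) * (C * (real (Suc w) + 2))"
  have "wn (Suc w) (C' * K) (S t v)" if t: "\<bar>t\<bar> <= 1" and v: "WJ (Suc w) (%i. Suc w - i) K v" for t K and v :: "'n L2"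
  proof -
    have K: "0 <= K" using v by (rule WJ_nonneg)
    have 1: "WJ w (%i. w - i) K v" by (rule WJ_le[OF v]) auto
    have "\<exists>a. xM j (S t v) a & wn w (C * ((real (Suc w) + 2) * K)) a" for j
    proof -
      obtain a where a: "xM j v a" "WJ w (%i. w - i) (real (Suc w) * K) a"
      proof -
        have "\<exists>a. xM j v a & WJ w (%i. w - i) (real (Suc w) * K) a" by (rule WJ_xM[OF v]) auto
        then show ?thesis using that by blast
      qed
      obtain d where d: "D j v d" "WJ w (%i. w - i) K d" using v by auto
      have "WJ w (%i. w - i) (real (Suc w) * K + cmod (- (2 * \<i> * of_real t)) * K) (a + cmult_L2 (- (2 * \<i> * of_real t)) d)"
        by (intro WJ_add WJ_cmult a d)
      then have "WJ w (%i. w - i) ((real (Suc w) + 2) * K) (a + cmult_L2 (- (2 * \<i> * of_real t)) d)"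
        by (rule WJ_mono) (use t K in "auto simp: norm_mult algebra_simps intro!: mult_right_mono mult_left_le")
      then show ?thesis using C(2)[OF t] xM_S[OF a(1) d(1)] by (auto simp: cmult_minus)
    qed
    then obtain a where a: "!!j. xM j (S t v) (a j)" "!!j. wn w (C * ((real (Suc w) + 2) * K)) (a j)" by metis
    from wn_Suc_from_coords[OF C(2)[OF t 1] a] show ?thesis
      by (simp add: C'_def algebra_simps)
  qed
  moreover have "C' >= 0" using C(1) by (simp add: C'_def)
  ultimately show ?case by blast
qed

text \<open>The two conditions on p say that the weight falls slowly and that at every order enough
  derivatives remain to pay for the weight there. Each order is then an instance of
  \<open>WJ_S_weight\<close>.\<close>

lemma WJ_S:
  assumes p: "!!i. i < r ==> p i <= Suc (p (Suc i))" "!!i. i <= r ==> p i + i <= r"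
  shows "\<exists>C\<ge>0. \<forall>t K (v :: 'n::finite L2). \<bar>t\<bar> <= 1 --> WJ r p K v --> WJ r p (C * K) (S t v)"
  using p
proof (induction r arbitrary: p)
  case 0
  then show ?case by (intro exI[of _ 1]) (simp add: wn_0)
next
  case (Suc r)
  have "\<exists>C\<ge>0. \<forall>t K (v :: 'n L2). \<bar>t\<bar> <= 1 --> WJ r (%i. p (Suc i)) K v --> WJ r (%i. p (Suc i)) (C * K) (S t v)"
    by (rule Suc(1)) (use Suc(2,3) in fastforce)+
  then obtain C where C: "C >= 0" "!!t K (v :: 'n L2). \<bar>t\<bar> <= 1 ==> WJ r (%i. p (Suc i)) K v ==> WJ r (%i. p (Suc i)) (C * K) (S t v)"
    by blast
  obtain C' where C': "C' >= 0" "!!t K (v :: 'n L2). \<bar>t\<bar> <= 1 ==> WJ (p 0) (%i. p 0 - i) K v ==> wn (p 0) (C' * K) (S t v)"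
    using WJ_S_weight[of "p 0"] by blast
  have pd: "p 0 - i <= p i" if "i <= Suc r" for i
    by (rule weight_slow[where p=p, OF Suc(2) that])
  have "WJ (Suc r) p (max C C' * K) (S t v)" if t: "\<bar>t\<bar> <= 1" and v: "WJ (Suc r) p K v" for t K and v :: "'n L2"
  proof -
    have K: "0 <= K" using v by (rule WJ_nonneg)
    have "WJ (p 0) (%i. p 0 - i) K v"
      by (rule WJ_le[OF v]) (use Suc(3)[of 0] pd in auto)
    from wn_mono[OF C'(2)[OF t this]] K have "wn (p 0) (max C C' * K) (S t v)" by (simp add: mult_right_mono)
    moreover have "\<exists>d. D j (S t v) d & WJ r (%i. p (Suc i)) (max C C' * K) d" for j
    proof -
      obtain d where d: "D j v d" "WJ r (%i. p (Suc i)) K d" using v by auto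
      from WJ_mono[OF C(2)[OF t d(2)]] K D_S[OF d(1)] show ?thesis by (meson max.cobounded1 mult_right_mono)
    qed
    ultimately show ?thesis by simp
  qed
  then show ?case using C(1) by (intro exI[of _ "max C C'"]) auto
qed

lemma S_tendsto:
  fixes v :: "'n::finite L2"
  assumes "0 < e" shows "\<forall>\<^sub>F t in nhds 0. norm (S t v - v) <= e"
proof -
  have "((%t. S t v) \<longlongrightarrow> v) (at 0)"
    unfolding tendsto_at_iff_sequentially comp_def
  proof (intro allI impI)
    fix X :: "nat => real" assume X: "X \<longlonglongrightarrow> 0"
    have f: "sqi (%\<xi>. phase (X j) \<xi> * rp (FT v) \<xi>) & abs_L2 (%\<xi>. phase (X j) \<xi> * rp (FT v) \<xi>) = FT (S (X j) v)" for j
      using isM_S[of "X j" v] by (intro abs_eq_AE) (auto simp: isM_def elim: eventually_mono)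
    have "(%j. abs_L2 (%\<xi>. phase (X j) \<xi> * rp (FT v) \<xi>)) \<longlonglongrightarrow> abs_L2 (rp (FT v))"
    proof (rule L2_dominated_convergence(3)[where w="rp (FT v)"])
      have "(%j. phase (X j) \<xi> * rp (FT v) \<xi>) \<longlonglongrightarrow> phase 0 \<xi> * rp (FT v) \<xi>" for \<xi>
        unfolding phase_def by (intro tendsto_intros X)
      then show "AE \<xi> in lborel. (%j. phase (X j) \<xi> * rp (FT v) \<xi>) \<longlonglongrightarrow> rp (FT v) \<xi>" by (simp add: phase_def)
    qed (auto simp: norm_mult sqi_rp)
    then have "(%j. FT (S (X j) v)) \<longlonglongrightarrow> FT v" using f by (simp add: abs_rp)
    then have "(%j. norm (FT (S (X j) v) - FT v)) \<longlonglongrightarrow> 0" by (simp add: tendsto_norm_zero LIM_zero)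
    then show "(%j. S (X j) v) \<longlonglongrightarrow> v"
      unfolding FT_diff[symmetric] norm_FT by (simp add: tendsto_norm_zero_iff LIM_zero_iff)
  qed
  then have "\<forall>\<^sub>F t in at 0. dist (S t v) v < e" using assms by (simp add: tendsto_iff)
  then have "\<forall>\<^sub>F t in nhds 0. dist (S t v) v < e" using assms by (simp add: eventually_nhds_conv_at)
  then show ?thesis by (rule eventually_mono) (simp add: dist_norm)
qed

text \<open>The induction of \<open>WJ_S_weight\<close> once more: x_j (S v - v) consists of the
  same increment for x_j v and a term with the explicit factor 2 t, which is small by boundedness of
  the group.\<close>

lemma WJ_S_weight_continuous:
  fixes v :: "'n::finite L2"
  assumes "WJ w (%i. w - i) K v" "0 < e"
  shows "\<forall>\<^sub>F t in nhds 0. wn w e (S t v - v)"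
  using assms
proof (induction w arbitrary: v K e)
  case 0
  then show ?case using S_tendsto by (simp add: wn_0)
next
  case (Suc w)
  note v = Suc(2)
  obtain C where C: "C >= 0" "!!t K (v :: 'n L2). \<bar>t\<bar> <= 1 ==> WJ w (%i. w - i) K v ==> wn w (C * K) (S t v)"
    using WJ_S_weight[of w] by blast
  \<comment> \<open>Raising the weight costs e' for v and 2 e' for each of the N coordinates, and e'
    + 2 N e' is at most e.\<close>
  define e' where "e' = e / (2 * (1 + real CARD('n)))"
  have e': "e' > 0" using Suc(3) by (simp add: e'_def)
  have 1: "WJ w (%i. w - i) K v" by (rule WJ_le[OF v]) auto
  have "\<exists>a d. xM j v a & D j v d & WJ w (%i. w - i) (real (Suc w) * K) a & WJ w (%i. w - i) K d" for j
  proof -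
    have "\<exists>a. xM j v a & WJ w (%i. w - i) (real (Suc w) * K) a" by (rule WJ_xM[OF v]) auto
    moreover have "\<exists>d. D j v d & WJ w (%i. w - i) K d" using v by simp
    ultimately show ?thesis by blast
  qed
  then obtain a d where a: "!!j. xM j v (a j)" "!!j. WJ w (%i. w - i) (real (Suc w) * K) (a j)"
    and d: "!!j. D j v (d j)" "!!j. WJ w (%i. w - i) K (d j)" by metis
  have K: "0 <= K" using v by (rule WJ_nonneg)
  have t0: "\<forall>\<^sub>F t::real in nhds 0. 2 * \<bar>t\<bar> * (C * K) < e' & \<bar>t\<bar> < 1"
  proof (rule eventually_conj)
    have "((%t::real. 2 * \<bar>t\<bar> * (C * K)) \<longlongrightarrow> 2 * \<bar>0\<bar> * (C * K)) (nhds 0)" by (intro tendsto_intros filterlim_ident)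
    then show "\<forall>\<^sub>F t::real in nhds 0. 2 * \<bar>t\<bar> * (C * K) < e'" using e' by (auto dest: order_tendstoD)
    have "((%t::real. \<bar>t\<bar>) \<longlongrightarrow> \<bar>0\<bar>) (nhds 0)" by (intro tendsto_intros filterlim_ident)
    from order_tendstoD(2)[OF this, of 1] show "\<forall>\<^sub>F t::real in nhds 0. \<bar>t\<bar> < 1" by simp
  qed
  have "\<forall>\<^sub>F t in nhds 0. \<forall>j. wn w e' (S t (a j) - a j)"
    by (intro eventually_all_finite Suc(1)[OF a(2) e'])
  then show ?case
    using Suc(1)[OF 1 e'] t0
  proof eventually_elim
    case (elim t)
    define b where "b j = (S t (a j) - a j) + cmult_L2 (- (2 * \<i> * of_real t)) (S t (d j))" for j
    have "xM j (S t v - v) (b j)" for j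
    proof -
      have "b j = S t (a j - cmult_L2 (2 * \<i> * of_real t) (d j)) - a j"
        unfolding b_def S_diff S_cmult cmult_minus by simp
      then show ?thesis using isM_diff[OF xM_S[OF a(1) d(1)] a(1)] by simp
    qed
    moreover have "wn w (2 * e') (b j)" for j
    proof -
      have "wn w (cmod (- (2 * \<i> * of_real t)) * (C * K)) (cmult_L2 (- (2 * \<i> * of_real t)) (S t (d j)))"
        by (intro wn_cmult C(2) d(2)) (use elim in auto)
      then have "wn w e' (cmult_L2 (- (2 * \<i> * of_real t)) (S t (d j)))"
        by (rule wn_mono) (use elim in "auto simp: norm_mult")
      from wn_add[OF _ this, of e'] elim show ?thesis unfolding b_def by simp
    qed
    ultimately have "wn (Suc w) (e' + real CARD('n) * (2 * e')) (S t v - v)"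
      using elim by (intro wn_Suc_from_coords) auto
    moreover have "e = 2 * e' + 2 * (real CARD('n) * e')"
    proof -
      have "2 * (1 + real CARD('n)) > 0" by (simp add: add_pos_nonneg)
      then have "e' * (2 * (1 + real CARD('n))) = e" unfolding e'_def by (metis less_irrefl nonzero_eq_divide_eq)
      then show ?thesis by (simp add: algebra_simps)
    qed
    ultimately show ?case using e' by (auto elim: wn_mono)
  qed
qed

lemma WJ_S_continuous:
  fixes v :: "'n::finite L2"
  assumes p: "!!i. i < r ==> p i <= Suc (p (Suc i))" "!!i. i <= r ==> p i + i <= r"
    and v: "WJ r p K v" and e: "0 < e"
  shows "\<forall>\<^sub>F t in nhds 0. WJ r p e (S t v - v)"
  using p v
proof (induction r arbitrary: p v)
  case 0
  then show ?case using S_tendsto[OF e] by (simp add: wn_0)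
next
  case (Suc r)
  obtain d where d: "!!j. D j v (d j)" "!!j. WJ r (%i. p (Suc i)) K (d j)" using Suc(4) by simp metis
  have pd: "p 0 - i <= p i" if "i <= Suc r" for i
    by (rule weight_slow[where p=p, OF Suc(2) that])
  have w: "WJ (p 0) (%i. p 0 - i) K v"
    by (rule WJ_le[OF Suc(4)]) (use Suc(3)[of 0] pd in auto)
  have "\<forall>\<^sub>F t in nhds 0. \<forall>j. WJ r (%i. p (Suc i)) e (S t (d j) - d j)"
  proof (intro eventually_all_finite Suc(1) d(2))
    show "i < r ==> p (Suc i) <= Suc (p (Suc (Suc i)))" for i using Suc(2)[of "Suc i"] by simp
    show "i <= r ==> p (Suc i) + i <= r" for i using Suc(3)[of "Suc i"] by simp
  qed
  then show ?case
    using WJ_S_weight_continuous[OF w e]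
  proof eventually_elim
    case (elim t)
    then show ?case using D_diff[OF D_S[OF d(1)] d(1)] by auto
  qed
qed

section \<open>Decay of powers of the weight\<close>

text \<open>Up to the constant \<open>2 powr \<sigma>\<close> the integrand is at most (1 + |y|)^(-2
  \<sigma>), which has an explicit primitive on the half line.\<close>

lemma powr_1D_integrable:
  assumes "\<sigma> > 1/2"
  shows "integrable lborel (%y::real. complex_of_real ((1 + y^2) powr (- \<sigma>)))"
proof -
  define f where "f y = (1 + \<bar>y\<bar>) powr (- 2 * \<sigma>)" for y :: real
  have [measurable]: "f \<in> BM" unfolding f_def by measurable
  have "(\<integral>\<^sup>+y. ennreal ((1 + y) powr (- 2 * \<sigma>)) * indicator {0..} y \<partial>lborel) = ennreal (0 - (1 + 0) powr (1 - 2 * \<sigma>) / (1 - 2 * \<sigma>))"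
  proof (rule nn_integral_FTC_atLeast)
    show "((%y. (1 + y) powr (1 - 2 * \<sigma>) / (1 - 2 * \<sigma>)) has_real_derivative (1 + y) powr (- 2 * \<sigma>)) (at y)" if "0 <= y" for y
    proof -
      have "((%y. 1 + y) has_real_derivative 1) (at y)" by (auto intro!: derivative_eq_intros)
      from DERIV_chain2[OF has_real_derivative_powr[of "1 + y" "1 - 2 * \<sigma>"] this] that
      have "((%y. (1 + y) powr (1 - 2 * \<sigma>)) has_real_derivative (1 - 2 * \<sigma>) * (1 + y) powr (- 2 * \<sigma>)) (at y)"
        by simp
      from DERIV_cdivide[OF this, of "1 - 2 * \<sigma>"] show ?thesis using assms by simp
    qed
    have "filterlim (%y::real. 1 + y) at_top at_top"
      by (rule filterlim_tendsto_add_at_top[OF tendsto_const filterlim_ident])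
    then have "((%y. (1 + y) powr (1 - 2 * \<sigma>)) \<longlongrightarrow> 0) at_top"
      using assms by (intro tendsto_neg_powr) auto
    then have "((%y. (1 + y) powr (1 - 2 * \<sigma>) / (1 - 2 * \<sigma>)) \<longlongrightarrow> 0 / (1 - 2 * \<sigma>)) at_top"
      using assms by (intro tendsto_divide tendsto_const) auto
    then show "((%y. (1 + y) powr (1 - 2 * \<sigma>) / (1 - 2 * \<sigma>)) \<longlongrightarrow> 0) at_top" by simp
  qed auto
  also have "\<dots> < \<infinity>" by simp
  finally have "(\<integral>\<^sup>+y. ennreal ((1 + y) powr (- 2 * \<sigma>)) * indicator {0..} y \<partial>lborel) < \<infinity>" .
  moreover have "(\<integral>\<^sup>+y. ennreal ((1 + y) powr (- 2 * \<sigma>)) * indicator {0..} y \<partial>lborel) = (\<integral>\<^sup>+y. ennreal (f y) * indicator {0..} y \<partial>lborel)"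
    by (intro nn_integral_cong) (auto simp: f_def indicator_def)
  ultimately have pos: "(\<integral>\<^sup>+y. ennreal (f y) * indicator {0..} y \<partial>lborel) < \<infinity>" by simp
  have "(\<integral>\<^sup>+y. ennreal (f y) \<partial>lborel) <= (\<integral>\<^sup>+y. ennreal (f y) * indicator {0..} y + ennreal (f (0 + (- 1) * y)) * indicator {0..} (0 + (- 1) * y) \<partial>lborel)"
    by (intro nn_integral_mono) (auto simp: f_def indicator_def)
  also have "\<dots> = (\<integral>\<^sup>+y. ennreal (f y) * indicator {0..} y \<partial>lborel) + (\<integral>\<^sup>+y. ennreal (f (0 + (- 1) * y)) * indicator {0..} (0 + (- 1) * y) \<partial>lborel)"
    by (rule nn_integral_add) measurable
  also have "(\<integral>\<^sup>+y. ennreal (f (0 + (- 1) * y)) * indicator {0..} (0 + (- 1) * y) \<partial>lborel) = (\<integral>\<^sup>+y. ennreal (f y) * indicator {0..} y \<partial>lborel)"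
    using nn_integral_real_affine[of "%y. ennreal (f y) * indicator {0..} y" "-1" 0] by simp
  also have "(\<integral>\<^sup>+y. ennreal (f y) * indicator {0..} y \<partial>lborel) + (\<integral>\<^sup>+y. ennreal (f y) * indicator {0..} y \<partial>lborel) < \<infinity>" using pos by simp
  finally have "integrable lborel f"
    by (intro integrableI_bounded) (auto simp: f_def)
  then have "integrable lborel (%y. 2 powr \<sigma> * f y)" by (rule integrable_mult_right)
  then show ?thesis
  proof (rule Bochner_Integration.integrable_bound)
    show "AE y in lborel. norm (complex_of_real ((1 + y^2) powr (- \<sigma>))) <= norm (2 powr \<sigma> * f y)"
    proof (rule AE_I2)
      fix y :: real
      have "(1 + \<bar>y\<bar>)^2 <= 2 * (1 + y^2)"
        using sum_squares_bound[of 1 "\<bar>y\<bar>"] by (simp add: power2_sum)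
      then have "(1 + y^2) powr (- \<sigma>) <= ((1 + \<bar>y\<bar>)^2 / 2) powr (- \<sigma>)"
        using assms by (intro powr_mono2') (auto intro: zero_less_power simp: add_pos_nonneg)
      also have "\<dots> = 2 powr \<sigma> * f y"
        by (simp add: f_def powr_divide powr_minus powr_powr field_simps flip: powr_numeral)
      finally show "norm (complex_of_real ((1 + y^2) powr (- \<sigma>))) <= norm (2 powr \<sigma> * f y)"
        by (simp add: f_def)
    qed
  qed measurable
qed

text \<open>The exponent is spread evenly over the coordinates: <x>^(-2s) is a product of N factors
  (1 + |x|^2)^(-s/N), each at most (1 + x_b^2)^(-s/N), and s/N > 1/2 makes the one-dimensional
  integrals finite.\<close>

lemma sqi_japanese_powr:
  assumes "s > real CARD('n) / 2"
  shows "sqi (%x :: real^'n::finite. complex_of_real (japanese x powr (- s)))"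
proof -
  define \<sigma> where "\<sigma> = s / real CARD('n)"
  have \<sigma>: "\<sigma> > 1/2" using assms by (simp add: \<sigma>_def field_simps)
  have "integrable lborel (%x :: real^'n. \<Prod>b\<in>Basis. complex_of_real ((1 + (x \<bullet> b)^2) powr (- \<sigma>)))"
    by (rule integrable_prod_Basis) (rule powr_1D_integrable[OF \<sigma>])
  then have "integrable lborel (%x :: real^'n. (cmod (complex_of_real (japanese x powr (- s))))^2)"
  proof (rule Bochner_Integration.integrable_bound)
    show "AE x :: real^'n in lborel. norm ((cmod (complex_of_real (japanese x powr (- s))))^2) <= norm (\<Prod>b\<in>Basis. complex_of_real ((1 + (x \<bullet> b)^2) powr (- \<sigma>)))"
    proof (rule AE_I2)
      fix x :: "real^'n"
      have j: "japanese x = (1 + (norm x)^2) powr (1/2)" by (simp add: japanese_def powr_half_sqrt)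
      have "(cmod (complex_of_real (japanese x powr (- s))))^2 = (1 + (norm x)^2) powr (- s)"
        unfolding j by (simp add: powr_powr power2_eq_square powr_add[symmetric])
      also have "\<dots> = (\<Prod>b\<in>(Basis :: (real^'n) set). (1 + (norm x)^2) powr (- \<sigma>))"
      proof -
        have "1 + (norm x)^2 ~= 0" using zero_le_power2[of "norm x"] by linarith
        then show ?thesis by (simp add: powr_power \<sigma>_def)
      qed
      also have "\<dots> <= (\<Prod>b\<in>Basis. (1 + (x \<bullet> b)^2) powr (- \<sigma>))"
      proof (intro prod_mono conjI powr_mono2')
        fix b :: "real^'n" assume "b \<in> Basis"
        then have "\<bar>x \<bullet> b\<bar> <= norm x" by (rule Basis_le_norm)
        then show "1 + (x \<bullet> b)^2 <= 1 + (norm x)^2" by (simp add: abs_le_square_iff[symmetric])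
      qed (use \<sigma> in "auto simp: add_pos_nonneg")
      finally show "norm ((cmod (complex_of_real (japanese x powr (- s))))^2) <= norm (\<Prod>b\<in>Basis. complex_of_real ((1 + (x \<bullet> b)^2) powr (- \<sigma>)))"
        by (simp add: prod_nonneg flip: of_real_prod)
    qed
  qed measurable
  then show ?thesis by (simp add: sqi_def)
qed

lemma japanese_powr_nat: "japanese x powr (- real p) = inverse (japanese x ^ p)"
  by (simp add: powr_minus powr_realpow japanese_pos)

lemma sqi_japanese_power:
  assumes "real p > real CARD('n) / 2"
  shows "sqi (%x :: real^'n::finite. complex_of_real (inverse (japanese x ^ p)))"
  using sqi_japanese_powr[OF assms] by (simp add: japanese_powr_nat)

section \<open>Weighted uniform bounds\<close>

definition LB :: "nat => real => 'n::finite L2 => bool" where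
  "LB p B u \<longleftrightarrow> (AE x in lborel. japanese x ^ p * cmod (rp u x) <= B)"

lemma LB_nonneg: assumes "LB p B (u :: 'n::finite L2)" shows "0 <= B"
proof -
  have "\<exists>x :: real^'n. japanese x ^ p * cmod (rp u x) <= B"
  proof (rule ccontr)
    assume "\<not> ?thesis"
    then have "AE x in lborel. x \<notin> (UNIV :: (real^'n) set)"
      using assms unfolding LB_def by (auto elim: eventually_mono)
    then have "(UNIV :: (real^'n) set) \<in> null_sets lborel" using AE_iff_null_sets[of UNIV "lborel :: (real^'n) measure"] by simp
    then show False by (simp add: null_sets_def)
  qed
  then show ?thesis using japanese_pos by (smt (verit) mult_nonneg_nonneg norm_ge_zero zero_le_power)
qed

lemma LB_mono: assumes "LB p B u" "B <= B'" shows "LB p B' u"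
  using assms(1) unfolding LB_def by eventually_elim (use assms(2) in simp)

lemma LB_add: assumes "LB p B u" "LB p C v" shows "LB p (B + C) (u + v)"
  using assms rp_add[of u v] unfolding LB_def
proof eventually_elim
  case (elim x)
  have "japanese x ^ p * cmod (rp u x + rp v x) <= japanese x ^ p * (cmod (rp u x) + cmod (rp v x))"
    using japanese_pos[of x] by (intro mult_left_mono norm_triangle_ineq) auto
  then show ?case using elim by (simp add: distrib_left)
qed

lemma LB_cmult: assumes "LB p B u" shows "LB p (cmod c * B) (cmult_L2 c u)"
  using assms rp_cmult[of c u] unfolding LB_def
proof eventually_elim
  case (elim x)
  have "cmod c * (japanese x ^ p * cmod (rp u x)) <= cmod c * B" using elim by (intro mult_left_mono) auto
  then show ?case using elim by (simp add: norm_mult mult_ac)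
qed

lemma LB_sum: assumes "finite I" "!!i. i \<in> I ==> LB p (B i) (u i)" shows "LB p (\<Sum>i\<in>I. B i) (\<Sum>i\<in>I. u i)"
  using assms
proof (induction I)
  case empty
  show ?case unfolding LB_def using rp_zero by eventually_elim simp
qed (simp add: LB_add)

text \<open>The norm of w in a weighted L1 space, whose dual norm is the one bounded by
  \<open>LB p\<close>.\<close>

definition dual_wt :: "nat => 'n::finite L2 => real" where
  "dual_wt p w = (LINT x|lborel. inverse (japanese x ^ p) * cmod (rp w x))"

lemma dual_wt_integrable:
  fixes w :: "'n::finite L2"
  assumes "real p > real CARD('n) / 2"
  shows "integrable lborel (%x. inverse (japanese x ^ p) * cmod (rp w x))"
  using integrable_norm[OF sqi_mult_integrable[OF sqi_japanese_power[OF assms] sqi_rp[of w]]]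
  by (simp add: norm_mult norm_power norm_inverse)

lemma dual_wt_nonneg: "0 <= dual_wt p w"
  unfolding dual_wt_def
  by (intro integral_nonneg_AE AE_I2 mult_nonneg_nonneg) (auto intro!: less_imp_le[OF japanese_pos] zero_le_power)

text \<open>Uniform weighted bounds are detected by duality; this makes them stable under limits and
  integrals in \<open>L\<^sup>2\<close>.\<close>

lemma LB_iff_dual:
  fixes u :: "'n::finite L2"
  assumes p: "real p > real CARD('n) / 2" and B: "0 <= B"
  shows "LB p B u \<longleftrightarrow> (\<forall>w. cmod (pr u w) <= B * dual_wt p w)"
proof (intro iffI allI)
  fix w assume u: "LB p B u"
  have "cmod (pr u w) <= (LINT x|lborel. cmod (rp u x * rp w x))"
    unfolding pr_def by (rule integral_norm_bound)
  also have "\<dots> <= (LINT x|lborel. B * (inverse (japanese x ^ p) * cmod (rp w x)))"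
  proof (rule integral_mono_AE)
    show "integrable lborel (%x. cmod (rp u x * rp w x))" by (intro integrable_norm sqi_mult_integrable sqi_rp)
    show "integrable lborel (%x. B * (inverse (japanese x ^ p) * cmod (rp w x)))"
      by (intro integrable_mult_right dual_wt_integrable p)
    show "AE x in lborel. cmod (rp u x * rp w x) <= B * (inverse (japanese x ^ p) * cmod (rp w x))"
      using u unfolding LB_def
    proof eventually_elim
      case (elim x)
      have "cmod (rp u x) <= B * inverse (japanese x ^ p)"
        using elim japanese_pos[of x] by (simp add: field_simps)
      from mult_right_mono[OF this, of "cmod (rp w x)"] show ?case by (simp add: norm_mult mult.assoc)
    qed
  qed
  finally show "cmod (pr u w) <= B * dual_wt p w" by (simp add: dual_wt_def)
next
  assume d: "\<forall>w. cmod (pr u w) <= B * dual_wt p w"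
  define E where "E = {x. B < japanese x ^ p * cmod (rp u x)}"
  have Em [measurable]: "E \<in> sets borel" unfolding E_def by measurable
  \<comment> \<open>On the set where the bound fails this has the phase that makes
    \<open>rp u x * g x\<close> nonnegative. The factor <x>^(-p) makes it square integrable, since p
    > N/2.\<close>
  define g where "g x = complex_of_real (inverse (japanese x ^ p) * indicator E x) * cnj (sgn (rp u x))" for x
  have [measurable]: "g \<in> BM"
    unfolding g_def sgn_div_norm by measurable
  have g: "sqi g"
    by (rule sqi_bound[OF sqi_japanese_power[OF p]])
       (auto simp: g_def norm_mult norm_power norm_inverse norm_sgn indicator_def japanese_pos less_imp_le)
  have gn: "cmod (g x) = inverse (japanese x ^ p) * indicator E x" for x
  proof (cases "x \<in> E")
    case True
    then have "rp u x ~= 0" using B japanese_pos[of x] by (auto simp: E_def)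
    then show ?thesis by (simp add: g_def norm_mult norm_power norm_inverse norm_sgn)
  qed (simp add: g_def)
  have sg: "z * cnj (sgn z) = of_real (cmod z)" for z
    by (cases "z = 0") (simp_all add: sgn_eq complex_norm_square[symmetric] power2_eq_square)
  have ug: "rp u x * g x = of_real (cmod (rp u x) * (inverse (japanese x ^ p) * indicator E x))" for x
    unfolding g_def mult.left_commute[of "rp u x"] sg by simp
  have iE: "integrable lborel (%x. inverse (japanese x ^ p) * (inverse (japanese x ^ p) * indicator E x))"
    and iu: "integrable lborel (%x. cmod (rp u x) * (inverse (japanese x ^ p) * indicator E x))"
    using integrable_norm[OF sqi_mult_integrable[OF sqi_japanese_power[OF p] g]] integrable_norm[OF sqi_mult_integrable[OF sqi_rp[of u] g]]
    by (auto simp: norm_mult norm_power norm_inverse gn)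
  have "pr u (abs_L2 g) = (LINT x|lborel. rp u x * g x)"
    by (rule pr_cong_AE) (auto intro: rp_abs g)
  also have "\<dots> = of_real (LINT x|lborel. cmod (rp u x) * (inverse (japanese x ^ p) * indicator E x))"
    unfolding ug by (rule integral_complex_of_real)
  finally have pu: "pr u (abs_L2 g) = of_real (LINT x|lborel. cmod (rp u x) * (inverse (japanese x ^ p) * indicator E x))" .
  have "\<bar>LINT x|lborel. cmod (rp u x) * (inverse (japanese x ^ p) * indicator E x)\<bar> <= B * dual_wt p (abs_L2 g)"
    using d[rule_format, of "abs_L2 g"] unfolding pu norm_of_real .
  then have "(LINT x|lborel. cmod (rp u x) * (inverse (japanese x ^ p) * indicator E x)) <= B * dual_wt p (abs_L2 g)"
    by linarith
  also have "dual_wt p (abs_L2 g) = (LINT x|lborel. inverse (japanese x ^ p) * (inverse (japanese x ^ p) * indicator E x))"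
    unfolding dual_wt_def
    by (rule integral_cong_AE) (use rp_abs[OF g] in "auto elim!: eventually_mono simp: gn")
  finally have le: "(LINT x|lborel. cmod (rp u x) * (inverse (japanese x ^ p) * indicator E x) - B * (inverse (japanese x ^ p) * (inverse (japanese x ^ p) * indicator E x))) <= 0"
    using iE iu by simp
  have pos: "0 <= cmod (rp u x) * (inverse (japanese x ^ p) * indicator E x) - B * (inverse (japanese x ^ p) * (inverse (japanese x ^ p) * indicator E x))" for x
  proof (cases "x \<in> E")
    case True
    then have "B * inverse (japanese x ^ p) <= cmod (rp u x)" using japanese_pos[of x] by (simp add: E_def field_simps)
    then have "(B * inverse (japanese x ^ p)) * inverse (japanese x ^ p) <= cmod (rp u x) * inverse (japanese x ^ p)"
      using japanese_pos[of x] by (intro mult_right_mono) auto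
    then show ?thesis using True by (simp add: mult.assoc)
  qed simp
  have "AE x in lborel. cmod (rp u x) * (inverse (japanese x ^ p) * indicator E x) - B * (inverse (japanese x ^ p) * (inverse (japanese x ^ p) * indicator E x)) = 0"
  proof (subst integral_nonneg_eq_0_iff_AE[symmetric])
    show "(LINT x|lborel. cmod (rp u x) * (inverse (japanese x ^ p) * indicator E x) - B * (inverse (japanese x ^ p) * (inverse (japanese x ^ p) * indicator E x))) = 0"
      by (rule antisym[OF le]) (rule integral_nonneg_AE, rule AE_I2, rule pos)
  qed (use pos iE iu in auto)
  then show "LB p B u"
    unfolding LB_def
  proof eventually_elim
    case (elim x)
    show ?case
    proof (rule ccontr)
      assume "\<not> ?case"
      then have "x \<in> E" by (simp add: E_def)
      then have "(cmod (rp u x) - B * inverse (japanese x ^ p)) * inverse (japanese x ^ p) = 0"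
        using elim by (simp add: algebra_simps)
      then have "cmod (rp u x) = B * inverse (japanese x ^ p)" using japanese_pos[of x] by simp
      then have "japanese x ^ p * cmod (rp u x) = B" using japanese_pos[of x] by simp
      then show False using \<open>x \<in> E\<close> by (simp add: E_def)
    qed
  qed
qed

lemma LB_norm:
  assumes p: "real p > real CARD('n::finite) / 2"
  shows "\<exists>C\<ge>0. \<forall>B (u :: 'n L2). LB p B u --> norm u <= C * B"
proof (intro exI[of _ "norm (abs_L2 (%x :: real^'n. complex_of_real (inverse (japanese x ^ p))))"] conjI allI impI)
  fix B and u :: "'n L2" assume u: "LB p B u"
  have B: "0 <= B" using u by (rule LB_nonneg)
  have "norm u <= B * norm (abs_L2 (%x :: real^'n. complex_of_real (inverse (japanese x ^ p))))"
  proof (rule norm_le_of_AE[OF _ B])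
    show "AE x in lborel. cmod (rp u x) <= B * cmod (rp (abs_L2 (%x :: real^'n. complex_of_real (inverse (japanese x ^ p)))) x)"
      using u[unfolded LB_def] rp_abs[OF sqi_japanese_power[OF p]]
    proof eventually_elim
      case (elim x)
      have "cmod (rp (abs_L2 (%x :: real^'n. complex_of_real (inverse (japanese x ^ p)))) x) = inverse (japanese x ^ p)"
        unfolding elim(2) norm_of_real using japanese_pos[of x] by (intro abs_of_pos) simp
      moreover have "cmod (rp u x) <= B * inverse (japanese x ^ p)"
        using elim(1) japanese_pos[of x] by (simp add: field_simps)
      ultimately show ?case by (simp only:)
    qed
  qed
  then show "norm u <= norm (abs_L2 (%x :: real^'n. complex_of_real (inverse (japanese x ^ p)))) * B"
    by (simp add: mult.commute)
qed simp

section \<open>Sobolev embedding\<close>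

lemma WJ_pure_derivative:
  assumes "WJ k (%_. 0) K v"
  shows "\<exists>d. isM (%\<xi>. (\<i> * of_real (\<xi> $ j)) ^ k) (FT v) (FT d) & norm d <= K"
  using assms
proof (induction k arbitrary: v)
  case 0
  then show ?case using isM_one by (auto simp: wn_0)
next
  case (Suc k)
  then obtain d where d: "D j v d" "WJ k (%_. 0) K d" by auto
  from Suc(1)[OF d(2)] obtain e where e: "isM (%\<xi>. (\<i> * of_real (\<xi> $ j)) ^ k) (FT d) (FT e)" "norm e <= K" by blast
  have "isM (%\<xi>. (\<i> * of_real (\<xi> $ j)) ^ Suc k) (FT v) (FT e)"
    by (rule isM_cong[OF isM_isM[OF d(1)[unfolded D_def] e(1)]]) simp
  with e(2) show ?case by blast
qed

text \<open>The largest coordinate dominates the weight, so the pure derivatives of order k in each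
  direction suffice to control <\<xi>>^k.\<close>

lemma japanese_power_le_sum:
  fixes \<xi> :: "real^'n::finite"
  shows "japanese \<xi> ^ k <= (real CARD('n) + 1) ^ k * (1 + (\<Sum>j\<in>UNIV. \<bar>\<xi> $ j\<bar> ^ k))"
proof -
  define M where "M = Max (insert 1 (range (%j. \<bar>\<xi> $ j\<bar>)))"
  have M: "1 <= M" "!!j. \<bar>\<xi> $ j\<bar> <= M" unfolding M_def by (rule Max_ge; simp)+
  have "M \<in> insert 1 (range (%j. \<bar>\<xi> $ j\<bar>))" unfolding M_def by (rule Max_in) auto
  then have "M ^ k <= 1 + (\<Sum>j\<in>UNIV. \<bar>\<xi> $ j\<bar> ^ k)"
  proof (elim insertE rangeE)
    assume "M = 1"
    then show ?thesis by (simp add: sum_nonneg)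
  next
    fix j assume "M = \<bar>\<xi> $ j\<bar>"
    then have "M ^ k = (\<Sum>j\<in>{j}. \<bar>\<xi> $ j\<bar> ^ k)" by simp
    also have "\<dots> <= (\<Sum>j\<in>UNIV. \<bar>\<xi> $ j\<bar> ^ k)" by (rule sum_mono2) auto
    finally show ?thesis by simp
  qed
  moreover have "japanese \<xi> <= (real CARD('n) + 1) * M"
  proof -
    have "(\<Sum>j\<in>UNIV. \<bar>\<xi> $ j\<bar>) <= (\<Sum>j\<in>(UNIV :: 'n set). M)" by (rule sum_mono) (rule M)
    then show ?thesis using japanese_le_sum[of \<xi>] M(1) by (simp add: algebra_simps)
  qed
  then have "japanese \<xi> ^ k <= ((real CARD('n) + 1) * M) ^ k"
    using japanese_pos[of \<xi>] by (intro power_mono) auto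
  ultimately show ?thesis
    by (simp add: power_mult_distrib) (meson mult_left_mono order_trans zero_le_power of_nat_0_le_iff add_nonneg_nonneg zero_le_one)
qed

text \<open>The transform is <\<xi>>^(-k) times <\<xi>>^k times itself, a product of two square
  integrable functions as k > N/2. It is therefore integrable, and Fourier inversion bounds v
  uniformly.\<close>

lemma sobolev_embedding:
  assumes k: "real k > real CARD('n::finite) / 2"
  shows "\<exists>C\<ge>0. \<forall>K (v :: 'n L2). WJ k (%_. 0) K v --> LB 0 (C * K) v"
proof -
  define j0 where "j0 = norm (abs_L2 (%x :: real^'n. complex_of_real (inverse (japanese x ^ k))))"
  define N1 where "N1 = real CARD('n) + 1"
  define C where "C = cN TYPE('n) * (j0 * (N1 ^ k * N1))"
  have C0: "0 <= C" using cN_pos[where 'n='n] by (simp add: C_def j0_def N1_def)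
  have "LB 0 (C * K) v" if v: "WJ k (%_. 0) K v" for K and v :: "'n L2"
  proof -
    have "\<forall>j. \<exists>d. isM (%\<xi>. (\<i> * of_real (\<xi> $ j)) ^ k) (FT v) (FT d) & norm d <= K"
      using WJ_pure_derivative[OF v] by blast
    then obtain d where d: "!!j. isM (%\<xi>. (\<i> * of_real (\<xi> $ j)) ^ k) (FT v) (FT (d j))" "!!j. norm (d j) <= K" by metis
    have vK: "norm v <= K" using WJ_wn[OF v] by (simp add: wn_0)
    define g where "g i = (case i of None => FT v | Some j => FT (d j))" for i
    \<comment> \<open>The factor \<open>inverse (N1 ^ k)\<close> absorbs the constant of
      \<open>japanese_power_le_sum\<close>, so that the sum over v and its pure derivatives
      dominates with coefficient one.\<close>
    let ?f = "%\<xi>. complex_of_real (inverse (N1 ^ k) * japanese \<xi> ^ k) * rp (FT v) \<xi>"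
    have N1: "N1 > 0" by (simp add: N1_def)
    have "AE \<xi> in lborel. \<forall>j. rp (FT (d j)) \<xi> = (\<i> * of_real (\<xi> $ j)) ^ k * rp (FT v) \<xi>"
      by (rule eventually_all_finite) (use d(1) in "simp add: isM_def")
    then have "AE \<xi> in lborel. cmod (?f \<xi>) <= (\<Sum>i\<in>UNIV. cmod (rp (g i) \<xi>))"
    proof eventually_elim
      case (elim \<xi>)
      have "(\<Sum>i\<in>UNIV. cmod (rp (g i) \<xi>)) = cmod (rp (FT v) \<xi>) + (\<Sum>j\<in>UNIV. cmod (rp (FT (d j)) \<xi>))"
        by (simp add: UNIV_option_conv sum.reindex g_def)
      also have "(\<Sum>j\<in>UNIV. cmod (rp (FT (d j)) \<xi>)) = (\<Sum>j\<in>UNIV. \<bar>\<xi> $ j\<bar> ^ k) * cmod (rp (FT v) \<xi>)"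
        unfolding sum_distrib_right using elim by (simp add: norm_mult norm_power)
      also have "cmod (rp (FT v) \<xi>) + \<dots> = (1 + (\<Sum>j\<in>UNIV. \<bar>\<xi> $ j\<bar> ^ k)) * cmod (rp (FT v) \<xi>)"
        by (simp add: distrib_right)
      also have "\<dots> >= (inverse (N1 ^ k) * japanese \<xi> ^ k) * cmod (rp (FT v) \<xi>)"
      proof (intro mult_right_mono)
        have "inverse (N1 ^ k) * japanese \<xi> ^ k <= inverse (N1 ^ k) * (N1 ^ k * (1 + (\<Sum>j\<in>UNIV. \<bar>\<xi> $ j\<bar> ^ k)))"
          using japanese_power_le_sum[of \<xi> k, folded N1_def] N1 by (intro mult_left_mono) auto
        then show "inverse (N1 ^ k) * japanese \<xi> ^ k <= 1 + (\<Sum>j\<in>UNIV. \<bar>\<xi> $ j\<bar> ^ k)"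
          using N1 by (simp add: mult.assoc[symmetric])
      qed simp
      finally show ?case using N1 japanese_pos[of \<xi>] by (simp add: norm_mult norm_power norm_inverse)
    qed
    then have f: "sqi ?f & norm (abs_L2 ?f) <= (\<Sum>i\<in>UNIV. norm (g i))"
      by (intro L2_dominated_sum) auto
    have "(\<Sum>i\<in>UNIV. norm (g i)) = norm v + (\<Sum>j\<in>UNIV. norm (d j))"
      by (simp add: UNIV_option_conv sum.reindex g_def)
    also have "\<dots> <= K + (\<Sum>j\<in>(UNIV :: 'n set). K)" using vK d(2) by (intro add_mono sum_mono) auto
    also have "\<dots> = N1 * K" by (simp add: N1_def algebra_simps)
    finally have fn: "norm (abs_L2 ?f) <= N1 * K" using f by simp
    have e: "rp (FT v) \<xi> = of_real (N1 ^ k) * (of_real (inverse (japanese \<xi> ^ k)) * ?f \<xi>)" for \<xi>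
      using N1 japanese_pos[of \<xi>] by (simp add: field_simps)
    have i: "integrable lborel (%\<xi>. of_real (inverse (japanese \<xi> ^ k)) * ?f \<xi>)"
      using f by (intro sqi_mult_integrable sqi_japanese_power k) auto
    have L1: "L1f (rp (FT v))"
      using integrable_mult_right[OF i, of "of_real (N1 ^ k)"] by (intro L1f_I) (simp only: e[symmetric])
    have "(LINT \<xi>|lborel. cmod (rp (FT v) \<xi>)) = N1 ^ k * (LINT \<xi>|lborel. cmod (of_real (inverse (japanese \<xi> ^ k))) * cmod (?f \<xi>))"
      using N1 by (subst e) (simp add: norm_mult norm_power)
    also have "\<dots> <= N1 ^ k * (j0 * (N1 * K))"
    proof (intro mult_left_mono)
      have "(LINT \<xi>|lborel. cmod (of_real (inverse (japanese \<xi> ^ k))) * cmod (?f \<xi>)) <= j0 * norm (abs_L2 ?f)"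
        unfolding j0_def using f by (intro L2_holder sqi_japanese_power k) auto
      also have "\<dots> <= j0 * (N1 * K)" using fn by (intro mult_left_mono) (auto simp: j0_def)
      finally show "(LINT \<xi>|lborel. cmod (of_real (inverse (japanese \<xi> ^ k))) * cmod (?f \<xi>)) <= j0 * (N1 * K)" .
    qed (use N1 in auto)
    finally have "cN TYPE('n) * (LINT \<xi>|lborel. cmod (rp (FT v) \<xi>)) <= C * K"
      using cN_pos[where 'n='n] by (simp add: C_def mult_ac)
    then have b: "cmod (fourier (rp (FT v)) x) <= C * K" for x
      using fourier_bound[OF L1, of x] by linarith
    have "iFT (abs_L2 (rp (FT v))) = v" by (simp add: abs_rp)
    then have "v = abs_L2 (%x. fourier (rp (FT v)) (- x))" using iFT_abs(1)[OF sqi_rp L1] by simp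
    then have "AE x in lborel. rp v x = fourier (rp (FT v)) (- x)"
      using rp_abs[OF iFT_abs(2)[OF sqi_rp L1]] by simp
    then show ?thesis unfolding LB_def by eventually_elim (simp add: b)
  qed
  with C0 show ?thesis by blast
qed

text \<open>Induction on the weight: the embedding is applied to v and to the products x_j v, whose
  sum controls one more power of <x>.\<close>

lemma weighted_sobolev:
  assumes k: "real k > real CARD('n::finite) / 2"
  shows "\<exists>C\<ge>0. \<forall>K (v :: 'n L2). WJ k (%_. p) K v --> LB p (C * K) v"
proof (induction p)
  case 0
  show ?case by (rule sobolev_embedding[OF k])
next
  case (Suc p)
  then obtain C where C: "C >= 0" "!!K (v :: 'n L2). WJ k (%_. p) K v ==> LB p (C * K) v" by blast
  have "LB (Suc p) ((C + real CARD('n) * (C * real (Suc k))) * K) v" if v: "WJ k (%_. Suc p) K v" for K and v :: "'n L2"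
  proof -
    have "LB p (C * K) v" by (rule C(2)) (rule WJ_le[OF v], auto)
    moreover have "\<exists>a. xM j v a & LB p (C * (real (Suc k) * K)) a" for j
    proof -
      have "\<exists>a. xM j v a & WJ k (%_. p) (real (Suc k) * K) a" by (rule WJ_xM[OF v]) auto
      then show ?thesis using C(2) by blast
    qed
    then obtain a where a: "!!j. xM j v (a j)" "!!j. LB p (C * (real (Suc k) * K)) (a j)" by metis
    have "AE x in lborel. \<forall>j. rp (a j) x = of_real (x $ j) * rp v x & japanese x ^ p * cmod (rp (a j) x) <= C * (real (Suc k) * K)"
      by (rule eventually_all_finite, rule eventually_conj) (use a in "auto simp: isM_def LB_def")
    ultimately show ?thesis
      unfolding LB_def
    proof eventually_elim
      case (elim x)
      have "japanese x ^ Suc p * cmod (rp v x) <= (1 + (\<Sum>j\<in>UNIV. \<bar>x $ j\<bar>)) * (japanese x ^ p * cmod (rp v x))"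
        using mult_right_mono[OF japanese_le_sum[of x], of "japanese x ^ p * cmod (rp v x)"] japanese_pos[of x] by (simp add: mult.assoc)
      also have "\<dots> = japanese x ^ p * cmod (rp v x) + (\<Sum>j\<in>UNIV. japanese x ^ p * cmod (rp (a j) x))"
        unfolding distrib_right sum_distrib_right using elim(2) by (simp add: norm_mult mult_ac)
      also have "\<dots> <= C * K + (\<Sum>j\<in>(UNIV :: 'n set). C * (real (Suc k) * K))"
        by (intro add_mono sum_mono) (use elim in blast)+
      also have "\<dots> = (C + real CARD('n) * (C * real (Suc k))) * K" by (simp add: algebra_simps)
      finally show ?case .
    qed
  qed
  moreover have "0 <= C + real CARD('n) * (C * real (Suc k))" using C(1) by simp
  ultimately show ?case by blast
qed

section \<open>The generator of the Schroedinger group\<close>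

lemma phase_quotient_bound: "cmod (phase t \<xi> - 1) <= \<bar>t\<bar> * (norm \<xi>)^2"
proof -
  have "cmod (exp (\<i> * of_real (t * (- (norm \<xi>)\<^sup>2))) - exp (\<i> * of_real (0 * (- (norm \<xi>)\<^sup>2)))) <= (norm \<xi>)^2 * \<bar>t\<bar>"
    by (rule norm_diff_le_of_vector_derivative[OF exp_i_vector_derivative]) (simp add: norm_mult norm_power)
  then show ?thesis by (simp add: phase_def mult.commute)
qed

text \<open>The difference quotients of the phase are bounded by |\<xi>|^2, so on the Fourier side
  they are dominated by the transform of l.\<close>

lemma S_derivative_0:
  fixes v l :: "'n::finite L2"
  assumes l: "isM (%\<xi>. - of_real ((norm \<xi>)^2)) (FT v) (FT l)"
  shows "((%t. S t v) has_vector_derivative cmult_L2 \<i> l) (at 0)"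
proof -
  have "((%t. (S t v - v) /\<^sub>R t - cmult_L2 \<i> l) \<longlongrightarrow> 0) (at 0)"
    unfolding tendsto_at_iff_sequentially comp_def
  proof (intro allI impI)
    fix X :: "nat => real" assume X0: "\<forall>i. X i \<in> UNIV - {0}" and X: "X \<longlonglongrightarrow> 0"
    have Xn: "X j ~= 0" for j using X0 by auto
    have Xat: "filterlim X (at 0) sequentially" using X Xn by (simp add: filterlim_at)
    let ?f = "%j \<xi>. (phase (X j) \<xi> - 1) / of_real (X j) * rp (FT v) \<xi>"
    let ?g = "%\<xi>. \<i> * of_real (- (norm \<xi>)\<^sup>2) * rp (FT v) \<xi>"
    have f: "sqi (?f j) & abs_L2 (?f j) = FT ((S (X j) v - v) /\<^sub>R X j)" for j
    proof (rule abs_eq_AE)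
      have e: "FT ((S (X j) v - v) /\<^sub>R X j) = (1 / X j) *\<^sub>R (FT (S (X j) v) - FT v)"
        by (simp only: linear_scale[OF bounded_linear.linear[OF bounded_linear_FT]] FT_diff inverse_eq_divide)
      show "AE \<xi> in lborel. ?f j \<xi> = rp (FT ((S (X j) v - v) /\<^sub>R X j)) \<xi>"
        unfolding e using rp_scaleR[of "1 / X j" "FT (S (X j) v) - FT v"] rp_diff[of "FT (S (X j) v)" "FT v"] isM_S[of "X j" v, unfolded isM_def]
        by eventually_elim (simp add: field_simps Xn)
    qed measurable
    have g: "sqi ?g & abs_L2 ?g = FT (cmult_L2 \<i> l)"
    proof (rule abs_eq_AE)
      show "AE \<xi> in lborel. ?g \<xi> = rp (FT (cmult_L2 \<i> l)) \<xi>"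
        using l[unfolded isM_def] rp_cmult[of \<i> "FT l"] unfolding FT_cmult by eventually_elim simp
    qed measurable
    have "(%j. abs_L2 (?f j)) \<longlonglongrightarrow> abs_L2 ?g"
    proof (rule L2_dominated_convergence(3)[where w="rp (FT l)"])
      show "AE \<xi> in lborel. (%j. ?f j \<xi>) \<longlonglongrightarrow> ?g \<xi>"
      proof (rule AE_I2)
        fix \<xi> :: "real^'n"
        have "(%j. (exp (\<i> * of_real (X j * (- (norm \<xi>)\<^sup>2))) - 1) / of_real (X j)) \<longlonglongrightarrow> \<i> * of_real (- (norm \<xi>)\<^sup>2)"
          by (rule filterlim_compose[OF exp_difference_quotient Xat])
        then show "(%j. ?f j \<xi>) \<longlonglongrightarrow> ?g \<xi>"
          by (intro tendsto_mult tendsto_const) (simp add: phase_def)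
      qed
      show "AE \<xi> in lborel. cmod (?f j \<xi>) <= cmod (rp (FT l) \<xi>)" for j
        using l[unfolded isM_def]
      proof eventually_elim
        case (elim \<xi>)
        have "cmod ((phase (X j) \<xi> - 1) / of_real (X j)) <= (norm \<xi>)^2"
          using phase_quotient_bound[of "X j" \<xi>] Xn[of j] by (simp add: norm_divide field_simps)
        from mult_right_mono[OF this, of "cmod (rp (FT v) \<xi>)"] show ?case
          unfolding norm_mult elim by (simp add: norm_mult norm_power)
      qed
    qed (auto simp: sqi_rp)
    then have "(%j. FT ((S (X j) v - v) /\<^sub>R X j)) \<longlonglongrightarrow> FT (cmult_L2 \<i> l)" using f g by simp
    then have "(%j. FT ((S (X j) v - v) /\<^sub>R X j) - FT (cmult_L2 \<i> l)) \<longlonglongrightarrow> 0" by (rule LIM_zero)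
    then have "(%j. norm (FT ((S (X j) v - v) /\<^sub>R X j - cmult_L2 \<i> l))) \<longlonglongrightarrow> 0"
      unfolding FT_diff[symmetric] by (rule tendsto_norm_zero)
    then show "(%j. (S (X j) v - v) /\<^sub>R X j - cmult_L2 \<i> l) \<longlonglongrightarrow> 0"
      unfolding norm_FT by (rule tendsto_norm_zero_cancel)
  qed
  then have "((%t. norm ((S t v - v) /\<^sub>R t - cmult_L2 \<i> l)) \<longlongrightarrow> 0) (at 0)" by (rule tendsto_norm_zero)
  moreover have "\<forall>\<^sub>F t in at 0. norm ((S t v - v) /\<^sub>R t - cmult_L2 \<i> l) = norm (S t v - S 0 v - (t - 0) *\<^sub>R cmult_L2 \<i> l) / norm (t - 0)"
  proof (rule eventually_at_filter[THEN iffD2], intro always_eventually allI impI)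
    fix t :: real assume "t ~= 0"
    then have "(S t v - v) /\<^sub>R t - cmult_L2 \<i> l = (S t v - v - t *\<^sub>R cmult_L2 \<i> l) /\<^sub>R t" by (simp add: scaleR_diff_right)
    then show "norm ((S t v - v) /\<^sub>R t - cmult_L2 \<i> l) = norm (S t v - S 0 v - (t - 0) *\<^sub>R cmult_L2 \<i> l) / norm (t - 0)"
      by (simp add: divide_inverse_commute)
  qed
  ultimately have "((%t. norm (S t v - S 0 v - (t - 0) *\<^sub>R cmult_L2 \<i> l) / norm (t - 0)) \<longlongrightarrow> 0) (at 0)"
    by (rule Lim_transform_eventually)
  then show ?thesis
    unfolding has_vector_derivative_def has_derivative_iff_norm by (simp add: bounded_linear_scaleR_left)
qed

lemma S_derivative:
  assumes l: "isM (%\<xi>. - of_real ((norm \<xi>)^2)) (FT v) (FT l)"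
  shows "((%t. S t v) has_vector_derivative cmult_L2 \<i> (S s l)) (at s)"
proof -
  have "((%t. S (t - s) v) has_vector_derivative cmult_L2 \<i> l) (at s)"
  proof -
    have "((%t. t - s) has_vector_derivative 1) (at s)" by (auto intro!: derivative_eq_intros)
    from vector_diff_chain_at[OF this, of "%t. S t v"] S_derivative_0[OF l] show ?thesis by (simp add: comp_def)
  qed
  from bounded_linear.has_vector_derivative[OF bounded_linear_S this, of s]
  show ?thesis by (simp add: S_S S_cmult)
qed

lemma laplacian_isM:
  assumes "!!j. D j v (d j)" "!!j. D j (d j) (e j)"
  shows "isM (%\<xi>. - of_real ((norm \<xi>)^2)) (FT v) (FT (\<Sum>j\<in>UNIV. e j))"
proof -
  have s: "isM (%\<xi>. \<Sum>j\<in>I. - of_real ((\<xi> $ j)^2)) (FT v) (FT (\<Sum>j\<in>I. e j))" if "finite I" for I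
    using that
  proof (induction I)
    case empty
    have "FT (0 :: 'a L2) = 0" by (metis norm_FT norm_eq_zero)
    then show ?case using rp_zero by (simp add: isM_def)
  next
    case (insert j I)
    have "isM (%\<xi>. - of_real ((\<xi> $ j)^2)) (FT v) (FT (e j))"
      by (rule isM_cong[OF isM_isM[OF assms(1)[of j, unfolded D_def] assms(2)[of j, unfolded D_def]]])
         (simp add: power2_eq_square algebra_simps)
    from isM_add_left[OF this insert(3)] insert(1,2) show ?case by (simp add: FT_add)
  qed
  have "(norm \<xi>)^2 = (\<Sum>j\<in>UNIV. (\<xi> $ j)^2)" for \<xi> :: "real^'a"
    unfolding power2_norm_eq_inner inner_vec_def by (simp add: power2_eq_square)
  then show ?thesis using isM_cong[OF s[OF finite]] by (simp add: sum_negf)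
qed

text \<open>Differentiability of t -> S t v is known only in L2. Pairing with w gives a scalar
  function, to which the mean value inequality applies with a bound in terms of
  \<open>dual_wt p w\<close>; duality turns this back into a weighted uniform estimate.\<close>

lemma S_increment_LB:
  fixes v :: "'n::finite L2"
  assumes p: "real p > real CARD('n) / 2"
    and de: "!!j. D j v (d j)" "!!j. D j (d j) (e j)"
    and b: "!!s j. \<bar>s\<bar> <= 1 ==> LB p B (S s (e j))" and t: "\<bar>t\<bar> <= 1"
  shows "LB p (real CARD('n) * B * \<bar>t\<bar>) (S t v - v)"
proof -
  define l where "l = (\<Sum>j\<in>UNIV. e j)"
  have lb: "LB p (real CARD('n) * B) (S s l)" if "\<bar>s\<bar> <= 1" for s
  proof -
    have "S s l = (\<Sum>j\<in>UNIV. S s (e j))" unfolding l_def by (rule linear_sum[OF bounded_linear.linear[OF bounded_linear_S]])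
    then show ?thesis using LB_sum[of "UNIV :: 'n set" p "%_. B" "%j. S s (e j)"] b[OF that] by simp
  qed
  have NB: "0 <= real CARD('n) * B" using lb[of 0] LB_nonneg by auto
  have vd: "((%t. S t v) has_vector_derivative cmult_L2 \<i> (S s l)) (at s)" for s
    unfolding l_def by (rule S_derivative[OF laplacian_isM[OF de]])
  have "cmod (pr (S t v - v) w) <= real CARD('n) * B * \<bar>t\<bar> * dual_wt p w" for w
  proof -
    have "norm (pr (S t v) w - pr (S 0 v) w) <= (real CARD('n) * B * dual_wt p w) * norm (t - 0)"
    proof (rule differentiable_bound[where S="{-1..1}" and f'="%s h. h *\<^sub>R pr (cmult_L2 \<i> (S s l)) w"])
      fix s :: real assume s: "s \<in> {-1..1}"
      show "((%t. pr (S t v) w) has_derivative (%h. h *\<^sub>R pr (cmult_L2 \<i> (S s l)) w)) (at s within {-1..1})"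
        using bounded_linear.has_vector_derivative[OF bounded_linear_pr_left vd]
        by (auto simp: has_vector_derivative_def intro: has_derivative_at_withinI)
      have "cmod (pr (cmult_L2 \<i> (S s l)) w) <= real CARD('n) * B * dual_wt p w"
        using LB_iff_dual[OF p NB, of "S s l"] lb[of s] s by (auto simp: pr_cmult_left norm_mult)
      then have "norm (h *\<^sub>R pr (cmult_L2 \<i> (S s l)) w) <= real CARD('n) * B * dual_wt p w * norm h" for h
        using mult_right_mono[of _ _ "norm h"] by (simp add: mult.commute[of "\<bar>h\<bar>"])
      then show "onorm (%h. h *\<^sub>R pr (cmult_L2 \<i> (S s l)) w) <= real CARD('n) * B * dual_wt p w"
        by (rule onorm_le)
    qed (use t in auto)
    then show ?thesis by (simp add: pr_diff_left mult_ac)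
  qed
  then show ?thesis using NB by (subst LB_iff_dual[OF p]) auto
qed

section \<open>Closedness under series and integrals\<close>

lemma bounded_linear_mu:
  assumes d: "d \<in> BM" "!!x. cmod (d x) <= 1"
  shows "bounded_linear (mu d)"
proof (rule bounded_linear_intro[where K=1])
  have d: "isM d w (mu d w)" for w by (rule isM_mu[where C=1]) (use d in auto)
  show "mu d (x + y) = mu d x + mu d y" for x y using isM_unique[OF d isM_add[OF d d]] .
  show "mu d (r *\<^sub>R x) = r *\<^sub>R mu d x" for r x using isM_unique[OF d isM_scaleR[OF d]] .
  show "norm (mu d x) <= norm x * 1" for x using isM_norm_le[OF d assms(2)] by simp
qed

text \<open>Multiplication by an unbounded a is a closed operator: with b = 1/(1 + |a|) and c = a b,
  both bounded by 1, the relation is equivalent to b v = c u, which passes to limits.\<close>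

lemma isM_closed:
  assumes [measurable]: "a \<in> BM"
    and uv: "!!i. isM a (u i) (v i)" and lim: "(u \<longlongrightarrow> u0) F" "(v \<longlongrightarrow> v0) F" and F: "F ~= bot"
  shows "isM a u0 v0"
proof -
  define b c where "b x = complex_of_real (1 / (1 + cmod (a x)))" and "c x = a x * b x" for x
  have [measurable]: "b \<in> BM" "c \<in> BM"
    unfolding b_def c_def by measurable
  have p: "1 + cmod (a x) > 0" for x by (simp add: add_pos_nonneg)
  have b1: "cmod (b x) <= 1" "cmod (c x) <= 1" for x
    using p[of x] by (auto simp: b_def c_def norm_mult norm_divide simp del: of_real_add of_real_divide)
  have b: "isM b w (mu b w)" and c: "isM c w (mu c w)" for w
    by (rule isM_mu[where C=1]; simp add: b1)+
  have eq: "mu b (v i) = mu c (u i)" for i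
  proof (rule L2_eqI)
    show "AE x in lborel. rp (mu b (v i)) x = rp (mu c (u i)) x"
      using b[of "v i"] c[of "u i"] uv[of i] unfolding isM_def by eventually_elim (simp add: c_def)
  qed
  have "((%i. mu b (v i)) \<longlongrightarrow> mu b v0) F"
    by (rule bounded_linear.tendsto[OF bounded_linear_mu lim(2)]) (auto simp: b1)
  moreover have "((%i. mu b (v i)) \<longlongrightarrow> mu c u0) F"
    unfolding eq by (rule bounded_linear.tendsto[OF bounded_linear_mu lim(1)]) (auto simp: b1)
  ultimately have "mu b v0 = mu c u0" by (rule tendsto_unique[OF F])
  then have "AE x in lborel. b x * rp v0 x = c x * rp u0 x"
    using b[of v0] c[of u0] unfolding isM_def by (auto elim: eventually_elim2)
  then show ?thesis
    unfolding isM_def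
  proof eventually_elim
    case (elim x)
    have "b x ~= 0" using p[of x] by (simp add: b_def del: of_real_add of_real_divide)
    then show ?case using elim by (simp add: c_def)
  qed
qed

text \<open>The same division by 1 + |m| replaces the closed operator by two bounded ones, which
  commute with the integral.\<close>

lemma isM_integral:
  fixes F G :: "real => 'n::finite L2"
  assumes [measurable]: "m \<in> BM"
    and FG: "!!s. s \<in> {a..b} ==> isM m (F s) (G s)"
    and I: "(F has_integral u) {a..b}" "(G has_integral v) {a..b}"
  shows "isM m u v"
proof -
  define c d where "c x = complex_of_real (1 / (1 + cmod (m x)))" and "d x = m x * c x" for x
  have [measurable]: "c \<in> BM" "d \<in> BM"
    unfolding c_def d_def by measurable
  have p: "1 + cmod (m x) > 0" for x by (simp add: add_pos_nonneg)
  have b1: "cmod (c x) <= 1" "cmod (d x) <= 1" for x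
    using p[of x] by (auto simp: c_def d_def norm_mult norm_divide simp del: of_real_add of_real_divide)
  have c: "isM c w (mu c w)" and d: "isM d w (mu d w)" for w
    by (rule isM_mu[where C=1]; simp add: b1)+
  have eq: "mu c (G s) = mu d (F s)" if "s \<in> {a..b}" for s
  proof (rule L2_eqI)
    show "AE x in lborel. rp (mu c (G s)) x = rp (mu d (F s)) x"
      using c[of "G s"] d[of "F s"] FG[OF that] unfolding isM_def by eventually_elim (simp add: d_def)
  qed
  have 1: "((%s. mu c (G s)) has_integral mu c v) {a..b}"
    using has_integral_linear[OF I(2) bounded_linear_mu[of c]] by (simp add: comp_def b1)
  have 2: "((%s. mu d (F s)) has_integral mu d u) {a..b}"
    using has_integral_linear[OF I(1) bounded_linear_mu[of d]] by (simp add: comp_def b1)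
  have "((%s. mu c (G s)) has_integral mu d u) {a..b}"
    using has_integral_cong[of "{a..b}" "%s. mu c (G s)" "%s. mu d (F s)"] eq 2 by blast
  with 1 have "mu c v = mu d u" by (rule has_integral_unique)
  then have "AE x in lborel. c x * rp v x = d x * rp u x"
    using c[of v] d[of u] unfolding isM_def by (auto elim: eventually_elim2)
  then show ?thesis
    unfolding isM_def
  proof eventually_elim
    case (elim x)
    have "c x ~= 0" using p[of x] by (simp add: c_def del: of_real_add of_real_divide)
    then show ?case using elim by (simp add: d_def)
  qed
qed

text \<open>Continuity measured by a bound predicate. The small number e plays the role of the norm
  of the increment, so no normed type for the smaller space has to be built.\<close>

definition ccont :: "(real => 'n::finite L2 => bool) => (real => 'n L2) => real set => bool" where
  "ccont P F I \<longleftrightarrow> (\<forall>s\<in>I. \<forall>e>0. \<forall>\<^sub>F s' in at s within I. P e (F s' - F s))"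

lemma ccont_continuous_on:
  assumes c: "ccont P F I" and C: "0 <= C" "!!e u. P e u ==> norm u <= C * e"
  shows "continuous_on I F"
  unfolding continuous_on_def
proof
  fix s assume s: "s \<in> I"
  show "(F \<longlongrightarrow> F s) (at s within I)"
  proof (rule tendstoI)
    fix e :: real assume "0 < e"
    then have "0 < e / (C + 1)" using C(1) by simp
    then have "\<forall>\<^sub>F s' in at s within I. P (e / (C + 1)) (F s' - F s)" using c s unfolding ccont_def by blast
    then show "\<forall>\<^sub>F s' in at s within I. dist (F s') (F s) < e"
    proof eventually_elim
      case (elim s')
      have "norm (F s' - F s) <= C * (e / (C + 1))" using C(2)[OF elim] .
      also have "\<dots> < e" using C(1) \<open>0 < e\<close> by (simp add: field_simps)
      finally show ?case by (simp add: dist_norm)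
    qed
  qed
qed

lemma ccont_mono:
  assumes c: "ccont P F I" and PQ: "!!e u. P e u ==> Q e u"
  shows "ccont Q F I"
  unfolding ccont_def
proof (intro ballI allI impI)
  fix s and e :: real assume "s \<in> I" "0 < e"
  with c have "\<forall>\<^sub>F s' in at s within I. P e (F s' - F s)" by (simp add: ccont_def)
  then show "\<forall>\<^sub>F s' in at s within I. Q e (F s' - F s)" by (rule eventually_mono) (rule PQ)
qed

lemma ccont_subset:
  assumes c: "ccont P F I" and I: "I' \<subseteq> I"
  shows "ccont P F I'"
  unfolding ccont_def
proof (intro ballI allI impI)
  fix s and e :: real assume "s \<in> I'" "0 < e"
  with c I have "\<forall>\<^sub>F s' in at s within I. P e (F s' - F s)" by (auto simp: ccont_def)
  then show "\<forall>\<^sub>F s' in at s within I'. P e (F s' - F s)" by (rule filter_leD[OF at_le[OF I]])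
qed

lemma wn_norm: "wn p K u ==> norm u <= K"
  using wn_le[of p K u 0] by (simp add: wn_0)

lemma wn_series:
  fixes u :: "nat => 'n::finite L2"
  assumes u: "!!q. wn p (\<epsilon> q) (u q)" and s: "summable \<epsilon>"
  shows "wn p (suminf \<epsilon>) (suminf u)" "summable u"
proof -
  have "\<forall>q. \<exists>a. wM p (u q) a & norm a <= \<epsilon> q" using u by (simp add: wn_def)
  then obtain a where a: "!!q. wM p (u q) (a q)" "!!q. norm (a q) <= \<epsilon> q" by metis
  have su: "summable u" using wn_norm[OF u] s by (intro summable_comparison_test'[OF s]) auto
  have sa: "summable a" using a(2) by (intro summable_comparison_test'[OF s]) auto
  have part: "wM p (\<Sum>q<i. u q) (\<Sum>q<i. a q)" for i
  proof (induction i)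
    case (Suc i)
    show ?case using isM_add[OF Suc a(1)] by simp
  qed (simp add: isM_zero)
  have "wM p (suminf u) (suminf a)"
    by (rule isM_closed[OF _ part summable_LIMSEQ[OF su] summable_LIMSEQ[OF sa]]) auto
  moreover have "norm (suminf a) <= suminf \<epsilon>"
    using norm_suminf_le[OF a(2) s] .
  ultimately show "wn p (suminf \<epsilon>) (suminf u)" by (rule wnI)
  show "summable u" by (rule su)
qed

text \<open>Continuity in the weighted predicate makes the weighted function G continuous in L2; its
  integral therefore exists, and closedness of the weight identifies it with the weighted integral
  of F.\<close>

lemma wn_integral:
  fixes F :: "real => 'n::finite L2"
  assumes ab: "a <= b" and K: "!!s. s \<in> {a..b} ==> wn p K (F s)"
    and c: "ccont (wn p) F {a..b}" and I: "(F has_integral v) {a..b}"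
  shows "wn p (K * (b - a)) v"
proof -
  have "\<forall>s\<in>{a..b}. \<exists>g. wM p (F s) g & norm g <= K" using K by (simp add: wn_def)
  then obtain G where G: "!!s. s \<in> {a..b} ==> wM p (F s) (G s)" "!!s. s \<in> {a..b} ==> norm (G s) <= K" by metis
  have "continuous_on {a..b} G"
    unfolding continuous_on_def
  proof (intro ballI tendstoI)
    fix s and e :: real assume s: "s \<in> {a..b}" and "0 < e"
    then have "\<forall>\<^sub>F s' in at s within {a..b}. wn p (e/2) (F s' - F s)" using c unfolding ccont_def by auto
    moreover have "\<forall>\<^sub>F s' in at s within {a..b}. s' \<in> {a..b}" by (auto simp: eventually_at_filter)
    ultimately show "\<forall>\<^sub>F s' in at s within {a..b}. dist (G s') (G s) < e"
    proof eventually_elim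
      case (elim s')
      obtain h where h: "wM p (F s' - F s) h" "norm h <= e/2" using elim(1) by (rule wnE)
      have "h = G s' - G s" by (rule isM_unique[OF h(1) isM_diff[OF G(1)[OF elim(2)] G(1)[OF s]]])
      then show ?case using h(2) \<open>0 < e\<close> by (simp add: dist_norm)
    qed
  qed
  then have GI: "(G has_integral integral {a..b} G) {a..b}"
    by (intro integrable_integral integrable_continuous_real)
  have "wM p v (integral {a..b} G)"
    by (rule isM_integral[OF _ G(1) I GI]) auto
  moreover have "norm (integral {a..b} G) <= K * (b - a)"
  proof -
    have "0 <= K" using wn_nonneg[OF K[of a]] ab by simp
    from has_integral_bound[OF this, of G "integral {a..b} G" a b] GI G(2) ab show ?thesis by simp
  qed
  ultimately show ?thesis by (rule wnI)
qed

lemma LB_series: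
  fixes u :: "nat => 'n::finite L2"
  assumes p: "real p > real CARD('n) / 2"
    and u: "!!q. LB p (\<epsilon> q) (u q)" and s: "summable \<epsilon>" and su: "summable u"
  shows "LB p (suminf \<epsilon>) (suminf u)"
proof -
  have e0: "0 <= \<epsilon> q" for q using u by (rule LB_nonneg)
  have "cmod (pr (suminf u) w) <= suminf \<epsilon> * dual_wt p w" for w
  proof -
    have "pr (suminf u) w = (\<Sum>q. pr (u q) w)"
      by (rule bounded_linear.suminf[OF bounded_linear_pr_left su])
    also have "cmod \<dots> <= (\<Sum>q. \<epsilon> q * dual_wt p w)"
    proof (rule norm_suminf_le)
      show "norm (pr (u q) w) <= \<epsilon> q * dual_wt p w" for q
        using u[of q] LB_iff_dual[OF p e0[of q], of "u q"] by simp
    qed (intro summable_mult2 s)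
    also have "\<dots> = suminf \<epsilon> * dual_wt p w" by (rule suminf_mult2[OF s, symmetric])
    finally show ?thesis .
  qed
  then show ?thesis using suminf_nonneg[OF s e0] by (subst LB_iff_dual[OF p]) auto
qed

lemma LB_integral:
  fixes F :: "real => 'n::finite L2"
  assumes p: "real p > real CARD('n) / 2" and ab: "a <= b"
    and K: "!!s. s \<in> {a..b} ==> LB p K (F s)" and I: "(F has_integral v) {a..b}"
  shows "LB p (K * (b - a)) v"
proof -
  have K0: "0 <= K" using LB_nonneg[OF K[of a]] ab by simp
  have "cmod (pr v w) <= K * (b - a) * dual_wt p w" for w
  proof -
    have h: "((%s. pr (F s) w) has_integral pr v w) (cbox a b)"
      using has_integral_linear[OF I bounded_linear_pr_left[of w]] by (simp add: comp_def)
    have "norm (pr v w) <= (K * dual_wt p w) * Henstock_Kurzweil_Integration.content (cbox a b)"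
    proof (rule has_integral_bound[OF _ h])
      show "0 <= K * dual_wt p w" using K0 dual_wt_nonneg by (intro mult_nonneg_nonneg)
      show "norm (pr (F s) w) <= K * dual_wt p w" if "s \<in> cbox a b" for s
        using K[of s] that LB_iff_dual[OF p K0, of "F s"] by simp
    qed
    then show ?thesis using ab by (simp add: mult_ac)
  qed
  then show ?thesis using K0 ab by (subst LB_iff_dual[OF p]) auto
qed

lemma D_integral:
  fixes F G :: "real => 'n::finite L2"
  assumes D: "!!s. s \<in> {a..b} ==> D j (F s) (G s)"
    and I: "(F has_integral u) {a..b}" "(G has_integral v) {a..b}"
  shows "D j u v"
  unfolding D_def
proof (rule isM_integral[where F="%s. FT (F s)" and G="%s. FT (G s)" and a=a and b=b])
  show "((%s. FT (F s)) has_integral FT u) {a..b}" "((%s. FT (G s)) has_integral FT v) {a..b}"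
    using has_integral_linear[OF I(1) bounded_linear_FT] has_integral_linear[OF I(2) bounded_linear_FT]
    by (simp_all add: comp_def)
qed (use D in "auto simp: D_def")

lemma D_series:
  fixes u v :: "nat => 'n::finite L2"
  assumes D: "!!q. D j (u q) (v q)" and s: "summable u" "summable v"
  shows "D j (suminf u) (suminf v)"
  unfolding D_def
proof (rule isM_closed)
  show "isM (%\<xi>. \<i> * of_real (\<xi> $ j)) (FT (\<Sum>q<i. u q)) (FT (\<Sum>q<i. v q))" for i
  proof -
    have "D j (\<Sum>q<i. u q) (\<Sum>q<i. v q)"
    proof (induction i)
      case (Suc i)
      show ?case using D_add[OF Suc D] by simp
    qed (simp add: D_zero)
    then show ?thesis by (simp add: D_def)
  qed
  show "(%i. FT (\<Sum>q<i. u q)) \<longlonglongrightarrow> FT (suminf u)" "(%i. FT (\<Sum>q<i. v q)) \<longlonglongrightarrow> FT (suminf v)"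
    using s by (auto intro!: bounded_linear.tendsto[OF bounded_linear_FT] summable_LIMSEQ)
qed auto

text \<open>The induction step shared by \<open>WJ\<close> and \<open>XL\<close>; Q stands for the
  requirement on the derivatives.\<close>

lemma D_step_series:
  fixes u :: "nat => 'n::finite L2"
  assumes u: "!!q. \<exists>d. D j (u q) d & Q (\<epsilon> q) d" and s: "summable \<epsilon>" "summable u"
    and Q: "!!v :: nat => 'n L2. (!!q. Q (\<epsilon> q) (v q)) ==> Q (suminf \<epsilon>) (suminf v) & summable v"
  shows "\<exists>d. D j (suminf u) d & Q (suminf \<epsilon>) d"
proof -
  obtain d where d: "!!q. D j (u q) (d q)" "!!q. Q (\<epsilon> q) (d q)" using u by metis
  from Q[OF d(2)] show ?thesis using D_series[OF d(1) s(2)] by blast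
qed

text \<open>The induction step shared by \<open>WJ\<close> and \<open>XL\<close>. Uniqueness of
  derivatives makes the chosen derivatives G(s) depend continuously on s, so that they can be
  integrated.\<close>

lemma D_step_integral:
  fixes F :: "real => 'n::finite L2"
  assumes ab: "a <= b" and K: "!!s. s \<in> {a..b} ==> \<exists>d. D j (F s) d & Q K d"
    and c: "ccont (%e u. \<exists>d. D j u d & Q e d) F {a..b}" and I: "(F has_integral v) {a..b}"
    and C: "0 <= C" "!!e u. Q e u ==> norm u <= C * e"
    and Q: "!!G w. (!!s. s \<in> {a..b} ==> Q K (G s)) ==> ccont Q G {a..b} ==> (G has_integral w) {a..b} ==> Q L w"
  shows "\<exists>d. D j v d & Q L d"
proof -
  obtain G where G: "!!s. s \<in> {a..b} ==> D j (F s) (G s)" "!!s. s \<in> {a..b} ==> Q K (G s)" using K by metis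
  have cG: "ccont Q G {a..b}"
    unfolding ccont_def
  proof (intro ballI allI impI)
    fix s and e :: real assume s: "s \<in> {a..b}" and "0 < e"
    then have "\<forall>\<^sub>F s' in at s within {a..b}. \<exists>d. D j (F s' - F s) d & Q e d" using c unfolding ccont_def by auto
    moreover have "\<forall>\<^sub>F s' in at s within {a..b}. s' \<in> {a..b}" by (auto simp: eventually_at_filter)
    ultimately show "\<forall>\<^sub>F s' in at s within {a..b}. Q e (G s' - G s)"
    proof eventually_elim
      case (elim s')
      obtain d where d: "D j (F s' - F s) d" "Q e d" using elim(1) by blast
      have "d = G s' - G s" by (rule D_unique[OF d(1) D_diff[OF G(1)[OF elim(2)] G(1)[OF s]]])
      then show ?case using d(2) by simp
    qed
  qed
  have "continuous_on {a..b} G" by (rule ccont_continuous_on[OF cG C])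
  then have GI: "(G has_integral integral {a..b} G) {a..b}"
    by (intro integrable_integral integrable_continuous_real)
  show ?thesis using D_integral[OF G(1) I GI] Q[OF G(2) cG GI] by blast
qed

lemma WJ_norm: "WJ r p K u ==> norm u <= K"
  using wn_norm[OF WJ_wn] .

lemma WJ_series:
  fixes u :: "nat => 'n::finite L2"
  assumes u: "!!q. WJ r p (\<epsilon> q) (u q)" and s: "summable \<epsilon>"
  shows "WJ r p (suminf \<epsilon>) (suminf u) & summable u"
  using u
proof (induction r arbitrary: p u)
  case 0
  then show ?case using wn_series[of "p 0" \<epsilon> u] s by simp
next
  case (Suc r)
  have w: "wn (p 0) (suminf \<epsilon>) (suminf u)" "summable u"
    using wn_series[of "p 0" \<epsilon> u] s Suc(2) by auto
  have "\<exists>d. D j (suminf u) d & WJ r (%i. p (Suc i)) (suminf \<epsilon>) d" for j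
    by (rule D_step_series[OF _ s w(2)]) (use Suc in auto)
  then show ?case using w by simp
qed

lemma WJ_integral:
  fixes F :: "real => 'n::finite L2"
  assumes ab: "a <= b" and K: "!!s. s \<in> {a..b} ==> WJ r p K (F s)"
    and c: "ccont (WJ r p) F {a..b}" and I: "(F has_integral v) {a..b}"
  shows "WJ r p (K * (b - a)) v"
  using K c I
proof (induction r arbitrary: p F v)
  case 0
  have "ccont (wn (p 0)) F {a..b}" using 0(2) by (rule ccont_mono) simp
  then show ?case using wn_integral[OF ab _ _ 0(3), of "p 0" K] 0(1) by simp
next
  case (Suc r)
  have "ccont (wn (p 0)) F {a..b}" using Suc(3) by (rule ccont_mono) simp
  then have w: "wn (p 0) (K * (b - a)) v" using wn_integral[OF ab _ _ Suc(4), of "p 0" K] Suc(2) by simp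
  have "\<exists>d. D j v d & WJ r (%i. p (Suc i)) (K * (b - a)) d" for j
  proof (rule D_step_integral[where C=1, OF ab _ _ Suc(4)])
    show "\<exists>d. D j (F s) d & WJ r (%i. p (Suc i)) K d" if "s \<in> {a..b}" for s using Suc(2)[OF that] by simp
    show "ccont (%e u. \<exists>d. D j u d & WJ r (%i. p (Suc i)) e d) F {a..b}"
      using Suc(3) by (rule ccont_mono) simp
    show "WJ r (%i. p (Suc i)) e u ==> norm u <= 1 * e" for e and u :: "'n L2" using WJ_norm by simp
    show "WJ r (%i. p (Suc i)) (K * (b - a)) w"
      if "!!s. s \<in> {a..b} ==> WJ r (%i. p (Suc i)) K (G s)" "ccont (WJ r (%i. p (Suc i))) G {a..b}" "(G has_integral w) {a..b}" for G and w :: "'n L2"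
      by (rule Suc(1)[OF that])
  qed simp
  with w show ?case by simp
qed

section \<open>The gauge of the space\<close>

declare WJ.simps [simp del]

text \<open>\<open>XL k n r K g\<close> bounds \<open>g\<close> and its derivatives as required of the derivatives of order
  \<open>2m + 1 - r\<close> of an element of \<open>\<X>\<close>: uniform bounds with weight \<open>n\<close> on the first \<open>r\<close> orders, then the
  \<open>L\<^sup>2\<close> bounds with the weights \<open>Pw k n i\<close>.\<close>

definition Pw :: "nat => nat => nat => nat" where
  "Pw k n i = min n (k + 1 + n - i)"

primrec XL :: "nat => nat => nat => real => 'n::finite L2 => bool" where
  "XL k n 0 K g \<longleftrightarrow> WJ (k + 1 + n) (Pw k n) K g"
| "XL k n (Suc r) K g \<longleftrightarrow> LB n K g & (\<forall>j. \<exists>d. D j g d & XL k n r K d)"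

lemma XL_mono: "XL k n r K g ==> K <= K' ==> XL k n r K' g"
proof (induction r arbitrary: g)
  case (Suc r)
  then show ?case by (auto intro: LB_mono) blast
qed (auto intro: WJ_mono)

lemma XL_add: "XL k n r K u ==> XL k n r L v ==> XL k n r (K + L) (u + v)"
proof (induction r arbitrary: u v)
  case (Suc r)
  then show ?case by (auto intro: LB_add) (blast intro: D_add)
qed (auto intro: WJ_add)

lemma XL_cmult: "XL k n r K u ==> XL k n r (cmod c * K) (cmult_L2 c u)"
proof (induction r arbitrary: u)
  case (Suc r)
  then show ?case by (auto intro: LB_cmult) (blast intro: D_cmult)
qed (auto intro: WJ_cmult)

lemma XL_uminus: "XL k n r K u ==> XL k n r K (- u)"
  using XL_cmult[of k n r K u "-1"] by (simp add: cmult_minus cmult_1)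

lemma XL_diff: "XL k n r K u ==> XL k n r L v ==> XL k n r (K + L) (u - v)"
  using XL_add[OF _ XL_uminus] by fastforce

lemma XL_nonneg: "XL k n r K u ==> 0 <= K"
  by (cases r) (auto intro: WJ_nonneg LB_nonneg)

context
  fixes k n :: nat and ty :: "'n::finite itself"
  assumes k: "real k > real CARD('n) / 2" and n: "real n > real CARD('n) / 2"
begin

lemma XL_norm: "\<exists>C\<ge>1. \<forall>r K (u :: 'n L2). XL k n r K u --> norm u <= C * K"
proof -
  obtain C where C: "C >= 0" "!!B (u :: 'n L2). LB n B u ==> norm u <= C * B" using LB_norm[OF n] by blast
  have "norm u <= (C + 1) * K" if u: "XL k n r K u" for r K and u :: "'n L2"
  proof (cases r)
    case 0
    then have "norm u <= K" using u WJ_norm by auto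
    then show ?thesis using C(1) XL_nonneg[OF u] by (simp add: distrib_right) (meson add_increasing mult_nonneg_nonneg)
  next
    case (Suc r')
    then have "norm u <= C * K" using u C(2) by auto
    then show ?thesis using XL_nonneg[OF u] by (simp add: distrib_right)
  qed
  then show ?thesis using C(1) by (intro exI[of _ "C + 1"]) auto
qed

lemma XL_series:
  fixes u :: "nat => 'n L2"
  assumes u: "!!q. XL k n r (\<epsilon> q) (u q)" and s: "summable \<epsilon>"
  shows "XL k n r (suminf \<epsilon>) (suminf u) & summable u"
  using u
proof (induction r arbitrary: u)
  case 0
  then show ?case unfolding XL.simps by (rule WJ_series[OF _ s])
next
  case (Suc r)
  obtain C where C: "C >= 1" "!!r K (u :: 'n L2). XL k n r K u ==> norm u <= C * K" using XL_norm by blast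
  have su: "summable u"
    using C(2)[OF Suc(2)] by (intro summable_comparison_test'[OF summable_mult[OF s, of C]]) auto
  have l: "LB n (suminf \<epsilon>) (suminf u)" by (rule LB_series[OF n _ s su]) (use Suc(2) in simp)
  have "\<exists>d. D j (suminf u) d & XL k n r (suminf \<epsilon>) d" for j
    by (rule D_step_series[OF _ s su]) (use Suc in auto)
  then show ?case using l su by simp
qed

lemma XL_integral:
  fixes F :: "real => 'n L2"
  assumes ab: "a <= b" and K: "!!s. s \<in> {a..b} ==> XL k n r K (F s)"
    and c: "ccont (XL k n r) F {a..b}" and I: "(F has_integral v) {a..b}"
  shows "XL k n r (K * (b - a)) v"
  using K c I
proof (induction r arbitrary: F v)
  case 0
  have "ccont (WJ (k + 1 + n) (Pw k n)) F {a..b}" using 0(2) by (rule ccont_mono) simp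
  then show ?case using WJ_integral[OF ab _ _ 0(3)] 0(1) by simp
next
  case (Suc r)
  obtain C where C: "C >= 1" "!!r K (u :: 'n L2). XL k n r K u ==> norm u <= C * K" using XL_norm by blast
  have l: "LB n (K * (b - a)) v" by (rule LB_integral[OF n ab _ Suc(4)]) (use Suc(2) in simp)
  have "\<exists>d. D j v d & XL k n r (K * (b - a)) d" for j
  proof (rule D_step_integral[where C=C, OF ab _ _ Suc(4)])
    show "\<exists>d. D j (F s) d & XL k n r K d" if "s \<in> {a..b}" for s using Suc(2)[OF that] by simp
    show "ccont (%e u. \<exists>d. D j u d & XL k n r e d) F {a..b}"
      using Suc(3) by (rule ccont_mono) simp
    show "XL k n r (K * (b - a)) w"
      if "!!s. s \<in> {a..b} ==> XL k n r K (G s)" "ccont (XL k n r) G {a..b}" "(G has_integral w) {a..b}" for G and w :: "'n L2"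
      by (rule Suc(1)[OF that])
  qed (use C in auto)
  with l show ?case by simp
qed

lemma Pw_conditions:
  "i < k + 1 + n ==> Pw k n i <= Suc (Pw k n (Suc i))" "i <= k + 1 + n ==> Pw k n i + i <= k + 1 + n"
  "i <= k + 1 ==> Pw k n i = n"
  by (auto simp: Pw_def)

text \<open>Uniform bounds for \<open>e\<^sup>i\<^sup>t\<^sup>\<Delta> g\<close> are obtained from those for \<open>e\<^sup>i\<^sup>t\<^sup>\<Delta> \<partial>\<^sub>j\<^sup>2 g\<close>, since the time derivative of
  \<open>e\<^sup>i\<^sup>t\<^sup>\<Delta> g\<close> is \<open>i e\<^sup>i\<^sup>t\<^sup>\<Delta> \<Delta> g\<close>; after enough steps the Sobolev embedding applies.\<close>

lemma XL_S_LB: "\<exists>C\<ge>0. \<forall>t K (g :: 'n L2). \<bar>t\<bar> <= 1 --> XL k n r K g --> LB n (C * K) (S t g)"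
  and XL_S_second: "\<exists>C\<ge>0. \<forall>K (g :: 'n L2). XL k n (Suc r) K g -->
     (\<exists>d e. \<forall>j. D j g (d j) & D j (d j) (e j) & (\<forall>t. \<bar>t\<bar> <= 1 --> LB n (C * K) (S t (e j))))"
proof (induction r)
  obtain Cs where Cs: "Cs >= 0" "!!K (v :: 'n L2). WJ k (%_. n) K v ==> LB n (Cs * K) v"
    using weighted_sobolev[OF k, of n] by blast
  case 0
  {
    case 1
    obtain C where C: "C >= 0" "!!t K (v :: 'n L2). \<bar>t\<bar> <= 1 ==> WJ (k + 1 + n) (Pw k n) K v ==> WJ (k + 1 + n) (Pw k n) (C * K) (S t v)"
      using WJ_S[of "k + 1 + n" "Pw k n"] Pw_conditions(1,2) by blast
    have "LB n (Cs * C * K) (S t g)" if "\<bar>t\<bar> <= 1" "XL k n 0 K g" for t K and g :: "'n L2"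
    proof -
      have "WJ k (%_. n) (C * K) (S t g)"
        by (rule WJ_le[OF C(2)[OF that(1)]]) (use that(2) Pw_conditions(3) in auto)
      from Cs(2)[OF this] show ?thesis by (simp add: mult.assoc)
    qed
    then show ?case using Cs(1) C(1) by (intro exI[of _ "Cs * C"]) auto
  next
    case 2
    \<comment> \<open>A second derivative of g has k + n orders left, with the weights shifted by
      one. As \<open>Pw k n\<close> equals n up to index k + 1, the first k of them still carry the
      full weight n that the embedding requires.\<close>
    have "\<exists>C\<ge>0. \<forall>t K (v :: 'n L2). \<bar>t\<bar> <= 1 --> WJ (k + n) (%i. Pw k n (Suc i)) K v --> WJ (k + n) (%i. Pw k n (Suc i)) (C * K) (S t v)"
    proof (rule WJ_S)
      show "i < k + n ==> Pw k n (Suc i) <= Suc (Pw k n (Suc (Suc i)))" for i using Pw_conditions(1)[of "Suc i"] by simp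
      show "i <= k + n ==> Pw k n (Suc i) + i <= k + n" for i using Pw_conditions(2)[of "Suc i"] by simp
    qed
    then obtain C where C: "C >= 0" "!!t K (v :: 'n L2). \<bar>t\<bar> <= 1 ==> WJ (k + n) (%i. Pw k n (Suc i)) K v ==> WJ (k + n) (%i. Pw k n (Suc i)) (C * K) (S t v)"
      by blast
    have "\<exists>d e. \<forall>j. D j g (d j) & D j (d j) (e j) & (\<forall>t. \<bar>t\<bar> <= 1 --> LB n (Cs * C * K) (S t (e j)))"
      if g: "XL k n (Suc 0) K g" for K and g :: "'n L2"
    proof -
      obtain d where d: "!!j. D j g (d j)" "!!j. WJ (Suc (k + n)) (Pw k n) K (d j)" using g by simp metis
      have "\<forall>j. \<exists>e. D j (d j) e & WJ (k + n) (%i. Pw k n (Suc i)) K e" using d(2) by (simp add: WJ.simps)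
      then obtain e where e: "!!j. D j (d j) (e j)" "!!j. WJ (k + n) (%i. Pw k n (Suc i)) K (e j)" by metis
      have "LB n (Cs * C * K) (S t (e j))" if "\<bar>t\<bar> <= 1" for t j
      proof -
        have "WJ k (%_. n) (C * K) (S t (e j))"
          by (rule WJ_le[OF C(2)[OF that e(2)]]) (use Pw_conditions(3) in auto)
        from Cs(2)[OF this] show ?thesis by (simp add: mult.assoc)
      qed
      with d(1) e(1) show ?thesis by blast
    qed
    then show ?case using Cs(1) C(1) by (intro exI[of _ "Cs * C"]) auto
  }
next
  case (Suc r)
  obtain C1 where C1: "C1 >= 0" "!!t K (g :: 'n L2). \<bar>t\<bar> <= 1 ==> XL k n r K g ==> LB n (C1 * K) (S t g)"
    using Suc(1) by blast
  obtain C2 where C2: "C2 >= 0" "!!K (g :: 'n L2). XL k n (Suc r) K g ==>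
     \<exists>d e. \<forall>j. D j g (d j) & D j (d j) (e j) & (\<forall>t. \<bar>t\<bar> <= 1 --> LB n (C2 * K) (S t (e j)))"
    using Suc(2) by blast
  {
    case 1
    have "LB n ((1 + real CARD('n) * C2) * K) (S t g)" if t: "\<bar>t\<bar> <= 1" and g: "XL k n (Suc r) K g" for t K and g :: "'n L2"
    proof -
      obtain d e where de: "!!j. D j g (d j)" "!!j. D j (d j) (e j)" "!!j t. \<bar>t\<bar> <= 1 ==> LB n (C2 * K) (S t (e j))"
        using C2(2)[OF g] by blast
      have "LB n (real CARD('n) * (C2 * K) * \<bar>t\<bar>) (S t g - g)"
        by (rule S_increment_LB[OF n de(1,2,3) t])
      then have "LB n (real CARD('n) * (C2 * K)) (S t g - g)"
        by (rule LB_mono) (use t C2(1) XL_nonneg[OF g] in "simp add: mult_left_le")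
      from LB_add[OF this, of K g] g show ?thesis by (simp add: algebra_simps)
    qed
    then show ?case using C2(1) by (intro exI[of _ "1 + real CARD('n) * C2"]) auto
  next
    case 2
    have "\<exists>d e. \<forall>j. D j g (d j) & D j (d j) (e j) & (\<forall>t. \<bar>t\<bar> <= 1 --> LB n (C1 * K) (S t (e j)))"
      if g: "XL k n (Suc (Suc r)) K g" for K and g :: "'n L2"
    proof -
      have "\<forall>j. \<exists>d e. D j g d & D j d e & XL k n r K e" using g by auto meson
      then obtain d e where "!!j. D j g (d j)" "!!j. D j (d j) (e j)" "!!j. XL k n r K (e j)" by metis
      with C1(2) show ?thesis by blast
    qed
    then show ?case using C1(1) by blast
  }
qed

lemma XL_S: "\<exists>C\<ge>0. \<forall>t K (g :: 'n L2). \<bar>t\<bar> <= 1 --> XL k n r K g --> XL k n r (C * K) (S t g)"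
proof (induction r)
  case 0
  then show ?case using WJ_S[of "k + 1 + n" "Pw k n"] Pw_conditions(1,2) by simp
next
  case (Suc r)
  then obtain C1 where C1: "C1 >= 0" "!!t K (g :: 'n L2). \<bar>t\<bar> <= 1 ==> XL k n r K g ==> XL k n r (C1 * K) (S t g)"
    by blast
  obtain C2 where C2: "C2 >= 0" "!!t K (g :: 'n L2). \<bar>t\<bar> <= 1 ==> XL k n (Suc r) K g ==> LB n (C2 * K) (S t g)"
    using XL_S_LB[of "Suc r"] by blast
  have "XL k n (Suc r) (max C1 C2 * K) (S t g)" if t: "\<bar>t\<bar> <= 1" and g: "XL k n (Suc r) K g" for t K and g :: "'n L2"
  proof -
    have K: "0 <= K" using g by (rule XL_nonneg)
    have "LB n (max C1 C2 * K) (S t g)"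
      by (rule LB_mono[OF C2(2)[OF t g]]) (use K in "simp add: mult_right_mono")
    moreover have "\<exists>d. D j (S t g) d & XL k n r (max C1 C2 * K) d" for j
    proof -
      obtain d where d: "D j g d" "XL k n r K d" using g by auto
      have "XL k n r (max C1 C2 * K) (S t d)"
        by (rule XL_mono[OF C1(2)[OF t d(2)]]) (use K in "simp add: mult_right_mono")
      with D_S[OF d(1)] show ?thesis by blast
    qed
    ultimately show ?thesis by simp
  qed
  then show ?case using C1(1) by (intro exI[of _ "max C1 C2"]) auto
qed

text \<open>Wherever a uniform bound is claimed two more derivatives are available, so that part of
  the increment is of order |t| by \<open>S_increment_LB\<close>. The remaining orders follow by
  induction down to the L2 case.\<close>

lemma XL_S_continuous:
  fixes g :: "'n L2"
  assumes g: "XL k n r K g" and e: "0 < e"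
  shows "\<forall>\<^sub>F t in nhds 0. XL k n r e (S t g - g)"
  using g
proof (induction r arbitrary: g)
  case 0
  then show ?case using WJ_S_continuous[OF Pw_conditions(1,2) _ e] by simp
next
  case (Suc r)
  obtain C2 where C2: "C2 >= 0" "!!K (g :: 'n L2). XL k n (Suc r) K g ==>
     \<exists>d e. \<forall>j. D j g (d j) & D j (d j) (e j) & (\<forall>t. \<bar>t\<bar> <= 1 --> LB n (C2 * K) (S t (e j)))"
    using XL_S_second by blast
  obtain d' e' where de: "!!j. D j g (d' j)" "!!j. D j (d' j) (e' j)" "!!j t. \<bar>t\<bar> <= 1 ==> LB n (C2 * K) (S t (e' j))"
    using C2(2)[OF Suc(2)] by blast
  have t0: "\<forall>\<^sub>F t::real in nhds 0. real CARD('n) * (C2 * K) * \<bar>t\<bar> < e & \<bar>t\<bar> < 1"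
  proof (rule eventually_conj)
    have "((%t::real. real CARD('n) * (C2 * K) * \<bar>t\<bar>) \<longlongrightarrow> real CARD('n) * (C2 * K) * \<bar>0\<bar>) (nhds 0)"
      by (intro tendsto_intros filterlim_ident)
    from order_tendstoD(2)[OF this, of e] e show "\<forall>\<^sub>F t::real in nhds 0. real CARD('n) * (C2 * K) * \<bar>t\<bar> < e" by simp
    have "((%t::real. \<bar>t\<bar>) \<longlongrightarrow> \<bar>0\<bar>) (nhds 0)" by (intro tendsto_intros filterlim_ident)
    from order_tendstoD(2)[OF this, of 1] show "\<forall>\<^sub>F t::real in nhds 0. \<bar>t\<bar> < 1" by simp
  qed
  obtain d where d: "!!j. D j g (d j)" "!!j. XL k n r K (d j)" using Suc(2) by simp metis
  have "\<forall>\<^sub>F t in nhds 0. \<forall>j. XL k n r e (S t (d j) - d j)"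
    by (intro eventually_all_finite Suc(1) d(2))
  then show ?case
    using t0
  proof eventually_elim
    case (elim t)
    have "LB n (real CARD('n) * (C2 * K) * \<bar>t\<bar>) (S t g - g)"
      by (rule S_increment_LB[OF n de]) (use elim in auto)
    then have "LB n e (S t g - g)" by (rule LB_mono) (use elim in simp)
    then show ?case using elim D_diff[OF D_S[OF d(1)] d(1)] by auto
  qed
qed

end

section \<open>The gauge and the norm\<close>

lemma msym_zero: "morder \<beta> = 0 ==> msym \<beta> \<xi> = 1"
  by (simp add: msym_def morder_def)

lemma msym_Suc: "msym (\<beta>(j := Suc (\<beta> j))) \<xi> = \<i> * of_real (\<xi> $ j) * msym \<beta> \<xi>"
proof -
  have "msym (\<beta>(j := Suc (\<beta> j))) \<xi> = (\<i> * of_real (\<xi> $ j)) ^ Suc (\<beta> j) * (\<Prod>i\<in>UNIV - {j}. (\<i> * of_real (\<xi> $ i)) ^ \<beta> i)"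
    unfolding msym_def by (subst prod.remove[of _ j]) auto
  also have "\<dots> = \<i> * of_real (\<xi> $ j) * msym \<beta> \<xi>"
    unfolding msym_def by (subst prod.remove[of UNIV j]) (auto simp: mult.assoc)
  finally show ?thesis .
qed

lemma morder_Suc: "morder (\<beta>(j := Suc (\<beta> j))) = Suc (morder \<beta>)"
proof -
  have "morder (\<beta>(j := Suc (\<beta> j))) = Suc (\<beta> j) + (\<Sum>i\<in>UNIV - {j}. \<beta> i)"
    unfolding morder_def by (subst sum.remove[of _ j]) auto
  also have "\<dots> = Suc (morder \<beta>)" unfolding morder_def by (subst sum.remove[of UNIV j]) auto
  finally show ?thesis .
qed

lemma morder_0_iff: "morder \<beta> = 0 \<longleftrightarrow> \<beta> = (%_. 0)"
  by (auto simp: morder_def)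

lemma morder_zero: "morder (%_. 0) = 0"
  by (simp add: morder_def)

lemma multiindex_SucE:
  assumes "morder \<beta> = Suc l"
  obtains j \<gamma> where "\<beta> = \<gamma>(j := Suc (\<gamma> j))" "morder \<gamma> = l"
proof -
  have "\<exists>j. \<beta> j ~= 0" using assms by (auto simp: morder_def intro: ccontr)
  then obtain j where j: "\<beta> j ~= 0" by blast
  define \<gamma> where "\<gamma> = \<beta>(j := \<beta> j - 1)"
  have "\<beta> = \<gamma>(j := Suc (\<gamma> j))" using j by (auto simp: \<gamma>_def)
  moreover from this have "morder \<gamma> = l" using assms morder_Suc[of \<gamma> j] by simp
  ultimately show ?thesis by (rule that)
qed

lemma has_weak_deriv_0: "has_weak_deriv (%_. 0) u v \<longleftrightarrow> v = u"
proof -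
  have "has_weak_deriv (%_. 0) u u" unfolding has_weak_deriv_iff isM_def
    by (intro AE_I2) (simp add: msym_zero morder_def)
  then show ?thesis using has_weak_deriv_unique by blast
qed

lemma D_has_weak_deriv: "D j u v \<longleftrightarrow> has_weak_deriv ((%_. 0)(j := Suc 0)) u v"
  unfolding has_weak_deriv_iff D_def isM_def using msym_Suc[of "%_. 0" j]
  by (simp add: msym_zero morder_def)

lemma has_weak_deriv_Suc:
  assumes "D j u d"
  shows "has_weak_deriv (\<beta>(j := Suc (\<beta> j))) u v \<longleftrightarrow> has_weak_deriv \<beta> d v"
proof -
  have "AE x in lborel. rp (FT v) x = msym (\<beta>(j := Suc (\<beta> j))) x * rp (FT u) x \<longleftrightarrow> rp (FT v) x = msym \<beta> x * rp (FT d) x"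
    using assms unfolding D_def isM_def by eventually_elim (simp add: msym_Suc mult_ac)
  then show ?thesis unfolding has_weak_deriv_iff isM_def by (rule eventually_subst)
qed

lemma WJ_iff:
  "WJ r p K g \<longleftrightarrow> (\<forall>\<beta>. morder \<beta> <= r --> (\<exists>v. has_weak_deriv \<beta> g v & wn (p (morder \<beta>)) K v))"
proof (induction r arbitrary: p g)
  case 0
  then show ?case by (simp add: WJ.simps morder_0_iff has_weak_deriv_0) (simp add: morder_def)
next
  case (Suc r)
  show ?case (is "?l \<longleftrightarrow> ?r")
  proof
    assume l: ?l
    show ?r
    proof (intro allI impI)
      fix \<beta> :: "'a multiindex" assume b: "morder \<beta> <= Suc r"
      show "\<exists>v. has_weak_deriv \<beta> g v & wn (p (morder \<beta>)) K v"
      proof (cases "morder \<beta>")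
        case 0
        then show ?thesis using l by (simp add: WJ.simps) (simp add: morder_0_iff has_weak_deriv_0 morder_zero)
      next
        case (Suc l')
        then obtain j \<gamma> where j: "\<beta> = \<gamma>(j := Suc (\<gamma> j))" "morder \<gamma> = l'" by (rule multiindex_SucE)
        obtain d where d: "D j g d" "WJ r (%i. p (Suc i)) K d" using l by (auto simp: WJ.simps)
        then obtain v where "has_weak_deriv \<gamma> d v" "wn (p (Suc l')) K v"
          using Suc.IH[of "%i. p (Suc i)" d] b Suc j(2) by auto
        then show ?thesis using has_weak_deriv_Suc[OF d(1)] j(1) Suc by auto
      qed
    qed
  next
    assume r: ?r
    have "wn (p 0) K g" using r[rule_format, of "%_. 0"] by (simp add: has_weak_deriv_0 morder_def)
    moreover have "\<exists>d. D j g d & WJ r (%i. p (Suc i)) K d" for j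
    proof -
      obtain d where d: "D j g d"
        using r[rule_format, of "(%_. 0)(j := Suc 0)"] morder_Suc[of "%_. 0" j]
        by (auto simp: D_has_weak_deriv morder_def)
      have "WJ r (%i. p (Suc i)) K d"
        unfolding Suc.IH
      proof (intro allI impI)
        fix \<beta> :: "'a multiindex" assume "morder \<beta> <= r"
        then show "\<exists>v. has_weak_deriv \<beta> d v & wn (p (Suc (morder \<beta>))) K v"
          using r[rule_format, of "\<beta>(j := Suc (\<beta> j))"] by (simp add: morder_Suc has_weak_deriv_Suc[OF d])
      qed
      with d show ?thesis by blast
    qed
    ultimately show ?l by (simp add: WJ.simps)
  qed
qed

text \<open>The recursion differentiates in one direction at a time, whereas \<open>Xspace\<close>
  speaks of multi-indices. The two match because a weak derivative of index \<beta> + e_j is that of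
  index \<beta> of the derivative j, by \<open>has_weak_deriv_Suc\<close>.\<close>

lemma XL_iff:
  "XL k n r K g \<longleftrightarrow> (\<forall>\<beta>. morder \<beta> <= r + k + 1 + n --> (\<exists>v. has_weak_deriv \<beta> g v &
     (if morder \<beta> < r then LB n K v else wn (Pw k n (morder \<beta> - r)) K v)))"
proof (induction r arbitrary: g)
  case 0
  then show ?case by (simp add: WJ_iff)
next
  case (Suc r)
  show ?case (is "?l \<longleftrightarrow> ?r")
  proof
    assume l: ?l
    show ?r
    proof (intro allI impI)
      fix \<beta> :: "'a multiindex" assume b: "morder \<beta> <= Suc r + k + 1 + n"
      show "\<exists>v. has_weak_deriv \<beta> g v & (if morder \<beta> < Suc r then LB n K v else wn (Pw k n (morder \<beta> - Suc r)) K v)"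
      proof (cases "morder \<beta>")
        case 0
        then show ?thesis using l by (simp add: morder_0_iff has_weak_deriv_0 morder_zero)
      next
        case (Suc l')
        then obtain j \<gamma> where j: "\<beta> = \<gamma>(j := Suc (\<gamma> j))" "morder \<gamma> = l'" by (rule multiindex_SucE)
        obtain d where d: "D j g d" "XL k n r K d" using l by auto
        then obtain v where "has_weak_deriv \<gamma> d v" "if l' < r then LB n K v else wn (Pw k n (l' - r)) K v"
          using Suc.IH[of d] b Suc j(2) by auto
        then show ?thesis using has_weak_deriv_Suc[OF d(1)] j(1) Suc by auto
      qed
    qed
  next
    assume r: ?r
    have "LB n K g" using r[rule_format, of "%_. 0"] by (simp add: has_weak_deriv_0 morder_def)
    moreover have "\<exists>d. D j g d & XL k n r K d" for j
    proof -
      obtain d where d: "D j g d"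
        using r[rule_format, of "(%_. 0)(j := Suc 0)"] morder_Suc[of "%_. 0" j]
        by (auto simp: D_has_weak_deriv morder_def)
      have "XL k n r K d"
        unfolding Suc.IH
      proof (intro allI impI)
        fix \<beta> :: "'a multiindex" assume "morder \<beta> <= r + k + 1 + n"
        then show "\<exists>v. has_weak_deriv \<beta> d v & (if morder \<beta> < r then LB n K v else wn (Pw k n (morder \<beta> - r)) K v)"
          using r[rule_format, of "\<beta>(j := Suc (\<beta> j))"] unfolding morder_Suc has_weak_deriv_Suc[OF d] diff_Suc_Suc by simp
      qed
      with d show ?thesis by blast
    qed
    ultimately show ?l by simp
  qed
qed

lemma weighted_measurable [measurable]:
  "(%x. japanese x ^ p *\<^sub>R rep_L2 v x) \<in> borel_measurable lebesgue"
proof -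
  have [measurable]: "rep_L2 v \<in> borel_measurable lebesgue"
    using square_integrable_rep_L2[of v] by (simp add: square_integrable_def)
  have [measurable]: "japanese \<in> borel_measurable lebesgue"
    by (intro measurable_completion) measurable
  show ?thesis by measurable
qed

lemma esssup_nonneg:
  fixes f :: "real^'n::finite => complex"
  shows "0 <= esssup lebesgue (%x. ereal (cmod (f x)))"
proof (rule ccontr)
  assume "\<not> ?thesis"
  then have "esssup lebesgue (%x. ereal (cmod (f x))) < 0" by simp
  then have imp: "ereal (cmod (f x)) <= esssup lebesgue (%x. ereal (cmod (f x))) --> ereal (cmod (f x)) < 0" for x
    using le_less_trans by blast
  have "AE x in lebesgue. ereal (cmod (f x)) < 0"
    by (rule AE_mp[OF esssup_AE AE_I2[OF imp]])
  then have "AE x in (lebesgue :: (real^'n) measure). False" by (rule AE_mp) simp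
  then have "ae_filter (lebesgue :: (real^'n) measure) = bot" by (simp add: trivial_limit_def)
  then show False by (simp add: Measure_Space.ae_filter_eq_bot_iff)
qed

lemma LB_bounded:
  fixes v :: "'n::finite L2"
  assumes "LB p K v"
  shows "bounded_AE (%x. japanese x ^ p *\<^sub>R rep_L2 v x)" "Linf_norm (%x. japanese x ^ p *\<^sub>R rep_L2 v x) <= K"
proof -
  have "AE x in lborel. ereal (cmod (japanese x ^ p *\<^sub>R rep_L2 v x)) <= ereal K"
    using assms rep_rp[of v] unfolding LB_def by eventually_elim (simp add: abs_japanese power_abs)
  then have "AE x in lebesgue. ereal (cmod (japanese x ^ p *\<^sub>R rep_L2 v x)) <= ereal K"
    by (rule AE_completion)
  then have le: "esssup lebesgue (%x. ereal (cmod (japanese x ^ p *\<^sub>R rep_L2 v x))) <= ereal K"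
    by (intro esssup_I) measurable
  then show "bounded_AE (%x. japanese x ^ p *\<^sub>R rep_L2 v x)"
    unfolding bounded_AE_def by (auto intro: le_less_trans)
  show "Linf_norm (%x. japanese x ^ p *\<^sub>R rep_L2 v x) <= K"
    unfolding Linf_norm_def using le esssup_nonneg[of "%x. japanese x ^ p *\<^sub>R rep_L2 v x"]
    by (cases "esssup lebesgue (%x. ereal (cmod (japanese x ^ p *\<^sub>R rep_L2 v x)))") auto
qed

lemma Linf_norm_nonneg: "0 <= Linf_norm f"
  unfolding Linf_norm_def by (intro real_of_ereal_pos esssup_nonneg)

lemma bounded_LB:
  fixes v :: "'n::finite L2"
  assumes "bounded_AE (%x. japanese x ^ p *\<^sub>R rep_L2 v x)"
  shows "LB p (Linf_norm (%x. japanese x ^ p *\<^sub>R rep_L2 v x)) v"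
proof -
  let ?f = "%x. japanese x ^ p *\<^sub>R rep_L2 v x"
  have e: "esssup lebesgue (%x. ereal (cmod (?f x))) = ereal (Linf_norm ?f)"
    using assms esssup_nonneg[of ?f] unfolding bounded_AE_def Linf_norm_def
    by (cases "esssup lebesgue (%x. ereal (cmod (?f x)))") auto
  have "AE x in lebesgue. ereal (cmod (?f x)) <= ereal (Linf_norm ?f)"
    using esssup_AE[of "%x. ereal (cmod (?f x))" lebesgue] unfolding e .
  moreover have "AE x in lebesgue. rep_L2 v x = rp v x" by (rule AE_completion[OF rep_rp])
  ultimately have "AE x in lebesgue. japanese x ^ p * cmod (rp v x) <= Linf_norm ?f"
    by eventually_elim (simp add: abs_japanese power_abs)
  then show ?thesis unfolding LB_def by (subst (asm) AE_completion_iff) measurable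
qed

lemma wn_iff:
  "wn p K v \<longleftrightarrow> square_integrable (%x. japanese x ^ p *\<^sub>R rep_L2 v x) & L2_norm (%x. japanese x ^ p *\<^sub>R rep_L2 v x) <= K"
    (is "_ \<longleftrightarrow> square_integrable ?f & _")
proof
  assume "wn p K v"
  then obtain a where a: "wM p v a" "norm a <= K" by (rule wnE)
  have "AE x in lborel. ?f x = rep_L2 a x"
    using a(1) rep_rp[of v] rep_rp[of a] unfolding isM_def
    by eventually_elim (simp add: scaleR_conv_of_real)
  then have e: "AE x in lebesgue. ?f x = rep_L2 a x" by (rule AE_completion)
  have sa: "square_integrable (rep_L2 a)" by (rule square_integrable_rep_L2)
  then have [measurable]: "rep_L2 a \<in> borel_measurable lebesgue" by (simp add: square_integrable_def)
  have "integrable lebesgue (%x. (cmod (rep_L2 a x))^2)" using sa by (simp add: square_integrable_def)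
  then have "integrable lebesgue (%x. (cmod (?f x))^2)"
  proof (rule Bochner_Integration.integrable_cong_AE_imp)
    show "(%x. (cmod (?f x))^2) \<in> borel_measurable lebesgue"
      using weighted_measurable[of p v] by measurable
    show "AE x in lebesgue. (cmod (rep_L2 a x))^2 = (cmod (?f x))^2" using e by eventually_elim simp
  qed
  then have sf: "square_integrable ?f" by (simp add: square_integrable_def)
  have "L2_norm ?f = L2_norm (rep_L2 a)" by (rule L2_norm_cong) (simp add: L2_rel_def sf sa e)
  also have "\<dots> = norm a" by (simp add: norm_L2.rep_eq)
  finally show "square_integrable ?f & L2_norm ?f <= K" using sf a(2) by simp
next
  assume s: "square_integrable ?f & L2_norm ?f <= K"
  then have "AE x in lebesgue. rep_L2 (abs_L2 ?f) x = ?f x" by (intro rep_abs_L2) simp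
  moreover have "AE x in lebesgue. rep_L2 v x = rp v x" "AE x in lebesgue. rep_L2 (abs_L2 ?f) x = rp (abs_L2 ?f) x"
    by (rule AE_completion[OF rep_rp])+
  ultimately have "AE x in lebesgue. rp (abs_L2 ?f) x = of_real (japanese x ^ p) * rp v x"
    by eventually_elim (simp add: scaleR_conv_of_real)
  then have "wM p v (abs_L2 ?f)" unfolding isM_def by (subst (asm) AE_completion_iff) measurable
  moreover have "norm (abs_L2 ?f) = L2_norm ?f"
    using s by (intro norm_L2.abs_eq) (simp add: L2_rel_def)
  ultimately show "wn p K v" using s by (intro wnI) auto
qed

text \<open>Every summand of \<open>Xnorm\<close> is at most K, and the constant counts the
  summands. The weights agree: \<open>Pw\<close> at index |\<beta>| - (2m+1) is n up to order 2m + 2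
  + k and J - |\<beta>| beyond.\<close>

lemma XL_Xspace:
  fixes u :: "'n::finite L2"
  assumes x: "XL k n (2*m+1) K u"
  shows "u \<in> Xspace k m n" "Xnorm k m n u <= ((\<Sum>j=0..2*m. 1) + (\<Sum>\<nu>=0..k+1. \<Sum>\<mu>=0..n. \<Sum>\<beta> :: 'n multiindex | morder \<beta> = \<nu> + \<mu> + 2*m + 1. 1)) * K"
proof -
  have v: "has_weak_deriv \<beta> u (weak_deriv \<beta> u)" "morder \<beta> <= 2*m ==> LB n K (weak_deriv \<beta> u)"
    "2*m < morder \<beta> ==> wn (Pw k n (morder \<beta> - (2*m+1))) K (weak_deriv \<beta> u)"
    if b: "morder \<beta> <= 2*m+2+k+n" for \<beta>
  proof -
    obtain v where "has_weak_deriv \<beta> u v" "if morder \<beta> < 2*m+1 then LB n K v else wn (Pw k n (morder \<beta> - (2*m+1))) K v"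
      using x[unfolded XL_iff, rule_format, of \<beta>] b by (auto simp del: if_split)
    then show "has_weak_deriv \<beta> u (weak_deriv \<beta> u)" "morder \<beta> <= 2*m ==> LB n K (weak_deriv \<beta> u)"
      "2*m < morder \<beta> ==> wn (Pw k n (morder \<beta> - (2*m+1))) K (weak_deriv \<beta> u)"
      using weak_deriv_eqI[of \<beta> u v] by auto
  qed
  note wd = weighted_deriv_def[abs_def]
  have w: "wn p K (weak_deriv \<beta> u)" if "morder \<beta> <= 2*m+2+k+n" "2*m < morder \<beta>" "p <= Pw k n (morder \<beta> - (2*m+1))" for p \<beta>
    using wn_le[OF v(3)[OF that(1,2)] that(3)] .
  show "u \<in> Xspace k m n"
    unfolding Xspace_def Let_def sobolev_def
  proof (intro CollectI conjI allI impI)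
    fix \<beta> :: "'n multiindex"
    show "\<exists>v. has_weak_deriv \<beta> u v" if "morder \<beta> <= 2*m+2+k+n" using v(1)[OF that] by blast
    show "bounded_AE (weighted_deriv n \<beta> u)" if "morder \<beta> <= 2*m"
      unfolding wd using LB_bounded(1)[OF v(2)] that by simp
    show "square_integrable (weighted_deriv n \<beta> u)" if "2*m+1 <= morder \<beta> & morder \<beta> <= 2*m+2+k"
      unfolding wd using w[of \<beta> n] that by (auto simp: Pw_def wn_iff)
    show "square_integrable (weighted_deriv (2*m+2+k+n - morder \<beta>) \<beta> u)" if "2*m+2+k < morder \<beta> & morder \<beta> <= 2*m+2+k+n"
    proof -
      have "wn (2*m+2+k+n - morder \<beta>) K (weak_deriv \<beta> u)" by (rule w) (use that in "auto simp: Pw_def")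
      then show ?thesis unfolding wd wn_iff by blast
    qed
  qed
  have 1: "(SUP \<beta>\<in>{\<beta>. morder \<beta> = j}. Linf_norm (weighted_deriv n \<beta> u)) <= K" if "j <= 2*m" for j
    unfolding wd by (rule cSUP_least[OF morder_nonempty]) (use that LB_bounded(2)[OF v(2)] in auto)
  have 2: "L2_norm (weighted_deriv (n-\<mu>) \<beta> u) <= K" if "\<nu> <= k+1" "\<mu> <= n" "morder \<beta> = \<nu> + \<mu> + 2*m + 1" for \<nu> \<mu> \<beta>
    unfolding wd using w[of \<beta> "n - \<mu>"] that by (auto simp: Pw_def wn_iff)
  have "Xnorm k m n u <= (\<Sum>j=0..2*m. K) + (\<Sum>\<nu>=0..k+1. \<Sum>\<mu>=0..n. \<Sum>\<beta> :: 'n multiindex | morder \<beta> = \<nu> + \<mu> + 2*m + 1. K)"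
    unfolding Xnorm_def by (intro add_mono sum_mono 1 2) auto
  then show "Xnorm k m n u <= ((\<Sum>j=0..2*m. 1) + (\<Sum>\<nu>=0..k+1. \<Sum>\<mu>=0..n. \<Sum>\<beta> :: 'n multiindex | morder \<beta> = \<nu> + \<mu> + 2*m + 1. 1)) * K"
    by (simp add: sum_distrib_right distrib_right del: sum_constant)
qed

lemma Xspace_XL:
  fixes u :: "'n::finite L2"
  assumes u: "u \<in> Xspace k m n"
  shows "XL k n (2*m+1) (Xnorm k m n u) u"
  unfolding XL_iff
proof (intro allI impI)
  fix \<beta> :: "'n multiindex" assume b: "morder \<beta> <= 2*m+1 + k + 1 + n"
  let ?A = "\<Sum>j=0..2*m. SUP \<beta>\<in>{\<beta>. morder \<beta> = j}. Linf_norm (weighted_deriv n \<beta> u)"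
  let ?B = "\<Sum>\<nu>=0..k+1. \<Sum>\<mu>=0..n. \<Sum>\<beta> | morder \<beta> = \<nu> + \<mu> + 2*m + 1. L2_norm (weighted_deriv (n - \<mu>) \<beta> u)"
  obtain v where v: "has_weak_deriv \<beta> u v" using u b unfolding Xspace_def Let_def sobolev_def by auto
  have wv: "weighted_deriv p \<beta> u = (%x. japanese x ^ p *\<^sub>R rep_L2 v x)" for p
    using weak_deriv_eqI[OF v] by (simp add: weighted_deriv_def[abs_def])
  have su: "Linf_norm (weighted_deriv n \<gamma> u) <= (SUP \<beta>\<in>{\<beta>. morder \<beta> = j}. Linf_norm (weighted_deriv n \<beta> u))"
    if "morder \<gamma> = j" for j \<gamma>
    by (rule cSUP_upper[OF _ bdd_above_finite]) (use that in "auto intro!: finite_imageI finite_morder")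
  have s0: "0 <= (SUP \<beta>\<in>{\<beta>. morder \<beta> = j}. Linf_norm (weighted_deriv n \<beta> u))" for j
  proof -
    obtain \<gamma> :: "'n multiindex" where "morder \<gamma> = j" using morder_nonempty by blast
    from su[OF this] Linf_norm_nonneg[of "weighted_deriv n \<gamma> u"] show ?thesis by linarith
  qed
  have l0: "0 <= L2_norm (f :: real^'n => complex)" for f by (simp add: L2_norm_def)
  have A0: "0 <= ?A" by (intro sum_nonneg s0)
  have B0: "0 <= ?B" by (intro sum_nonneg l0)
  have "if morder \<beta> < 2*m+1 then LB n (Xnorm k m n u) v else wn (Pw k n (morder \<beta> - (2*m+1))) (Xnorm k m n u) v"
  proof (cases "morder \<beta> < 2*m+1")
    case True
    then have "bounded_AE (weighted_deriv n \<beta> u)" using u unfolding Xspace_def Let_def by auto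
    then have "LB n (Linf_norm (weighted_deriv n \<beta> u)) v" unfolding wv by (rule bounded_LB)
    moreover have "(SUP \<beta>\<in>{\<beta>. morder \<beta> = morder \<beta>'}. Linf_norm (weighted_deriv n \<beta> u)) <= ?A" if "\<beta>' = \<beta>" for \<beta>'
      by (rule member_le_sum) (use True that s0 in auto)
    ultimately have "LB n (Xnorm k m n u) v"
      using su[of \<beta> "morder \<beta>"] B0 by (elim LB_mono) (simp add: Xnorm_def)
    then show ?thesis using True by simp
  next
    case False
    \<comment> \<open>This locates, for the order of \<beta>, a summand of the norm that contains
      it: the excess of i over k + 1 is \<mu>, so that n - \<mu> is the weight
      \<open>Pw k n i\<close>.\<close>
    define i \<mu> \<nu> where "i = morder \<beta> - (2*m+1)" and "\<mu> = i - (k+1)" and "\<nu> = min i (k+1)"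
    have i: "\<nu> <= k+1" "\<mu> <= n" "morder \<beta> = \<nu> + \<mu> + 2*m + 1" "Pw k n i = n - \<mu>"
      using b False by (auto simp: i_def \<mu>_def \<nu>_def Pw_def)
    have sq: "square_integrable (weighted_deriv (n - \<mu>) \<beta> u)"
    proof (cases "morder \<beta> <= 2*m+2+k")
      case True
      then have "\<mu> = 0" by (simp add: \<mu>_def i_def)
      then show ?thesis using u True False unfolding Xspace_def Let_def by auto
    next
      case F: False
      have "n - \<mu> = 2*m+2+k+n - morder \<beta>" using F b by (simp add: \<mu>_def i_def)
      then show ?thesis using u F b unfolding Xspace_def Let_def by auto
    qed
    have "L2_norm (weighted_deriv (n - \<mu>) \<beta> u) <= (\<Sum>\<beta> | morder \<beta> = \<nu> + \<mu> + 2*m + 1. L2_norm (weighted_deriv (n - \<mu>) \<beta> u))"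
      by (rule member_le_sum) (use i(3) l0 finite_morder in auto)
    also have "\<dots> <= (\<Sum>\<mu>=0..n. \<Sum>\<beta> | morder \<beta> = \<nu> + \<mu> + 2*m + 1. L2_norm (weighted_deriv (n - \<mu>) \<beta> u))"
      by (rule member_le_sum) (use i(2) in "auto intro!: sum_nonneg l0")
    also have "\<dots> <= ?B"
      by (rule member_le_sum) (use i(1) in "auto intro!: sum_nonneg l0")
    also have "\<dots> <= Xnorm k m n u" unfolding Xnorm_def using A0 by linarith
    finally have "wn (n - \<mu>) (Xnorm k m n u) v" using sq unfolding wn_iff wv by simp
    then show ?thesis using False i(4) by (simp add: i_def)
  qed
  with v show "\<exists>v. has_weak_deriv \<beta> u v & (if morder \<beta> < 2*m+1 then LB n (Xnorm k m n u) v
      else wn (Pw k n (morder \<beta> - (2*m+1))) (Xnorm k m n u) v)" by blast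
qed

section \<open>Functions with bounded jets\<close>

definition L2b :: "(real^'n::finite => complex) => real => bool" where
  "L2b f K \<longleftrightarrow> sqi f & norm (abs_L2 f) <= K"

lemma L2b_bound:
  assumes g: "L2b g K" and f: "f \<in> BM" and le: "AE x in lborel. cmod (f x) <= c * cmod (g x)" and c: "0 <= c"
  shows "L2b f (c * K)"
proof -
  have sg: "sqi g" using g by (simp add: L2b_def)
  have sf: "sqi f"
    by (rule sqi_bound[OF sqi_cmult[OF sg, of "of_real c"] f]) (use le c in "simp add: norm_mult")
  have "norm (abs_L2 f) <= c * norm (abs_L2 g)"
  proof (rule norm_le_of_AE[OF _ c])
    show "AE x in lborel. cmod (rp (abs_L2 f) x) <= c * cmod (rp (abs_L2 g) x)"
      using rp_abs[OF sf] rp_abs[OF sg] le by eventually_elim simp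
  qed
  also have "\<dots> <= c * K" using g c by (intro mult_left_mono) (auto simp: L2b_def)
  finally show ?thesis using sf by (simp add: L2b_def)
qed

lemma L2b_add: "L2b f K ==> L2b g L ==> L2b (%x. f x + g x) (K + L)"
  unfolding L2b_def using norm_triangle_ineq[of "abs_L2 f" "abs_L2 g"]
  by (auto simp: abs_add sqi_add)

lemma L2b_mono: "L2b f K ==> K <= L ==> L2b f L"
  by (auto simp: L2b_def)

definition cjp :: "real => real^'n::finite => complex" where
  "cjp s x = of_real (japanese x powr s)"

lemma cjp_measurable [measurable]: "cjp s \<in> BM"
  unfolding cjp_def[abs_def] by measurable

lemma cmod_cjp [simp]: "cmod (cjp s x) = japanese x powr s"
  by (simp add: cjp_def)

lemma cjp_add: "cjp (s + t) x = cjp s x * cjp t x"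
  by (simp add: cjp_def powr_add)

lemma cjp_0 [simp]: "cjp 0 x = 1"
  using japanese_pos[of x] by (simp add: cjp_def)

lemma japanese_powr_mono: "s <= t ==> japanese x powr s <= japanese x powr t"
  by (rule powr_mono) (auto simp: japanese_ge_1)

section \<open>Leibniz coefficients and the submultiplicative norm\<close>

definition conv :: "(nat => real) => (nat => real) => nat => real" where
  "conv c d l = (\<Sum>i\<le>l. real (l choose i) * (c i * d (l - i)))"

lemma conv_0 [simp]: "conv c d 0 = c 0 * d 0"
  by (simp add: conv_def)

text \<open>Pascal's rule. The two summands are the bounds for the two terms of the product rule, so
  that this recursion fits the induction on jets.\<close>

lemma conv_Suc: "conv c d (Suc l) = conv (%i. c (Suc i)) d l + conv c (%i. d (Suc i)) l"
proof -
  have "conv c d (Suc l) = c 0 * d (Suc l) + (\<Sum>i\<le>l. real (Suc l choose Suc i) * (c (Suc i) * d (l - i)))"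
    unfolding conv_def by (subst sum.atMost_Suc_shift) simp
  also have "(\<Sum>i\<le>l. real (Suc l choose Suc i) * (c (Suc i) * d (l - i)))
    = conv (%i. c (Suc i)) d l + (\<Sum>i\<le>l. real (l choose Suc i) * (c (Suc i) * d (l - i)))"
    unfolding conv_def by (simp add: sum.distrib distrib_right)
  also have "(\<Sum>i\<le>l. real (l choose Suc i) * (c (Suc i) * d (l - i)))
    = (\<Sum>i<l. real (l choose Suc i) * (c (Suc i) * d (Suc (l - Suc i))))"
  proof -
    have "(\<Sum>i\<le>l. real (l choose Suc i) * (c (Suc i) * d (l - i))) = (\<Sum>i<l. real (l choose Suc i) * (c (Suc i) * d (l - i)))"
      unfolding lessThan_Suc_atMost[symmetric] by (simp add: binomial_eq_0)
    also have "\<dots> = (\<Sum>i<l. real (l choose Suc i) * (c (Suc i) * d (Suc (l - Suc i))))"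
      by (intro sum.cong) (auto simp: Suc_diff_Suc)
    finally show ?thesis .
  qed
  also have "c 0 * d (Suc l) + (conv (%i. c (Suc i)) d l + \<dots>) = conv (%i. c (Suc i)) d l + conv c (%i. d (Suc i)) l"
  proof -
    have "conv c (%i. d (Suc i)) l = (\<Sum>i<Suc l. real (l choose i) * (c i * d (Suc (l - i))))"
      unfolding conv_def lessThan_Suc_atMost ..
    also have "\<dots> = c 0 * d (Suc l) + (\<Sum>i<l. real (l choose Suc i) * (c (Suc i) * d (Suc (l - Suc i))))"
      by (subst sum.lessThan_Suc_shift) simp
    finally show ?thesis by simp
  qed
  finally show ?thesis .
qed

lemma conv_nonneg: "(!!i. 0 <= c i) ==> (!!i. 0 <= d i) ==> 0 <= conv c d l"
  unfolding conv_def by (intro sum_nonneg mult_nonneg_nonneg) auto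

definition En :: "nat => real => (nat => real) => real" where
  "En J \<epsilon> c = (\<Sum>l\<le>J. \<epsilon> ^ l / fact l * c l)"

text \<open>Division by l! turns the binomial convolution into a Cauchy product. Truncation at J
  only drops nonnegative terms from the product of the two sums.\<close>

lemma En_conv:
  assumes c: "!!i. 0 <= c i" and d: "!!i. 0 <= d i" and e: "0 <= \<epsilon>"
  shows "En J \<epsilon> (conv c d) <= En J \<epsilon> c * En J \<epsilon> d"
proof -
  define a b where "a i = \<epsilon> ^ i / fact i * c i" and "b i = \<epsilon> ^ i / fact i * d i" for i
  have ab: "0 <= a i" "0 <= b i" for i using assms by (auto simp: a_def b_def)
  have "\<epsilon> ^ l / fact l * conv c d l = (\<Sum>i\<le>l. a i * b (l - i))" for l
    unfolding conv_def sum_distrib_left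
  proof (rule sum.cong[OF refl])
    fix i assume i: "i \<in> {..l}"
    have "real (l choose i) = fact l / (fact i * fact (l - i))" using i by (simp add: binomial_fact)
    moreover have "\<epsilon> ^ l = \<epsilon> ^ i * \<epsilon> ^ (l - i)" using i by (simp add: power_add[symmetric])
    ultimately show "\<epsilon> ^ l / fact l * (real (l choose i) * (c i * d (l - i))) = a i * b (l - i)"
      by (simp add: a_def b_def)
  qed
  then have "En J \<epsilon> (conv c d) = (\<Sum>l\<le>J. \<Sum>i\<le>l. a i * b (l - i))" by (simp add: En_def)
  also have "\<dots> = (\<Sum>(i,j)\<in>{(i,j). i + j <= J}. a i * b j)"
    by (subst sum.triangle_reindex_eq) simp
  also have "\<dots> <= (\<Sum>(i,j)\<in>{..J}\<times>{..J}. a i * b j)"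
    by (rule sum_mono2) (auto intro!: mult_nonneg_nonneg ab)
  also have "\<dots> = En J \<epsilon> c * En J \<epsilon> d"
    by (simp add: En_def a_def b_def sum_product sum.cartesian_product)
  finally show ?thesis .
qed

lemma En_nonneg: "(!!i. 0 <= c i) ==> 0 <= \<epsilon> ==> 0 <= En J \<epsilon> c"
  unfolding En_def by (intro sum_nonneg mult_nonneg_nonneg) auto

lemma En_add: "En J \<epsilon> (%i. c i + d i) = En J \<epsilon> c + En J \<epsilon> d"
  by (simp add: En_def distrib_left sum.distrib)

lemma En_cmult: "En J \<epsilon> (%i. a * c i) = a * En J \<epsilon> c"
  by (simp add: En_def sum_distrib_left mult_ac)

lemma En_const: "En J \<epsilon> (%i. if i = 0 then a else 0) = a"
  by (simp add: En_def if_distrib sum.delta cong: if_cong)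

lemma En_le:
  assumes c: "!!i. 0 <= c i" and e: "0 < \<epsilon>" and l: "l <= J"
  shows "c l <= fact l / \<epsilon> ^ l * En J \<epsilon> c"
proof -
  have "\<epsilon> ^ l / fact l * c l <= En J \<epsilon> c"
    unfolding En_def by (rule member_le_sum) (use c e l in auto)
  then have "fact l / \<epsilon> ^ l * (\<epsilon> ^ l / fact l * c l) <= fact l / \<epsilon> ^ l * En J \<epsilon> c"
    by (rule mult_left_mono) (use e in simp)
  then show ?thesis using e by simp
qed

lemma En_tendsto: "((%\<epsilon>. En J \<epsilon> c) \<longlongrightarrow> c 0) (at_right 0)"
proof -
  have "continuous_on UNIV (%\<epsilon>. En J \<epsilon> c)" unfolding En_def by (intro continuous_intros) auto
  then have "((%\<epsilon>. En J \<epsilon> c) \<longlongrightarrow> En J 0 c) (at 0)" by (simp add: continuous_on_def)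
  moreover have "En J 0 c = c 0"
  proof -
    have "En J 0 c = (\<Sum>l\<le>J. if l = 0 then c 0 else 0)" unfolding En_def by (intro sum.cong) auto
    then show ?thesis by simp
  qed
  ultimately show ?thesis by (auto intro: tendsto_mono[OF at_le])
qed

text \<open>The parameter \<sigma> is instantiated by n \<alpha>, the decay contributed by
  |u|^\<alpha>. Since J = 2m + 2 + k + n, the condition on m says J < 4m + 2: orders of two factors
  adding up to at most J cannot both exceed 2m.\<close>

locale nls_space =
  fixes k m n :: nat and \<sigma> :: real and ty :: "'n::finite itself"
  assumes k: "real k > real CARD('n) / 2" and n: "real n > real CARD('n) / 2"
    and \<sigma>: "\<sigma> > real CARD('n) / 2" and m: "2 * m >= k + n + 1"
begin

abbreviation X :: "real => 'n L2 => bool" where "X \<equiv> XL k n (2*m+1)"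

abbreviation cw :: "real^'n => complex" where "cw \<equiv> cjp (- real n - \<sigma>)"

definition "J = 2*m + 2 + k + n"

text \<open>The weight lost at order l in comparison with n. It is 0 up to order 2m + 2 + k;
  truncated subtraction covers the orders below 2m + 1.\<close>

definition vl :: "nat => real" where
  "vl l = real (n - Pw k n (l - (2*m+1)))"

lemma vl_mono: "l <= l' ==> vl l <= vl l'"
  by (auto simp: vl_def Pw_def)

lemma vl_bounds: "0 <= vl l" "vl l <= real n"
  by (auto simp: vl_def)

definition c0 :: real where
  "c0 = 1 + norm (abs_L2 (cjp (-\<sigma>) :: real^'n => complex))"

lemma c0: "1 <= c0" by (simp add: c0_def)

lemma L2b_c0: "L2b (cjp (-\<sigma>) :: real^'n => complex) c0"
  using sqi_japanese_powr[OF \<sigma>] by (simp add: L2b_def c0_def cjp_def[abs_def])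

text \<open>A function controlled at order \<open>l\<close>: uniformly with weight \<open>s\<close> if \<open>l \<le> M\<close>, in a weighted \<open>L\<^sup>2\<close>
  space otherwise.  The constant \<open>c0\<close> makes the uniform bound with exponent \<open>\<tau> - \<sigma>\<close> imply the \<open>L\<^sup>2\<close> bound
  with the same constant \<open>c\<close>.\<close>

definition Gb :: "nat => real => real => nat => (real^'n => complex) => real => bool" where
  "Gb M s \<tau> l f c \<longleftrightarrow> f \<in> BM & 0 <= c &
     (if l <= M then AE x in lborel. cmod (f x) <= c * japanese x powr s
      else L2b (%x. cjp (- \<tau> - vl l) x * f x) (c * c0))"

text \<open>By \<open>J < M1 + M2 + 2\<close> at least one factor is controlled uniformly. Two
  uniform factors in an L2 order gain the integrable decay -\<sigma>; a uniform factor times an L2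
  factor stays in L2, its growth being absorbed by \<tau>, and \<open>vl_mono\<close> says that the
  product may have the smaller weight of the two.\<close>

lemma Gb_mult:
  assumes f: "Gb M1 s1 \<tau>1 l1 f c" and g: "Gb M2 s2 \<tau>2 l2 g d"
    and M: "M <= M1" "M <= M2" "J < M1 + M2 + 2" and l: "l1 + l2 <= J"
    and s: "s1 + s2 <= s" "M < J ==> s1 + s2 - \<tau> <= - \<sigma>" "M2 < J ==> s1 - \<tau> <= - \<tau>2" "M1 < J ==> s2 - \<tau> <= - \<tau>1"
  shows "Gb M s \<tau> (l1 + l2) (%x. f x * g x) (c * d)"
proof -
  have [measurable]: "f \<in> BM" "g \<in> BM" and c: "0 <= c" "0 <= d"
    using f g by (auto simp: Gb_def)
  have ff: "AE x in lborel. cmod (f x) <= c * japanese x powr s1" if "l1 <= M1" using f that by (simp add: Gb_def)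
  have gg: "AE x in lborel. cmod (g x) <= d * japanese x powr s2" if "l2 <= M2" using g that by (simp add: Gb_def)
  have fg: "AE x in lborel. cmod (f x * g x) <= c * d * japanese x powr (s1 + s2)" if "l1 <= M1" "l2 <= M2"
    using ff[OF that(1)] gg[OF that(2)]
  proof eventually_elim
    case (elim x)
    have "cmod (f x * g x) <= (c * japanese x powr s1) * (d * japanese x powr s2)"
      unfolding norm_mult by (intro mult_mono elim mult_nonneg_nonneg c) auto
    then show ?case by (simp add: powr_add mult_ac)
  qed
  have "if l1 + l2 <= M then AE x in lborel. cmod (f x * g x) <= c * d * japanese x powr s
    else L2b (%x. cjp (- \<tau> - vl (l1 + l2)) x * (f x * g x)) (c * d * c0)"
  proof (cases "l1 + l2 <= M")
    case True
    have "AE x in lborel. cmod (f x * g x) <= c * d * japanese x powr s"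
      using fg
    proof (rule eventually_mono)
      show "cmod (f x * g x) <= c * d * japanese x powr s" if "cmod (f x * g x) <= c * d * japanese x powr (s1 + s2)" for x
        using that mult_left_mono[OF japanese_powr_mono[OF s(1), of x], of "c * d"] c by simp
    qed (use True M in auto)
    with True show ?thesis by simp
  next
    case False
    then have MJ: "M < J" using l by simp
    consider "l1 <= M1" "l2 <= M2" | "l1 <= M1" "M2 < l2" | "M1 < l1" "l2 <= M2"
      using l M by linarith
    then have "L2b (%x. cjp (- \<tau> - vl (l1 + l2)) x * (f x * g x)) (c * d * c0)"
    proof cases
      case 1
      have "AE x in lborel. cmod (cjp (- \<tau> - vl (l1 + l2)) x * (f x * g x)) <= (c * d) * cmod (cjp (- \<sigma>) x)"
        using fg[OF 1]
      proof eventually_elim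
        case (elim x)
        have "cmod (cjp (- \<tau> - vl (l1 + l2)) x * (f x * g x)) <= japanese x powr (- \<tau> - vl (l1 + l2)) * (c * d * japanese x powr (s1 + s2))"
          unfolding norm_mult[of "cjp (- \<tau> - vl (l1 + l2)) x"] cmod_cjp by (rule mult_left_mono[OF elim]) simp
        also have "\<dots> = (c * d) * japanese x powr (- \<tau> - vl (l1 + l2) + (s1 + s2))" by (simp add: powr_add)
        also have "\<dots> <= (c * d) * japanese x powr (- \<sigma>)"
          by (intro mult_left_mono japanese_powr_mono) (use s(2)[OF MJ] vl_bounds(1)[of "l1 + l2"] c in auto)
        finally show ?case by simp
      qed
      then show ?thesis by (intro L2b_bound[OF L2b_c0]) (use c in auto)
    next
      case 2
      have "L2b (%x. cjp (- \<tau>2 - vl l2) x * g x) (d * c0)" using g 2 by (simp add: Gb_def)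
      moreover have "AE x in lborel. cmod (cjp (- \<tau> - vl (l1 + l2)) x * (f x * g x)) <= c * cmod (cjp (- \<tau>2 - vl l2) x * g x)"
        using ff[OF 2(1)]
      proof eventually_elim
        case (elim x)
        have "cmod (cjp (- \<tau> - vl (l1 + l2)) x * (f x * g x)) = (japanese x powr (- \<tau> - vl (l1 + l2)) * cmod (g x)) * cmod (f x)"
          by (simp add: norm_mult)
        also have "\<dots> <= (japanese x powr (- \<tau> - vl (l1 + l2)) * cmod (g x)) * (c * japanese x powr s1)"
          by (rule mult_left_mono[OF elim]) simp
        also have "\<dots> = (c * cmod (g x)) * japanese x powr (- \<tau> - vl (l1 + l2) + s1)" by (simp add: powr_add)
        also have "\<dots> <= (c * cmod (g x)) * japanese x powr (- \<tau>2 - vl l2)"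
          by (intro mult_left_mono japanese_powr_mono) (use s(3) 2 l vl_mono[of l2 "l1 + l2"] c in auto)
        finally show ?case by (simp add: norm_mult mult_ac)
      qed
      ultimately show ?thesis using L2b_bound[OF _ _ _ c(1)] by (fastforce simp: mult.assoc)
    next
      case 3
      have "L2b (%x. cjp (- \<tau>1 - vl l1) x * f x) (c * c0)" using f 3 by (simp add: Gb_def)
      moreover have "AE x in lborel. cmod (cjp (- \<tau> - vl (l1 + l2)) x * (f x * g x)) <= d * cmod (cjp (- \<tau>1 - vl l1) x * f x)"
        using gg[OF 3(2)]
      proof eventually_elim
        case (elim x)
        have "cmod (cjp (- \<tau> - vl (l1 + l2)) x * (f x * g x)) = (japanese x powr (- \<tau> - vl (l1 + l2)) * cmod (f x)) * cmod (g x)"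
          by (simp add: norm_mult)
        also have "\<dots> <= (japanese x powr (- \<tau> - vl (l1 + l2)) * cmod (f x)) * (d * japanese x powr s2)"
          by (rule mult_left_mono[OF elim]) simp
        also have "\<dots> = (d * cmod (f x)) * japanese x powr (- \<tau> - vl (l1 + l2) + s2)" by (simp add: powr_add)
        also have "\<dots> <= (d * cmod (f x)) * japanese x powr (- \<tau>1 - vl l1)"
          by (intro mult_left_mono japanese_powr_mono) (use s(4) 3 l vl_mono[of l1 "l1 + l2"] c in auto)
        finally show ?case by (simp add: norm_mult mult_ac)
      qed
      ultimately have "L2b (%x. cjp (- \<tau> - vl (l1 + l2)) x * (f x * g x)) (d * (c * c0))"
        by (intro L2b_bound[OF _ _ _ c(2)]) auto
      then show ?thesis by (simp add: mult_ac)
    qed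
    with False show ?thesis by simp
  qed
  with c show ?thesis by (simp add: Gb_def)
qed

lemma Gb_add:
  assumes f: "Gb M s \<tau> l f c" and g: "Gb M s \<tau> l g d"
  shows "Gb M s \<tau> l (%x. f x + g x) (c + d)"
proof -
  have "AE x in lborel. cmod (f x + g x) <= (c + d) * japanese x powr s" if "l <= M"
  proof -
    have "AE x in lborel. cmod (f x) <= c * japanese x powr s" "AE x in lborel. cmod (g x) <= d * japanese x powr s"
      using f g that by (auto simp: Gb_def)
    then show ?thesis
    proof eventually_elim
      case (elim x)
      then show ?case using norm_triangle_ineq[of "f x" "g x"] by (simp add: distrib_right)
    qed
  qed
  moreover have "L2b (%x. cjp (- \<tau> - vl l) x * (f x + g x)) ((c + d) * c0)" if "\<not> l <= M"
    using L2b_add[of "%x. cjp (- \<tau> - vl l) x * f x" "c * c0" "%x. cjp (- \<tau> - vl l) x * g x" "d * c0"] f g that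
    by (simp add: Gb_def distrib_left distrib_right)
  ultimately show ?thesis using f g by (auto simp: Gb_def)
qed

lemma Gb_bound:
  assumes f: "Gb M s \<tau> l f c" and g: "g \<in> BM" and le: "!!x. cmod (g x) <= a * cmod (f x)" and a: "0 <= a"
  shows "Gb M s \<tau> l g (a * c)"
proof -
  have "AE x in lborel. cmod (g x) <= (a * c) * japanese x powr s" if "l <= M"
  proof -
    have "AE x in lborel. cmod (f x) <= c * japanese x powr s" using f that by (auto simp: Gb_def)
    then show ?thesis
    proof eventually_elim
      case (elim x)
      show ?case using le[of x] mult_left_mono[OF elim a] by (simp add: mult.assoc)
    qed
  qed
  moreover have "L2b (%x. cjp (- \<tau> - vl l) x * g x) (a * c * c0)" if "\<not> l <= M"
  proof -
    have "L2b (%x. cjp (- \<tau> - vl l) x * f x) (c * c0)" using f that by (simp add: Gb_def)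
    then have "L2b (%x. cjp (- \<tau> - vl l) x * g x) (a * (c * c0))"
    proof (rule L2b_bound[OF _ _ _ a])
      show "AE x in lborel. cmod (cjp (- \<tau> - vl l) x * g x) <= a * cmod (cjp (- \<tau> - vl l) x * f x)"
      proof (rule AE_I2)
        show "cmod (cjp (- \<tau> - vl l) x * g x) <= a * cmod (cjp (- \<tau> - vl l) x * f x)" for x
          using mult_left_mono[OF le[of x], of "japanese x powr (- \<tau> - vl l)"]
          by (simp add: norm_mult mult.left_commute)
      qed
    qed (use g in measurable)
    then show ?thesis by (simp add: mult.assoc)
  qed
  ultimately show ?thesis using f g a by (auto simp: Gb_def)
qed

lemma Gb_mono:
  assumes "Gb M s \<tau> l f c" "c <= c'" shows "Gb M s \<tau> l f c'"
proof -
  have "AE x in lborel. cmod (f x) <= c' * japanese x powr s" if "l <= M"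
  proof -
    have "AE x in lborel. cmod (f x) <= c * japanese x powr s" using assms(1) that by (auto simp: Gb_def)
    then show ?thesis
    proof eventually_elim
      case (elim x)
      show ?case using elim mult_right_mono[OF assms(2), of "japanese x powr s"] by simp
    qed
  qed
  moreover have "c * c0 <= c' * c0" using assms(2) c0 by (intro mult_right_mono) auto
  ultimately show ?thesis using assms L2b_mono[of _ "c * c0" "c' * c0"] unfolding Gb_def by auto
qed

lemma Gb_zero: "Gb M s \<tau> l (%x. 0) 0"
  by (simp add: Gb_def L2b_def sqi_zero abs_zero)

text \<open>The derivatives form a tree of \<open>ACL\<close> derivatives, r levels deep. The number
  l is the absolute order of f in a larger jet, since \<open>Gb\<close> changes its meaning with
  that order; \<open>c i\<close> bounds everything i levels below.\<close>

primrec Jet :: "nat => nat => nat => real => real => (real^'n => complex) => (nat => real) => bool" where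
  "Jet 0 l M s \<tau> f c \<longleftrightarrow> Gb M s \<tau> l f (c 0)"
| "Jet (Suc r) l M s \<tau> f c \<longleftrightarrow> Gb M s \<tau> l f (c 0) & (\<forall>j. \<exists>f'. ACL j f f' & Jet r (Suc l) M s \<tau> f' (%i. c (Suc i)))"

lemma Jet_Gb: "Jet r l M s \<tau> f c ==> Gb M s \<tau> l f (c 0)"
  by (cases r) auto

lemma Jet_mono: "Jet r l M s \<tau> f c ==> (!!i. i <= r ==> c i <= c' i) ==> Jet r l M s \<tau> f c'"
proof (induction r arbitrary: l f c c')
  case (Suc r)
  have "\<exists>f'. ACL j f f' & Jet r (Suc l) M s \<tau> f' (%i. c' (Suc i))" for j
  proof -
    obtain f' where f': "ACL j f f'" "Jet r (Suc l) M s \<tau> f' (%i. c (Suc i))" using Suc(2) by auto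
    have "Jet r (Suc l) M s \<tau> f' (%i. c' (Suc i))" by (rule Suc(1)[OF f'(2)]) (use Suc(3) in simp)
    with f'(1) show ?thesis by blast
  qed
  then show ?case using Suc(2) Gb_mono[OF _ Suc(3)[of 0]] by simp
qed (auto intro: Gb_mono)

lemma Jet_less: "Jet r l M s \<tau> f c ==> r' <= r ==> Jet r' l M s \<tau> f c"
proof (induction r arbitrary: r' l f c)
  case (Suc r)
  show ?case
  proof (cases r')
    case 0
    then show ?thesis using Jet_Gb[OF Suc(2)] by simp
  next
    case (Suc r'')
    have "\<exists>f'. ACL j f f' & Jet r'' (Suc l) M s \<tau> f' (%i. c (Suc i))" for j
    proof -
      obtain f' where f': "ACL j f f'" "Jet r (Suc l) M s \<tau> f' (%i. c (Suc i))" using Suc.prems(1) by auto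
      have "Jet r'' (Suc l) M s \<tau> f' (%i. c (Suc i))" by (rule Suc.IH[OF f'(2)]) (use Suc Suc.prems(2) in simp)
      with f'(1) show ?thesis by blast
    qed
    then show ?thesis using Suc Suc.prems(1) by simp
  qed
qed auto

lemma Jet_add: "Jet r l M s \<tau> f c ==> Jet r l M s \<tau> g d ==> Jet r l M s \<tau> (%x. f x + g x) (%i. c i + d i)"
proof (induction r arbitrary: l f g c d)
  case (Suc r)
  have "\<exists>h. ACL j (%x. f x + g x) h & Jet r (Suc l) M s \<tau> h (%i. c (Suc i) + d (Suc i))" for j
  proof -
    obtain f' where f': "ACL j f f'" "Jet r (Suc l) M s \<tau> f' (%i. c (Suc i))" using Suc(2) by auto
    obtain g' where g': "ACL j g g'" "Jet r (Suc l) M s \<tau> g' (%i. d (Suc i))" using Suc(3) by auto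
    show ?thesis using ACL_add[OF f'(1) g'(1)] Suc(1)[OF f'(2) g'(2)] by blast
  qed
  then show ?case using Suc(2,3) by (simp add: Gb_add)
qed (simp add: Gb_add)

lemma Jet_cmult: "Jet r l M s \<tau> f c ==> Jet r l M s \<tau> (%x. a * f x) (%i. cmod a * c i)"
proof (induction r arbitrary: l f c)
  case 0
  then have [measurable]: "f \<in> BM" by (simp add: Gb_def)
  show ?case using Gb_bound[OF 0[unfolded Jet.simps], of "%x. a * f x" "cmod a"] by (simp add: norm_mult)
next
  case (Suc r)
  have [measurable]: "f \<in> BM" using Suc(2) by (simp add: Gb_def)
  have "Gb M s \<tau> l (%x. a * f x) (cmod a * c 0)"
    using Gb_bound[OF Jet_Gb[OF Suc(2)], of "%x. a * f x" "cmod a"] by (simp add: norm_mult)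
  moreover have "\<exists>h. ACL j (%x. a * f x) h & Jet r (Suc l) M s \<tau> h (%i. cmod a * c (Suc i))" for j
  proof -
    obtain f' where f': "ACL j f f'" "Jet r (Suc l) M s \<tau> f' (%i. c (Suc i))" using Suc(2) by auto
    show ?thesis using ACL_cmult[OF f'(1), of a] Suc(1)[OF f'(2)] by blast
  qed
  ultimately show ?case by simp
qed

lemma Jet_cnj: "Jet r l M s \<tau> f c ==> Jet r l M s \<tau> (%x. cnj (f x)) c"
proof (induction r arbitrary: l f c)
  case 0
  then have [measurable]: "f \<in> BM" by (simp add: Gb_def)
  show ?case using Gb_bound[OF 0[unfolded Jet.simps], of "%x. cnj (f x)" 1] cnj_measurable by simp
next
  case (Suc r)
  have [measurable]: "f \<in> BM" using Suc(2) by (simp add: Gb_def)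
  have "Gb M s \<tau> l (%x. cnj (f x)) (c 0)"
    using Gb_bound[OF Jet_Gb[OF Suc(2)], of "%x. cnj (f x)" 1] cnj_measurable by simp
  moreover have "\<exists>h. ACL j (%x. cnj (f x)) h & Jet r (Suc l) M s \<tau> h (%i. c (Suc i))" for j
  proof -
    obtain f' where f': "ACL j f f'" "Jet r (Suc l) M s \<tau> f' (%i. c (Suc i))" using Suc(2) by auto
    show ?thesis using ACL_cnj[OF f'(1)] Suc(1)[OF f'(2)] by blast
  qed
  ultimately show ?case by simp
qed

lemma Jet_zero: "Jet r l M s \<tau> (%x. 0) (%i. 0)"
  by (induction r arbitrary: l) (auto simp: Gb_zero intro!: exI[of _ "%x. 0"] ACL_const)

lemma Jet_mult:
  assumes M: "M <= M1" "M <= M2" "J < M1 + M2 + 2"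
    and s: "s1 + s2 <= s" "M < J ==> s1 + s2 - \<tau> <= - \<sigma>" "M2 < J ==> s1 - \<tau> <= - \<tau>2" "M1 < J ==> s2 - \<tau> <= - \<tau>1"
  shows "Jet r l1 M1 s1 \<tau>1 f c ==> Jet r l2 M2 s2 \<tau>2 g d ==> l1 + l2 + r <= J ==>
    Jet r (l1 + l2) M s \<tau> (%x. f x * g x) (conv c d)"
proof (induction r arbitrary: l1 l2 f g c d)
  case 0
  then show ?case using Gb_mult[OF _ _ M _ s] by simp
next
  case (Suc r)
  have "Gb M s \<tau> (l1 + l2) (%x. f x * g x) (c 0 * d 0)"
    by (rule Gb_mult[OF Jet_Gb[OF Suc(2)] Jet_Gb[OF Suc(3)] M _ s]) (use Suc(4) in auto)
  moreover have "\<exists>h. ACL j (%x. f x * g x) h & Jet r (Suc (l1 + l2)) M s \<tau> h (%i. conv c d (Suc i))" for j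
  proof -
    obtain f' where f': "ACL j f f'" "Jet r (Suc l1) M1 s1 \<tau>1 f' (%i. c (Suc i))" using Suc(2) by auto
    obtain g' where g': "ACL j g g'" "Jet r (Suc l2) M2 s2 \<tau>2 g' (%i. d (Suc i))" using Suc(3) by auto
    have "Jet r (Suc l1 + l2) M s \<tau> (%x. f' x * g x) (conv (%i. c (Suc i)) d)"
      by (rule Suc(1)[OF f'(2) Jet_less[OF Suc(3)]]) (use Suc(4) in auto)
    moreover have "Jet r (l1 + Suc l2) M s \<tau> (%x. f x * g' x) (conv c (%i. d (Suc i)))"
      by (rule Suc(1)[OF Jet_less[OF Suc(2)] g'(2)]) (use Suc(4) in auto)
    ultimately have "Jet r (Suc (l1 + l2)) M s \<tau> (%x. f' x * g x + f x * g' x) (%i. conv c d (Suc i))"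
      unfolding conv_Suc using Jet_add by simp
    then show ?thesis using ACL_mult[OF f'(1) g'(1)] by blast
  qed
  ultimately show ?case by simp
qed

lemma Jet_const:
  assumes "0 <= s" "l <= M" shows "Jet r l M s \<tau> (%x. a) (%i. if i = 0 then cmod a else 0)"
proof -
  have "Gb M s \<tau> l (%x. a) (cmod a)"
  proof -
    have "1 <= japanese x powr s" for x :: "real^'n"
      using japanese_ge_1[of x] assms(1) by (simp add: ge_one_powr_ge_zero)
    then have "cmod a <= cmod a * japanese x powr s" for x :: "real^'n"
      using mult_left_mono[of 1 "japanese x powr s" "cmod a"] by simp
    then show ?thesis using assms(2) by (simp add: Gb_def)
  qed
  then show ?thesis using Jet_zero ACL_const by (cases r) fastforce+
qed

end

lemma ACL_cjp: "ACL (j :: 'n::finite) (cjp s) (%x. of_real s * (of_real (x $ j) * cjp (s - 2) x))"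
proof (rule ACL_classical)
  fix x :: "real^'n" and h :: real
  define \<phi> where "\<phi> h = 1 + (norm (sh j h x))^2" for h
  have \<phi>pos: "0 < \<phi> h" for h unfolding \<phi>_def by (simp add: add_pos_nonneg)
  have \<phi>eq: "\<phi> h = 1 + (norm x)^2 + 2 * h * (x $ j) + h^2" for h
    unfolding \<phi>_def power2_norm_eq_inner
    by (simp add: inner_add_left inner_add_right inner_axis inner_axis_axis inner_axis' power2_eq_square distrib_left)
  have jp: "japanese (sh j h x) powr t = \<phi> h powr (t / 2)" for h t
    unfolding japanese_def \<phi>_def[symmetric] using \<phi>pos[of h] by (simp add: powr_half_sqrt[symmetric] powr_powr)
  have "(\<phi> has_real_derivative 2 * (x $ j) + 2 * h) (at h)"
    unfolding \<phi>eq[abs_def] by (auto intro!: derivative_eq_intros)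
  from DERIV_powr[OF this \<phi>pos DERIV_const[of "s/2"]]
  have "((%h. \<phi> h powr (s/2)) has_real_derivative s * ((x $ j + h) * \<phi> h powr ((s - 2)/2))) (at h)"
  proof (rule DERIV_cong)
    have *: "a * (0 * L + (2 * X + 2 * H) * (s / 2) / p) = s * ((X + H) * (a / p))" if "p ~= 0" for a L X H p :: real
      using that by (simp add: field_simps)
    have "\<phi> h powr ((s - 2) / 2) = \<phi> h powr (s/2) / \<phi> h"
      using \<phi>pos[of h] powr_diff[of "\<phi> h" "s/2" 1] by (simp add: diff_divide_distrib)
    then show "\<phi> h powr (s / 2) * (0 * ln (\<phi> h) + (2 * (x $ j) + 2 * h) * (s / 2) / \<phi> h) = s * ((x $ j + h) * \<phi> h powr ((s - 2) / 2))"
      using *[of "\<phi> h"] \<phi>pos[of h] by simp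
  qed
  then have "((%h. japanese (sh j h x) powr s) has_real_derivative
      s * ((sh j h x) $ j * japanese (sh j h x) powr (s - 2))) (at h)"
    unfolding jp by simp
  from bounded_linear.has_vector_derivative[OF bounded_linear_of_real this[unfolded has_real_derivative_iff_has_vector_derivative]]
  show "((%h. cjp s (sh j h x)) has_vector_derivative
      of_real s * (of_real ((sh j h x) $ j) * cjp (s - 2) (sh j h x))) (at h)"
    by (simp add: cjp_def)
next
  have "continuous_on UNIV (%x :: real^'n. japanese x powr (s - 2))"
  proof (rule continuous_on_powr)
    show "continuous_on UNIV (japanese :: real^'n => real)"
      unfolding japanese_def[abs_def] by (intro continuous_intros)
  qed (simp_all add: japanese_pos[THEN less_imp_neq, THEN not_sym])
  then show "continuous_on UNIV (%x :: real^'n. of_real s * (of_real (x $ j) * cjp (s - 2) x))"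
    unfolding cjp_def by (intro continuous_on_mult continuous_on_of_real continuous_on_const continuous_on_component continuous_on_id)
qed measurable

lemma wn_L2b:
  assumes "wn p K g" shows "L2b (%x. cjp (real p) x * rp g x) K"
proof -
  obtain a where a: "wM p g a" "norm a <= K" using assms by (rule wnE)
  have "L2b (%x. cjp (real p) x * rp g x) (1 * K)"
  proof (rule L2b_bound)
    show "L2b (rp a) K" using a(2) by (simp add: L2b_def sqi_rp abs_rp)
    show "AE x in lborel. cmod (cjp (real p) x * rp g x) <= 1 * cmod (rp a x)"
      using a(1) unfolding isM_def
      by eventually_elim (simp add: cjp_def powr_realpow[OF japanese_pos])
  qed auto
  then show ?thesis by simp
qed

lemma L2b_wn:
  assumes "L2b (%x. cjp (real p) x * f x) K" "sqi f" shows "wn p K (abs_L2 f)"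
proof (rule wnI)
  show "wM p (abs_L2 f) (abs_L2 (%x. cjp (real p) x * f x))"
    using rp_abs[OF assms(2)] rp_abs[of "%x. cjp (real p) x * f x"] assms(1) unfolding isM_def L2b_def
    by (auto elim!: eventually_elim2 simp: cjp_def powr_realpow[OF japanese_pos])
qed (use assms in "simp add: L2b_def")

lemma conv_cmult: "conv c (%i. a * d i) l = a * conv c d l"
  by (simp add: conv_def sum_distrib_left mult_ac)

section \<open>Powers of the weight, and the algebra \<open>Al\<close>\<close>

context nls_space
begin

lemma Jet_coord:
  assumes "l + r <= J"
  shows "Jet r l J 1 \<tau> (%x. of_real (x $ i)) (%_. 1)"
proof -
  have G: "Gb J 1 \<tau> l (%x. of_real (x $ i)) 1"
    using assms by (auto simp: Gb_def abs_coord_le_japanese powr_one[OF less_imp_le[OF japanese_pos]] intro!: AE_I2)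
  show ?thesis
  proof (cases r)
    case (Suc r')
    have "Jet r' (Suc l) J 1 \<tau> (%x. if i = j then 1 else 0) (%_. 1)" for j
      by (rule Jet_mono[OF Jet_const]) (use assms Suc in auto)
    then show ?thesis using G ACL_coord Suc by auto
  qed (use G in simp)
qed

text \<open>The derivative s x_j <x>^(s-2) is a coordinate of growth 1 times a power of growth s -
  2, hence again of growth at most s. With the threshold J all orders are uniform, and the L2 clause
  of \<open>Gb\<close> never comes into play.\<close>

lemma Jet_cjp: "l + r <= J ==> \<exists>c. (\<forall>i. 0 <= c i) & Jet r l J s \<tau> (cjp s) c"
proof (induction r arbitrary: l s)
  case 0
  have "Gb J s \<tau> l (cjp s) 1" using 0 by (simp add: Gb_def)
  then show ?case by (intro exI[of _ "%_. 1"]) simp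
next
  case (Suc r)
  have G: "Gb J s \<tau> l (cjp s) 1" using Suc(2) by (simp add: Gb_def)
  obtain c where c: "!!i. 0 <= c i" "Jet r (Suc l) J (s - 2) \<tau> (cjp (s - 2)) c"
    using Suc(1)[of "Suc l" "s - 2"] Suc(2) by auto
  define d where "d i = \<bar>s\<bar> * conv (%_. 1) c i" for i
  have d0: "0 <= d i" for i unfolding d_def by (intro mult_nonneg_nonneg conv_nonneg c) auto
  have "\<exists>f'. ACL j (cjp s) f' & Jet r (Suc l) J s \<tau> f' d" for j
  proof -
    have "Jet r (0 + Suc l) J s \<tau> (%x. of_real (x $ j) * cjp (s - 2) x) (conv (%_. 1) c)"
      by (rule Jet_mult[OF _ _ _ _ _ _ _ Jet_coord c(2)]) (use Suc(2) in auto)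
    from Jet_cmult[OF this, of "of_real s"] show ?thesis using ACL_cjp[of j s] unfolding d_def by auto
  qed
  then show ?case using G d0 by (intro exI[of _ "case_nat 1 d"]) (auto split: nat.split)
qed

text \<open>The growth exponent 0 admits constants, which the function 1 - |w|^2/M^2 needs. The L2
  exponent -\<sigma> in the high orders is weak enough to contain products of bounded
  factors.\<close>

definition Al :: "real => (real^'n => complex) => real => bool" where
  "Al \<epsilon> f K \<longleftrightarrow> (\<exists>c. (\<forall>i. 0 <= c i) & Jet J 0 (2*m) 0 \<sigma> f c & En J \<epsilon> c <= K)"

lemma AlI: "(!!i. 0 <= c i) ==> Jet J 0 (2*m) 0 \<sigma> f c ==> En J \<epsilon> c <= K ==> Al \<epsilon> f K"
  unfolding Al_def by blast

lemma AlE: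
  assumes "Al \<epsilon> f K"
  obtains c where "!!i. 0 <= c i" "Jet J 0 (2*m) 0 \<sigma> f c" "En J \<epsilon> c <= K"
  using assms unfolding Al_def by blast

lemma Al_mono: assumes "Al \<epsilon> f K" "K <= L" shows "Al \<epsilon> f L"
proof -
  obtain c where c: "!!i. 0 <= c i" "Jet J 0 (2*m) 0 \<sigma> f c" "En J \<epsilon> c <= K" using assms(1) by (rule AlE) blast
  show ?thesis by (rule AlI[OF c(1,2)]) (use c(3) assms(2) in simp)
qed

lemma Al_measurable: "Al \<epsilon> f K ==> f \<in> BM"
  using Jet_Gb by (auto simp: Al_def Gb_def)

lemma Al_add: assumes "Al \<epsilon> f K" "Al \<epsilon> g L" shows "Al \<epsilon> (%x. f x + g x) (K + L)"
proof -
  obtain c where c: "!!i. 0 <= c i" "Jet J 0 (2*m) 0 \<sigma> f c" "En J \<epsilon> c <= K" using assms(1) by (rule AlE) blast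
  obtain d where d: "!!i. 0 <= d i" "Jet J 0 (2*m) 0 \<sigma> g d" "En J \<epsilon> d <= L" using assms(2) by (rule AlE) blast
  show ?thesis by (rule AlI[OF _ Jet_add[OF c(2) d(2)]]) (use c d in "auto simp: En_add intro: add_mono")
qed

lemma Al_cmult: assumes "Al \<epsilon> f K" shows "Al \<epsilon> (%x. a * f x) (cmod a * K)"
proof -
  obtain c where c: "!!i. 0 <= c i" "Jet J 0 (2*m) 0 \<sigma> f c" "En J \<epsilon> c <= K" using assms(1) by (rule AlE) blast
  show ?thesis by (rule AlI[OF _ Jet_cmult[OF c(2)]]) (use c in "auto simp: En_cmult intro: mult_left_mono")
qed

lemma Al_diff: assumes "Al \<epsilon> f K" "Al \<epsilon> g L" shows "Al \<epsilon> (%x. f x - g x) (K + L)"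
  using Al_add[OF assms(1) Al_cmult[OF assms(2), of "-1"]] by simp

lemma Al_cnj: "Al \<epsilon> f K ==> Al \<epsilon> (%x. cnj (f x)) K"
  unfolding Al_def using Jet_cnj by blast

lemma Al_const: "Al \<epsilon> (%x. a) (cmod a)"
  by (rule AlI[OF _ Jet_const]) (auto simp: En_const)

lemma Al_zero: "Al \<epsilon> (%x. 0) 0" using Al_const[of \<epsilon> 0] by simp

context
  fixes \<epsilon> :: real
  assumes \<epsilon>: "0 < \<epsilon>"
begin

lemma Al_nonneg: assumes "Al \<epsilon> f K" shows "0 <= K"
proof -
  obtain c where c: "!!i. 0 <= c i" "En J \<epsilon> c <= K" using assms(1) by (rule AlE) blast
  from En_nonneg[of c \<epsilon> J] c \<epsilon> show ?thesis by auto
qed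

lemma Al_mult: assumes "Al \<epsilon> f K" "Al \<epsilon> g L" shows "Al \<epsilon> (%x. f x * g x) (K * L)"
proof -
  obtain c where c: "!!i. 0 <= c i" "Jet J 0 (2*m) 0 \<sigma> f c" "En J \<epsilon> c <= K" using assms(1) by (rule AlE) blast
  obtain d where d: "!!i. 0 <= d i" "Jet J 0 (2*m) 0 \<sigma> g d" "En J \<epsilon> d <= L" using assms(2) by (rule AlE) blast
  have "Jet J (0 + 0) (2*m) 0 \<sigma> (%x. f x * g x) (conv c d)"
    by (rule Jet_mult[OF _ _ _ _ _ _ _ c(2) d(2)]) (use m in "auto simp: J_def")
  then have j: "Jet J 0 (2*m) 0 \<sigma> (%x. f x * g x) (conv c d)" by simp
  have "En J \<epsilon> (conv c d) <= En J \<epsilon> c * En J \<epsilon> d" by (rule En_conv) (use c d \<epsilon> in auto)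
  also have "\<dots> <= K * L" using c d \<epsilon> Al_nonneg[OF assms(1)] by (intro mult_mono En_nonneg) auto
  finally show ?thesis using j conv_nonneg[OF c(1) d(1)] by (intro AlI[OF _ j]) auto
qed

lemma Al_power: assumes "Al \<epsilon> f K" shows "Al \<epsilon> (%x. f x ^ q) (K ^ q)"
proof (induction q)
  case 0
  show ?case using Al_const[of \<epsilon> 1] by simp
next
  case (Suc q)
  then show ?case using Al_mult[OF assms Suc] by simp
qed

lemma Al_sup: assumes "Al \<epsilon> f K" shows "AE x in lborel. cmod (f x) <= K"
proof -
  obtain c where c: "!!i. 0 <= c i" "Jet J 0 (2*m) 0 \<sigma> f c" "En J \<epsilon> c <= K" using assms(1) by (rule AlE) blast
  have "c 0 <= K" using En_le[of c \<epsilon> 0 J] c \<epsilon> by auto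
  moreover have "AE x in lborel. cmod (f x) <= c 0 * japanese x powr 0" using Jet_Gb[OF c(2)] by (simp add: Gb_def)
  ultimately show ?thesis
  proof (elim eventually_mono)
    fix x :: "real^'n" assume "c 0 <= K" "cmod (f x) <= c 0 * japanese x powr 0"
    then show "cmod (f x) <= K" using japanese_pos[of x] by simp
  qed
qed

end

section \<open>Passage between the gauge and jets\<close>

lemma WJ_Jet:
  "i0 + r <= k + 1 + n ==> WJ r (%i. Pw k n (i0 + i)) K g ==>
   Jet r (2*m+1+i0) (2*m) (- real n) (- real n) (rp g) (%_. K)"
proof (induction r arbitrary: i0 g)
  have G: "Gb (2*m) (- real n) (- real n) (2*m+1+i0) (rp g) K" if "wn (Pw k n i0) K g" for i0 and g :: "'n L2"
  proof -
    have K: "0 <= K" using that by (rule wn_nonneg)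
    have "- (- real n) - vl (2*m+1+i0) = real (Pw k n i0)" by (simp add: vl_def Pw_def of_nat_diff)
    moreover have "K * 1 <= K * c0" using K c0 by (intro mult_left_mono) auto
    ultimately show ?thesis using L2b_mono[OF wn_L2b[OF that], of "K * c0"] K by (simp add: Gb_def)
  qed
  {
    case 0
    then show ?case using G[of i0] by (simp add: WJ.simps)
  next
    case (Suc r)
    have "\<exists>f'. ACL j (rp g) f' & Jet r (Suc (2*m+1+i0)) (2*m) (- real n) (- real n) f' (%_. K)" for j
    proof -
      obtain d where d: "D j g d" "WJ r (%i. Pw k n (i0 + Suc i)) K d" using Suc(3) by (auto simp: WJ.simps)
      have "Jet r (2*m+1+Suc i0) (2*m) (- real n) (- real n) (rp d) (%_. K)"
        by (rule Suc(1)) (use Suc(2) d(2) in auto)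
      then show ?thesis using D_imp_ACL[OF d(1)] by auto
    qed
    then show ?case using G[of i0 g] Suc(3) by (simp add: WJ.simps)
  }
qed

text \<open>With both exponents equal to -n, the weight in the L2 clause of \<open>Gb\<close> is n -
  \<open>vl l\<close>, which is exactly \<open>Pw\<close> at that order.\<close>

lemma XL_Jet:
  "l + r = 2*m+1 ==> XL k n r K g ==> Jet (r + (k + 1 + n)) l (2*m) (- real n) (- real n) (rp g) (%_. K)"
proof (induction r arbitrary: l g)
  case 0
  then show ?case using WJ_Jet[of 0 "k+1+n" K g] by simp
next
  case (Suc r)
  have K: "0 <= K" using Suc(3) by (rule XL_nonneg)
  have "LB n K g" using Suc(3) by simp
  then have "AE x in lborel. cmod (rp g x) <= K * japanese x powr (- real n)"
    unfolding LB_def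
  proof (rule eventually_mono)
    show "cmod (rp g x) <= K * japanese x powr (- real n)" if "japanese x ^ n * cmod (rp g x) <= K" for x
      using that japanese_pos[of x] by (simp add: japanese_powr_nat field_simps)
  qed
  then have G: "Gb (2*m) (- real n) (- real n) l (rp g) K" using Suc(2) K by (simp add: Gb_def)
  have "\<exists>f'. ACL j (rp g) f' & Jet (r + (k+1+n)) (Suc l) (2*m) (- real n) (- real n) f' (%_. K)" for j
  proof -
    obtain d where d: "D j g d" "XL k n r K d" using Suc(3) by auto
    have "Jet (r + (k+1+n)) (Suc l) (2*m) (- real n) (- real n) (rp d) (%_. K)"
      by (rule Suc(1)) (use Suc(2) d(2) in auto)
    then show ?thesis using D_imp_ACL[OF d(1)] by auto
  qed
  then show ?case using G by simp
qed

lemma Jet_sqi: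
  assumes "Jet r l (2*m) (- real n) (- real n) f c" shows "sqi f"
proof -
  note G = Jet_Gb[OF assms]
  have [measurable]: "f \<in> BM" using G by (simp add: Gb_def)
  show ?thesis
  proof (cases "l <= 2*m")
    case True
    then have le: "AE x in lborel. cmod (f x) <= c 0 * japanese x powr (- real n)" and c: "0 <= c 0"
      using G by (auto simp: Gb_def)
    have "sqi (%x :: real^'n. of_real (c 0) * complex_of_real (japanese x powr (- real n)))"
      by (intro sqi_cmult sqi_japanese_powr n)
    then show ?thesis
    proof (rule sqi_bound)
      show "AE x in lborel. cmod (f x) <= cmod (of_real (c 0) * complex_of_real (japanese x powr (- real n)))"
        using le by (rule eventually_mono) (use c in "simp add: norm_mult")
    qed simp
  next
    case False
    then have "sqi (%x. cjp (real n - vl l) x * f x)" using G by (simp add: Gb_def L2b_def)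
    then show ?thesis
    proof (rule sqi_bound)
      have "1 <= japanese x powr (real n - vl l)" for x :: "real^'n"
        using japanese_ge_1[of x] vl_bounds(2)[of l] by (simp add: ge_one_powr_ge_zero)
      then have "1 * cmod (f x) <= japanese x powr (real n - vl l) * cmod (f x)" for x
        by (rule mult_right_mono) simp
      then show "AE x in lborel. cmod (f x) <= cmod (cjp (real n - vl l) x * f x)"
        by (simp add: norm_mult)
    qed simp
  qed
qed

lemma Jet_WJ:
  "i0 + r <= k + 1 + n ==> Jet r (2*m+1+i0) (2*m) (- real n) (- real n) f (%_. K) ==>
   WJ r (%i. Pw k n (i0 + i)) (K * c0) (abs_L2 f)"
proof (induction r arbitrary: i0 f)
  have W: "wn (Pw k n i0) (K * c0) (abs_L2 f)" if "Jet r (2*m+1+i0) (2*m) (- real n) (- real n) f (%_. K)" for i0 f r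
  proof (rule L2b_wn[OF _ Jet_sqi[OF that]])
    have "- (- real n) - vl (2*m+1+i0) = real (Pw k n i0)" by (simp add: vl_def Pw_def of_nat_diff)
    then show "L2b (%x. cjp (real (Pw k n i0)) x * f x) (K * c0)" using Jet_Gb[OF that] by (simp add: Gb_def)
  qed
  {
    case 0
    then show ?case using W[OF 0(2)] by (simp add: WJ.simps)
  next
    case (Suc r)
    have "\<exists>d. D j (abs_L2 f) d & WJ r (%i. Pw k n (i0 + Suc i)) (K * c0) d" for j
    proof -
      obtain f' where f': "ACL j f f'" "Jet r (2*m+1+Suc i0) (2*m) (- real n) (- real n) f' (%_. K)" using Suc(3) by auto
      have "WJ r (%i. Pw k n (Suc i0 + i)) (K * c0) (abs_L2 f')" by (rule Suc(1)[OF _ f'(2)]) (use Suc(2) in simp)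
      then show ?thesis using ACL_imp_D[OF f'(1) Jet_sqi[OF Suc(3)] Jet_sqi[OF f'(2)]] by auto
    qed
    then show ?case using W[OF Suc(3)] by (simp add: WJ.simps)
  }
qed

lemma Jet_XL:
  "l + r = 2*m+1 ==> Jet (r + (k + 1 + n)) l (2*m) (- real n) (- real n) f (%_. K) ==> XL k n r (K * c0) (abs_L2 f)"
proof (induction r arbitrary: l f)
  case 0
  then show ?case using Jet_WJ[of 0 "k+1+n" f K] by simp
next
  case (Suc r)
  have G: "0 <= K" "AE x in lborel. cmod (f x) <= K * japanese x powr (- real n)"
    using Jet_Gb[OF Suc(3)] Suc(2) by (auto simp: Gb_def)
  have "LB n K (abs_L2 f)"
    unfolding LB_def using rp_abs[OF Jet_sqi[OF Suc(3)]] G(2)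
  proof eventually_elim
    case (elim x)
    then show ?case using japanese_pos[of x] by (simp add: japanese_powr_nat field_simps)
  qed
  moreover have "K * 1 <= K * c0" using G c0 by (intro mult_left_mono) auto
  ultimately have L: "LB n (K * c0) (abs_L2 f)" by (simp add: LB_mono[where B=K])
  have "\<exists>d. D j (abs_L2 f) d & XL k n r (K * c0) d" for j
  proof -
    obtain f' where f': "ACL j f f'" "Jet (r + (k+1+n)) (Suc l) (2*m) (- real n) (- real n) f' (%_. K)"
      using Suc(3) unfolding add_Suc Jet.simps by blast
    have "XL k n r (K * c0) (abs_L2 f')" by (rule Suc(1)[OF _ f'(2)]) (use Suc(2) in simp)
    then show ?thesis using ACL_imp_D[OF f'(1) Jet_sqi[OF Suc(3)] Jet_sqi[OF f'(2)]] by auto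
  qed
  with L show ?case by simp
qed

lemma J_eq: "2*m+1 + (k + 1 + n) = J" by (simp add: J_def)

lemma \<sigma>_pos: "0 < \<sigma>" using \<sigma> by (rule le_less_trans[rotated]) simp

text \<open>Multiplication by <x>^n, whose jets are uniform, raises the exponents from -n to 0. The
  coefficients are proportional to K and free of \<epsilon>, which can therefore be chosen later, in
  dependence on the initial value.\<close>

lemma Jet_of_XL:
  "\<exists>c. (\<forall>i. 0 <= c i) & (\<forall>K (u :: 'n L2). X K u --> Jet J 0 (2*m) 0 \<sigma> (%x. cjp (real n) x * rp u x) (%i. K * c i))"
proof -
  obtain c where c: "!!i. 0 <= c i" "Jet J 0 J (real n) 0 (cjp (real n)) c" using Jet_cjp[of 0 J "real n" 0] by auto
  have "Jet J 0 (2*m) 0 \<sigma> (%x. cjp (real n) x * rp u x) (%i. K * conv c (%_. 1) i)" if u: "X K u" for K u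
  proof -
    have "Jet J 0 (2*m) (- real n) (- real n) (rp u) (%_. K)" using XL_Jet[OF _ u, of 0] unfolding J_eq by simp
    then have "Jet J (0 + 0) (2*m) 0 \<sigma> (%x. cjp (real n) x * rp u x) (conv c (%i. K * 1))"
      by (intro Jet_mult[OF _ _ _ _ _ _ _ c(2)]) (use \<sigma>_pos in "auto simp: J_def")
    then show ?thesis unfolding conv_cmult[abs_def] by simp
  qed
  then show ?thesis using conv_nonneg[OF c(1), of "%_. 1"] by (intro exI[of _ "conv c (%_. 1)"]) auto
qed

text \<open>Multiplication by <x>^(-n-\<sigma>) leads back: <x>^(-n) restores the weight, and
  <x>^(-\<sigma>) pays for the exponent -\<sigma> allowed in \<open>Al\<close>. The constant depends
  on \<epsilon> through \<open>B\<close>, which recovers the single coefficients from the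
  norm.\<close>

lemma XL_of_Al:
  assumes e: "0 < \<epsilon>"
  shows "\<exists>C\<ge>0. \<forall>f K. Al \<epsilon> f K --> sqi (%x. cw x * f x) & X (C * K) (abs_L2 (%x. cw x * f x))"
proof -
  obtain c where c: "!!i. 0 <= c i" "Jet J 0 J (- real n - \<sigma>) 0 cw c" using Jet_cjp[of 0 J "- real n - \<sigma>" 0] by auto
  define B where "B = (\<Sum>i\<le>J. fact i / \<epsilon> ^ i)"
  have B0: "0 <= B" unfolding B_def using e by (intro sum_nonneg) auto
  have E0: "0 <= En J \<epsilon> c" using c(1) e by (intro En_nonneg) auto
  have "sqi (%x. cw x * f x) & X (B * En J \<epsilon> c * c0 * K) (abs_L2 (%x. cw x * f x))"
    if f: "Al \<epsilon> f K" for f K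
  proof -
    obtain d where d: "!!i. 0 <= d i" "Jet J 0 (2*m) 0 \<sigma> f d" "En J \<epsilon> d <= K" using f by (rule AlE) blast
    have "Jet J (0 + 0) (2*m) (- real n) (- real n) (%x. cw x * f x) (conv c d)"
      by (rule Jet_mult[OF _ _ _ _ _ _ _ c(2) d(2)]) (use \<sigma>_pos in "auto simp: J_def")
    moreover have "conv c d i <= B * En J \<epsilon> c * K" if i: "i <= J" for i
    proof -
      have "conv c d i <= fact i / \<epsilon> ^ i * En J \<epsilon> (conv c d)" by (rule En_le[OF conv_nonneg[OF c(1) d(1)] e i])
      also have "\<dots> <= B * (En J \<epsilon> c * K)"
      proof (rule mult_mono)
        show "fact i / \<epsilon> ^ i <= B" unfolding B_def by (rule member_le_sum) (use i e in auto)
        have "En J \<epsilon> (conv c d) <= En J \<epsilon> c * En J \<epsilon> d" by (rule En_conv[OF c(1) d(1)]) (use e in simp)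
        also have "\<dots> <= En J \<epsilon> c * K" by (rule mult_left_mono[OF d(3) E0])
        finally show "En J \<epsilon> (conv c d) <= En J \<epsilon> c * K" .
      qed (use B0 conv_nonneg[OF c(1) d(1)] e in "auto intro: En_nonneg")
      finally show ?thesis by (simp add: mult.assoc)
    qed
    ultimately have "Jet J 0 (2*m) (- real n) (- real n) (%x. cw x * f x) (%_. B * En J \<epsilon> c * K)"
      using Jet_mono by simp
    then have "Jet (2*m+1 + (k + 1 + n)) 0 (2*m) (- real n) (- real n) (%x. cw x * f x) (%_. B * En J \<epsilon> c * K)"
      unfolding J_eq .
    from Jet_XL[OF _ this] Jet_sqi[OF this] show ?thesis by (simp add: mult_ac)
  qed
  then show ?thesis using B0 E0 c0 by (intro exI[of _ "B * En J \<epsilon> c * c0"]) auto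
qed

end

section \<open>The nonlinearity\<close>

lemma nonlin_eqI:
  assumes g: "sqi g" and eq: "AE x in lborel. g x = (cmod (rp u x) powr \<alpha>) *\<^sub>R rp u x"
  shows "nonlin \<alpha> u = abs_L2 g"
  unfolding nonlin_def
proof (subst abs_L2_eq_iff)
  let ?f = "%x. (cmod (rep_L2 u x) powr \<alpha>) *\<^sub>R rep_L2 u x"
  have "AE x in lborel. g x = ?f x" using eq rep_rp[of u] by eventually_elim simp
  then have e: "AE x in lebesgue. g x = ?f x" by (rule AE_completion)
  have [measurable]: "rep_L2 u \<in> borel_measurable lebesgue"
    using square_integrable_rep_L2[of u] by (simp add: square_integrable_def)
  have "(%x. (cmod (?f x))^2) \<in> borel_measurable lebesgue" by measurable
  moreover have "integrable lebesgue (%x. (cmod (g x))^2)"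
    using sqi_square_integrable[OF g] by (simp add: square_integrable_def)
  moreover have "AE x in lebesgue. (cmod (g x))^2 = (cmod (?f x))^2" using e by eventually_elim simp
  ultimately have "integrable lebesgue (%x. (cmod (?f x))^2)"
    using Bochner_Integration.integrable_cong_AE_imp by blast
  moreover have "?f \<in> borel_measurable lebesgue" by measurable
  ultimately show "square_integrable ?f" by (simp add: square_integrable_def)
  show "square_integrable g" by (rule sqi_square_integrable[OF g])
  show "AE x in lebesgue. ?f x = g x" using e by eventually_elim simp
qed

text \<open>The first series bounds the nonlinearity; the second, its termwise derivative, enters
  the Lipschitz constant.\<close>

lemma gchoose_summable:
  fixes a x :: real
  assumes "\<bar>x\<bar> < 1"
  shows "summable (%q. \<bar>a gchoose q\<bar> * x ^ q)" "summable (%q. \<bar>a gchoose q\<bar> * (real q * x ^ (q - 1)))"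
proof -
  have 1: "summable (%q. \<bar>a gchoose q\<bar> * x ^ q)" if "\<bar>x\<bar> < 1" for x :: real
  proof -
    define y where "y = (1 + \<bar>x\<bar>) / 2"
    have y: "\<bar>y\<bar> < 1" "norm x < norm y" using that by (auto simp: y_def)
    have "summable (%q. norm ((a gchoose q) * x ^ q))"
      by (rule powser_insidea[OF sums_summable[OF gen_binomial_real[OF y(1)]] y(2)])
    then have "summable (%q. norm (\<bar>a gchoose q\<bar> * x ^ q))" by (simp add: abs_mult)
    then show ?thesis by (rule summable_norm_cancel)
  qed
  show "summable (%q. \<bar>a gchoose q\<bar> * x ^ q)" by (rule 1[OF assms])
  have "summable (%q. diffs (%q. \<bar>a gchoose q\<bar>) q * x ^ q)"
    by (rule termdiff_converges[where K=1]) (use assms 1 in auto)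
  then have "summable (%q. \<bar>a gchoose Suc q\<bar> * (real (Suc q) * x ^ (Suc q - 1)))"
    by (simp add: diffs_def mult_ac)
  then show "summable (%q. \<bar>a gchoose q\<bar> * (real q * x ^ (q - 1)))" by (subst (asm) summable_Suc_iff)
qed

context nls_space
begin

lemma Jet_replace:
  "Jet r l M s \<tau> f c ==> Gb M s \<tau> l f a ==> Jet r l M s \<tau> f (c(0 := a))"
  by (cases r) auto

text \<open>The series is summed after multiplication by \<open>cw\<close>, in the gauge
  \<open>X\<close>, for which \<open>XL_series\<close> is available. Its L2 sum is identified with
  the pointwise sum by dominated convergence, the uniform bounds being those of
  \<open>Al_sup\<close>.\<close>

lemma Al_series:
  assumes e: "0 < \<epsilon>" and f: "!!q. Al \<epsilon> (f q) (c q)" and c: "summable c"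
    and g: "g \<in> BM" "AE x in lborel. (%q. f q x) sums g x"
    and C: "!!f K. Al \<epsilon> f K ==> sqi (%x. cw x * f x) &
      X (C * K) (abs_L2 (%x. cw x * f x))"
  shows "sqi (%x. cw x * g x) &
      X (C * suminf c) (abs_L2 (%x. cw x * g x))"
proof -
  let ?w = "cw"
  let ?u = "%q. abs_L2 (%x. ?w x * f q x)"
  have [measurable]: "f q \<in> BM" "g \<in> BM" for q
    using Al_measurable[OF f] g by auto
  have c0: "0 <= c q" for q by (rule Al_nonneg[OF e f])
  have "\<forall>q. AE x in lborel. cmod (f q x) <= c q" using Al_sup[OF e f] by blast
  then have ae: "AE x in lborel. \<forall>q. cmod (f q x) <= c q" by (rule AE_all_countable[THEN iffD2])
  have part: "sqi (%x. ?w x * (\<Sum>q<i. f q x)) & abs_L2 (%x. ?w x * (\<Sum>q<i. f q x)) = (\<Sum>q<i. ?u q)" for i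
  proof (induction i)
    case (Suc i)
    have s: "sqi (%x. ?w x * f i x)" using C[OF f] by blast
    show ?case using Suc sqi_add[OF conjunct1[OF Suc] s] abs_add[OF conjunct1[OF Suc] s]
      by (simp add: distrib_left)
  qed (simp add: sqi_zero abs_zero)
  have w: "sqi (%x. of_real (suminf c) * ?w x)"
  proof (rule sqi_cmult)
    have "real CARD('n) / 2 < real n + \<sigma>" using n \<sigma> by simp
    from sqi_japanese_powr[OF this] show "sqi ?w" unfolding cjp_def[abs_def] by simp
  qed
  have l: "AE x in lborel. (%i. ?w x * (\<Sum>q<i. f q x)) \<longlonglongrightarrow> ?w x * g x"
    using g(2) by eventually_elim (auto simp: sums_def intro: tendsto_intros)
  have bd: "AE x in lborel. cmod (?w x * (\<Sum>q<i. f q x)) <= cmod (of_real (suminf c) * ?w x)" for i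
      using ae
    proof eventually_elim
      case (elim x)
      have "cmod (\<Sum>q<i. f q x) <= (\<Sum>q<i. c q)" by (rule sum_norm_le) (use elim in auto)
      also have "\<dots> <= suminf c" by (rule sum_le_suminf[OF c]) (use c0 in auto)
      finally have "cmod (?w x) * cmod (\<Sum>q<i. f q x) <= cmod (?w x) * suminf c" by (rule mult_left_mono) simp
      then show ?case using suminf_nonneg[OF c c0] by (simp add: norm_mult mult.commute)
    qed
  have me: "(%x. ?w x * (\<Sum>q<i. f q x)) \<in> BM" "(%x. ?w x * g x) \<in> BM" for i
    by measurable
  note lim = L2_dominated_convergence(1,3)[OF me l bd w]
  have X: "X (\<Sum>q. C * c q) (suminf ?u) & summable ?u"
    by (rule XL_series[OF k n _ summable_mult[OF c]]) (use C[OF f] in blast)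
  have "(%i. \<Sum>q<i. ?u q) \<longlonglongrightarrow> abs_L2 (%x. ?w x * g x)" using lim(2) part by simp
  moreover have "(%i. \<Sum>q<i. ?u q) \<longlonglongrightarrow> suminf ?u" using X by (simp add: summable_LIMSEQ)
  ultimately have "suminf ?u = abs_L2 (%x. ?w x * g x)" by (rule LIMSEQ_unique[rotated])
  then show ?thesis using X lim(1) suminf_mult[OF c, of C] by simp
qed

definition zf :: "real => (real^'n => complex) => real^'n => complex" where
  "zf M w x = 1 - of_real (1 / M^2) * (w x * cnj (w x))"

lemma zf_sums:
  assumes M: "0 < M" and z: "cmod (zf M w x) < 1"
  shows "(%q. of_real (M powr \<alpha> * ((\<alpha>/2) gchoose q) * (-1) ^ q) * (zf M w x ^ q * w x)) sums ((cmod (w x) powr \<alpha>) *\<^sub>R w x)"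
proof -
  define r where "r = 1 - (cmod (w x))^2 / M^2"
  have zr: "zf M w x = of_real r"
    by (simp add: zf_def r_def complex_norm_square[symmetric] del: of_real_power)
  then have r: "\<bar>- r\<bar> < 1" using z by simp
  have "(cmod (w x))^2 = M^2 * (1 - r)" using M by (simp add: r_def)
  then have "cmod (w x) = sqrt (M^2 * (1 - r))" by (metis norm_ge_zero real_sqrt_unique)
  also have "\<dots> = M * sqrt (1 - r)" using M by (simp add: real_sqrt_mult)
  finally have "cmod (w x) = M * sqrt (1 - r)" .
  then have "cmod (w x) powr \<alpha> = M powr \<alpha> * (1 - r) powr (\<alpha>/2)"
    using M r by (simp add: powr_mult powr_half_sqrt[symmetric] powr_powr)
  moreover have "(%q. M powr \<alpha> * (((\<alpha>/2) gchoose q) * (- r) ^ q)) sums (M powr \<alpha> * (1 + - r) powr (\<alpha>/2))"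
    by (intro sums_mult gen_binomial_real r)
  ultimately have "(%q. M powr \<alpha> * (((\<alpha>/2) gchoose q) * (- r) ^ q)) sums (cmod (w x) powr \<alpha>)" by simp
  from sums_mult2[OF sums_of_real[OF this, where 'a=complex], of "w x"]
  show ?thesis unfolding zr scaleR_conv_of_real by (simp add: power_minus[of r] mult_ac)
qed

lemma power_diff_Al:
  assumes e: "0 < \<epsilon>" and f: "Al \<epsilon> f \<rho>" and g: "Al \<epsilon> g \<rho>" and d: "Al \<epsilon> (%x. g x - f x) d"
  shows "Al \<epsilon> (%x. g x ^ q - f x ^ q) (real q * \<rho> ^ (q - 1) * d)"
proof (induction q)
  case 0
  show ?case using Al_zero by simp
next
  case (Suc q)
  have "Al \<epsilon> (%x. g x ^ q * (g x - f x) + (g x ^ q - f x ^ q) * f x) (\<rho> ^ q * d + real q * \<rho> ^ (q - 1) * d * \<rho>)"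
    by (intro Al_add Al_mult[OF e] Al_power[OF e] g d Suc f)
  moreover have "(%x. g x ^ q * (g x - f x) + (g x ^ q - f x ^ q) * f x) = (%x. g x ^ Suc q - f x ^ Suc q)"
    by (simp add: algebra_simps)
  moreover have "\<rho> ^ q * d + real q * \<rho> ^ (q - 1) * d * \<rho> = real (Suc q) * \<rho> ^ (Suc q - 1) * d"
    by (cases q) (simp_all add: algebra_simps)
  ultimately show ?case by simp
qed

lemma nonlin_Al:
  assumes e: "0 < \<epsilon>" and M: "0 < M" and \<rho>: "0 <= \<rho>" "\<rho> < 1" and A: "0 <= A"
  shows "\<exists>L\<ge>0. (\<forall>w. Al \<epsilon> w A --> Al \<epsilon> (zf M w) \<rho> -->
      sqi (%x. cw x * ((cmod (w x) powr \<alpha>) *\<^sub>R w x)) &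
      X L (abs_L2 (%x. cw x * ((cmod (w x) powr \<alpha>) *\<^sub>R w x)))) &
    (\<forall>w w' d. Al \<epsilon> w A --> Al \<epsilon> (zf M w) \<rho> --> Al \<epsilon> w' A --> Al \<epsilon> (zf M w') \<rho> --> Al \<epsilon> (%x. w' x - w x) d -->
      X (L * d) (abs_L2 (%x. cw x * ((cmod (w' x) powr \<alpha>) *\<^sub>R w' x)) -
        abs_L2 (%x. cw x * ((cmod (w x) powr \<alpha>) *\<^sub>R w x))))"
proof -
  obtain C where C0: "C >= 0" and C: "!!f K. Al \<epsilon> f K ==> sqi (%x. cw x * f x) &
      X (C * K) (abs_L2 (%x. cw x * f x))"
    using XL_of_Al[OF e] by blast
  define b where "b q = M powr \<alpha> * \<bar>(\<alpha>/2) gchoose q\<bar>" for q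
  have b0: "0 <= b q" for q by (simp add: b_def)
  have s\<rho>: "\<bar>\<rho>\<bar> < 1" using \<rho> by simp
  have s1: "summable (%q. b q * \<rho> ^ q)" and s2: "summable (%q. b q * (real q * \<rho> ^ (q - 1)))"
    using summable_mult[OF gchoose_summable(1)[OF s\<rho>, of "\<alpha>/2"], of "M powr \<alpha>"]
      summable_mult[OF gchoose_summable(2)[OF s\<rho>, of "\<alpha>/2"], of "M powr \<alpha>"]
    by (simp_all add: b_def mult.assoc)
  define \<beta> where "\<beta> q = complex_of_real (M powr \<alpha> * ((\<alpha>/2) gchoose q) * (-1) ^ q)" for q
  have cb: "cmod (\<beta> q) = b q" for q
    by (simp add: \<beta>_def b_def abs_mult power_abs del: of_real_mult of_real_power)
  \<comment> \<open>A Lipschitz constant of w -> \<open>zf M w\<close>: in the algebra the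
    difference of the squared moduli is bounded by 2 A times the distance.\<close>
  define B where "B = 2 * A / M^2"
  have B0: "0 <= B" using A by (simp add: B_def)
  \<comment> \<open>\<open>c1\<close> bounds the terms of the series. \<open>c2\<close> bounds their
    differences per unit of distance, after splitting z'^q w' - z^q w into z'^q (w' - w) and (z'^q -
    z^q) w.\<close>
  define c1 c2 where "c1 q = b q * \<rho> ^ q * A" and "c2 q = b q * \<rho> ^ q + (b q * (real q * \<rho> ^ (q - 1))) * (B * A)" for q
  have sc1: "summable c1" unfolding c1_def by (intro summable_mult2 s1)
  have sc2: "summable c2" unfolding c2_def by (intro summable_add summable_mult2 s1 s2)
  have c0: "0 <= c1 q" "0 <= c2 q" for q
    using b0 \<rho>(1) A B0 by (auto simp: c1_def c2_def)
  define T where "T w q x = \<beta> q * (zf M w x ^ q * w x)" for w :: "real^'n => complex" and q x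
  define F where "F w x = (cmod (w x) powr \<alpha>) *\<^sub>R w x" for w :: "real^'n => complex" and x
  have F: "F w \<in> BM" "AE x in lborel. (%q. T w q x) sums F w x"
    if w: "Al \<epsilon> w A" "Al \<epsilon> (zf M w) \<rho>" for w
  proof -
    have [measurable]: "w \<in> BM" by (rule Al_measurable[OF w(1)])
    show "F w \<in> BM" unfolding F_def[abs_def] by measurable
    show "AE x in lborel. (%q. T w q x) sums F w x"
      using Al_sup[OF e w(2)]
    proof eventually_elim
      case (elim x)
      then show ?case using zf_sums[OF M, of w x \<alpha>] \<rho>(2) by (simp add: T_def F_def \<beta>_def)
    qed
  qed
  have 1: "sqi (%x. cw x * F w x) & X (C * suminf c1) (abs_L2 (%x. cw x * F w x))"
    if w: "Al \<epsilon> w A" "Al \<epsilon> (zf M w) \<rho>" for w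
  proof (rule Al_series[OF e _ sc1 F[OF w] C])
    show "Al \<epsilon> (T w q) (c1 q)" for q
      using Al_cmult[OF Al_mult[OF e Al_power[OF e w(2)] w(1)], of "\<beta> q" q]
      by (simp add: T_def[abs_def] c1_def cb mult.assoc)
  qed
  have 2: "X (C * suminf c2 * d) (abs_L2 (%x. cw x * F w' x) - abs_L2 (%x. cw x * F w x))"
    if w: "Al \<epsilon> w A" "Al \<epsilon> (zf M w) \<rho>" and w': "Al \<epsilon> w' A" "Al \<epsilon> (zf M w') \<rho>" and d: "Al \<epsilon> (%x. w' x - w x) d" for w w' d
  proof -
    have "Al \<epsilon> (%x. of_real (- 1 / M^2) * ((w' x - w x) * cnj (w' x) + w x * cnj (w' x - w x))) (cmod (of_real (- 1 / M^2)) * (d * A + A * d))"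
      by (intro Al_cmult Al_add Al_mult[OF e] Al_cnj d w w')
    moreover have "(%x. of_real (- 1 / M^2) * ((w' x - w x) * cnj (w' x) + w x * cnj (w' x - w x))) = (%x. zf M w' x - zf M w x)"
      by (rule ext) (simp add: zf_def algebra_simps)
    moreover have "cmod (of_real (- 1 / M^2)) * (d * A + A * d) = B * d"
      by (simp add: B_def norm_divide norm_power)
    ultimately have dz: "Al \<epsilon> (%x. zf M w' x - zf M w x) (B * d)" by (simp only:)
    have T: "Al \<epsilon> (%x. T w' q x - T w q x) (c2 q * d)" for q
    proof -
      have "Al \<epsilon> (%x. \<beta> q * (zf M w' x ^ q * (w' x - w x) + (zf M w' x ^ q - zf M w x ^ q) * w x))
        (cmod (\<beta> q) * (\<rho> ^ q * d + real q * \<rho> ^ (q - 1) * (B * d) * A))"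
        by (intro Al_cmult Al_add Al_mult[OF e] Al_power[OF e] power_diff_Al[OF e] d dz w w')
      then show ?thesis by (simp add: T_def c2_def cb algebra_simps)
    qed
    note s = 1[OF w, THEN conjunct1] 1[OF w', THEN conjunct1]
    have "X (C * (\<Sum>q. c2 q * d)) (abs_L2 (%x. cw x * (F w' x - F w x)))"
    proof (rule Al_series[OF e T summable_mult2[OF sc2] _ _ C, THEN conjunct2])
      show "(%x. F w' x - F w x) \<in> BM" using F(1)[OF w] F(1)[OF w'] by measurable
      show "AE x in lborel. (%q. T w' q x - T w q x) sums (F w' x - F w x)"
        using F(2)[OF w] F(2)[OF w'] by eventually_elim (rule sums_diff)
    qed
    then show ?thesis using abs_diff[OF s(2,1)] suminf_mult2[OF sc2, of d] by (simp add: right_diff_distrib mult.assoc)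
  qed
  define L where "L = C * suminf c1 + C * suminf c2"
  have p: "0 <= C * suminf c1" "0 <= C * suminf c2"
    using C0 suminf_nonneg[OF sc1 c0(1)] suminf_nonneg[OF sc2 c0(2)] by auto
  show ?thesis
    unfolding F_def[symmetric]
  proof (intro exI[of _ L] conjI allI impI)
    show "0 <= L" using p by (simp add: L_def)
    show "sqi (%x. cw x * F w x)" if "Al \<epsilon> w A" "Al \<epsilon> (zf M w) \<rho>" for w using 1[OF that] by blast
    show "X L (abs_L2 (%x. cw x * F w x))" if "Al \<epsilon> w A" "Al \<epsilon> (zf M w) \<rho>" for w
      by (rule XL_mono[OF 1[OF that, THEN conjunct2]]) (use p in "simp add: L_def")
    show "X (L * d) (abs_L2 (%x. cw x * F w' x) - abs_L2 (%x. cw x * F w x))"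
      if "Al \<epsilon> w A" "Al \<epsilon> (zf M w) \<rho>" "Al \<epsilon> w' A" "Al \<epsilon> (zf M w') \<rho>" "Al \<epsilon> (%x. w' x - w x) d" for w w' d
      by (rule XL_mono[OF 2[OF that]]) (use p Al_nonneg[OF e that(5)] in "simp add: L_def distrib_right")
  qed
qed

end

context nls_space
begin

text \<open>The hypothesis with parameter 1 merely supplies finite bounds for all orders. The one of
  order zero is replaced by the supremum \<theta>, and for small \<epsilon> the other orders
  contribute less than \<rho> - \<theta>.\<close>

lemma Al_eps:
  assumes f: "Al 1 f K" and le: "AE x in lborel. cmod (f x) <= \<theta>" and \<theta>: "0 <= \<theta>" "\<theta> < \<rho>"
  shows "\<exists>\<epsilon>>0. Al \<epsilon> f \<rho>"
proof -
  obtain c where c: "!!i. 0 <= c i" "Jet J 0 (2*m) 0 \<sigma> f c" using f by (rule AlE) blast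
  define d where "d = c(0 := \<theta>)"
  have d0: "0 <= d i" for i using c(1) \<theta> by (simp add: d_def)
  have "Gb (2*m) 0 \<sigma> 0 f \<theta>"
    using Al_measurable[OF f] le \<theta> by (simp add: Gb_def japanese_pos[THEN less_imp_neq, THEN not_sym])
  then have j: "Jet J 0 (2*m) 0 \<sigma> f d" unfolding d_def by (rule Jet_replace[OF c(2)])
  have "((%\<epsilon>. En J \<epsilon> d) \<longlongrightarrow> \<theta>) (at_right 0)" using En_tendsto[of J d] by (simp add: d_def)
  then have "\<forall>\<^sub>F \<epsilon> in at_right 0. En J \<epsilon> d < \<rho>" by (rule order_tendstoD) (rule \<theta>)
  moreover have "\<forall>\<^sub>F \<epsilon> in at_right (0::real). 0 < \<epsilon>" by (simp add: eventually_at_filter)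
  ultimately have "\<forall>\<^sub>F \<epsilon> in at_right 0. En J \<epsilon> d < \<rho> & 0 < \<epsilon>" by (rule eventually_conj)
  then obtain \<epsilon> where "En J \<epsilon> d < \<rho>" "0 < \<epsilon>" using eventually_happens'[OF trivial_limit_at_right_real] by blast
  then show ?thesis using AlI[OF d0 j, of \<epsilon> \<rho>] by auto
qed

lemma nonlin_rep:
  assumes \<sigma>eq: "\<sigma> = real n * \<alpha>" and w: "AE x in lborel. w x = cjp (real n) x * rp u x"
    and s: "sqi (%x. cw x * ((cmod (w x) powr \<alpha>) *\<^sub>R w x))"
  shows "nonlin \<alpha> u = abs_L2 (%x. cw x * ((cmod (w x) powr \<alpha>) *\<^sub>R w x))"
proof (rule nonlin_eqI[OF s])
  show "AE x in lborel. cw x * ((cmod (w x) powr \<alpha>) *\<^sub>R w x) = (cmod (rp u x) powr \<alpha>) *\<^sub>R rp u x"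
    using w
  proof eventually_elim
    case (elim x)
    have "cmod (w x) powr \<alpha> = japanese x powr \<sigma> * cmod (rp u x) powr \<alpha>"
      unfolding elim by (simp add: norm_mult powr_mult powr_powr \<sigma>eq)
    then have "cw x * ((cmod (w x) powr \<alpha>) *\<^sub>R w x) =
      (cw x * cjp \<sigma> x * cjp (real n) x) * ((cmod (rp u x) powr \<alpha>) *\<^sub>R rp u x)"
      unfolding elim by (simp add: scaleR_conv_of_real cjp_def)
    also have "cw x * cjp \<sigma> x * cjp (real n) x = 1"
      by (simp add: cjp_add[symmetric])
    finally show ?case by simp
  qed
qed

text \<open>The lower bound for \<open>u0\<close> makes \<open>1 - |w|\<^sup>2 / M\<^sup>2\<close> with \<open>w = \<langle>x\<rangle>\<^sup>n u\<close> smaller than one in the algebra \<open>Al \<epsilon>\<close>,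
  first for \<open>u0\<close> and \<open>\<epsilon>\<close> small, then for all \<open>u\<close> near \<open>u0\<close>.\<close>

lemma nonlin_lipschitz:
  fixes u0 :: "'n L2"
  assumes \<sigma>eq: "\<sigma> = real n * \<alpha>" and u0: "X K0 u0"
    and c: "0 < c" "AE x in lborel. c <= japanese x ^ n * cmod (rp u0 x)"
  shows "\<exists>\<delta>>0. \<exists>L\<ge>0. (\<forall>u. X \<delta> (u - u0) --> X L (nonlin \<alpha> u)) &
    (\<forall>u v d. X \<delta> (u - u0) --> X \<delta> (v - u0) --> X d (u - v) -->
      X (L * d) (nonlin \<alpha> u - nonlin \<alpha> v))"
proof -
  define W where "W u x = cjp (real n) x * rp u x" for u :: "'n L2" and x
  obtain cj where cj: "!!i. 0 <= cj i" "!!K (u :: 'n L2). X K u ==> Jet J 0 (2*m) 0 \<sigma> (W u) (%i. K * cj i)"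
    using Jet_of_XL unfolding W_def[abs_def] by blast
  have WA: "Al \<epsilon> (W u) (K * En J \<epsilon> cj)" if "X K u" for \<epsilon> K u
    by (rule AlI[OF _ cj(2)[OF that]]) (use cj(1) XL_nonneg[OF that] in "simp_all add: En_cmult")
  \<comment> \<open>K0 bounds |w|, so |w|/M is at most 1; including c makes M positive and \<theta>
    nonnegative.\<close>
  define M where "M = max K0 c"
  have M: "0 < M" "c <= M" "K0 <= M" using c(1) by (auto simp: M_def)
  define \<theta> where "\<theta> = 1 - c^2 / M^2"
  have cM: "c^2 / M^2 <= 1" "0 < c^2 / M^2" using M c(1) by (auto simp: power_mono)
  then have \<theta>: "0 <= \<theta>" "\<theta> < 1" by (auto simp: \<theta>_def)
  have "LB n K0 u0" using u0 by simp
  then have z0: "AE x in lborel. cmod (zf M (W u0) x) <= \<theta>"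
    using c(2) unfolding LB_def
  proof eventually_elim
    case (elim x)
    have "cmod (W u0 x) = japanese x ^ n * cmod (rp u0 x)"
      by (simp add: W_def norm_mult powr_realpow[OF japanese_pos])
    then have w: "c <= cmod (W u0 x)" "cmod (W u0 x) <= M" using elim M by auto
    have "zf M (W u0) x = of_real (1 - (cmod (W u0 x))^2 / M^2)"
      by (simp add: zf_def complex_norm_square[symmetric] del: of_real_power)
    then have "cmod (zf M (W u0) x) = \<bar>1 - (cmod (W u0 x))^2 / M^2\<bar>" by (simp only: norm_of_real)
    moreover have "(cmod (W u0 x))^2 / M^2 <= 1" using w M by (simp add: power_mono)
    moreover have "c^2 / M^2 <= (cmod (W u0 x))^2 / M^2" using w c(1) by (intro divide_right_mono power_mono) auto
    ultimately show ?case by (simp add: \<theta>_def)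
  qed
  have "\<exists>K. Al 1 (zf M (W u0)) K"
    unfolding zf_def[abs_def]
    by (rule exI, rule Al_diff[OF Al_const Al_cmult[OF Al_mult[OF zero_less_one WA[OF u0] Al_cnj[OF WA[OF u0]]]]])
  then obtain K1 where K1: "Al 1 (zf M (W u0)) K1" by blast
  \<comment> \<open>Half of the gap between \<theta> and 1 is spent on the passage from the supremum
    to the algebra norm. Half of the remaining gap, up to \<rho> below, is reserved for the passage
    from u0 to nearby u.\<close>
  define \<rho>0 where "\<rho>0 = (1 + \<theta>) / 2"
  have \<rho>0: "\<theta> < \<rho>0" "\<rho>0 < 1" using \<theta> by (auto simp: \<rho>0_def)
  obtain \<epsilon> where e: "0 < \<epsilon>" and z0A: "Al \<epsilon> (zf M (W u0)) \<rho>0" using Al_eps[OF K1 z0 \<theta>(1) \<rho>0(1)] by blast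
  define E where "E = En J \<epsilon> cj"
  have E0: "0 <= E" unfolding E_def using e cj(1) by (intro En_nonneg) auto
  define A0 where "A0 = K0 * E"
  have A0: "0 <= A0" unfolding A0_def using XL_nonneg[OF u0] E0 by simp
  \<comment> \<open>A perturbation of size \<eta> changes \<open>zf\<close> by at most (2 A0 \<eta>
    + \<eta>^2)/M^2. As \<eta> is at most 1, this is bounded by \<eta> (2 A0 + 1)/M^2, which has to
    stay below (1 - \<rho>0)/2.\<close>
  define \<eta> where "\<eta> = min 1 ((1 - \<rho>0) * M^2 / (2 * (2 * A0 + 1)))"
  have \<eta>: "0 < \<eta>" "\<eta> <= 1" using \<rho>0 M A0 by (auto simp: \<eta>_def)
  have "\<eta> * (2 * A0 + 1) <= (1 - \<rho>0) * M^2 / (2 * (2 * A0 + 1)) * (2 * A0 + 1)"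
    using A0 by (intro mult_right_mono) (auto simp: \<eta>_def)
  also have "\<dots> = (1 - \<rho>0) * M^2 / 2" using A0 by (simp add: field_simps)
  finally have \<eta>M: "\<eta> * (2 * A0 + 1) / M^2 <= (1 - \<rho>0) / 2" using M by (simp add: field_simps)
  define \<rho> where "\<rho> = (1 + \<rho>0) / 2"
  have \<rho>: "0 <= \<rho>" "\<rho> < 1" using \<rho>0 \<theta> by (auto simp: \<rho>_def)
  define A where "A = A0 + 1"
  have near: "Al \<epsilon> (%x. W u0 x + p x) A & Al \<epsilon> (zf M (%x. W u0 x + p x)) \<rho>" if p: "Al \<epsilon> p \<eta>" for p
  proof
    have w0: "Al \<epsilon> (W u0) A0" using WA[OF u0] by (simp add: A0_def E_def)
    show "Al \<epsilon> (%x. W u0 x + p x) A"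
      by (rule Al_mono[OF Al_add[OF w0 p]]) (use \<eta> in "simp add: A_def")
    have "Al \<epsilon> (%x. zf M (W u0) x - of_real (1 / M^2) * ((W u0 x * cnj (p x) + p x * cnj (W u0 x)) + p x * cnj (p x)))
      (\<rho>0 + cmod (of_real (1 / M^2)) * ((A0 * \<eta> + \<eta> * A0) + \<eta> * \<eta>))"
      by (intro Al_diff Al_cmult Al_add Al_mult[OF e] Al_cnj w0 p z0A)
    moreover have "(%x. zf M (W u0) x - of_real (1 / M^2) * ((W u0 x * cnj (p x) + p x * cnj (W u0 x)) + p x * cnj (p x))) = zf M (%x. W u0 x + p x)"
      by (rule ext) (simp add: zf_def algebra_simps)
    moreover have "\<rho>0 + cmod (of_real (1 / M^2)) * ((A0 * \<eta> + \<eta> * A0) + \<eta> * \<eta>) <= \<rho>"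
    proof -
      have "cmod (of_real (1 / M^2)) = 1 / M^2" by (simp only: norm_of_real) simp
      then have 1: "cmod (of_real (1 / M^2)) * a = a / M^2" for a by simp
      have "\<eta> * \<eta> <= \<eta>" using \<eta> by (simp add: mult_left_le)
      then have "((A0 * \<eta> + \<eta> * A0) + \<eta> * \<eta>) / M^2 <= \<eta> * (2 * A0 + 1) / M^2"
        by (intro divide_right_mono) (simp_all add: algebra_simps)
      moreover have "\<rho> = \<rho>0 + (1 - \<rho>0) / 2" by (simp add: \<rho>_def field_simps)
      ultimately show ?thesis using \<eta>M unfolding 1 by linarith
    qed
    ultimately show "Al \<epsilon> (zf M (%x. W u0 x + p x)) \<rho>" by (simp add: Al_mono)
  qed
  define F where "F w x = cw x * ((cmod (w x) powr \<alpha>) *\<^sub>R w x)" for w :: "real^'n => complex" and x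
  have "0 <= A" using A0 by (simp add: A_def)
  from nonlin_Al[OF e M(1) \<rho> this, of \<alpha>] obtain L where L: "L >= 0"
    "!!w. Al \<epsilon> w A ==> Al \<epsilon> (zf M w) \<rho> ==> sqi (F w) & X L (abs_L2 (F w))"
    "!!w w' d. Al \<epsilon> w A ==> Al \<epsilon> (zf M w) \<rho> ==> Al \<epsilon> w' A ==> Al \<epsilon> (zf M w') \<rho> ==> Al \<epsilon> (%x. w' x - w x) d ==>
      X (L * d) (abs_L2 (F w') - abs_L2 (F w))"
    unfolding F_def[symmetric] by blast
  have rep: "nonlin \<alpha> u = abs_L2 (F (%x. W u0 x + p x))"
    if "Al \<epsilon> p \<eta>" "AE x in lborel. W u0 x + p x = W u x" for p u
  proof -
    have "sqi (F (%x. W u0 x + p x))" using L(2) near[OF that(1)] by blast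
    then show ?thesis
      using nonlin_rep[OF \<sigma>eq that(2)[unfolded W_def]] unfolding F_def[abs_def] W_def by blast
  qed
  \<comment> \<open>The factor 3 leaves room for \<delta> from v - u0 and 2 \<delta> from u - v; E +
    1 replaces E to avoid division by zero.\<close>
  define \<delta> where "\<delta> = \<eta> / (3 * (E + 1))"
  have \<delta>: "0 < \<delta>" using \<eta> E0 by (simp add: \<delta>_def)
  have \<delta>3: "3 * \<delta> * E <= \<eta>"
  proof -
    have "3 * \<delta> * E <= 3 * \<delta> * (E + 1)" using \<delta> by (intro mult_left_mono) auto
    also have "\<dots> = \<eta>" using E0 by (simp add: \<delta>_def field_simps)
    finally show ?thesis .
  qed
  have \<delta>1: "\<delta> * E <= \<eta>" using \<delta>3 \<delta> E0 mult_nonneg_nonneg[of \<delta> E] by linarith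
  have Wd: "AE x in lborel. W (u - v) x = W u x - W v x" for u v
    using rp_diff[of u v] by eventually_elim (simp add: W_def right_diff_distrib)
  have near1: "Al \<epsilon> (W (u - u0)) (\<delta> * E)" if "X \<delta> (u - u0)" for u
    using WA[OF that] by (simp add: E_def)
  have eq1: "AE x in lborel. W u0 x + W (u - u0) x = W u x" for u
    using Wd[of u u0] by eventually_elim simp
  have b: "X L (nonlin \<alpha> u)" if u: "X \<delta> (u - u0)" for u
  proof -
    have p: "Al \<epsilon> (W (u - u0)) \<eta>" by (rule Al_mono[OF near1[OF u] \<delta>1])
    show ?thesis unfolding rep[OF p eq1] using L(2) near[OF p] by blast
  qed
  have l: "X (L * E * d) (nonlin \<alpha> u - nonlin \<alpha> v)"
    if u: "X \<delta> (u - u0)" and v: "X \<delta> (v - u0)" and d: "X d (u - v)" for u v d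
  proof -
    \<comment> \<open>The given bound d may be large, but u - v is also bounded by 2 \<delta>; the
      smaller of the two keeps the perturbation within \<eta>.\<close>
    define d' where "d' = min d (2 * \<delta>)"
    have "X (\<delta> + \<delta>) ((u - u0) - (v - u0))" by (rule XL_diff[OF u v])
    then have d': "X d' (u - v)" using d by (simp add: d'_def min_def del: XL.simps)
    have p: "Al \<epsilon> (W (v - u0)) \<eta>" by (rule Al_mono[OF near1[OF v] \<delta>1])
    have q: "Al \<epsilon> (W (u - v)) (d' * E)" using WA[OF d'] by (simp add: E_def)
    have pq: "Al \<epsilon> (%x. W (v - u0) x + W (u - v) x) \<eta>"
    proof (rule Al_mono[OF Al_add[OF near1[OF v] q]])
      have "d' * E <= 2 * \<delta> * E" using E0 by (intro mult_right_mono) (auto simp: d'_def)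
      then show "\<delta> * E + d' * E <= \<eta>" using \<delta>3 by simp
    qed
    \<comment> \<open>\<open>Al\<close> speaks of functions, not of classes. Writing u as u0 + (v -
      u0) + (u - v) makes the difference of the two functions literally the representative of u -
      v.\<close>
    have eq2: "AE x in lborel. W u0 x + (W (v - u0) x + W (u - v) x) = W u x"
      using Wd[of v u0] Wd[of u v] by eventually_elim simp
    have "X (L * (d' * E)) (nonlin \<alpha> u - nonlin \<alpha> v)"
      unfolding rep[OF p eq1] rep[OF pq eq2]
      by (rule L(3)) (use near[OF p] near[OF pq] q in auto)
    moreover have "L * (d' * E) <= L * E * d"
    proof -
      have "d' * E <= d * E" using E0 by (intro mult_right_mono) (auto simp: d'_def)
      from mult_left_mono[OF this L(1)] show ?thesis by (simp add: mult_ac)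
    qed
    ultimately show ?thesis by (rule XL_mono)
  qed
  show ?thesis
  proof (rule exI[of _ \<delta>], rule conjI[OF \<delta>], rule exI[of _ "L + L * E"], intro conjI allI impI)
    show "0 <= L + L * E" using L(1) E0 by simp
    show "X (L + L * E) (nonlin \<alpha> u)" if "X \<delta> (u - u0)" for u
      by (rule XL_mono[OF b[OF that]]) (use L(1) E0 in simp)
    show "X ((L + L * E) * d) (nonlin \<alpha> u - nonlin \<alpha> v)"
      if "X \<delta> (u - u0)" "X \<delta> (v - u0)" "X d (u - v)" for u v d
      by (rule XL_mono[OF l[OF that]]) (use L(1) XL_nonneg[OF that(3)] in "simp add: distrib_right")
  qed
qed

end

section \<open>Existence by Picard iteration\<close>

text \<open>A primitive on both sides of 0 that vanishes there. Starting from the left end point -T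
  avoids a case distinction on the sign of t.\<close>

definition oint :: "real => (real => 'a::banach) => real => 'a" where
  "oint T F t = integral {-T..t} F - integral {-T..0} F"

lemma oint_diff:
  assumes F: "continuous_on {-T..T} F" and ab: "-T <= a" "a <= b" "b <= T"
  shows "(F has_integral (oint T F b - oint T F a)) {a..b}"
proof -
  have i: "F integrable_on {-T..b}" "F integrable_on {a..b}"
    by (rule integrable_continuous_real, rule continuous_on_subset[OF F], use ab in auto)+
  have "integral {-T..a} F + integral {a..b} F = integral {-T..b} F"
    by (rule Henstock_Kurzweil_Integration.integral_combine) (use ab i in auto)
  then have "oint T F b - oint T F a = integral {a..b} F" by (simp add: oint_def algebra_simps)
  then show ?thesis using i(2) by (simp add: integrable_integral)
qed

lemma oint_0 [simp]: "oint T F 0 = 0" by (simp add: oint_def)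

lemma oint_oriented:
  assumes F: "continuous_on {-T..T} F" and t: "t \<in> {-T..T}"
  shows "has_oriented_integral F (oint T F t) 0 t"
proof (cases "0 <= t")
  case True
  then show ?thesis using oint_diff[OF F, of 0 t] t by (simp add: has_oriented_integral_def)
next
  case False
  then show ?thesis using oint_diff[OF F, of t 0] t by (simp add: has_oriented_integral_def)
qed

lemma oint_sub:
  assumes F: "continuous_on {-T..T} F" and G: "continuous_on {-T..T} G" and t: "t \<in> {-T..T}"
  shows "oint T (%s. F s - G s) t = oint T F t - oint T G t"
proof -
  have i: "H integrable_on {-T..r}" if "continuous_on {-T..T} H" "r <= T" for H :: "real => 'a" and r
    by (rule integrable_continuous_real, rule continuous_on_subset[OF that(1)]) (use that(2) in auto)
  have "0 <= T" using t by simp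
  then show ?thesis
    using t by (simp add: oint_def integral_diff[OF i[OF F] i[OF G]])
qed

section \<open>Continuity and integration in the gauge, and the fixed point\<close>

context nls_space
begin

lemma X_S: "\<exists>C\<ge>1. \<forall>t K g. \<bar>t\<bar> <= 1 --> X K g --> X (C * K) (S t g)"
proof -
  obtain C where C: "C >= 0" "!!t K (g :: 'n L2). \<bar>t\<bar> <= 1 ==> X K g ==> X (C * K) (S t g)"
    using XL_S[OF k n, of "2*m+1"] by blast
  have "X ((C + 1) * K) (S t g)" if "\<bar>t\<bar> <= 1" "X K g" for t K g
    by (rule XL_mono[OF C(2)[OF that]]) (use XL_nonneg[OF that(2)] in "simp add: distrib_right")
  then show ?thesis using C(1) by (intro exI[of _ "C + 1"]) auto
qed

lemma X_norm: "\<exists>C\<ge>1. \<forall>K u. X K u --> norm u <= C * K"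
  using XL_norm[OF k n] by blast

lemma X_continuous_on: assumes "ccont X F I" shows "continuous_on I F"
proof -
  obtain C where C: "C >= 1" "!!K u. X K u ==> norm u <= C * K" using X_norm by blast
  show ?thesis by (rule ccont_continuous_on[OF assms, of C]) (use C in auto)
qed

lemma eventually_in: "\<forall>\<^sub>F s in at a within I. s \<in> I"
  by (simp add: eventually_at_filter)

lemma ccont_diff: assumes "ccont X f I" "ccont X g I" shows "ccont X (%s. f s - g s) I"
  unfolding ccont_def
proof (intro ballI allI impI)
  fix s and e :: real assume s: "s \<in> I" and e: "0 < e"
  have "\<forall>\<^sub>F s' in at s within I. X (e/2) (f s' - f s)" "\<forall>\<^sub>F s' in at s within I. X (e/2) (g s' - g s)"
    using assms s e unfolding ccont_def by simp_all
  then show "\<forall>\<^sub>F s' in at s within I. X e (f s' - g s' - (f s - g s))"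
  proof eventually_elim
    case (elim s')
    from XL_diff[OF elim] show ?case by (simp add: algebra_simps)
  qed
qed

lemma ccont_affine: assumes f: "ccont X f I" shows "ccont X (%s. u + cmult_L2 c (f s)) I"
  unfolding ccont_def
proof (intro ballI allI impI)
  fix s and e :: real assume s: "s \<in> I" and e: "0 < e"
  have p: "0 < cmod c + 1" by (simp add: add_nonneg_pos)
  then have "\<forall>\<^sub>F s' in at s within I. X (e / (cmod c + 1)) (f s' - f s)"
    using f s e unfolding ccont_def by simp
  then show "\<forall>\<^sub>F s' in at s within I. X e (u + cmult_L2 c (f s') - (u + cmult_L2 c (f s)))"
  proof eventually_elim
    case (elim s')
    have "X e (cmult_L2 c (f s' - f s))"
      by (rule XL_mono[OF XL_cmult[OF elim]]) (use p e in "simp add: field_simps")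
    then show ?case by (simp add: cmult_diff)
  qed
qed

text \<open>The increment splits into the group applied to the increment of f, controlled by
  boundedness on [-1,1], and the increment of the group at the fixed class f(s), controlled by
  strong continuity.\<close>

lemma ccont_S:
  assumes f: "ccont X f I" and K: "!!s. s \<in> I ==> \<exists>K. X K (f s)" and I: "!!s. s \<in> I ==> \<bar>a * s\<bar> <= 1"
  shows "ccont X (%s. S (a * s) (f s)) I"
  unfolding ccont_def
proof (intro ballI allI impI)
  fix s and e :: real assume s: "s \<in> I" and e: "0 < e"
  obtain C where C: "C >= 1" "!!t K g. \<bar>t\<bar> <= 1 ==> X K g ==> X (C * K) (S t g)" using X_S by blast
  have e': "0 < e / (2 * C)" using C(1) e by simp
  obtain K where K: "X K (f s)" using K[OF s] by blast
  have "((%s'. a * s' - a * s) \<longlongrightarrow> a * s - a * s) (at s within I)" by (intro tendsto_intros)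
  then have l: "filterlim (%s'. a * s' - a * s) (nhds 0) (at s within I)" by simp
  have "\<forall>\<^sub>F s' in at s within I. X (e / (2 * C)) (f s' - f s)" using f s e' unfolding ccont_def by blast
  then show "\<forall>\<^sub>F s' in at s within I. X e (S (a * s') (f s') - S (a * s) (f s))"
    using eventually_compose_filterlim[OF XL_S_continuous[OF k n K e'] l] eventually_in[of I s]
  proof eventually_elim
    case (elim s')
    have "X (C * (e / (2 * C)) + C * (e / (2 * C))) (S (a * s') (f s' - f s) + S (a * s) (S (a * s' - a * s) (f s) - f s))"
      by (intro XL_add C(2) elim(1,2) I s elim(3))
    moreover have "C * (e / (2 * C)) + C * (e / (2 * C)) = e" using C(1) by simp
    ultimately show ?case by (simp add: S_diff S_S)
  qed
qed

lemma oint_X: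
  assumes c: "ccont X F {-T..T}" and K: "!!s. s \<in> {-T..T} ==> X K (F s)" and ab: "a \<in> {-T..T}" "b \<in> {-T..T}"
  shows "X (K * \<bar>b - a\<bar>) (oint T F b - oint T F a)"
proof -
  have *: "X (K * (b - a)) (oint T F b - oint T F a)" if "-T <= a" "a <= b" "b <= T" for a b
  proof (rule XL_integral[OF k n that(2) K _ oint_diff[OF X_continuous_on[OF c] that]])
    show "ccont X F {a..b}" by (rule ccont_subset[OF c]) (use that in auto)
  qed (use that in auto)
  show ?thesis
  proof (cases "a <= b")
    case True
    then show ?thesis using *[of a b] ab by simp
  next
    case False
    then have "X (K * (a - b)) (- (oint T F a - oint T F b))" using *[of b a] ab by (intro XL_uminus) auto
    then show ?thesis using False by simp
  qed
qed

lemma oint_ccont: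
  assumes c: "ccont X F {-T..T}" and K: "!!s. s \<in> {-T..T} ==> X K (F s)"
  shows "ccont X (oint T F) {-T..T}"
  unfolding ccont_def
proof (intro ballI allI impI)
  fix s and e :: real assume s: "s \<in> {-T..T}" and e: "0 < e"
  have "((%s'. K * \<bar>s' - s\<bar>) \<longlongrightarrow> K * \<bar>s - s\<bar>) (at s within {-T..T})" by (intro tendsto_intros)
  from order_tendstoD(2)[OF this, of e] e have "\<forall>\<^sub>F s' in at s within {-T..T}. K * \<bar>s' - s\<bar> < e" by simp
  then show "\<forall>\<^sub>F s' in at s within {-T..T}. X e (oint T F s' - oint T F s)"
    using eventually_in[of "{-T..T}" s]
  proof eventually_elim
    case (elim s')
    show ?case by (rule XL_mono[OF oint_X[OF c K s elim(2)]]) (use elim(1) in auto)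
  qed
qed

text \<open>Banach's argument for bounds uniform on I. The limit is taken in L2 for each t
  separately, and \<open>XL_series\<close> upgrades it to a bound in the gauge that does not depend
  on t.\<close>

lemma picard_fixed_point:
  fixes w0 :: "real => 'n L2"
  assumes r: "0 < r" and w0: "good w0"
    and P: "!!w. good w ==> good (P w)" "!!w t. good w ==> t \<in> I ==> X (r/2) (P w t - w0 t)"
    and contr: "!!w w' d t. good w ==> good w' ==> (!!s. s \<in> I ==> X d (w s - w' s)) ==> t \<in> I ==> X (d/2) (P w t - P w' t)"
    and good: "!!w. good w \<longleftrightarrow> ccont X w I & (\<forall>t\<in>I. X r (w t - w0 t))"
  shows "\<exists>w. good w & (\<forall>t\<in>I. w t = P w t)"
proof -
  define W where "W j = (P ^^ j) w0" for j
  have W0: "W 0 = w0" and WS: "W (Suc j) = P (W j)" for j by (auto simp: W_def)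
  have gW: "good (W j)" for j by (induction j) (simp_all only: W0 WS w0 P(1))
  have inc: "X (r/2 * (1/2)^j) (W (Suc j) t - W j t)" if "t \<in> I" for j t
    using that
  proof (induction j arbitrary: t)
    case 0
    then show ?case using P(2)[OF gW[of 0]] by (simp add: WS W0)
  next
    case (Suc j)
    from contr[OF gW gW Suc] show ?case by (simp add: WS)
  qed
  define w where "w t = lim (%i. W i t)" for t
  \<comment> \<open>The increments from index j on form a geometric series with first term r/2
    (1/2)^j, whose sum is r (1/2)^j.\<close>
  have wW: "X (r * (1/2)^j) (w t - W j t)" if t: "t \<in> I" for t j
  proof -
    define d where "d i = W (Suc (i + j)) t - W (i + j) t" for i
    define \<epsilon> where "\<epsilon> i = (r/2 * (1/2)^j) * (1/2)^i" for i :: nat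
    have \<epsilon>: "\<epsilon> sums (r/2 * (1/2)^j * (1 / (1 - 1/2)))"
      unfolding \<epsilon>_def by (intro sums_mult geometric_sums) simp
    have "X (\<epsilon> i) (d i)" for i
      using inc[OF t, of "i + j"] by (simp add: \<epsilon>_def d_def power_add mult_ac)
    from XL_series[OF k n this sums_summable[OF \<epsilon>]]
    have X: "X (suminf \<epsilon>) (suminf d)" "summable d" by auto
    have "(%q. (\<Sum>i<q. d i) + W j t) \<longlonglongrightarrow> suminf d + W j t"
      by (intro tendsto_intros summable_LIMSEQ X(2))
    moreover have "(\<Sum>i<q. d i) + W j t = W (q + j) t" for q
      unfolding d_def using sum_lessThan_telescope[of "%i. W (i + j) t" q] by simp
    ultimately have "(%q. W (q + j) t) \<longlonglongrightarrow> suminf d + W j t" by (simp only:)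
    then have "(%i. W i t) \<longlonglongrightarrow> suminf d + W j t" by (rule LIMSEQ_offset)
    then have "w t = suminf d + W j t" unfolding w_def by (rule limI)
    moreover have "suminf \<epsilon> = r * (1/2)^j" using sums_unique[OF \<epsilon>] by simp
    ultimately show ?thesis using X(1) by simp
  qed
  have "ccont X w I"
    unfolding ccont_def
  proof (intro ballI allI impI)
    fix s and e :: real assume s: "s \<in> I" and e: "0 < e"
    have "0 < e / 3 / r" using e r by simp
    from real_arch_pow_inv[OF this, of "1/2"] obtain j where j: "(1/2)^j < e / 3 / r" by auto
    then have j: "r * (1/2)^j <= e/3" using r by (simp add: field_simps)
    have wj: "X (e/3) (w t - W j t)" if "t \<in> I" for t by (rule XL_mono[OF wW[OF that] j])
    have "0 < e/3" using e by simp
    then have "\<forall>\<^sub>F s' in at s within I. X (e/3) (W j s' - W j s)"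
      using gW[of j] s unfolding good ccont_def by blast
    then show "\<forall>\<^sub>F s' in at s within I. X e (w s' - w s)"
      using eventually_in[of I s]
    proof eventually_elim
      case (elim s')
      from XL_diff[OF XL_add[OF wj[OF elim(2)] elim(1)] wj[OF s]] show ?case by (simp add: algebra_simps)
    qed
  qed
  then have gw: "good w" using wW[of _ 0] by (simp add: good W0)
  have "w t = P w t" if t: "t \<in> I" for t
  proof -
    obtain C where C: "C >= 1" "!!K u. X K u ==> norm u <= C * K" using X_norm by blast
    have "norm (w t - P w t) <= C * r * (1/2)^j" for j
    proof -
      have "X (r * (1/2)^j / 2) (P w t - W (Suc j) t)"
        unfolding WS by (rule contr[OF gw gW wW t])
      from XL_diff[OF wW[OF t, of "Suc j"] this]
      have "X (r * (1/2)^Suc j + r * (1/2)^j / 2) (w t - W (Suc j) t - (P w t - W (Suc j) t))" .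
      from C(2)[OF this] show ?thesis by (simp add: mult.assoc)
    qed
    moreover have "(%j. C * r * (1/2)^j) \<longlonglongrightarrow> C * r * 0"
      by (intro tendsto_intros LIMSEQ_realpow_zero) auto
    ultimately have "norm (w t - P w t) <= C * r * 0" by (intro LIMSEQ_le_const) auto
    then show ?thesis by simp
  qed
  with gw show ?thesis by blast
qed

lemma picard:
  fixes Nl :: "'n L2 => 'n L2"
  assumes u0: "X K0 u0" and \<delta>: "0 < \<delta>" and L: "0 <= L"
    and b: "!!u. X \<delta> (u - u0) ==> X L (Nl u)"
    and l: "!!u v d. X \<delta> (u - u0) ==> X \<delta> (v - u0) ==> X d (u - v) ==> X (L * d) (Nl u - Nl v)"
  shows "\<exists>T>0. \<exists>u. ccont X u {-T..T} & (\<forall>t\<in>{-T..T}. \<exists>K. X K (u t)) &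
    (\<forall>t\<in>{-T..T}. \<exists>v. has_oriented_integral (%s. S (t - s) (Nl (u s))) v 0 t & u t = S t u0 + cmult_L2 c v)"
proof -
  obtain C where C: "C >= 1" "!!t K g. \<bar>t\<bar> <= 1 ==> X K g ==> X (C * K) (S t g)" using X_S by blast
  \<comment> \<open>C r = \<delta>/2 lets the group applied to w - u0 use one half of \<delta>; the
    other half is left to S s u0 - u0.\<close>
  define r where "r = \<delta> / (2 * C)"
  have r: "0 < r" "C * r = \<delta> / 2" using \<delta> C(1) by (auto simp: r_def)
  have "\<forall>\<^sub>F t in nhds 0. X (\<delta>/2) (S t u0 - u0)" by (rule XL_S_continuous[OF k n u0]) (use \<delta> in simp)
  then obtain T0 where T0: "T0 > 0" "!!t. \<bar>t\<bar> < T0 ==> X (\<delta>/2) (S t u0 - u0)"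
    unfolding eventually_nhds_metric by (auto simp: dist_norm)
  \<comment> \<open>T q at most r/2 makes the iteration map the ball of radius r into itself; T q at
    most 1/2 makes it a contraction. The two factors C come from the two applications of the group
    in \<open>G\<close>.\<close>
  define q where "q = cmod c * (C * L) * C + 1"
  have q: "1 <= q" using C(1) L by (simp add: q_def)
  define T where "T = min (min 1 (T0 / 2)) (min (r/2) (1/2) / q)"
  have T: "0 < T" "T <= 1" "T < T0" using T0 r q by (auto simp: T_def)
  have Tq: "T * q <= min (r/2) (1/2)"
  proof -
    have "T * q <= min (r/2) (1/2) / q * q" using q by (intro mult_right_mono) (auto simp: T_def)
    then show ?thesis using q by simp
  qed
  define I where "I = {-T..T}"
  have I: "\<bar>s\<bar> <= T" "\<bar>s\<bar> <= 1" "\<bar>s\<bar> < T0" if "s \<in> I" for s using that T by (auto simp: I_def)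
  have cL: "cmod c * (C * L) * \<bar>t\<bar> <= r / 2" "cmod c * (C * L) * C * \<bar>t\<bar> <= 1 / 2" if "t \<in> I" for t
  proof -
    have nn: "0 <= cmod c * (C * L)" using C(1) L by simp
    have "cmod c * (C * L) * C * \<bar>t\<bar> <= q * T"
      using I(1)[OF that] q nn C(1) by (intro mult_mono) (auto simp: q_def)
    then show "cmod c * (C * L) * C * \<bar>t\<bar> <= 1 / 2" using Tq by (simp add: mult.commute)
    have "cmod c * (C * L) * 1 <= cmod c * (C * L) * C" using nn C(1) by (intro mult_left_mono)
    then have "cmod c * (C * L) * \<bar>t\<bar> <= q * T"
      using I(1)[OF that] q nn by (intro mult_mono) (auto simp: q_def)
    then show "cmod c * (C * L) * \<bar>t\<bar> <= r / 2" using Tq by (simp add: mult.commute)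
  qed
  define good where "good w \<longleftrightarrow> ccont X w I & (\<forall>t\<in>I. X r (w t - u0))" for w
  \<comment> \<open>In terms of w the integrand does not contain t, so the integral is a primitive
    in t. The factors \<open>1 *\<close> and \<open>- 1 *\<close> match the shape of
    \<open>ccont_S\<close>.\<close>
  define G where "G w s = S (- 1 * s) (Nl (S (1 * s) (w s)))" for w s
  have near: "X \<delta> (S (1 * s) (w s) - u0)" if "good w" "s \<in> I" for w s
  proof -
    have "X (C * r + \<delta> / 2) (S s (w s - u0) + (S s u0 - u0))"
      by (intro XL_add C(2) T0(2) I that(2)) (use that in "simp add: good_def")
    then show ?thesis by (simp add: S_diff r(2))
  qed
  have Gb: "X (C * L) (G w s)" if "good w" "s \<in> I" for w s
    unfolding G_def by (intro C(2) b near that) (use I that in simp)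
  have cS: "ccont X (%s. S (1 * s) (w s)) I" if w: "good w" for w
  proof (rule ccont_S)
    show "ccont X w I" using w by (simp add: good_def)
    show "\<exists>K. X K (w s)" if "s \<in> I" for s
    proof -
      have "X (r + K0) ((w s - u0) + u0)" by (rule XL_add[OF _ u0]) (use w that in "simp add: good_def")
      then show ?thesis by auto
    qed
  qed (use I in simp)
  have Gc: "ccont X (G w) I" if w: "good w" for w
    unfolding G_def
  proof (rule ccont_S)
    show "ccont X (%s. Nl (S (1 * s) (w s))) I"
      unfolding ccont_def
    proof (intro ballI allI impI)
      fix s and e :: real assume s: "s \<in> I" and e: "0 < e"
      then have "\<forall>\<^sub>F s' in at s within I. X (e / (L + 1)) (S (1 * s') (w s') - S (1 * s) (w s))"
        using cS[OF w] L unfolding ccont_def by simp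
      then show "\<forall>\<^sub>F s' in at s within I. X e (Nl (S (1 * s') (w s')) - Nl (S (1 * s) (w s)))"
        using eventually_in[of I s]
      proof eventually_elim
        case (elim s')
        show ?case by (rule XL_mono[OF l[OF near[OF w elim(2)] near[OF w s] elim(1)]]) (use L e in "simp add: field_simps")
      qed
    qed
    show "\<exists>K. X K (Nl (S (1 * s) (w s)))" if "s \<in> I" for s by (rule exI, rule b[OF near[OF w that]])
  qed (use I in simp)
  have Gl: "X (C * (L * (C * d))) (G w s - G w' s)" if "good w" "good w'" "s \<in> I" "X d (w s - w' s)" for w w' s d
  proof -
    have "X (C * d) (S (1 * s) (w s) - S (1 * s) (w' s))"
      unfolding S_diff[symmetric] by (rule C(2)) (use that I in auto)
    from l[OF near[OF that(1,3)] near[OF that(2,3)] this] show ?thesis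
      unfolding G_def S_diff[symmetric] by (intro C(2)) (use that I in auto)
  qed
  define P where "P w t = u0 + cmult_L2 c (oint T (G w) t)" for w t
  have I0: "0 \<in> {-T..T}" using T by simp
  have Pb: "X (r/2) (P w t - u0)" if "good w" "t \<in> I" for w t
  proof -
    have "X (C * L * \<bar>t - 0\<bar>) (oint T (G w) t - oint T (G w) 0)"
      by (rule oint_X[OF _ _ I0]) (use Gc Gb that in "auto simp: I_def")
    then have "X (cmod c * (C * L * \<bar>t\<bar>)) (cmult_L2 c (oint T (G w) t))"
      unfolding oint_0 diff_0_right by (rule XL_cmult)
    then have "X (r/2) (cmult_L2 c (oint T (G w) t))" by (rule XL_mono) (use cL(1)[OF that(2)] in "simp add: mult_ac")
    then show ?thesis by (simp add: P_def)
  qed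
  have "\<exists>w. good w & (\<forall>t\<in>I. w t = P w t)"
  proof (rule picard_fixed_point[where r=r and ?w0.0="%_. u0"])
    have "X (cmod 0 * K0) (cmult_L2 0 u0)" by (rule XL_cmult[OF u0])
    moreover have "cmult_L2 0 u0 = 0" using scaleR_L2_def[of 0 u0] by simp
    ultimately have X0: "X 0 0" by (simp del: XL.simps)
    have "X e 0" if "0 <= e" for e by (rule XL_mono[OF X0 that])
    then show "good (%_. u0)" using r by (simp add: good_def ccont_def del: XL.simps)
    show "good (P w)" if w: "good w" for w
      unfolding good_def
    proof
      show "ccont X (P w) I" unfolding P_def I_def
        by (intro ccont_affine oint_ccont) (use Gc[OF w] Gb[OF w] in "auto simp: I_def")
      have "X r (P w t - u0)" if "t \<in> I" for t by (rule XL_mono[OF Pb[OF w that]]) (use r in simp)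
      then show "\<forall>t\<in>I. X r (P w t - u0)" by blast
    qed
    show "X (d/2) (P w t - P w' t)"
      if w: "good w" "good w'" and d: "!!s. s \<in> I ==> X d (w s - w' s)" and t: "t \<in> I" for w w' d t
    proof -
      have o: "oint T (%s. G w s - G w' s) t = oint T (G w) t - oint T (G w') t"
        by (rule oint_sub) (use t X_continuous_on[OF Gc[OF w(1)]] X_continuous_on[OF Gc[OF w(2)]] in "auto simp: I_def")
      have "X (C * (L * (C * d)) * \<bar>t - 0\<bar>) (oint T (%s. G w s - G w' s) t - oint T (%s. G w s - G w' s) 0)"
        by (rule oint_X[OF _ _ I0]) (use ccont_diff[OF Gc[OF w(1)] Gc[OF w(2)]] Gl[OF w] d t in "auto simp: I_def")
      then have "X (cmod c * (C * (L * (C * d)) * \<bar>t\<bar>)) (cmult_L2 c (oint T (G w) t - oint T (G w') t))"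
        unfolding o oint_0 by (intro XL_cmult) simp
      moreover have "cmod c * (C * (L * (C * d)) * \<bar>t\<bar>) <= d / 2"
        using mult_right_mono[OF cL(2)[OF t] XL_nonneg[OF d[OF t]]] by (simp add: mult_ac)
      ultimately have "X (d/2) (cmult_L2 c (oint T (G w) t - oint T (G w') t))" by (rule XL_mono)
      then show ?thesis by (simp add: P_def cmult_diff)
    qed
  qed (use Pb r good_def in auto)
  then obtain w where w: "good w" "!!t. t \<in> I ==> w t = P w t" by blast
  define u where "u s = S (1 * s) (w s)" for s
  have "\<exists>v. has_oriented_integral (%s. S (t - s) (Nl (u s))) v 0 t & u t = S t u0 + cmult_L2 c v" if t: "t \<in> I" for t
  proof (intro exI conjI)
    have cG: "continuous_on {-T..T} (G w)" using X_continuous_on[OF Gc[OF w(1)]] by (simp add: I_def)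
    have "has_oriented_integral (G w) (oint T (G w) t) 0 t"
      by (rule oint_oriented[OF cG]) (use t in "simp add: I_def")
    then have "has_oriented_integral (S t \<circ> G w) (S t (oint T (G w) t)) 0 t"
      unfolding has_oriented_integral_def
      using has_integral_linear[OF _ bounded_linear_S[of t], of "G w"] S_diff[of t 0]
      by (auto split: if_splits simp: linear_neg[OF bounded_linear.linear[OF bounded_linear_S]] dest: has_integral_linear[OF _ bounded_linear_S[of t]])
    moreover have "S t \<circ> G w = (%s. S (t - s) (Nl (u s)))"
      by (rule ext) (simp add: G_def S_S u_def)
    ultimately show "has_oriented_integral (%s. S (t - s) (Nl (u s))) (S t (oint T (G w) t)) 0 t" by simp
    show "u t = S t u0 + cmult_L2 c (S t (oint T (G w) t))"
      unfolding u_def w(2)[OF t] P_def by (simp add: S_add S_cmult)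
  qed
  moreover have "ccont X u I" unfolding u_def by (rule cS[OF w(1)])
  moreover have "\<exists>K. X K (u t)" if "t \<in> I" for t
  proof -
    have "X (\<delta> + K0) ((u t - u0) + u0)" unfolding u_def by (rule XL_add[OF near[OF w(1) that] u0])
    then show ?thesis by auto
  qed
  ultimately show ?thesis using T(1) unfolding I_def by blast
qed

end

section \<open>Uniqueness\<close>

text \<open>For \<alpha> < 1 the derivative of the power is unbounded near 0. The factor y, smaller
  than the intermediate point z, compensates: z^(\<alpha>-1) y is at most z^\<alpha>.\<close>

lemma powr_diff_times_le:
  fixes x y B :: real
  assumes "0 <= y" "y <= x" "x <= B" "0 < \<alpha>"
  shows "(x powr \<alpha> - y powr \<alpha>) * y <= \<alpha> * B powr \<alpha> * (x - y)"
proof (cases "0 < y & y < x")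
  case False
  then have "y = 0 \<or> y = x" using assms by linarith
  then show ?thesis using assms by (auto intro!: mult_nonneg_nonneg)
next
  case True
  have "\<exists>z>y. z < x & x powr \<alpha> - y powr \<alpha> = (x - y) * (\<alpha> * z powr (\<alpha> - 1))"
    by (rule MVT2) (use True in "auto intro!: has_real_derivative_powr")
  then obtain z where z: "y < z" "z < x" "x powr \<alpha> - y powr \<alpha> = (x - y) * (\<alpha> * z powr (\<alpha> - 1))" by blast
  have "z powr (\<alpha> - 1) * y <= z powr (\<alpha> - 1) * z" using z(1) by (intro mult_left_mono) auto
  also have "\<dots> = z powr \<alpha>" using z(1) assms(1) by (simp add: powr_diff)
  also have "\<dots> <= B powr \<alpha>" using z assms by (intro powr_mono2) auto
  finally have "(x - y) * (\<alpha> * (z powr (\<alpha> - 1) * y)) <= (x - y) * (\<alpha> * B powr \<alpha>)"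
    using assms True by (intro mult_left_mono) auto
  then show ?thesis unfolding z(3) by (simp add: mult_ac)
qed

lemma power_nonlinearity_lipschitz:
  fixes a b :: complex
  assumes "0 < \<alpha>" "cmod a <= B" "cmod b <= B"
  shows "cmod ((cmod a powr \<alpha>) *\<^sub>R a - (cmod b powr \<alpha>) *\<^sub>R b) <= (1 + \<alpha>) * B powr \<alpha> * cmod (a - b)"
proof -
  have *: "cmod ((cmod a powr \<alpha>) *\<^sub>R a - (cmod b powr \<alpha>) *\<^sub>R b) <= (1 + \<alpha>) * B powr \<alpha> * cmod (a - b)"
    if le: "cmod b <= cmod a" "cmod a <= B" for a b
  proof -
    have "(cmod a powr \<alpha>) *\<^sub>R a - (cmod b powr \<alpha>) *\<^sub>R b = (cmod a powr \<alpha>) *\<^sub>R (a - b) + (cmod a powr \<alpha> - cmod b powr \<alpha>) *\<^sub>R b"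
      by (simp add: algebra_simps)
    also have "cmod \<dots> <= cmod a powr \<alpha> * cmod (a - b) + \<bar>cmod a powr \<alpha> - cmod b powr \<alpha>\<bar> * cmod b"
      using norm_triangle_ineq[of "(cmod a powr \<alpha>) *\<^sub>R (a - b)" "(cmod a powr \<alpha> - cmod b powr \<alpha>) *\<^sub>R b"] by simp
    also have "\<bar>cmod a powr \<alpha> - cmod b powr \<alpha>\<bar> = cmod a powr \<alpha> - cmod b powr \<alpha>"
      using powr_mono2[of \<alpha> "cmod b" "cmod a"] le(1) assms(1) by simp
    also have "(cmod a powr \<alpha> - cmod b powr \<alpha>) * cmod b <= \<alpha> * B powr \<alpha> * (cmod a - cmod b)"
      by (rule powr_diff_times_le) (use le assms(1) in auto)
    also have "\<dots> <= \<alpha> * B powr \<alpha> * cmod (a - b)"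
      using assms(1) norm_triangle_ineq2[of a b] by (intro mult_left_mono) auto
    also have "cmod a powr \<alpha> * cmod (a - b) <= B powr \<alpha> * cmod (a - b)"
      using le assms(1) by (intro mult_right_mono powr_mono2) auto
    finally show ?thesis by (simp add: distrib_right)
  qed
  show ?thesis
  proof (cases "cmod b <= cmod a")
    case True
    then show ?thesis using * assms(2) by simp
  next
    case False
    then show ?thesis using *[of a b] assms(3) by (simp add: norm_minus_commute)
  qed
qed

lemma nonlin_norm_diff:
  fixes u v :: "'n::finite L2"
  assumes \<alpha>: "0 < \<alpha>" and u: "LB 0 B u" and v: "LB 0 B v"
  shows "norm (nonlin \<alpha> u - nonlin \<alpha> v) <= (1 + \<alpha>) * B powr \<alpha> * norm (u - v)"
proof -
  define f where "f w x = (cmod (rp w x) powr \<alpha>) *\<^sub>R rp w x" for w :: "'n L2" and x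
  have B: "0 <= B" using u by (rule LB_nonneg)
  have [measurable]: "f w \<in> BM" for w unfolding f_def[abs_def] by measurable
  have s: "sqi (f w)" if "LB 0 B w" for w
  proof (rule sqi_bound[OF sqi_cmult[OF sqi_rp[of w], of "of_real (B powr \<alpha>)"]])
    show "AE x in lborel. cmod (f w x) <= cmod (of_real (B powr \<alpha>) * rp w x)"
      using that unfolding LB_def
    proof eventually_elim
      case (elim x)
      have "cmod (rp w x) powr \<alpha> <= B powr \<alpha>" using elim \<alpha> by (intro powr_mono2) auto
      then show ?case by (simp add: f_def norm_mult mult_right_mono)
    qed
  qed measurable
  have e: "nonlin \<alpha> w = abs_L2 (f w)" if "LB 0 B w" for w
    by (rule nonlin_eqI[OF s[OF that]]) (simp add: f_def)
  have "norm (nonlin \<alpha> u - nonlin \<alpha> v) <= ((1 + \<alpha>) * B powr \<alpha>) * norm (u - v)"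
  proof (rule norm_le_of_AE)
    have "nonlin \<alpha> u - nonlin \<alpha> v = abs_L2 (%x. f u x - f v x)" by (simp add: e u v abs_diff s)
    then have "AE x in lborel. rp (nonlin \<alpha> u - nonlin \<alpha> v) x = f u x - f v x"
      using rp_abs[OF sqi_diff[OF s[OF u] s[OF v]]] by simp
    then show "AE x in lborel. cmod (rp (nonlin \<alpha> u - nonlin \<alpha> v) x) <= (1 + \<alpha>) * B powr \<alpha> * cmod (rp (u - v) x)"
      using rp_diff[of u v] u[unfolded LB_def] v[unfolded LB_def]
    proof eventually_elim
      case (elim x)
      then show ?case using power_nonlinearity_lipschitz[OF \<alpha>, of "rp u x" B "rp v x"] by (simp add: f_def)
    qed
  qed (use \<alpha> in simp)
  then show ?thesis .
qed

text \<open>Integrating exp (2 c |s|) divides it by 2 c, so in the supremum weighted by exp (-2 c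
  |t|) an integral operator with Lipschitz constant c is a contraction by 1/2 on an interval of any
  length. This gives the Gronwall argument.\<close>

lemma oriented_integral_exp_bound:
  fixes F :: "real => 'a::banach"
  assumes F: "has_oriented_integral F v 0 t" and c: "0 < c" and M: "0 <= M"
    and le: "!!s. \<bar>s\<bar> <= \<bar>t\<bar> ==> norm (F s) <= c * M * exp (2 * c * \<bar>s\<bar>)"
  shows "norm v <= M * exp (2 * c * \<bar>t\<bar>) / 2"
proof (cases "0 <= t")
  case True
  have "((%s. c * M * exp (2 * c * s)) has_integral (M * exp (2 * c * t) / 2 - M * exp (2 * c * 0) / 2)) {0..t}"
    by (rule fundamental_theorem_of_calculus[OF True])
      (auto intro!: derivative_eq_intros simp: has_real_derivative_iff_has_vector_derivative[symmetric])
  note g = this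
  have FI: "(F has_integral v) {0..t}" using F True by (simp add: has_oriented_integral_def)
  have "norm (integral {0..t} F) <= integral {0..t} (%s. c * M * exp (2 * c * s))"
  proof (rule integral_norm_bound_integral)
    show "norm (F s) <= c * M * exp (2 * c * s)" if "s \<in> {0..t}" for s
      using le[of s] that by simp
  qed (use FI g in "auto intro: has_integral_integrable")
  then show ?thesis using integral_unique[OF FI] integral_unique[OF g] M True by simp
next
  case False
  then have t: "t <= 0" by simp
  have g: "((%s. c * M * exp (- (2 * c * s))) has_integral (- (M * exp (- (2 * c * 0)) / 2) - - (M * exp (- (2 * c * t)) / 2))) {t..0}"
    by (rule fundamental_theorem_of_calculus[OF t])
      (auto intro!: derivative_eq_intros simp: has_real_derivative_iff_has_vector_derivative[symmetric])
  have FI: "(F has_integral (- v)) {t..0}" using F False by (simp add: has_oriented_integral_def)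
  have "norm (integral {t..0} F) <= integral {t..0} (%s. c * M * exp (- (2 * c * s)))"
  proof (rule integral_norm_bound_integral)
    show "norm (F s) <= c * M * exp (- (2 * c * s))" if "s \<in> {t..0}" for s
      using le[of s] that by simp
  qed (use FI g in "auto intro: has_integral_integrable")
  then show ?thesis using integral_unique[OF FI] integral_unique[OF g] M False by simp
qed

context nls_space
begin

lemma continuous_on_X_ccont:
  fixes u :: "real => 'n L2"
  assumes "continuous_on_X k m n I u" shows "ccont X u I"
  unfolding ccont_def
proof (intro ballI allI impI)
  fix s and e :: real assume s: "s \<in> I" and e: "0 < e"
  have "((%s'. Xnorm k m n (u s' - u s)) \<longlongrightarrow> 0) (at s within I)" using assms s by (simp add: continuous_on_X_def)
  then have "\<forall>\<^sub>F s' in at s within I. Xnorm k m n (u s' - u s) < e" using e by (rule order_tendstoD(2))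
  then show "\<forall>\<^sub>F s' in at s within I. X e (u s' - u s)"
    using eventually_in[of I s]
  proof eventually_elim
    case (elim s')
    have x: "u s' \<in> Xspace k m n" "u s \<in> Xspace k m n"
      using assms elim(2) s by (auto simp: continuous_on_X_def)
    from XL_Xspace(1)[OF XL_diff[OF Xspace_XL[OF x(1)] Xspace_XL[OF x(2)]]] have "X (Xnorm k m n (u s' - u s)) (u s' - u s)" by (rule Xspace_XL)
    then show ?case by (rule XL_mono) (use elim(1) in simp)
  qed
qed

lemma ccont_continuous_on_X:
  fixes u :: "real => 'n L2"
  assumes u: "ccont X u I" and K: "!!t. t \<in> I ==> \<exists>K. X K (u t)"
  shows "continuous_on_X k m n I u"
  unfolding continuous_on_X_def
proof (intro conjI ballI)
  show "u t \<in> Xspace k m n" if "t \<in> I" for t using K[OF that] XL_Xspace(1) by blast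
  define C where "C = (\<Sum>j=0..2*m. 1) + (\<Sum>\<nu>=0..k+1. \<Sum>\<mu>=0..n. \<Sum>\<beta> :: 'n multiindex | morder \<beta> = \<nu> + \<mu> + 2*m + 1. (1::real))"
  have C: "0 <= C" unfolding C_def by (intro add_nonneg_nonneg sum_nonneg) auto
  show "((%s. Xnorm k m n (u s - u t)) \<longlongrightarrow> 0) (at t within I)" if "t \<in> I" for t
  proof (rule tendstoI)
    fix e :: real assume e: "0 < e"
    then have "\<forall>\<^sub>F s in at t within I. X (e / (C + 1)) (u s - u t)"
      using u that C unfolding ccont_def by simp
    then show "\<forall>\<^sub>F s in at t within I. dist (Xnorm k m n (u s - u t)) 0 < e"
    proof eventually_elim
      case (elim s)
      have "0 <= Xnorm k m n (u s - u t)" by (rule XL_nonneg[OF Xspace_XL[OF XL_Xspace(1)[OF elim]]])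
      moreover have "Xnorm k m n (u s - u t) <= C * (e / (C + 1))" using XL_Xspace(2)[OF elim] by (simp add: C_def)
      moreover have "C * (e / (C + 1)) < e" using C e by (simp add: field_simps)
      ultimately show ?case by simp
    qed
  qed
qed

text \<open>The gauge bound K depends on t a priori. Continuity makes it locally uniform, and
  compactness leaves finitely many local bounds to add up.\<close>

lemma ccont_bounded:
  assumes u: "ccont X u I" and K: "!!t. t \<in> I ==> \<exists>K. X K (u t)" and I: "compact I"
  shows "\<exists>K. \<forall>t\<in>I. X K (u t)"
proof -
  have "\<exists>U K. open U & t \<in> U & (\<forall>s\<in>U \<inter> I. X K (u s))" if t: "t \<in> I" for t
  proof -
    obtain K where K: "X K (u t)" using K[OF t] by blast
    have "\<forall>\<^sub>F s in at t within I. X 1 (u s - u t)" using u t unfolding ccont_def by simp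
    then obtain U where U: "open U" "t \<in> U" "!!s. s \<in> U ==> s ~= t ==> s \<in> I ==> X 1 (u s - u t)"
      unfolding eventually_at_topological by blast
    have "X (1 + K) (u s)" if "s \<in> U \<inter> I" for s
    proof (cases "s = t")
      case True
      show ?thesis unfolding True by (rule XL_mono[OF K]) simp
    next
      case False
      from XL_add[OF U(3)[OF _ False] K] that show ?thesis by (simp del: XL.simps)
    qed
    with U(1,2) show ?thesis by blast
  qed
  then obtain U KK where U: "!!t. t \<in> I ==> open (U t)" "!!t. t \<in> I ==> t \<in> U t"
    "!!t s. t \<in> I ==> s \<in> U t \<inter> I ==> X (KK t) (u s)" by metis
  have "I \<subseteq> (\<Union>t\<in>I. U t)" using U(2) by blast
  from compactE_image[OF I U(1) this] obtain A where A: "A \<subseteq> I" "finite A" "I \<subseteq> (\<Union>t\<in>A. U t)" by blast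
  have "X (\<Sum>t\<in>A. \<bar>KK t\<bar>) (u s)" if s: "s \<in> I" for s
  proof -
    obtain t where t: "t \<in> A" "s \<in> U t" using A(3) s by blast
    have "X (KK t) (u s)" using U(3) t s A(1) by blast
    moreover have "\<bar>KK t\<bar> <= (\<Sum>t\<in>A. \<bar>KK t\<bar>)" by (rule member_le_sum) (use t A in auto)
    ultimately show ?thesis by (elim XL_mono) simp
  qed
  then show ?thesis by blast
qed

text \<open>A second solution may leave the neighbourhood of u0 where
  \<open>nonlin_lipschitz\<close> applies. Both solutions are uniformly bounded on the compact
  interval, and there the nonlinearity is Lipschitz in L2, so the weighted distance f has a supremum
  M with M at most M/2.\<close>

lemma NLS_unique:
  fixes u v :: "real => 'n L2"
  assumes \<alpha>: "0 < \<alpha>" and T: "0 < T"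
    and u: "ccont X u {-T..T}" "!!t. t \<in> {-T..T} ==> \<exists>K. X K (u t)" "NLS_solution \<alpha> lam u0 {-T..T} u"
    and v: "ccont X v {-T..T}" "!!t. t \<in> {-T..T} ==> \<exists>K. X K (v t)" "NLS_solution \<alpha> lam u0 {-T..T} v"
    and t: "t \<in> {-T..T}"
  shows "v t = u t"
proof -
  define I where "I = {-T..T}"
  have I: "compact I" "I ~= {}" using T by (auto simp: I_def)
  obtain Ku where Ku: "!!t. t \<in> I ==> X Ku (u t)" using ccont_bounded[OF u(1,2)] I unfolding I_def by blast
  obtain Kv where Kv: "!!t. t \<in> I ==> X Kv (v t)" using ccont_bounded[OF v(1,2)] I unfolding I_def by blast
  define B where "B = max Ku Kv"
  have LB: "LB 0 B (w t)" if "X B (w t)" for w :: "real => 'n L2" and t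
  proof -
    have "LB n B (w t)" using that by simp
    then show ?thesis unfolding LB_def
    proof eventually_elim
      case (elim x)
      have "1 * cmod (rp (w t) x) <= japanese x ^ n * cmod (rp (w t) x)"
        by (intro mult_right_mono) (auto simp: japanese_ge_1)
      then show ?case using elim by simp
    qed
  qed
  have XB: "X B (u t)" "X B (v t)" if "t \<in> I" for t
    by (rule XL_mono[OF Ku[OF that]], simp add: B_def) (rule XL_mono[OF Kv[OF that]], simp add: B_def)
  define \<Lambda> where "\<Lambda> = (1 + \<alpha>) * B powr \<alpha>"
  have \<Lambda>: "0 <= \<Lambda>" using \<alpha> by (simp add: \<Lambda>_def)
  define c where "c = cmod lam * \<Lambda> + 1"
  have c: "0 < c" unfolding c_def using \<Lambda> by (simp add: add_nonneg_pos)
  define f where "f t = exp (- (2 * c * \<bar>t\<bar>)) * norm (u t - v t)" for t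
  obtain C where C: "C >= 1" "!!K u. X K u ==> norm u <= C * K" using X_norm by blast
  have bdd: "bdd_above (f ` I)"
  proof (rule bdd_aboveI2)
    fix t assume t: "t \<in> I"
    have "exp (- (2 * c * \<bar>t\<bar>)) * norm (u t - v t) <= 1 * norm (u t - v t)"
      using c by (intro mult_right_mono) auto
    also have "\<dots> <= C * (B + B)" using C(2)[OF XL_diff[OF XB[OF t]]] by simp
    finally show "f t <= C * (B + B)" by (simp add: f_def)
  qed
  define M where "M = (SUP t\<in>I. f t)"
  have fM: "f t <= M" if "t \<in> I" for t unfolding M_def by (rule cSUP_upper[OF that bdd])
  have M0: "0 <= M"
  proof -
    have "0 <= f 0" by (simp add: f_def)
    also have "\<dots> <= M" by (rule fM) (use T in "simp add: I_def")
    finally show ?thesis .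
  qed
  have eM: "norm (u t - v t) <= M * exp (2 * c * \<bar>t\<bar>)" if "t \<in> I" for t
    using fM[OF that] by (simp add: f_def exp_minus field_simps)
  have half: "f t <= M / 2" if t: "t \<in> I" for t
  proof -
    obtain V V' where V: "has_oriented_integral (%s. S (t - s) (nonlin \<alpha> (u s))) V 0 t" "u t = S t u0 + cmult_L2 (\<i> * lam) V"
      and V': "has_oriented_integral (%s. S (t - s) (nonlin \<alpha> (v s))) V' 0 t" "v t = S t u0 + cmult_L2 (\<i> * lam) V'"
      using u(3) v(3) t unfolding NLS_solution_def I_def by blast
    let ?F = "%s. cmult_L2 (\<i> * lam) (S (t - s) (nonlin \<alpha> (u s)) - S (t - s) (nonlin \<alpha> (v s)))"
    have "has_oriented_integral ?F (cmult_L2 (\<i> * lam) (V - V')) 0 t"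
    proof -
      have *: "(?F has_integral cmult_L2 (\<i> * lam) (W - W')) A"
        if "((%s. S (t - s) (nonlin \<alpha> (u s))) has_integral W) A" "((%s. S (t - s) (nonlin \<alpha> (v s))) has_integral W') A" for W W' A
        using has_integral_linear[OF has_integral_diff[OF that] bounded_linear_cmult[of "\<i> * lam"]] by (simp add: comp_def)
      show ?thesis
      proof (cases "0 <= t")
        case True
        then show ?thesis using V(1) V'(1) *[of V "{0..t}" V'] by (simp add: has_oriented_integral_def)
      next
        case False
        then have "(?F has_integral cmult_L2 (\<i> * lam) (- V - - V')) {t..0}"
          using V(1) V'(1) by (intro *) (simp_all add: has_oriented_integral_def)
        moreover have "cmult_L2 (\<i> * lam) (- V - - V') = - cmult_L2 (\<i> * lam) (V - V')"
          by (simp add: cmult_diff)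
        ultimately show ?thesis using False by (simp add: has_oriented_integral_def)
      qed
    qed
    then have "norm (cmult_L2 (\<i> * lam) (V - V')) <= M * exp (2 * c * \<bar>t\<bar>) / 2"
    proof (rule oriented_integral_exp_bound[OF _ c M0])
      fix s assume s: "\<bar>s\<bar> <= \<bar>t\<bar>"
      then have sI: "s \<in> I" using t by (auto simp: I_def)
      have "norm (?F s) = cmod lam * norm (nonlin \<alpha> (u s) - nonlin \<alpha> (v s))"
        by (simp add: S_diff[symmetric] norm_mult)
      also have "\<dots> <= cmod lam * (\<Lambda> * norm (u s - v s))"
        unfolding \<Lambda>_def by (intro mult_left_mono nonlin_norm_diff \<alpha> LB XB sI) auto
      also have "\<dots> <= c * norm (u s - v s)" by (simp add: c_def distrib_right)
      also have "\<dots> <= c * (M * exp (2 * c * \<bar>s\<bar>))" by (rule mult_left_mono[OF eM[OF sI]]) (use c in simp)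
      finally show "norm (?F s) <= c * M * exp (2 * c * \<bar>s\<bar>)" by (simp add: mult.assoc)
    qed
    then have "norm (u t - v t) <= M * exp (2 * c * \<bar>t\<bar>) / 2" by (simp add: V(2) V'(2) cmult_diff)
    then show ?thesis by (simp add: f_def exp_minus field_simps)
  qed
  have "M <= M / 2" unfolding M_def by (rule cSUP_least[OF I(2)]) (use half in "simp add: M_def")
  then have "f t <= 0" using fM[of t] t M0 by (simp add: I_def)
  then have "norm (u t - v t) <= 0" unfolding f_def by (simp add: mult_le_0_iff)
  then show ?thesis by simp
qed

end

theorem theorem1p2:
  fixes \<alpha> :: real and lam :: complex and k m n :: nat and u0 :: "'n::finite L2"
  assumes "\<alpha> > 0"
    and "real k > real CARD('n) / 2"
    and "real n > max (real CARD('n) / 2 + 1) (real CARD('n) / (2 * \<alpha>))"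
    and "2 * m \<ge> k + n + 1"
    and "u0 \<in> Xspace k m n"
    and "\<exists>f. continuous_representative u0 f \<and> (INF x. japanese x ^ n * cmod (f x)) > 0"
  shows "\<exists>T>0. \<exists>u.
           continuous_on_X k m n {-T..T} u \<and> NLS_solution \<alpha> lam u0 {-T..T} u \<and>
           (\<forall>v. continuous_on_X k m n {-T..T} v \<and> NLS_solution \<alpha> lam u0 {-T..T} v \<longrightarrow>
                (\<forall>t\<in>{-T..T}. v t = u t))"
proof -
  \<comment> \<open>This is the condition n > N/(2 \<alpha>), multiplied by \<alpha>.\<close>
  have \<sigma>: "real n * \<alpha> > real CARD('n) / 2"
    using assms(1,3) by (simp add: field_simps)
  interpret nls_space k m n "real n * \<alpha>" "TYPE('n)"
    by unfold_locales (use assms(2,3,4) \<sigma> in auto)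
  obtain f where f: "continuous_representative u0 f" "(INF x. japanese x ^ n * cmod (f x)) > 0" using assms(6) by blast
  define c where "c = (INF x. japanese x ^ n * cmod (f x))"
  have [measurable]: "f \<in> BM"
    using f(1) by (auto simp: continuous_representative_def intro: borel_measurable_continuous_onI)
  have "AE x in lebesgue. rep_L2 u0 x = f x" using f(1) by (simp add: continuous_representative_def)
  then have "AE x in lborel. rep_L2 u0 x = f x" by (simp add: AE_completion_iff)
  \<comment> \<open>The infimum concerns the continuous representative; off a null set the bound
    passes to the Borel representative, which is the form used in
    \<open>nonlin_lipschitz\<close>.\<close>
  then have lb: "AE x in lborel. c <= japanese x ^ n * cmod (rp u0 x)"
    using rep_rp[of u0]
  proof eventually_elim
    case (elim x)
    have "c <= japanese x ^ n * cmod (f x)" unfolding c_def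
      by (rule cINF_lower) (auto intro!: bdd_belowI2[of _ 0] simp: less_imp_le[OF japanese_pos])
    then show ?case using elim by simp
  qed
  have c0: "0 < c" using f(2) by (simp add: c_def)
  have Xu0: "X (Xnorm k m n u0) u0" by (rule Xspace_XL[OF assms(5)])
  obtain \<delta> L where N: "0 < \<delta>" "0 <= L" "!!u. X \<delta> (u - u0) ==> X L (nonlin \<alpha> u)"
    "!!u v d. X \<delta> (u - u0) ==> X \<delta> (v - u0) ==> X d (u - v) ==> X (L * d) (nonlin \<alpha> u - nonlin \<alpha> v)"
    using nonlin_lipschitz[OF refl Xu0 c0 lb] by blast
  obtain T u where T: "0 < T" and u: "ccont X u {-T..T}" "!!t. t \<in> {-T..T} ==> \<exists>K. X K (u t)"
    and sol: "!!t. t \<in> {-T..T} ==> \<exists>v. has_oriented_integral (%s. S (t - s) (nonlin \<alpha> (u s))) v 0 t & u t = S t u0 + cmult_L2 (\<i> * lam) v"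
    using picard[OF Xu0 N(1,2), of "nonlin \<alpha>" "\<i> * lam", OF N(3,4)] by blast
  have nls: "NLS_solution \<alpha> lam u0 {-T..T} u" unfolding NLS_solution_def using sol by blast
  show ?thesis
  proof (rule exI[of _ T], rule conjI[OF T], rule exI[of _ u], intro conjI allI impI ballI nls)
    show "continuous_on_X k m n {-T..T} u" by (rule ccont_continuous_on_X[OF u])
    fix v t assume v: "continuous_on_X k m n {-T..T} v & NLS_solution \<alpha> lam u0 {-T..T} v" and t: "t \<in> {-T..T}"
    have "\<exists>K. X K (v s)" if "s \<in> {-T..T}" for s
      using v that Xspace_XL unfolding continuous_on_X_def by blast
    then show "v t = u t"
      using v by (intro NLS_unique[OF assms(1) T u nls continuous_on_X_ccont _ _ t]) auto
  qed
qed

end
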